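(* Let $N\ge1$, $\gamma>0$, $\alpha\in(1,2]$. Let $m$ satisfy condition $(\mathcal H)$ and let $u\in H^s$ for $s\ge0$. Then $(-\Delta)^{\frac\alpha2}Q_{\gamma,\alpha}(t,\cdot)\star u\in H^s$ for $t\in(0,\infty)$. Assume further that $m$ is nonincreasing on $(0,\infty)$. Then the following assertions hold. (i) $(-\Delta)^{\frac\alpha2}G_{\gamma,\alpha}(t,\cdot)\star u\in H^s$ and $\partial_t[Q_{\gamma,\alpha}(t,\cdot)\star u]=-(-\Delta)^{\frac\alpha2}G_{\gamma,\alpha}(t,\cdot)\star u$ (derivative in $H^s$) for $t\in(0,\infty)$. (ii) When $\beta_\gamma>0$, or $\beta_\gamma=0$ and $m$ is continuous on $(0,\infty)$, we have $\partial_t\big(m_\gamma*Q_{\gamma,\alpha}(\cdot,\cdot)\star u\big)(t)=G_{\gamma,\alpha}(t,\cdot)\star u$ (derivative in $H^s$) for $t\in(0,\infty)$.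
   Context: Notation: $*$ is convolution in time, $(a*b)(t)=\int_0^t a(t-\tau)b(\tau)\,d\tau$; $\star$ is convolution in $x$; $\mathbb R_+=[0,\infty)$. $(-\Delta)^{\alpha/2}$ is the Fourier multiplier with symbol $|\xi|^\alpha$. $H^s=H^s(\mathbb R^N)$ has norm $\|u\|_{H^s}^2=\int(1+|\xi|^2)^s|\tilde u(\xi)|^2d\xi$, where $\tilde u$ is the Fourier transform. Put $m_\gamma(t)=1+\gamma m(t)$. Condition $(\mathcal H)$: $m\in L^1_{loc}(\mathbb R_+)$, and there exist a nonnegative and nonincreasing function $k_\gamma\in L^1_{loc}(\mathbb R_+)$ and $\beta_\gamma\ge0$ such that $\beta_\gamma m_\gamma(t)+(k_\gamma*m_\gamma)(t)=1$ for $t>0$. For $\nu\ge0$, $s_\gamma(\cdot,\nu)$ and $r_\gamma(\cdot,\nu)$ are the unique solutions of $s_\gamma(t,\nu)+\nu(m_\gamma*s_\gamma(\cdot,\nu))(t)=1$ ($t\ge0$) and $r_\gamma(t,\nu)+\nu(m_\gamma*r_\gamma(\cdot,\nu))(t)=m_\gamma(t)$ ($t>0$). $Q_{\gamma,\alpha}(t,\cdot)$ and $G_{\gamma,\alpha}(t,\cdot)$ are given by their Fourier transforms in $x$: $\tilde Q_{\gamma,\alpha}(t,\xi)=s_\gamma(t,|\xi|^\alpha)$, $\tilde G_{\gamma,\alpha}(t,\xi)=r_\gamma(t,|\xi|^\alpha)$; so $Q_{\gamma,\alpha}(t,\cdot)\star$ and $G_{\gamma,\alpha}(t,\cdot)\star$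 are the Fourier multipliers with these symbols. *)

theory Defs
  imports "HOL-Analysis.Analysis"
begin


definition L1_loc :: "(real \<Rightarrow> real) \<Rightarrow> bool" where
  "L1_loc f \<longleftrightarrow> (\<forall>T>0. set_integrable lebesgue {0..T} f)"

definition time_conv :: "(real \<Rightarrow> real) \<Rightarrow> (real \<Rightarrow> real) \<Rightarrow> real \<Rightarrow> real" where
  "time_conv a b t = (LINT \<tau>:{0..t}|lebesgue. a (t - \<tau>) * b \<tau>)"

definition m_gam :: "real \<Rightarrow> (real \<Rightarrow> real) \<Rightarrow> real \<Rightarrow> real" where
  "m_gam \<gamma> m t = 1 + \<gamma> * m t"

text \<open>Condition (H), with the witnesses \<open>\<beta>\<close>, \<open>k\<close> exposed because the sign of \<open>\<beta>\<close> is referred to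
  later. Elements of \<open>L\<^sup>1\<^sub>l\<^sub>o\<^sub>c\<close> are determined up to null sets, so the identity is required for
  almost every \<open>t > 0\<close>. Monotonicity concerns \<open>(0,\<infinity>)\<close> only: \<open>k\<close> may blow up at \<open>0\<close>.\<close>

definition cond_H :: "real \<Rightarrow> (real \<Rightarrow> real) \<Rightarrow> real \<Rightarrow> (real \<Rightarrow> real) \<Rightarrow> bool" where
  "cond_H \<gamma> m \<beta> k \<longleftrightarrow>
     L1_loc m \<and> L1_loc k \<and> (\<forall>t>0. 0 \<le> k t) \<and> antimono_on {0<..} k \<and> 0 \<le> \<beta> \<and>
     (AE t in lebesgue. 0 < t \<longrightarrow> \<beta> * m_gam \<gamma> m t + time_conv k (m_gam \<gamma> m) t = 1)"

text \<open>The solutions are sought in \<open>L\<^sup>1\<^sub>l\<^sub>o\<^sub>c\<close>. The value \<open>0\<close> outside the half line on which the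
  equation is posed only serves to make the solution unique as a function on all of \<open>\<real>\<close>.\<close>

definition relax_s :: "real \<Rightarrow> (real \<Rightarrow> real) \<Rightarrow> real \<Rightarrow> real \<Rightarrow> real" where
  "relax_s \<gamma> m \<nu> = (THE f. L1_loc f \<and> (\<forall>t<0. f t = 0) \<and>
     (\<forall>t\<ge>0. f t + \<nu> * time_conv (m_gam \<gamma> m) f t = 1))"

definition relax_r :: "real \<Rightarrow> (real \<Rightarrow> real) \<Rightarrow> real \<Rightarrow> real \<Rightarrow> real" where
  "relax_r \<gamma> m \<nu> = (THE f. L1_loc f \<and> (\<forall>t\<le>0. f t = 0) \<and>
     (\<forall>t>0. f t + \<nu> * time_conv (m_gam \<gamma> m) f t = m_gam \<gamma> m t))"



text \<open>Elements of \<open>L\<^sup>2\<close> and \<open>H\<^sup>s\<close> are handled through representatives; nothing below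
  depends, up to null sets, on the choice of the representative.\<close>

definition L2 :: "((real^'n) \<Rightarrow> complex) set" where
  "L2 = {u. u \<in> borel_measurable lebesgue \<and> integrable lebesgue (\<lambda>x. (cmod (u x))\<^sup>2)}"

definition trunc_fourier :: "real \<Rightarrow> (real^'n \<Rightarrow> complex) \<Rightarrow> real^'n \<Rightarrow> complex" where
  "trunc_fourier R u \<xi> = (LINT x:cball 0 R|lebesgue. cis (- (x \<bullet> \<xi>)) * u x)"

text \<open>\<open>v\<close> is (a representative of) the \<open>L\<^sup>2\<close> Fourier transform of \<open>u\<close>, i.e. the \<open>L\<^sup>2\<close>-limit of
  \<open>\<integral>\<^bsub>|x| \<le> R\<^esub> e\<^bsup>-i x\<xi>\<^esup> u(x) dx\<close> as \<open>R \<rightarrow> \<infinity>\<close>. There is no factor \<open>(2\<pi>)\<^bsup>-N/2\<^esup>\<close>, so that convolution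
  corresponds to multiplication of transforms.\<close>

definition has_fourier :: "(real^'n \<Rightarrow> complex) \<Rightarrow> (real^'n \<Rightarrow> complex) \<Rightarrow> bool" where
  "has_fourier u v \<longleftrightarrow> u \<in> L2 \<and> v \<in> L2 \<and>
     ((\<lambda>R. \<integral>\<^sup>+\<xi>. ennreal ((cmod (trunc_fourier R u \<xi> - v \<xi>))\<^sup>2) \<partial>lebesgue) \<longlongrightarrow> 0) at_top"

definition fourier :: "(real^'n \<Rightarrow> complex) \<Rightarrow> real^'n \<Rightarrow> complex" where
  "fourier u = (SOME v. has_fourier u v)"

text \<open>For \<open>s \<ge> 0\<close>, where \<open>H\<^sup>s \<subseteq> L\<^sup>2\<close>.\<close>

definition Hs :: "real \<Rightarrow> (real^'n \<Rightarrow> complex) set" where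
  "Hs s = {u. has_fourier u (fourier u) \<and>
     integrable lebesgue (\<lambda>\<xi>. (1 + (norm \<xi>)\<^sup>2) powr s * (cmod (fourier u \<xi>))\<^sup>2)}"

definition Hs_norm :: "real \<Rightarrow> (real^'n \<Rightarrow> complex) \<Rightarrow> real" where
  "Hs_norm s u = sqrt (LINT \<xi>|lebesgue. (1 + (norm \<xi>)\<^sup>2) powr s * (cmod (fourier u \<xi>))\<^sup>2)"

text \<open>Outside its domain \<open>{u \<in> L\<^sup>2. p \<cdot> fourier u \<in> L\<^sup>2}\<close> the multiplier operator returns the
  constant function \<open>1\<close>, which is not in \<open>L\<^sup>2\<close>. Hence \<open>fourier_multiplier p u \<in> Hs s\<close>
  asserts in particular that \<open>u\<close> is in the domain.\<close>

definition is_multiplier ::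
    "(real^'n \<Rightarrow> real) \<Rightarrow> (real^'n \<Rightarrow> complex) \<Rightarrow> (real^'n \<Rightarrow> complex) \<Rightarrow> bool" where
  "is_multiplier p u w \<longleftrightarrow>
     has_fourier u (fourier u) \<and> has_fourier w (\<lambda>\<xi>. p \<xi> *\<^sub>R fourier u \<xi>)"

definition fourier_multiplier ::
    "(real^'n \<Rightarrow> real) \<Rightarrow> (real^'n \<Rightarrow> complex) \<Rightarrow> real^'n \<Rightarrow> complex" where
  "fourier_multiplier p u =
     (if \<exists>w. is_multiplier p u w then SOME w. is_multiplier p u w else (\<lambda>_. 1))"

text \<open>The operator \<open>(-\<Delta>)\<^bsup>\<alpha>/2\<^esup>\<close>.\<close>

definition frac_laplacian :: "real \<Rightarrow> (real^'n \<Rightarrow> complex) \<Rightarrow> real^'n \<Rightarrow> complex" where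
  "frac_laplacian \<alpha> = fourier_multiplier (\<lambda>\<xi>. norm \<xi> powr \<alpha>)"

text \<open>Convolution in space with \<open>Q(t,\<cdot>)\<close>, \<open>G(t,\<cdot>)\<close>, which are in general only distributions, is the
  Fourier multiplier whose symbol is the transform of the kernel.\<close>

definition Q_star ::
    "real \<Rightarrow> (real \<Rightarrow> real) \<Rightarrow> real \<Rightarrow> real \<Rightarrow> (real^'n \<Rightarrow> complex) \<Rightarrow> real^'n \<Rightarrow> complex" where
  "Q_star \<gamma> m \<alpha> t = fourier_multiplier (\<lambda>\<xi>. relax_s \<gamma> m (norm \<xi> powr \<alpha>) t)"

definition G_star ::
    "real \<Rightarrow> (real \<Rightarrow> real) \<Rightarrow> real \<Rightarrow> real \<Rightarrow> (real^'n \<Rightarrow> complex) \<Rightarrow> real^'n \<Rightarrow> complex" where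
  "G_star \<gamma> m \<alpha> t = fourier_multiplier (\<lambda>\<xi>. relax_r \<gamma> m (norm \<xi> powr \<alpha>) t)"



definition has_Hs_derivative ::
    "real \<Rightarrow> (real \<Rightarrow> real^'n \<Rightarrow> complex) \<Rightarrow> (real^'n \<Rightarrow> complex) \<Rightarrow> real \<Rightarrow> bool" where
  "has_Hs_derivative s F D t \<longleftrightarrow>
     (\<forall>\<^sub>F \<tau> in nhds t. F \<tau> \<in> Hs s) \<and> D \<in> Hs s \<and>
     ((\<lambda>h. Hs_norm s (\<lambda>x. (F (t + h) x - F t x) /\<^sub>R h - D x)) \<longlongrightarrow> 0) (at 0)"

text \<open>The Bochner integral in \<open>H\<^sup>s\<close> over a measurable set \<open>S\<close>: the limit of the integrals of
  \<open>H\<^sup>s\<close>-valued simple functions \<open>g n\<close> with \<open>\<integral>\<^sub>S \<parallel>f - g n\<parallel> \<rightarrow> 0\<close>. The library's integral is not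
  applicable since \<open>H\<^sup>s\<close>, depending on the real parameter \<open>s\<close>, is not a type.\<close>

definition has_Hs_simple_integral ::
    "real \<Rightarrow> real set \<Rightarrow> (real \<Rightarrow> real^'n \<Rightarrow> complex) \<Rightarrow> (real^'n \<Rightarrow> complex) \<Rightarrow> bool" where
  "has_Hs_simple_integral s S g w \<longleftrightarrow>
     (\<exists>(J::nat set) A c. finite J \<and>
        (\<forall>j\<in>J. A j \<in> sets lebesgue \<and> A j \<subseteq> S \<and> emeasure lebesgue (A j) < \<infinity> \<and> c j \<in> Hs s) \<and>
        g = (\<lambda>\<tau> x. \<Sum>j\<in>J. indicat_real (A j) \<tau> *\<^sub>R c j x) \<and>
        w = (\<lambda>x. \<Sum>j\<in>J. measure lebesgue (A j) *\<^sub>R c j x))"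

definition has_Hs_integral ::
    "real \<Rightarrow> real set \<Rightarrow> (real \<Rightarrow> real^'n \<Rightarrow> complex) \<Rightarrow> (real^'n \<Rightarrow> complex) \<Rightarrow> bool" where
  "has_Hs_integral s S f w \<longleftrightarrow> w \<in> Hs s \<and> (\<forall>\<tau>\<in>S. f \<tau> \<in> Hs s) \<and>
     (\<exists>g I. (\<forall>n::nat. has_Hs_simple_integral s S (g n) (I n)) \<and>
        (\<forall>n. set_integrable lebesgue S (\<lambda>\<tau>. Hs_norm s (\<lambda>x. f \<tau> x - g n \<tau> x))) \<and>
        (\<lambda>n. LINT \<tau>:S|lebesgue. Hs_norm s (\<lambda>x. f \<tau> x - g n \<tau> x)) \<longlonglongrightarrow> 0 \<and>
        (\<lambda>n. Hs_norm s (\<lambda>x. I n x - w x)) \<longlonglongrightarrow> 0)"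

text \<open>As for multipliers, the default value \<open>1\<close> is outside \<open>H\<^sup>s\<close>.\<close>

definition Hs_integral ::
    "real \<Rightarrow> real set \<Rightarrow> (real \<Rightarrow> real^'n \<Rightarrow> complex) \<Rightarrow> real^'n \<Rightarrow> complex" where
  "Hs_integral s S f =
     (if \<exists>w. has_Hs_integral s S f w then SOME w. has_Hs_integral s S f w else (\<lambda>_. 1))"

definition Hs_time_conv ::
    "real \<Rightarrow> (real \<Rightarrow> real) \<Rightarrow> (real \<Rightarrow> real^'n \<Rightarrow> complex) \<Rightarrow> real \<Rightarrow> real^'n \<Rightarrow> complex" where
  "Hs_time_conv s a F t = Hs_integral s {0<..<t} (\<lambda>\<tau> x. a (t - \<tau>) *\<^sub>R F \<tau> x)"

end

theory Submission
  imports Defs "HOL-Probability.Characteristic_Functions"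
begin

text \<open>
Both assertions concern Fourier multipliers. By Plancherel's theorem they reduce to bounds and limits of the scalar
functions \<open>s(t,\<nu>)\<close> and \<open>r(t,\<nu>)\<close> that are uniform in \<open>\<nu> = |\<xi>|\<^sup>\<alpha>\<close>, because dominated convergence applies in the finite measure
\<open>(1 + |\<xi>|\<^sup>2)\<^sup>s |fourier u \<xi>|\<^sup>2 d\<xi>\<close>. Put \<open>a = m\<^sub>\<gamma>\<close>. Convolving the equation of \<open>r\<close> with \<open>k\<close> gives
\<open>\<beta> r + (k + \<nu>) * r = 1\<close>, and a minimum principle for nonnegative nonincreasing kernels yields \<open>r \<ge> 0\<close>. Hence
\<open>s = 1 - \<nu> (1 * r) = \<beta> r + k * r\<close> is nonnegative and nonincreasing, and \<open>s + \<nu> (a * s) = 1\<close> implies \<open>\<nu> s(t) \<integral>\<^sub>0\<^sup>t a \<le> 1\<close>.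
If \<open>m\<close> is nonincreasing, then \<open>\<nu> (a * r) \<ge> a (1 - s)\<close>, so \<open>r \<le> a s\<close> and \<open>\<nu> r\<close> is bounded as well. Moreover \<open>a\<close> cannot
jump, since \<open>k\<close> is unbounded at \<open>0\<close> when \<open>\<beta> = 0\<close>. Thus \<open>r\<close> is continuous in time, and \<open>s' = - \<nu> r\<close> and \<open>(a * s)' = r\<close>
hold at every \<open>t > 0\<close>.
\<close>

text \<open>Condition (H) does not mention the sign of m, so the minimum principle is used twice:
  with the kernel k for a itself, and with k + \<nu> for r. Both functions are only locally
  integrable and need not have a pointwise minimum; the principle is therefore proved for
  convolutions with Lipschitz test functions, and positivity follows by letting these approach an
  indicator. The equations of s and r are posed at every t, so null sets matter: r is first built as
  a nonnegative function jointly measurable in \<nu> and t, as the symbols in \<xi> require, and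
  then inserted into its own equation to obtain the pointwise solution. Plancherel's theorem has to
  include surjectivity, since an operator with a given symbol exists only if the product of symbol
  and transform is again a transform. The derivatives in H^s rest on the mean value theorem: for |h|
  < t / 2 a difference quotient in time is a derivative at some z \<ge> t / 2, where the bounds are
  uniform in \<nu>.\<close>

section \<open>Continuity of translation in \<open>L\<^sup>1\<close>\<close>

lemma lborel_integrable_shift:
  fixes f :: "'a::euclidean_space \<Rightarrow> 'b::{banach, second_countable_topology}"
  assumes "integrable lborel f" shows "integrable lborel (\<lambda>x. f (x + c))"
proof -
  have "integrable (distr lborel borel ((+) c)) f" using assms by (simp add: lborel_distr_plus)
  then show ?thesis by (subst (asm) integrable_distr_eq) (use assms in \<open>auto simp: add.commute\<close>)
qed

lemma lborel_integral_shift: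
  fixes f :: "'a::euclidean_space \<Rightarrow> 'b::{banach, second_countable_topology}"
  assumes [measurable]: "f \<in> borel_measurable borel"
  shows "(\<integral>x. f (x + c) \<partial>lborel) = (\<integral>x. f x \<partial>lborel)"
proof -
  have "(\<integral>x. f x \<partial>lborel) = (\<integral>x. f x \<partial>distr lborel borel ((+) c))" by (simp add: lborel_distr_plus)
  also have "\<dots> = (\<integral>x. f (x + c) \<partial>lborel)" by (subst integral_distr) (auto simp: add.commute)
  finally show ?thesis ..
qed

lemma lborel_nn_integral_shift:
  fixes f :: "'a::euclidean_space \<Rightarrow> ennreal"
  assumes [measurable]: "f \<in> borel_measurable borel"
  shows "(\<integral>\<^sup>+x. f (x + c) \<partial>lborel) = (\<integral>\<^sup>+x. f x \<partial>lborel)"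
proof -
  have "(\<integral>\<^sup>+x. f x \<partial>lborel) = (\<integral>\<^sup>+x. f x \<partial>distr lborel borel ((+) c))" by (simp add: lborel_distr_plus)
  also have "\<dots> = (\<integral>\<^sup>+x. f (x + c) \<partial>lborel)" by (subst nn_integral_distr) (auto simp: add.commute)
  finally show ?thesis ..
qed

definition translation_cont :: "('a::euclidean_space \<Rightarrow> 'b::{banach, second_countable_topology}) \<Rightarrow> bool" where
  "translation_cont f \<longleftrightarrow> ((\<lambda>z. \<integral>x. norm (f (x + z) - f x) \<partial>lborel) \<longlongrightarrow> 0) (at 0)"

text \<open>Translation is an isometry of L^1, so replacing f by g costs at most twice their
  distance, uniformly in the shift.\<close>

lemma translation_cont_approx:
  fixes f :: "'a::euclidean_space \<Rightarrow> 'b::{banach, second_countable_topology}"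
  assumes f: "integrable lborel f"
    and g: "\<And>e. 0 < e \<Longrightarrow> \<exists>g. integrable lborel g \<and> translation_cont g \<and> (\<integral>x. norm (f x - g x) \<partial>lborel) < e"
  shows "translation_cont f"
  unfolding translation_cont_def
proof (rule tendstoI)
  fix e :: real assume e: "0 < e"
  obtain g where gi: "integrable lborel g" and gt: "translation_cont g" and gd: "(\<integral>x. norm (f x - g x) \<partial>lborel) < e / 3"
    using g[of "e/3"] e by auto
  have d: "integrable lborel (\<lambda>x. norm (f x - g x))" using f gi by auto
  have "\<forall>\<^sub>F z in at 0. (\<integral>x. norm (g (x + z) - g x) \<partial>lborel) < e / 3"
    using gt e unfolding translation_cont_def by (intro order_tendstoD) auto
  then show "\<forall>\<^sub>F z in at 0. dist (\<integral>x. norm (f (x + z) - f x) \<partial>lborel) 0 < e"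
  proof eventually_elim
    case (elim z)
    have "(\<integral>x. norm (f (x + z) - f x) \<partial>lborel)
        \<le> (\<integral>x. norm (f (x + z) - g (x + z)) + norm (g (x + z) - g x) + norm (f x - g x) \<partial>lborel)"
    proof (rule integral_mono)
      fix x
      have "norm (f (x + z) - f x) = norm ((f (x + z) - g (x + z)) + (g (x + z) - g x) - (f x - g x))" by simp
      also have "\<dots> \<le> norm (f (x + z) - g (x + z)) + norm (g (x + z) - g x) + norm (f x - g x)"
        by (meson norm_triangle_ineq norm_triangle_ineq4 add_right_mono order_trans)
      finally show "norm (f (x + z) - f x) \<le> norm (f (x + z) - g (x + z)) + norm (g (x + z) - g x) + norm (f x - g x)" .
    qed (intro Bochner_Integration.integrable_add integrable_norm Bochner_Integration.integrable_diff lborel_integrable_shift f gi)+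
    also have "\<dots> = (\<integral>x. norm (f (x + z) - g (x + z)) \<partial>lborel) + (\<integral>x. norm (g (x + z) - g x) \<partial>lborel) + (\<integral>x. norm (f x - g x) \<partial>lborel)"
      by (subst Bochner_Integration.integral_add Bochner_Integration.integral_add;
          (intro Bochner_Integration.integrable_add integrable_norm Bochner_Integration.integrable_diff lborel_integrable_shift f gi)?)+ simp
    also have "(\<integral>x. norm (f (x + z) - g (x + z)) \<partial>lborel) = (\<integral>x. norm (f x - g x) \<partial>lborel)"
      using lborel_integral_shift[of "\<lambda>x. norm (f x - g x)" z] d by auto
    finally have "(\<integral>x. norm (f (x + z) - f x) \<partial>lborel) < e" using elim gd by linarith
    then show ?case by (simp add: Bochner_Integration.integral_nonneg)
  qed
qed

lemma translation_cont_add: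
  fixes f g :: "'a::euclidean_space \<Rightarrow> 'b::{banach, second_countable_topology}"
  assumes f: "integrable lborel f" "translation_cont f" and g: "integrable lborel g" "translation_cont g"
  shows "translation_cont (\<lambda>x. f x + g x)"
  unfolding translation_cont_def
proof (rule tendsto_sandwich[OF _ _ tendsto_const])
  show "((\<lambda>z. (\<integral>x. norm (f (x + z) - f x) \<partial>lborel) + (\<integral>x. norm (g (x + z) - g x) \<partial>lborel)) \<longlongrightarrow> 0) (at 0)"
    using tendsto_add[OF f(2)[unfolded translation_cont_def] g(2)[unfolded translation_cont_def]] by simp
  show "\<forall>\<^sub>F z in at 0. (\<integral>x. norm (f (x + z) + g (x + z) - (f x + g x)) \<partial>lborel)
      \<le> (\<integral>x. norm (f (x + z) - f x) \<partial>lborel) + (\<integral>x. norm (g (x + z) - g x) \<partial>lborel)"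
  proof (intro always_eventually allI)
    fix z :: 'a
    have "(\<integral>x. norm (f (x + z) + g (x + z) - (f x + g x)) \<partial>lborel)
      \<le> (\<integral>x. norm (f (x + z) - f x) + norm (g (x + z) - g x) \<partial>lborel)"
      by (intro integral_mono norm_diff_triangle_ineq Bochner_Integration.integrable_add integrable_norm Bochner_Integration.integrable_diff lborel_integrable_shift f g)
    then show "(\<integral>x. norm (f (x + z) + g (x + z) - (f x + g x)) \<partial>lborel)
      \<le> (\<integral>x. norm (f (x + z) - f x) \<partial>lborel) + (\<integral>x. norm (g (x + z) - g x) \<partial>lborel)"
      by (subst (asm) Bochner_Integration.integral_add)
       (auto intro!: integrable_norm Bochner_Integration.integrable_diff lborel_integrable_shift f g)
  qed
qed (auto intro!: always_eventually Bochner_Integration.integral_nonneg)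

text \<open>For |z| < 1 the difference f (x + z) - f x vanishes outside the ball of radius r + 1 and
  is at most L |z| inside it.\<close>

lemma translation_cont_lipschitz:
  fixes f :: "'a::euclidean_space \<Rightarrow> 'b::{banach, second_countable_topology}"
  assumes f: "integrable lborel f" and L: "\<And>x y. norm (f x - f y) \<le> L * norm (x - y)"
    and supp: "\<And>x. r < norm x \<Longrightarrow> f x = 0"
  shows "translation_cont f"
  unfolding translation_cont_def
proof (rule tendsto_sandwich[OF _ _ tendsto_const])
  let ?B = "measure lborel (cball (0::'a) (r + 1))"
  have "((\<lambda>z::'a. L * norm z * ?B) \<longlongrightarrow> L * norm (0::'a) * ?B) (at 0)" by (intro tendsto_intros)
  then show "((\<lambda>z::'a. L * norm z * ?B) \<longlongrightarrow> 0) (at 0)" by simp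
  have "\<forall>\<^sub>F z::'a in at 0. norm z < 1"
    using eventually_at_ball[of 1 "0::'a" UNIV] by (simp add: eventually_at_filter eventually_mono)
  then show "\<forall>\<^sub>F z in at 0. (\<integral>x. norm (f (x + z) - f x) \<partial>lborel) \<le> L * norm z * ?B"
  proof eventually_elim
    case (elim z)
    have "(\<integral>x. norm (f (x + z) - f x) \<partial>lborel) \<le> (\<integral>x. indicator (cball (0::'a) (r + 1)) x * (L * norm z) \<partial>lborel)"
    proof (rule integral_mono)
      show "integrable lborel (\<lambda>x::'a. indicator (cball 0 (r + 1)) x * (L * norm z))"
        by (intro integrable_mult_left integrable_real_indicator) (simp_all add: emeasure_bounded_finite[unfolded infinity_ennreal_def])
      fix x :: 'a
      show "norm (f (x + z) - f x) \<le> indicator (cball 0 (r + 1)) x * (L * norm z)"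
      proof (cases "norm x \<le> r + 1")
        case False
        then have "r < norm x" "r < norm (x + z)" using elim norm_triangle_ineq4[of "x + z" z] by auto
        then show ?thesis using supp False by simp
      qed (use L[of "x + z" x] in simp)
    qed (intro integrable_norm Bochner_Integration.integrable_diff lborel_integrable_shift f)
    then show ?case by (simp add: mult_ac)
  qed
qed (auto intro!: always_eventually Bochner_Integration.integral_nonneg)

text \<open>For closed nonempty K these functions decrease to the indicator of K, and each is
  Lipschitz. They approximate indicators in L^1 here and serve as test functions in
  \<open>sonine_nonneg\<close>.\<close>

definition bump :: "'a::metric_space set \<Rightarrow> nat \<Rightarrow> 'a \<Rightarrow> real" where
  "bump K j x = max 0 (1 - real (Suc j) * infdist x K)"

lemma bump_measurable [measurable]: "bump K j \<in> borel_measurable borel"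
  unfolding bump_def by (intro borel_measurable_continuous_onI continuous_intros)

lemma bump_range: "0 \<le> bump K j x" "bump K j x \<le> 1"
  by (auto simp: bump_def infdist_nonneg)

lemma bump_lipschitz: "\<bar>bump K j x - bump K j y\<bar> \<le> real (Suc j) * dist x y"
proof -
  have "real (Suc j) * \<bar>infdist x K - infdist y K\<bar> \<le> real (Suc j) * dist x y"
    using infdist_triangle_abs[of x K y] by (intro mult_left_mono) auto
  moreover have "real (Suc j) * \<bar>infdist x K - infdist y K\<bar> = \<bar>real (Suc j) * infdist x K - real (Suc j) * infdist y K\<bar>"
    by (simp add: abs_mult right_diff_distrib[symmetric] del: of_nat_Suc)
  ultimately show ?thesis unfolding bump_def by linarith
qed

text \<open>Distance 1 suffices for every j at once because the slope \<open>Suc j\<close> is at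
  least 1; so all bumps of a bounded set are supported in one ball.\<close>

lemma bump_eq_0:
  assumes "K \<noteq> {}" "\<And>y. y \<in> K \<Longrightarrow> 1 \<le> dist x y" shows "bump K j x = 0"
proof -
  have "1 \<le> infdist x K"
    unfolding infdist_notempty[OF assms(1)] by (rule cINF_greatest[OF assms])
  then have "1 \<le> real (Suc j) * infdist x K" using mult_mono[of 1 "real (Suc j)" 1 "infdist x K"] by simp
  then show ?thesis by (simp add: bump_def)
qed

lemma bump_tendsto:
  assumes K: "closed K" "K \<noteq> {}" shows "(\<lambda>j. bump K j x) \<longlonglongrightarrow> indicator K x"
proof (cases "x \<in> K")
  case True
  then show ?thesis by (simp add: bump_def)
next
  case False
  then have d: "0 < infdist x K" using in_closed_iff_infdist_zero[OF K, of x] infdist_nonneg[of x K] by auto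
  obtain N :: nat where N: "1 < real N * infdist x K" using d reals_Archimedean3 by blast
  have "\<forall>\<^sub>F j in sequentially. bump K j x = 0"
    using eventually_ge_at_top[of N]
  proof eventually_elim
    case (elim j)
    then have "real N * infdist x K \<le> real (Suc j) * infdist x K" using d by (intro mult_right_mono) auto
    then show ?case using N by (simp add: bump_def)
  qed
  then show ?thesis using False by (simp add: tendsto_eventually)
qed

text \<open>The bumps are Lipschitz with supports in a common ball, so dominated convergence makes
  them approach the indicator in L^1.\<close>

lemma translation_cont_compact:
  fixes K :: "'a::euclidean_space set" and c :: "'b::{banach, second_countable_topology}"
  assumes K: "compact K"
  shows "translation_cont (\<lambda>x. indicator K x *\<^sub>R c)"
proof (cases "K = {}")
  case False
  obtain r where r: "\<And>x. x \<in> K \<Longrightarrow> norm x \<le> r" using K compact_imp_bounded bounded_iff by metis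
  have cl: "closed K" using K by (rule compact_imp_closed)
  have [measurable]: "K \<in> sets borel" using cl by simp
  have psupp: "bump K j x = 0" if "r + 1 < norm x" for j x
  proof (rule bump_eq_0[OF False])
    fix y assume "y \<in> K"
    then show "1 \<le> dist x y" using r[of y] that norm_triangle_ineq2[of x y] by (simp add: dist_norm)
  qed
  have ind_int: "integrable lborel (\<lambda>x. indicator (cball (0::'a) (r + 1)) x * norm c)"
    by (intro integrable_mult_left integrable_real_indicator) (simp_all add: emeasure_bounded_finite[unfolded infinity_ennreal_def])
  have pint: "integrable lborel (\<lambda>x. bump K j x *\<^sub>R c)" for j
  proof (rule Bochner_Integration.integrable_bound[OF ind_int])
    show "AE x in lborel. norm (bump K j x *\<^sub>R c) \<le> norm (indicator (cball 0 (r + 1)) x * norm c)"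
      using psupp by (intro AE_I2) (auto simp: indicator_def abs_of_nonneg bump_range mult_left_le_one_le not_le)
  qed measurable
  have pt: "translation_cont (\<lambda>x. bump K j x *\<^sub>R c)" for j
  proof (rule translation_cont_lipschitz[OF pint])
    show "norm (bump K j x *\<^sub>R c - bump K j y *\<^sub>R c) \<le> (real (Suc j) * norm c) * norm (x - y)" for x y
      using mult_right_mono[OF bump_lipschitz[of K j x y], of "norm c"]
      by (simp add: scaleR_diff_left[symmetric] dist_norm mult_ac del: of_nat_Suc)
  qed (use psupp in auto)
  have lim: "(\<lambda>j. \<integral>x. norm (indicator K x *\<^sub>R c - bump K j x *\<^sub>R c) \<partial>lborel) \<longlonglongrightarrow> (\<integral>x. 0 \<partial>(lborel::'a measure))"
  proof (rule integral_dominated_convergence[where w="\<lambda>x. indicator (cball 0 (r + 1)) x * norm c"])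
    show "AE x in lborel. (\<lambda>j. norm (indicator K x *\<^sub>R c - bump K j x *\<^sub>R c)) \<longlonglongrightarrow> 0"
    proof (rule AE_I2)
      fix x :: 'a
      have "(\<lambda>j. norm (indicator K x *\<^sub>R c - bump K j x *\<^sub>R c)) \<longlonglongrightarrow> norm (indicator K x *\<^sub>R c - indicator K x *\<^sub>R c)"
        by (intro tendsto_intros bump_tendsto cl False)
      then show "(\<lambda>j. norm (indicator K x *\<^sub>R c - bump K j x *\<^sub>R c)) \<longlonglongrightarrow> 0" by simp
    qed
    show "AE x in lborel. norm (norm (indicator K x *\<^sub>R c - bump K j x *\<^sub>R c)) \<le> indicator (cball 0 (r + 1)) x * norm c" for j
    proof (rule AE_I2)
      fix x :: 'a
      have "\<bar>indicator K x - bump K j x\<bar> \<le> indicator (cball 0 (r + 1)) x"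
        using bump_range[of K j x] psupp[of x j] r[of x] by (auto simp: indicator_def)
      then show "norm (norm (indicator K x *\<^sub>R c - bump K j x *\<^sub>R c)) \<le> indicator (cball 0 (r + 1)) x * norm c"
        by (simp add: scaleR_diff_left[symmetric] mult_right_mono)
    qed
  qed (use ind_int in auto)
  show ?thesis
  proof (rule translation_cont_approx)
    show "integrable lborel (\<lambda>x. indicator K x *\<^sub>R c)"
      using K by (intro integrable_scaleR_left integrable_real_indicator)
        (simp_all add: emeasure_bounded_finite[unfolded infinity_ennreal_def] compact_imp_bounded)
    fix e :: real assume "0 < e"
    then have "\<forall>\<^sub>F j in sequentially. (\<integral>x. norm (indicator K x *\<^sub>R c - bump K j x *\<^sub>R c) \<partial>lborel) < e"
      using lim by (intro order_tendstoD) auto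
    then obtain j where "(\<integral>x. norm (indicator K x *\<^sub>R c - bump K j x *\<^sub>R c) \<partial>lborel) < e" by (auto simp: eventually_sequentially)
    then show "\<exists>g. integrable lborel g \<and> translation_cont g \<and> (\<integral>x. norm (indicator K x *\<^sub>R c - g x) \<partial>lborel) < e"
      using pint pt by blast
  qed
qed (simp add: translation_cont_def)

text \<open>Inner regularity reduces a bounded Borel set to a compact subset, with a remainder of
  small measure.\<close>

lemma translation_cont_indicator:
  fixes A :: "'a::euclidean_space set" and c :: "'b::{banach, second_countable_topology}"
  assumes A: "A \<in> sets borel" and b: "bounded A"
  shows "translation_cont (\<lambda>x. indicator A x *\<^sub>R c)"
proof (rule translation_cont_approx)
  have fin: "emeasure lborel A < \<infinity>" using b by (rule emeasure_bounded_finite)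
  then show "integrable lborel (\<lambda>x. indicator A x *\<^sub>R c)"
    using A by (intro integrable_scaleR_left integrable_real_indicator) auto
  fix e :: real assume e: "0 < e"
  \<comment> \<open>The summand 1 in the denominator covers the case c = 0.\<close>
  have "0 < e / (norm c + 1)" using e by (simp add: add_nonneg_pos)
  moreover have "A \<in> sets lebesgue" using A by (simp add: sets_completionI_sets)
  ultimately obtain K where K: "closed K" "K \<subseteq> A" "emeasure lebesgue (A - K) < ennreal (e / (norm c + 1))"
    using sets_lebesgue_inner_closed by metis
  have Kc: "compact K" using K b bounded_subset compact_eq_bounded_closed by blast
  have [measurable]: "K \<in> sets borel" using K by simp
  have mK: "emeasure lborel (A - K) < ennreal (e / (norm c + 1))"
    using K(3) A by simp
  then have mK': "measure lborel (A - K) < e / (norm c + 1)"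
    using enn2real_less_iff \<open>0 < e / (norm c + 1)\<close> unfolding measure_def
    by (metis enn2real_nonneg ennreal_enn2real ennreal_less_iff less_top mK order.strict_trans ennreal_less_top)
  have "(\<integral>x. norm (indicator A x *\<^sub>R c - indicator K x *\<^sub>R c) \<partial>lborel) = (\<integral>x. indicator (A - K) x * norm c \<partial>lborel)"
    using K(2) by (intro Bochner_Integration.integral_cong refl) (auto simp: indicator_def)
  also have "\<dots> = measure lborel (A - K) * norm c" by simp
  also have "\<dots> \<le> e / (norm c + 1) * norm c" using mK' by (intro mult_right_mono) auto
  also have "\<dots> < e"
  proof -
    have "0 < norm c + 1" by (simp add: add_nonneg_pos)
    then show ?thesis using e by (simp add: divide_less_eq algebra_simps)
  qed
  finally show "\<exists>g. integrable lborel g \<and> translation_cont g \<and> (\<integral>x. norm (indicator A x *\<^sub>R c - g x) \<partial>lborel) < e"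
    using translation_cont_compact[OF Kc] Kc
    by (intro exI[of _ "\<lambda>x. indicator K x *\<^sub>R c"]) (auto intro!: integrable_scaleR_left integrable_real_indicator emeasure_bounded_finite[unfolded infinity_ennreal_def] compact_imp_bounded)
qed

theorem translation_cont_integrable:
  fixes f :: "'a::euclidean_space \<Rightarrow> 'b::{banach, second_countable_topology}"
  assumes "integrable lborel f"
  shows "translation_cont f"
  using assms
proof (induction rule: integrable_induct)
  case (base A c)
  then have [measurable]: "A \<in> sets borel" by simp
  have i: "integrable lborel (\<lambda>x. indicator A x *\<^sub>R c)"
    using base by (intro integrable_scaleR_left integrable_real_indicator) auto
  \<comment> \<open>The induction rule supplies sets of finite measure; intersecting them with
    growing balls makes them bounded.\<close>
  have lim: "(\<lambda>j. \<integral>x. norm (indicator A x *\<^sub>R c - indicator (A \<inter> ball 0 (real j)) x *\<^sub>R c) \<partial>lborel) \<longlonglongrightarrow> (\<integral>x. 0 \<partial>(lborel::'a measure))"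
  proof (rule integral_dominated_convergence[where w="\<lambda>x. norm (indicator A x *\<^sub>R c)"])
    show "AE x in lborel. (\<lambda>j. norm (indicator A x *\<^sub>R c - indicator (A \<inter> ball 0 (real j)) x *\<^sub>R c)) \<longlonglongrightarrow> 0"
    proof (rule AE_I2, rule tendsto_eventually)
      fix x :: 'a
      obtain N :: nat where "norm x < real N" using reals_Archimedean2 by blast
      then show "\<forall>\<^sub>F j in sequentially. norm (indicator A x *\<^sub>R c - indicator (A \<inter> ball 0 (real j)) x *\<^sub>R c) = 0"
        by (intro eventually_mono[OF eventually_ge_at_top[of N]]) (auto simp: indicator_def)
    qed
    show "AE x in lborel. norm (norm (indicator A x *\<^sub>R c - indicator (A \<inter> ball 0 (real j)) x *\<^sub>R c)) \<le> norm (indicator A x *\<^sub>R c)" for j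
      by (auto simp: indicator_def)
    show "integrable lborel (\<lambda>x. norm (indicator A x *\<^sub>R c))" using i by (rule integrable_norm)
    have [measurable]: "ball (0::'a) (real j) \<in> sets borel" for j by simp
    show "(\<lambda>x. norm (indicator A x *\<^sub>R c - indicator (A \<inter> ball 0 (real j)) x *\<^sub>R c)) \<in> borel_measurable lborel" for j
      by measurable
  qed auto
  show ?case
  proof (rule translation_cont_approx[OF i])
    fix e :: real assume "0 < e"
    then have "\<forall>\<^sub>F j in sequentially. (\<integral>x. norm (indicator A x *\<^sub>R c - indicator (A \<inter> ball 0 (real j)) x *\<^sub>R c) \<partial>lborel) < e"
      using lim by (intro order_tendstoD) auto
    then obtain j where "(\<integral>x. norm (indicator A x *\<^sub>R c - indicator (A \<inter> ball 0 (real j)) x *\<^sub>R c) \<partial>lborel) < e"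
      by (auto simp: eventually_sequentially)
    moreover have "bounded (A \<inter> ball 0 (real j))" by (simp add: bounded_Int)
    ultimately show "\<exists>g. integrable lborel g \<and> translation_cont g \<and> (\<integral>x. norm (indicator A x *\<^sub>R c - g x) \<partial>lborel) < e"
      using translation_cont_indicator[of "A \<inter> ball 0 (real j)"]
      by (intro exI[of _ "\<lambda>x. indicator (A \<inter> ball 0 (real j)) x *\<^sub>R c"])
        (auto intro!: integrable_scaleR_left integrable_real_indicator emeasure_bounded_finite[unfolded infinity_ennreal_def])
  qed
next
  case (add f g)
  then show ?case by (intro translation_cont_add)
next
  case (lim f s)
  have bnd: "norm (s i x) \<le> 2 * norm (f x)" for i x using lim by auto
  show ?case
  proof (rule translation_cont_approx[OF \<open>integrable lborel f\<close>])
    have "(\<lambda>i. \<integral>x. norm (f x - s i x) \<partial>lborel) \<longlonglongrightarrow> (\<integral>x. 0 \<partial>(lborel::'a measure))"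
    proof (rule integral_dominated_convergence[where w="\<lambda>x. 3 * norm (f x)"])
      show "AE x in lborel. (\<lambda>i. norm (f x - s i x)) \<longlonglongrightarrow> 0"
      proof (rule AE_I2)
        fix x :: 'a
        have "(\<lambda>i. norm (f x - s i x)) \<longlonglongrightarrow> norm (f x - f x)"
          by (intro tendsto_intros lim) auto
        then show "(\<lambda>i. norm (f x - s i x)) \<longlonglongrightarrow> 0" by simp
      qed
      show "AE x in lborel. norm (norm (f x - s i x)) \<le> 3 * norm (f x)" for i
      proof (rule AE_I2)
        fix x :: 'a
        have "norm (f x - s i x) \<le> norm (f x) + norm (s i x)" by (rule norm_triangle_ineq4)
        then show "norm (norm (f x - s i x)) \<le> 3 * norm (f x)" using bnd[of i x] by simp
      qed
    qed (use lim in auto)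
    then have *: "(\<lambda>i. \<integral>x. norm (f x - s i x) \<partial>lborel) \<longlonglongrightarrow> 0" by simp
    fix e :: real assume "0 < e"
    then have "\<forall>\<^sub>F i in sequentially. (\<integral>x. norm (f x - s i x) \<partial>lborel) < e"
      using * by (intro order_tendstoD) auto
    then obtain i where "(\<integral>x. norm (f x - s i x) \<partial>lborel) < e" by (auto simp: eventually_sequentially)
    then show "\<exists>g. integrable lborel g \<and> translation_cont g \<and> (\<integral>x. norm (f x - g x) \<partial>lborel) < e"
      using lim by blast
  qed
qed

section \<open>The Fourier transform of integrable functions\<close>

text \<open>No normalising factor, in agreement with \<open>has_fourier\<close>; powers of 2 pi are
  collected in \<open>plancherel_const\<close>.\<close>

definition ft :: "('a::euclidean_space \<Rightarrow> complex) \<Rightarrow> 'a \<Rightarrow> complex" where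
  "ft f \<xi> = (\<integral>x. cis (- (x \<bullet> \<xi>)) * f x \<partial>lborel)"

lemma ft_measurable [measurable]:
  assumes [measurable]: "f \<in> borel_measurable borel"
  shows "ft f \<in> borel_measurable borel"
proof -
  have [measurable]: "(\<lambda>p::'a \<times> 'a. cis (- (snd p \<bullet> fst p))) \<in> borel_measurable (borel \<Otimes>\<^sub>M borel)"
    unfolding cis_conv_exp by measurable
  show ?thesis unfolding ft_def[abs_def] by measurable
qed

lemma cnj_measurable [measurable]: "cnj \<in> borel_measurable borel"
  by (intro borel_measurable_continuous_onI continuous_intros)

lemma cis_measurable [measurable]: "cis \<in> borel_measurable borel"
  unfolding cis_conv_exp[abs_def] by measurable

lemma integrable_cis_mult:
  fixes g :: "'a \<Rightarrow> real"
  assumes "integrable M f" and [measurable]: "g \<in> borel_measurable M"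
  shows "integrable M (\<lambda>x. cis (g x) * f x)"
  by (rule Bochner_Integration.integrable_bound[OF assms(1)]) (use assms in \<open>auto simp: norm_mult\<close>)

lemma norm_ft_le:
  assumes "integrable lborel f" shows "norm (ft f \<xi>) \<le> (\<integral>x. norm (f x) \<partial>lborel)"
proof -
  have "norm (ft f \<xi>) \<le> (\<integral>x. norm (cis (- (x \<bullet> \<xi>)) * f x) \<partial>lborel)"
    unfolding ft_def by (rule integral_norm_bound)
  then show ?thesis by (simp add: norm_mult)
qed

lemma integrable_prod_mult:
  fixes f :: "'a::euclidean_space \<Rightarrow> complex" and g :: "'b::euclidean_space \<Rightarrow> complex"
  assumes f: "integrable lborel f" and g: "integrable lborel g"
  shows "integrable (lborel \<Otimes>\<^sub>M lborel) (\<lambda>p. f (fst p) * g (snd p))"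
proof (rule integrableI_bounded)
  have [measurable]: "f \<in> borel_measurable borel" "g \<in> borel_measurable borel" using f g by auto
  show "(\<lambda>p. f (fst p) * g (snd p)) \<in> borel_measurable (lborel \<Otimes>\<^sub>M lborel)" by measurable
  have "(\<integral>\<^sup>+p. ennreal (norm (f (fst p) * g (snd p))) \<partial>(lborel \<Otimes>\<^sub>M lborel))
      = (\<integral>\<^sup>+x. \<integral>\<^sup>+y. ennreal (norm (f x)) * ennreal (norm (g y)) \<partial>lborel \<partial>lborel)"
    by (subst lborel.nn_integral_fst[symmetric]) (auto simp: norm_mult ennreal_mult)
  also have "\<dots> = (\<integral>\<^sup>+x. ennreal (norm (f x)) \<partial>lborel) * (\<integral>\<^sup>+y. ennreal (norm (g y)) \<partial>lborel)"
    by (simp add: nn_integral_cmult nn_integral_multc)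
  also have "\<dots> < \<infinity>" using f g by (simp add: integrable_iff_bounded ennreal_mult_less_top)
  finally show "(\<integral>\<^sup>+p. ennreal (norm (f (fst p) * g (snd p))) \<partial>(lborel \<Otimes>\<^sub>M lborel)) < \<infinity>" .
qed

text \<open>Fubini for the kernel \<open>cis (- (x \<bullet> \<xi>))\<close>, which is symmetric in
  x and \<xi>. In this development the identity takes the place of an inversion formula.\<close>

lemma ft_multiplication:
  fixes f g :: "'a::euclidean_space \<Rightarrow> complex"
  assumes f: "integrable lborel f" and g: "integrable lborel g"
  shows "(\<integral>\<xi>. ft f \<xi> * g \<xi> \<partial>lborel) = (\<integral>x. f x * ft g x \<partial>lborel)"
proof -
  have [measurable]: "f \<in> borel_measurable borel" "g \<in> borel_measurable borel" using f g by auto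
  have int: "integrable (lborel \<Otimes>\<^sub>M lborel) (\<lambda>(x, \<xi>). cis (- (x \<bullet> \<xi>)) * (f x * g \<xi>))"
    using integrable_cis_mult[OF integrable_prod_mult[OF f g], of "\<lambda>p. - (fst p \<bullet> snd p)"]
    by (simp add: split_beta')
  have "(\<integral>\<xi>. ft f \<xi> * g \<xi> \<partial>lborel) = (\<integral>\<xi>. \<integral>x. cis (- (x \<bullet> \<xi>)) * (f x * g \<xi>) \<partial>lborel \<partial>lborel)"
    by (simp add: ft_def mult.assoc[symmetric])
  also have "\<dots> = (\<integral>x. \<integral>\<xi>. cis (- (x \<bullet> \<xi>)) * (f x * g \<xi>) \<partial>lborel \<partial>lborel)"
    using lborel_pair.Fubini_integral[OF int] by simp
  also have "\<dots> = (\<integral>x. f x * ft g x \<partial>lborel)"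
    by (simp add: ft_def inner_commute mult.left_commute[of _ "f _"])
  finally show ?thesis .
qed

text \<open>The convolution of f with the conjugate of its reflection. Its value at 0 is the squared
  L^2 norm of f.\<close>

definition autocorr :: "('a::euclidean_space \<Rightarrow> complex) \<Rightarrow> 'a \<Rightarrow> complex" where
  "autocorr f z = (\<integral>y. f (y + z) * cnj (f y) \<partial>lborel)"

text \<open>The shift z + y splits the exponential into two factors, so the double integral becomes
  a product. Since \<open>autocorr f 0\<close> is the squared L^2 norm, Plancherel's identity
  amounts to recovering the autocorrelation at 0 from its transform.\<close>

lemma autocorr_ft:
  fixes f :: "'a::euclidean_space \<Rightarrow> complex"
  assumes f: "integrable lborel f"
  shows "integrable lborel (autocorr f)" "ft (autocorr f) \<xi> = ft f \<xi> * cnj (ft f \<xi>)"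
proof -
  have [measurable]: "f \<in> borel_measurable borel" using f by auto
  have *: "integrable (lborel \<Otimes>\<^sub>M lborel) (\<lambda>(z, y). f (y + z) * cnj (f y))"
  proof (rule integrableI_bounded)
    have "(\<integral>\<^sup>+p. ennreal (norm (case p of (z, y) \<Rightarrow> f (y + z) * cnj (f y))) \<partial>(lborel \<Otimes>\<^sub>M lborel))
        = (\<integral>\<^sup>+y. \<integral>\<^sup>+z. ennreal (norm (f y)) * ennreal (norm (f (z + y))) \<partial>lborel \<partial>lborel)"
      by (subst lborel_pair.nn_integral_snd[symmetric]) (auto simp: norm_mult ennreal_mult mult.commute add.commute split_beta')
    also have "\<dots> = (\<integral>\<^sup>+y. ennreal (norm (f y)) * (\<integral>\<^sup>+z. ennreal (norm (f z)) \<partial>lborel) \<partial>lborel)"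
      using lborel_nn_integral_shift[of "\<lambda>z. ennreal (norm (f z))"] by (simp add: nn_integral_cmult)
    also have "\<dots> < \<infinity>" using f by (simp add: nn_integral_multc integrable_iff_bounded ennreal_mult_less_top)
    finally show "(\<integral>\<^sup>+p. ennreal (norm (case p of (z, y) \<Rightarrow> f (y + z) * cnj (f y))) \<partial>(lborel \<Otimes>\<^sub>M lborel)) < \<infinity>" .
  qed (simp add: split_beta')
  show "integrable lborel (autocorr f)"
    using lborel_pair.integrable_fst[OF *] by (simp add: autocorr_def[abs_def])
  have int: "integrable (lborel \<Otimes>\<^sub>M lborel) (\<lambda>(z, y). cis (- (z \<bullet> \<xi>)) * (f (y + z) * cnj (f y)))"
    using integrable_cis_mult[OF *, of "\<lambda>p. - (fst p \<bullet> \<xi>)"] by (simp add: split_beta')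
  have "ft (autocorr f) \<xi> = (\<integral>z. \<integral>y. cis (- (z \<bullet> \<xi>)) * (f (y + z) * cnj (f y)) \<partial>lborel \<partial>lborel)"
    by (simp add: ft_def autocorr_def)
  also have "\<dots> = (\<integral>y. \<integral>z. cis (- (z \<bullet> \<xi>)) * (f (y + z) * cnj (f y)) \<partial>lborel \<partial>lborel)"
    using lborel_pair.Fubini_integral[OF int] by simp
  also have "\<dots> = (\<integral>y. ft f \<xi> * (cis (y \<bullet> \<xi>) * cnj (f y)) \<partial>lborel)"
  proof (intro Bochner_Integration.integral_cong refl)
    fix y :: 'a
    have "(\<integral>z. cis (- (z \<bullet> \<xi>)) * (f (y + z) * cnj (f y)) \<partial>lborel)
        = (\<integral>z. (cis (- ((z + y) \<bullet> \<xi>)) * f (z + y)) * (cis (y \<bullet> \<xi>) * cnj (f y)) \<partial>lborel)"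
    proof (intro Bochner_Integration.integral_cong refl)
      fix z
      have "cis (- (z \<bullet> \<xi>)) = cis (- ((z + y) \<bullet> \<xi>)) * cis (y \<bullet> \<xi>)"
        by (simp add: cis_mult inner_add_left)
      then show "cis (- (z \<bullet> \<xi>)) * (f (y + z) * cnj (f y)) = (cis (- ((z + y) \<bullet> \<xi>)) * f (z + y)) * (cis (y \<bullet> \<xi>) * cnj (f y))"
        by (simp add: add.commute)
    qed
    also have "\<dots> = (\<integral>z. cis (- ((z + y) \<bullet> \<xi>)) * f (z + y) \<partial>lborel) * (cis (y \<bullet> \<xi>) * cnj (f y))"
      by (rule integral_mult_left_zero)
    also have "(\<integral>z. cis (- ((z + y) \<bullet> \<xi>)) * f (z + y) \<partial>lborel) = ft f \<xi>"
      unfolding ft_def by (rule lborel_integral_shift) measurable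
    finally show "(\<integral>z. cis (- (z \<bullet> \<xi>)) * (f (y + z) * cnj (f y)) \<partial>lborel) = ft f \<xi> * (cis (y \<bullet> \<xi>) * cnj (f y))" .
  qed
  also have "\<dots> = ft f \<xi> * (\<integral>y. cis (y \<bullet> \<xi>) * cnj (f y) \<partial>lborel)" by simp
  also have "(\<integral>y. cis (y \<bullet> \<xi>) * cnj (f y) \<partial>lborel) = cnj (ft f \<xi>)"
    unfolding ft_def by (simp add: Bochner_Integration.integral_cnj[symmetric] cis_cnj)
  finally show "ft (autocorr f) \<xi> = ft f \<xi> * cnj (ft f \<xi>)" .
qed

subsection \<open>Gaussians\<close>

text \<open>Lebesgue measure is the image of the product measure indexed by the basis under the
  coordinate map (\<open>lborel_eq\<close>), and there the integral of a product factorises.\<close>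

lemma integral_lborel_prod:
  fixes f :: "'a::euclidean_space \<Rightarrow> real \<Rightarrow> complex"
  assumes int: "\<And>b. b \<in> Basis \<Longrightarrow> integrable lborel (f b)"
  shows "(\<integral>x. (\<Prod>b\<in>Basis. f b (x \<bullet> b)) \<partial>lborel) = (\<Prod>b\<in>Basis. \<integral>x. f b x \<partial>lborel)"
    and "integrable lborel (\<lambda>x. \<Prod>b\<in>Basis. f b (x \<bullet> b))"
proof -
  interpret product_sigma_finite "\<lambda>_. lborel :: real measure" ..
  have [measurable]: "\<And>b. b \<in> Basis \<Longrightarrow> f b \<in> borel_measurable borel" using int by auto
  have m[measurable]: "(\<lambda>x. \<Prod>b\<in>Basis. f b (x \<bullet> b)) \<in> borel_measurable borel"
    by (intro borel_measurable_prod) measurable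
  have T[measurable]: "(\<lambda>g. \<Sum>b\<in>Basis. g b *\<^sub>R b) \<in> (\<Pi>\<^sub>M b\<in>Basis. lborel) \<rightarrow>\<^sub>M (borel :: 'a measure)"
    by measurable
  have e: "(\<Prod>b\<in>Basis. f b ((\<Sum>c\<in>Basis. g c *\<^sub>R c) \<bullet> b)) = (\<Prod>b\<in>Basis. f b (g b))" for g :: "'a \<Rightarrow> real"
    by (intro prod.cong refl) simp
  have i: "integrable (\<Pi>\<^sub>M b\<in>Basis. lborel) (\<lambda>g. \<Prod>b\<in>Basis. f b (g b))"
    by (rule product_integrable_prod) (use int in auto)
  show "integrable lborel (\<lambda>x. \<Prod>b\<in>Basis. f b (x \<bullet> b))"
    by (subst lborel_eq, subst integrable_distr_eq[OF T m]) (simp only: e i)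
  have "(\<integral>x. (\<Prod>b\<in>Basis. f b (x \<bullet> b)) \<partial>lborel) = (\<integral>g. (\<Prod>b\<in>Basis. f b (g b)) \<partial>(\<Pi>\<^sub>M b\<in>Basis. lborel))"
    by (subst lborel_eq, subst integral_distr[OF T m]) (simp only: e)
  also have "\<dots> = (\<Prod>b\<in>Basis. \<integral>x. f b x \<partial>lborel)"
    by (rule product_integral_prod) (use int in auto)
  finally show "(\<integral>x. (\<Prod>b\<in>Basis. f b (x \<bullet> b)) \<partial>lborel) = (\<Prod>b\<in>Basis. \<integral>x. f b x \<partial>lborel)" .
qed

text \<open>Up to the factor \<open>sqrt (2 * pi)\<close> the integral is the characteristic
  function of the standard normal distribution at - t.\<close>

lemma gauss_1d:
  shows "integrable lborel (\<lambda>x::real. complex_of_real (exp (- x\<^sup>2 / 2)))"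
    and "(\<integral>x. cis (- (x * t)) * complex_of_real (exp (- x\<^sup>2 / 2)) \<partial>lborel) = complex_of_real (sqrt (2 * pi) * exp (- t\<^sup>2 / 2))"
proof -
  have d: "exp (- x\<^sup>2 / 2) = sqrt (2 * pi) * std_normal_density x" for x :: real
    by (simp add: std_normal_density_def)
  have "integrable lborel (\<lambda>x::real. exp (- x\<^sup>2 / 2))"
    unfolding d by (intro integrable_mult_right) (simp add: integrable_normal_density)
  then show i: "integrable lborel (\<lambda>x::real. complex_of_real (exp (- x\<^sup>2 / 2)))"
    by simp
  have "char std_normal_distribution (- t) = (\<integral>x. std_normal_density x *\<^sub>R iexp (- t * x) \<partial>lborel)"
    unfolding char_def by (subst integral_density) auto
  then have "complex_of_real (exp (- (t\<^sup>2) / 2)) = (\<integral>x. std_normal_density x *\<^sub>R iexp (- t * x) \<partial>lborel)"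
    by (simp add: char_std_normal_distribution)
  then have "complex_of_real (sqrt (2 * pi) * exp (- t\<^sup>2 / 2)) = complex_of_real (sqrt (2 * pi)) * (\<integral>x. std_normal_density x *\<^sub>R iexp (- t * x) \<partial>lborel)"
    by simp
  also have "\<dots> = (\<integral>x. complex_of_real (sqrt (2 * pi)) * (std_normal_density x *\<^sub>R iexp (- t * x)) \<partial>lborel)"
    by (rule integral_mult_right_zero[symmetric])
  also have "\<dots> = (\<integral>x. cis (- (x * t)) * complex_of_real (exp (- x\<^sup>2 / 2)) \<partial>lborel)"
    unfolding d by (intro Bochner_Integration.integral_cong refl) (simp add: cis_conv_exp scaleR_conv_of_real mult_ac)
  finally show "(\<integral>x. cis (- (x * t)) * complex_of_real (exp (- x\<^sup>2 / 2)) \<partial>lborel) = complex_of_real (sqrt (2 * pi) * exp (- t\<^sup>2 / 2))" ..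
qed

definition gauss :: "'a::euclidean_space \<Rightarrow> complex" where
  "gauss x = complex_of_real (exp (- (norm x)\<^sup>2 / 2))"

lemma gauss_measurable [measurable]: "gauss \<in> borel_measurable borel"
  unfolding gauss_def[abs_def] by measurable

lemma gauss_prod: "gauss x = (\<Prod>b\<in>Basis. complex_of_real (exp (- (x \<bullet> b)\<^sup>2 / 2)))"
proof -
  have "(norm x)\<^sup>2 = (\<Sum>b\<in>Basis. (x \<bullet> b)\<^sup>2)"
    unfolding power2_norm_eq_inner by (subst euclidean_inner) (simp add: power2_eq_square)
  then show ?thesis
    unfolding gauss_def of_real_prod[symmetric]
    by (simp add: exp_sum[symmetric] sum_negf[symmetric] sum_divide_distrib del: of_real_prod)
qed

lemma cis_inner_prod: "cis (- (x \<bullet> \<xi>)) = (\<Prod>b\<in>Basis. cis (- ((x \<bullet> b) * (\<xi> \<bullet> b))))"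
  for x :: "'a::euclidean_space"
  unfolding cis_conv_exp by (subst exp_sum[symmetric]) (simp_all add: euclidean_inner[of x \<xi>] sum_distrib_left sum_negf)

lemma gauss_integrable: "integrable lborel (gauss :: 'a::euclidean_space \<Rightarrow> complex)"
  unfolding gauss_prod[abs_def] by (rule integral_lborel_prod(2)) (rule gauss_1d(1))

lemma ft_gauss: "ft gauss \<xi> = complex_of_real (sqrt (2 * pi) ^ DIM('a)) * gauss (\<xi>::'a::euclidean_space)"
proof -
  have "ft gauss \<xi> = (\<integral>x. (\<Prod>b\<in>(Basis::'a set). cis (- ((x \<bullet> b) * (\<xi> \<bullet> b))) * complex_of_real (exp (- (x \<bullet> b)\<^sup>2 / 2))) \<partial>lborel)"
    unfolding ft_def cis_inner_prod gauss_prod prod.distrib ..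
  also have "\<dots> = (\<Prod>b\<in>(Basis::'a set). complex_of_real (sqrt (2 * pi) * exp (- (\<xi> \<bullet> b)\<^sup>2 / 2)))"
  proof -
    have "integrable lborel (\<lambda>x. cis (- (x * (\<xi> \<bullet> b))) * complex_of_real (exp (- x\<^sup>2 / 2)))" for b :: 'a
      by (rule integrable_cis_mult[OF gauss_1d(1)]) measurable
    from integral_lborel_prod(1)[OF this] show ?thesis by (simp only: gauss_1d(2))
  qed
  also have "\<dots> = complex_of_real (sqrt (2 * pi) ^ DIM('a)) * gauss \<xi>"
    by (simp add: gauss_prod prod.distrib)
  finally show ?thesis .
qed

lemma ft_0: "ft f 0 = (\<integral>x. f x \<partial>lborel)"
  by (simp add: ft_def)

lemma gauss_integral: "(\<integral>x. gauss (x::'a::euclidean_space) \<partial>lborel) = complex_of_real (sqrt (2 * pi) ^ DIM('a))"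
  using ft_gauss[of "0::'a"] by (simp add: ft_0 gauss_def)

section \<open>Dilations of Lebesgue integrals\<close>

lemma lborel_integral_scale:
  fixes F :: "'a::euclidean_space \<Rightarrow> complex"
  assumes [measurable]: "F \<in> borel_measurable borel" and c: "0 < c"
  shows "(\<integral>x. F x \<partial>lborel) = complex_of_real (c ^ DIM('a)) * (\<integral>x. F (c *\<^sub>R x) \<partial>lborel)"
proof -
  have "(\<integral>x. F x \<partial>lborel) = (\<integral>x. F x \<partial>density (distr lborel borel (\<lambda>x. 0 + c *\<^sub>R x)) (\<lambda>_. \<bar>c\<bar> ^ DIM('a)))"
    using lborel_affine[of c "0::'a"] c by simp
  also have "\<dots> = (\<integral>x. (\<bar>c\<bar> ^ DIM('a)) *\<^sub>R F (c *\<^sub>R x) \<partial>lborel)"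
    using c by (subst integral_density) (auto simp: integral_distr)
  finally show ?thesis using c by (simp add: scaleR_conv_of_real)
qed

lemma lborel_integrable_scale:
  fixes F :: "'a::euclidean_space \<Rightarrow> complex"
  assumes F: "integrable lborel F" and c: "0 < c"
  shows "integrable lborel (\<lambda>x. F (c *\<^sub>R x))"
proof -
  have [measurable]: "F \<in> borel_measurable borel" using F by auto
  have "integrable (density (distr lborel borel (\<lambda>x. 0 + c *\<^sub>R x)) (\<lambda>_. ennreal (\<bar>c\<bar> ^ DIM('a)))) F"
    using lborel_affine[of c "0::'a"] c F by simp
  then have "integrable lborel (\<lambda>x. (\<bar>c\<bar> ^ DIM('a)) *\<^sub>R F (c *\<^sub>R x))"
    by (subst (asm) integrable_density) (auto simp: integrable_distr_eq)
  then have "integrable lborel (\<lambda>x. inverse (\<bar>c\<bar> ^ DIM('a)) *\<^sub>R (\<bar>c\<bar> ^ DIM('a)) *\<^sub>R F (c *\<^sub>R x))"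
    by (rule integrable_scaleR_right)
  then show ?thesis using c by simp
qed

section \<open>Plancherel's theorem\<close>

lemma mult_le_sum_squares: "x * y \<le> (x\<^sup>2 + y\<^sup>2) / 2" for x y :: real
  using zero_le_power2[of "x - y"] by (simp add: power2_diff)

text \<open>The pointwise inequality x y \<le> (x^2 + y^2) / 2 suffices, because the two squares
  have the same integral by translation invariance.\<close>

lemma autocorr_bound:
  fixes f :: "'a::euclidean_space \<Rightarrow> complex"
  assumes [measurable]: "f \<in> borel_measurable borel" and f2: "integrable lborel (\<lambda>x. (norm (f x))\<^sup>2)"
  shows "integrable lborel (\<lambda>y. f (y + z) * cnj (f y))" "norm (autocorr f z) \<le> (\<integral>x. (norm (f x))\<^sup>2 \<partial>lborel)"
proof -
  have s2: "integrable lborel (\<lambda>y. (norm (f (y + z)))\<^sup>2)"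
    using lborel_integrable_shift[OF f2, of z] by simp
  have s: "(\<integral>y. (norm (f (y + z)))\<^sup>2 \<partial>lborel) = (\<integral>x. (norm (f x))\<^sup>2 \<partial>lborel)"
    using lborel_integral_shift[of "\<lambda>x. (norm (f x))\<^sup>2" z] by simp
  have i: "integrable lborel (\<lambda>y. ((norm (f (y + z)))\<^sup>2 + (norm (f y))\<^sup>2) / 2)" using s2 f2 by auto
  have b: "norm (f (y + z) * cnj (f y)) \<le> ((norm (f (y + z)))\<^sup>2 + (norm (f y))\<^sup>2) / 2" for y
    using mult_le_sum_squares by (simp add: norm_mult)
  show *: "integrable lborel (\<lambda>y. f (y + z) * cnj (f y))"
    by (rule Bochner_Integration.integrable_bound[OF i], measurable, rule AE_I2)
      (use b in \<open>auto intro: order_trans\<close>)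
  have "norm (autocorr f z) \<le> (\<integral>y. ((norm (f (y + z)))\<^sup>2 + (norm (f y))\<^sup>2) / 2 \<partial>lborel)"
    unfolding autocorr_def by (rule Bochner_Integration.integral_norm_bound_integral[OF * i b])
  also have "\<dots> = (\<integral>x. (norm (f x))\<^sup>2 \<partial>lborel)"
    using s2 f2 by (simp add: s)
  finally show "norm (autocorr f z) \<le> (\<integral>x. (norm (f x))\<^sup>2 \<partial>lborel)" .
qed

text \<open>Translation is continuous in L^1, but the second factor of the integrand may be
  unbounded. Hence |f| is bounded by n plus the function \<open>b n\<close>, which keeps |f| where
  it exceeds n and is small in L^2; its product with the increment of f is split by Young's
  inequality with weight \<delta>.\<close>

lemma autocorr_tendsto:
  fixes f :: "'a::euclidean_space \<Rightarrow> complex"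
  assumes f: "integrable lborel f" and f2: "integrable lborel (\<lambda>x. (norm (f x))\<^sup>2)"
  shows "(autocorr f \<longlongrightarrow> autocorr f 0) (at 0)"
proof (rule tendstoI)
  fix e :: real assume e: "0 < e"
  have [measurable]: "f \<in> borel_measurable borel" using f by auto
  define S where "S = (\<integral>x. (norm (f x))\<^sup>2 \<partial>lborel)"
  have S: "0 \<le> S" unfolding S_def by (intro Bochner_Integration.integral_nonneg) auto
  \<comment> \<open>The squared increments contribute 2 \<delta> (S + S), which must stay below e /
    3; S + 1 instead of S covers S = 0.\<close>
  define \<delta> where "\<delta> = e / (12 * (S + 1))"
  have \<delta>: "0 < \<delta>" "4 * S * \<delta> < e / 3" using e S by (auto simp: \<delta>_def field_simps)
  define b where "b n x = (if norm (f x) > real n then norm (f x) else 0)" for n x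
  have bm[measurable]: "b n \<in> borel_measurable borel" for n unfolding b_def by measurable
  have b0: "0 \<le> b n x" "(b n x)\<^sup>2 \<le> (norm (f x))\<^sup>2" "norm (f x) \<le> real n + b n x" for n x by (auto simp: b_def)
  have bi: "integrable lborel (\<lambda>x. (b n x)\<^sup>2)" for n
    by (rule Bochner_Integration.integrable_bound[OF f2]) (use b0 in auto)
  have "(\<lambda>n. \<integral>x. (b n x)\<^sup>2 \<partial>lborel) \<longlonglongrightarrow> (\<integral>x. 0 \<partial>(lborel :: 'a measure))"
  proof (rule integral_dominated_convergence[OF _ _ f2])
    show "AE x in lborel. (\<lambda>n. (b n x)\<^sup>2) \<longlonglongrightarrow> 0"
    proof (rule AE_I2, rule tendsto_eventually)
      fix x :: 'a
      obtain N :: nat where "norm (f x) < real N" using reals_Archimedean2 by blast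
      then show "\<forall>\<^sub>F n in sequentially. (b n x)\<^sup>2 = 0"
        by (intro eventually_mono[OF eventually_ge_at_top[of N]]) (auto simp: b_def)
    qed
  qed (use b0 in auto)
  then have "\<forall>\<^sub>F n in sequentially. (\<integral>x. (b n x)\<^sup>2 \<partial>lborel) < \<delta> * e / 3"
    using e \<delta> by (intro order_tendstoD) auto
  then obtain n where n: "(\<integral>x. (b n x)\<^sup>2 \<partial>lborel) < \<delta> * e / 3" by (auto simp: eventually_sequentially)
  have "((\<lambda>z. \<integral>x. norm (f (x + z) - f x) \<partial>lborel) \<longlongrightarrow> 0) (at 0)"
    using translation_cont_integrable[OF f] by (simp add: translation_cont_def)
  then have "((\<lambda>z. real n * (\<integral>x. norm (f (x + z) - f x) \<partial>lborel)) \<longlongrightarrow> real n * 0) (at 0)"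
    by (intro tendsto_intros)
  then have "\<forall>\<^sub>F z in at 0. real n * (\<integral>x. norm (f (x + z) - f x) \<partial>lborel) < e / 3"
    using e by (intro order_tendstoD) auto
  then show "\<forall>\<^sub>F z in at 0. dist (autocorr f z) (autocorr f 0) < e"
  proof eventually_elim
    case (elim z)
    have s2: "integrable lborel (\<lambda>y. (norm (f (y + z)))\<^sup>2)"
      using lborel_integrable_shift[OF f2, of z] by simp
    have s: "(\<integral>y. (norm (f (y + z)))\<^sup>2 \<partial>lborel) = S"
      using lborel_integral_shift[of "\<lambda>x. (norm (f x))\<^sup>2" z] by (simp add: S_def)
    have i1: "integrable lborel (\<lambda>y. norm (f (y + z) - f y))"
      by (intro integrable_norm Bochner_Integration.integrable_diff lborel_integrable_shift f)
    have i0: "integrable lborel (\<lambda>y. real n * norm (f (y + z) - f y) + (2 * \<delta> * ((norm (f (y + z)))\<^sup>2 + (norm (f y))\<^sup>2) + (b n y)\<^sup>2 / \<delta>))"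
      using i1 s2 f2 bi by (intro Bochner_Integration.integrable_add) auto
    have "autocorr f z - autocorr f 0 = (\<integral>y. f (y + z) * cnj (f y) - f (y + 0) * cnj (f y) \<partial>lborel)"
      unfolding autocorr_def
      by (rule Bochner_Integration.integral_diff[symmetric]) (rule autocorr_bound; use f2 in simp)+
    also have "norm \<dots> \<le> (\<integral>y. real n * norm (f (y + z) - f y) + (2 * \<delta> * ((norm (f (y + z)))\<^sup>2 + (norm (f y))\<^sup>2) + (b n y)\<^sup>2 / \<delta>) \<partial>lborel)"
    proof (rule Bochner_Integration.integral_norm_bound_integral[OF _ i0])
      show "integrable lborel (\<lambda>y. f (y + z) * cnj (f y) - f (y + 0) * cnj (f y))"
        by (intro Bochner_Integration.integrable_diff autocorr_bound f2) measurable
      fix y :: 'a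
      let ?d = "norm (f (y + z) - f y)"
      have "norm (f (y + z) * cnj (f y) - f (y + 0) * cnj (f y)) = ?d * norm (f y)"
        by (simp add: norm_mult left_diff_distrib[symmetric])
      also have "\<dots> \<le> ?d * (real n + b n y)" by (intro mult_left_mono b0) auto
      also have "?d * b n y \<le> \<delta> * ?d\<^sup>2 + (b n y)\<^sup>2 / \<delta>"
      proof -
        have q: "(sqrt \<delta>)\<^sup>2 = \<delta>" using \<delta> by simp
        have "?d * b n y = (sqrt \<delta> * ?d) * (b n y / sqrt \<delta>)" using \<delta> by simp
        also have "\<dots> \<le> ((sqrt \<delta> * ?d)\<^sup>2 + (b n y / sqrt \<delta>)\<^sup>2) / 2" by (rule mult_le_sum_squares)
        also have "\<dots> \<le> (sqrt \<delta> * ?d)\<^sup>2 + (b n y / sqrt \<delta>)\<^sup>2" by simp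
        finally show ?thesis using \<delta> by (simp add: power_mult_distrib power_divide)
      qed
      then have "?d * (real n + b n y) \<le> real n * ?d + (\<delta> * ?d\<^sup>2 + (b n y)\<^sup>2 / \<delta>)" by (simp add: algebra_simps)
      also have "?d\<^sup>2 \<le> 2 * ((norm (f (y + z)))\<^sup>2 + (norm (f y))\<^sup>2)"
      proof -
        have "?d\<^sup>2 \<le> (norm (f (y + z)) + norm (f y))\<^sup>2" by (intro power_mono norm_triangle_ineq4) auto
        also have "\<dots> \<le> 2 * ((norm (f (y + z)))\<^sup>2 + (norm (f y))\<^sup>2)"
          using mult_le_sum_squares[of "norm (f (y + z))" "norm (f y)"] by (simp add: power2_sum)
        finally show ?thesis .
      qed
      then have "\<delta> * ?d\<^sup>2 \<le> 2 * \<delta> * ((norm (f (y + z)))\<^sup>2 + (norm (f y))\<^sup>2)"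
        using \<delta>(1) by (simp add: mult_left_mono)
      finally show "norm (f (y + z) * cnj (f y) - f (y + 0) * cnj (f y))
          \<le> real n * ?d + (2 * \<delta> * ((norm (f (y + z)))\<^sup>2 + (norm (f y))\<^sup>2) + (b n y)\<^sup>2 / \<delta>)"
        by simp
    qed
    also have "\<dots> = real n * (\<integral>x. norm (f (x + z) - f x) \<partial>lborel) + (2 * \<delta> * (S + S) + (\<integral>x. (b n x)\<^sup>2 \<partial>lborel) / \<delta>)"
      using i1 s2 f2 bi by (simp add: s S_def)
    also have "\<dots> < e / 3 + (e / 3 + e / 3)"
    proof (intro add_strict_mono elim)
      show "2 * \<delta> * (S + S) < e / 3" using \<delta>(2) by (simp add: algebra_simps)
      show "(\<integral>x. (b n x)\<^sup>2 \<partial>lborel) / \<delta> < e / 3" using n \<delta>(1) by (simp add: field_simps)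
    qed
    finally show ?case by (simp add: dist_norm)
  qed
qed

lemma ft_gauss_scale:
  assumes c: "0 < c"
  shows "ft (\<lambda>\<xi>. gauss (c *\<^sub>R \<xi>)) z = complex_of_real (sqrt (2 * pi) ^ DIM('a) / c ^ DIM('a)) * gauss ((1 / c) *\<^sub>R (z::'a::euclidean_space))"
proof -
  have "ft gauss ((1 / c) *\<^sub>R z) = complex_of_real (c ^ DIM('a)) * (\<integral>x. cis (- ((c *\<^sub>R x) \<bullet> ((1 / c) *\<^sub>R z))) * gauss (c *\<^sub>R x) \<partial>lborel)"
    unfolding ft_def by (rule lborel_integral_scale[OF _ c]) measurable
  also have "(\<integral>x. cis (- ((c *\<^sub>R x) \<bullet> ((1 / c) *\<^sub>R z))) * gauss (c *\<^sub>R x) \<partial>lborel) = ft (\<lambda>\<xi>. gauss (c *\<^sub>R \<xi>)) z"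
    unfolding ft_def using c by simp
  finally show ?thesis using c by (simp add: ft_gauss field_simps)
qed

text \<open>Multiply the transform |ft f|^2 of the autocorrelation A by a Gaussian of width 1 / c.
  Moving the transform to the Gaussian turns the integral into a Gaussian mean of A at scale c. As c
  tends to 0 the mean tends to a multiple of A 0 by continuity of A, while the left side increases
  to the integral of |ft f|^2, whose finiteness is thereby a result.\<close>

theorem plancherel_L1_L2:
  fixes f :: "'a::euclidean_space \<Rightarrow> complex"
  assumes f: "integrable lborel f" and f2: "integrable lborel (\<lambda>x. (norm (f x))\<^sup>2)"
  shows "(\<integral>\<^sup>+\<xi>. ennreal ((norm (ft f \<xi>))\<^sup>2) \<partial>lborel) = ennreal ((2 * pi) ^ DIM('a)) * (\<integral>\<^sup>+x. ennreal ((norm (f x))\<^sup>2) \<partial>lborel)"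
proof -
  have fm[measurable]: "f \<in> borel_measurable borel" using f by auto
  define S where "S = (\<integral>x. (norm (f x))\<^sup>2 \<partial>lborel)"
  define K where "K = sqrt (2 * pi) ^ DIM('a)"
  define A where "A = autocorr f"
  have Ai: "integrable lborel A" unfolding A_def by (rule autocorr_ft[OF f])
  have Am[measurable]: "A \<in> borel_measurable borel" using Ai by auto
  have A0: "A 0 = complex_of_real S"
    by (simp add: A_def autocorr_def S_def complex_norm_square[symmetric] del: of_real_power)
  define c where "c n = 1 / real (Suc n)" for n
  have c: "0 < c n" for n by (simp add: c_def)
  define J where "J n = (\<integral>\<xi>. (norm (ft f \<xi>))\<^sup>2 * exp (- (norm (c n *\<^sub>R \<xi>))\<^sup>2 / 2) \<partial>lborel)" for n
  have gi: "integrable lborel (\<lambda>\<xi>::'a. gauss (c n *\<^sub>R \<xi>))" for n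
    by (rule lborel_integrable_scale[OF gauss_integrable c])
  have Jc: "complex_of_real (J n) = complex_of_real K * (\<integral>w. A (c n *\<^sub>R w) * gauss w \<partial>lborel)" for n
  proof -
    have "complex_of_real (J n) = (\<integral>\<xi>. ft A \<xi> * gauss (c n *\<^sub>R \<xi>) \<partial>lborel)"
      unfolding J_def A_def autocorr_ft(2)[OF f] integral_complex_of_real[symmetric]
      by (intro Bochner_Integration.integral_cong refl) (simp only: gauss_def of_real_mult complex_norm_square)
    also have "\<dots> = (\<integral>z. A z * ft (\<lambda>\<xi>. gauss (c n *\<^sub>R \<xi>)) z \<partial>lborel)"
      by (rule ft_multiplication[OF Ai gi])
    also have "\<dots> = (\<integral>z. A z * (complex_of_real (K / c n ^ DIM('a)) * gauss ((1 / c n) *\<^sub>R z)) \<partial>lborel)"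
      by (simp only: ft_gauss_scale[OF c] K_def)
    also have "\<dots> = complex_of_real (c n ^ DIM('a)) * (\<integral>w. A (c n *\<^sub>R w) * (complex_of_real (K / c n ^ DIM('a)) * gauss ((1 / c n) *\<^sub>R (c n *\<^sub>R w))) \<partial>lborel)"
      by (rule lborel_integral_scale[OF _ c]) measurable
    also have "\<dots> = complex_of_real K * (\<integral>w. A (c n *\<^sub>R w) * gauss w \<partial>lborel)"
      using c[of n] by (simp add: mult.left_commute[of "A _"])
    finally show ?thesis .
  qed
  have cl: "c \<longlonglongrightarrow> 0" unfolding c_def using LIMSEQ_inverse_real_of_nat by (simp add: inverse_eq_divide)
  have "(\<lambda>n. \<integral>w. A (c n *\<^sub>R w) * gauss w \<partial>lborel) \<longlonglongrightarrow> (\<integral>w. A 0 * gauss (w::'a) \<partial>lborel)"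
  proof (rule integral_dominated_convergence[where w="\<lambda>w. S * norm (gauss w)"])
    show "integrable lborel (\<lambda>w::'a. S * norm (gauss w))"
      by (intro integrable_mult_right integrable_norm gauss_integrable)
    show "AE w in lborel. (\<lambda>n. A (c n *\<^sub>R w) * gauss w) \<longlonglongrightarrow> A 0 * gauss w"
    proof (rule AE_I2, intro tendsto_mult tendsto_const)
      fix w :: 'a
      have "(\<lambda>n. c n *\<^sub>R w) \<longlonglongrightarrow> 0 *\<^sub>R w" by (intro tendsto_intros cl)
      moreover have "isCont A 0"
        using autocorr_tendsto[OF f f2] by (simp add: isCont_def A_def)
      ultimately show "(\<lambda>n. A (c n *\<^sub>R w)) \<longlonglongrightarrow> A 0"
        using isCont_tendsto_compose[of "0::'a" A] by simp
    qed
    show "AE w in lborel. norm (A (c n *\<^sub>R w) * gauss w) \<le> S * norm (gauss w)" for n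
      using autocorr_bound(2)[OF fm f2] by (auto simp: norm_mult A_def S_def intro!: AE_I2 mult_right_mono)
  qed measurable
  then have "(\<lambda>n. complex_of_real (J n)) \<longlonglongrightarrow> complex_of_real K * (\<integral>w. A 0 * gauss (w::'a) \<partial>lborel)"
    unfolding Jc by (intro tendsto_intros)
  \<comment> \<open>One factor K comes from the transform of the Gaussian, the other from its
    integral.\<close>
  also have "complex_of_real K * (\<integral>w. A 0 * gauss (w::'a) \<partial>lborel) = complex_of_real (K * K * S)"
    by (simp add: gauss_integral A0 K_def)
  also have "K * K = (sqrt (2 * pi) * sqrt (2 * pi)) ^ DIM('a)" unfolding K_def by (rule power_mult_distrib[symmetric])
  also have "sqrt (2 * pi) * sqrt (2 * pi) = 2 * pi" by simp
  finally have "J \<longlonglongrightarrow> (2 * pi) ^ DIM('a) * S" by (simp only: tendsto_of_real_iff)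
  then have 1: "(\<lambda>n. ennreal (J n)) \<longlonglongrightarrow> ennreal ((2 * pi) ^ DIM('a) * S)" by (rule tendsto_ennrealI)
  have Jnn: "(\<integral>\<^sup>+\<xi>. ennreal ((norm (ft f \<xi>))\<^sup>2 * exp (- (norm (c n *\<^sub>R \<xi>))\<^sup>2 / 2)) \<partial>lborel) = ennreal (J n)" for n
    unfolding J_def
  proof (rule nn_integral_eq_integral)
    define B where "B = (\<integral>x. norm (f x) \<partial>lborel)\<^sup>2"
    have "integrable lborel (\<lambda>\<xi>::'a. B * norm (gauss (c n *\<^sub>R \<xi>)))" by (intro integrable_mult_right integrable_norm gi)
    then show "integrable lborel (\<lambda>\<xi>. (norm (ft f \<xi>))\<^sup>2 * exp (- (norm (c n *\<^sub>R \<xi>))\<^sup>2 / 2))"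
    proof (rule Bochner_Integration.integrable_bound)
      show "AE \<xi> in lborel. norm ((norm (ft f \<xi>))\<^sup>2 * exp (- (norm (c n *\<^sub>R \<xi>))\<^sup>2 / 2)) \<le> norm (B * norm (gauss (c n *\<^sub>R \<xi>)))"
        using norm_ft_le[OF f] by (intro AE_I2) (auto simp: B_def gauss_def abs_mult intro!: mult_right_mono power_mono)
    qed measurable
  qed simp
  have 2: "(\<lambda>n. \<integral>\<^sup>+\<xi>. ennreal ((norm (ft f \<xi>))\<^sup>2 * exp (- (norm (c n *\<^sub>R \<xi>))\<^sup>2 / 2)) \<partial>lborel) \<longlonglongrightarrow> (\<integral>\<^sup>+\<xi>. ennreal ((norm (ft f \<xi>))\<^sup>2) \<partial>lborel)"
  proof (rule nn_integral_LIMSEQ)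
    show "incseq (\<lambda>n \<xi>. ennreal ((norm (ft f \<xi>))\<^sup>2 * exp (- (norm (c n *\<^sub>R \<xi>))\<^sup>2 / 2)))"
    proof (intro incseq_SucI le_funI ennreal_leI mult_left_mono)
      fix n \<xi>
      have "c (Suc n) \<le> c n" by (simp add: c_def frac_le)
      then have "norm (c (Suc n) *\<^sub>R \<xi>) \<le> norm (c n *\<^sub>R \<xi>)" using c[of n] c[of "Suc n"] by (simp add: mult_right_mono)
      then have "(norm (c (Suc n) *\<^sub>R \<xi>))\<^sup>2 \<le> (norm (c n *\<^sub>R \<xi>))\<^sup>2" by (intro power_mono) auto
      then show "exp (- (norm (c n *\<^sub>R \<xi>))\<^sup>2 / 2) \<le> exp (- (norm (c (Suc n) *\<^sub>R \<xi>))\<^sup>2 / 2)" by simp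
    qed auto
    fix \<xi> :: 'a
    have "(\<lambda>n. ennreal ((norm (ft f \<xi>))\<^sup>2 * exp (- (norm (c n *\<^sub>R \<xi>))\<^sup>2 / 2))) \<longlonglongrightarrow> ennreal ((norm (ft f \<xi>))\<^sup>2 * exp (- (norm (0 *\<^sub>R \<xi>))\<^sup>2 / 2))"
      by (intro tendsto_ennrealI tendsto_intros cl) simp
    moreover have "(norm (ft f \<xi>))\<^sup>2 * exp (- (norm (0 *\<^sub>R \<xi>))\<^sup>2 / 2) = (norm (ft f \<xi>))\<^sup>2" by simp
    ultimately show "(\<lambda>n. ennreal ((norm (ft f \<xi>))\<^sup>2 * exp (- (norm (c n *\<^sub>R \<xi>))\<^sup>2 / 2))) \<longlonglongrightarrow> ennreal ((norm (ft f \<xi>))\<^sup>2)"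
      by metis
  qed measurable
  have "(\<integral>\<^sup>+\<xi>. ennreal ((norm (ft f \<xi>))\<^sup>2) \<partial>lborel) = ennreal ((2 * pi) ^ DIM('a) * S)"
    using LIMSEQ_unique[OF 2[unfolded Jnn] 1] .
  also have "\<dots> = ennreal ((2 * pi) ^ DIM('a)) * (\<integral>\<^sup>+x. ennreal ((norm (f x))\<^sup>2) \<partial>lborel)"
    unfolding S_def by (subst nn_integral_eq_integral[OF f2]) (simp_all add: ennreal_mult')
  finally show ?thesis .
qed

section \<open>Square integrable functions\<close>

text \<open>The measure is a parameter because both \<open>lborel\<close> and its completion
  \<open>lebesgue\<close> occur.\<close>

definition sq_int :: "'a measure \<Rightarrow> ('a \<Rightarrow> complex) \<Rightarrow> bool" where
  "sq_int M f \<longleftrightarrow> f \<in> borel_measurable M \<and> integrable M (\<lambda>x. (cmod (f x))\<^sup>2)"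

definition l2norm :: "'a measure \<Rightarrow> ('a \<Rightarrow> complex) \<Rightarrow> real" where
  "l2norm M f = sqrt (\<integral>x. (cmod (f x))\<^sup>2 \<partial>M)"

lemma sq_int_measurable [measurable_dest]: "sq_int M f \<Longrightarrow> f \<in> borel_measurable M"
  by (simp add: sq_int_def)

lemma l2norm_nonneg: "0 \<le> l2norm M f"
  by (simp add: l2norm_def Bochner_Integration.integral_nonneg)

lemma l2norm_square: "(l2norm M f)\<^sup>2 = (\<integral>x. (cmod (f x))\<^sup>2 \<partial>M)"
  by (simp add: l2norm_def Bochner_Integration.integral_nonneg)

lemma sq_int_bound:
  assumes g: "sq_int M g" and [measurable]: "f \<in> borel_measurable M" and le: "\<And>x. cmod (f x) \<le> C * cmod (g x)"
  shows "sq_int M f"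
  unfolding sq_int_def
proof
  have "integrable M (\<lambda>x. C\<^sup>2 * (cmod (g x))\<^sup>2)" using g by (simp add: sq_int_def)
  then show "integrable M (\<lambda>x. (cmod (f x))\<^sup>2)"
  proof (rule Bochner_Integration.integrable_bound)
    show "AE x in M. norm ((cmod (f x))\<^sup>2) \<le> norm (C\<^sup>2 * (cmod (g x))\<^sup>2)"
      using power_mono[OF le, of _ 2] by (intro AE_I2) (simp add: power_mult_distrib)
  qed measurable
qed fact

lemma sq_int_add:
  assumes f: "sq_int M f" and g: "sq_int M g" shows "sq_int M (\<lambda>x. f x + g x)"
  unfolding sq_int_def
proof
  note [measurable] = sq_int_measurable[OF f] sq_int_measurable[OF g]
  show "(\<lambda>x. f x + g x) \<in> borel_measurable M" by measurable
  have i: "integrable M (\<lambda>x. 2 * ((cmod (f x))\<^sup>2 + (cmod (g x))\<^sup>2))" using f g by (auto simp: sq_int_def)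
  show "integrable M (\<lambda>x. (cmod (f x + g x))\<^sup>2)"
  proof (rule Bochner_Integration.integrable_bound[OF i], measurable, rule AE_I2)
    fix x
    have "(cmod (f x + g x))\<^sup>2 \<le> (cmod (f x) + cmod (g x))\<^sup>2" by (intro power_mono norm_triangle_ineq) auto
    also have "\<dots> \<le> 2 * ((cmod (f x))\<^sup>2 + (cmod (g x))\<^sup>2)"
      using mult_le_sum_squares[of "cmod (f x)" "cmod (g x)"] by (simp add: power2_sum)
    finally show "norm ((cmod (f x + g x))\<^sup>2) \<le> norm (2 * ((cmod (f x))\<^sup>2 + (cmod (g x))\<^sup>2))" by simp
  qed
qed

lemma sq_int_cmult: "sq_int M f \<Longrightarrow> sq_int M (\<lambda>x. c * f x)"
  by (rule sq_int_bound[where C="cmod c"]) (auto simp: norm_mult)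

lemma sq_int_diff: "sq_int M f \<Longrightarrow> sq_int M g \<Longrightarrow> sq_int M (\<lambda>x. f x - g x)"
  using sq_int_add[of M f "\<lambda>x. (-1) * g x"] sq_int_cmult[of M g "-1"] by simp

lemma sq_int_cnj: "sq_int M f \<Longrightarrow> sq_int M (\<lambda>x. cnj (f x))"
  by (rule sq_int_bound[where C=1]) auto

lemma integrable_sq_int_mult:
  assumes f: "sq_int M f" and g: "sq_int M g" shows "integrable M (\<lambda>x. f x * g x)"
proof -
  note [measurable] = sq_int_measurable[OF f] sq_int_measurable[OF g]
  have i: "integrable M (\<lambda>x. ((cmod (f x))\<^sup>2 + (cmod (g x))\<^sup>2) / 2)" using f g by (auto simp: sq_int_def)
  show ?thesis
    by (rule Bochner_Integration.integrable_bound[OF i], measurable, rule AE_I2)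
      (use mult_le_sum_squares in \<open>auto simp: norm_mult\<close>)
qed

text \<open>A weighted arithmetic-geometric mean inequality with the ratio of the two norms as
  weight. Adding e to the squared norms keeps the ratio meaningful when a norm is 0; then e tends to
  0.\<close>

lemma cauchy_schwarz_integral:
  assumes f: "sq_int M f" and g: "sq_int M g"
  shows "(\<integral>x. cmod (f x) * cmod (g x) \<partial>M) \<le> l2norm M f * l2norm M g"
proof -
  define A where "A = (\<integral>x. (cmod (f x))\<^sup>2 \<partial>M)"
  define B where "B = (\<integral>x. (cmod (g x))\<^sup>2 \<partial>M)"
  have AB: "0 \<le> A" "0 \<le> B" by (auto simp: A_def B_def Bochner_Integration.integral_nonneg)
  have i: "integrable M (\<lambda>x. cmod (f x) * cmod (g x))"
    using integrable_norm[OF integrable_sq_int_mult[OF f g]] by (simp add: norm_mult)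
  have *: "(\<integral>x. cmod (f x) * cmod (g x) \<partial>M) \<le> sqrt (A + e) * sqrt (B + e)" if e: "0 < e" for e
  proof -
    define p where "p = sqrt (A + e)"
    define q where "q = sqrt (B + e)"
    have pq: "0 < p" "0 < q" "p\<^sup>2 = A + e" "q\<^sup>2 = B + e" using AB e by (auto simp: p_def q_def)
    have "(\<integral>x. cmod (f x) * cmod (g x) \<partial>M) \<le> (\<integral>x. (q / p * (cmod (f x))\<^sup>2 + p / q * (cmod (g x))\<^sup>2) / 2 \<partial>M)"
    proof (rule integral_mono[OF i])
      show "integrable M (\<lambda>x. (q / p * (cmod (f x))\<^sup>2 + p / q * (cmod (g x))\<^sup>2) / 2)" using f g by (auto simp: sq_int_def)
      fix x
      have s: "(sqrt (q / p))\<^sup>2 = q / p" "(sqrt (p / q))\<^sup>2 = p / q" using pq by auto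
      have "sqrt (q / p) * sqrt (p / q) = 1" using pq by (simp add: real_sqrt_mult[symmetric])
      then have "cmod (f x) * cmod (g x) = (sqrt (q / p) * cmod (f x)) * (sqrt (p / q) * cmod (g x))" by simp
      also have "\<dots> \<le> ((sqrt (q / p) * cmod (f x))\<^sup>2 + (sqrt (p / q) * cmod (g x))\<^sup>2) / 2"
        by (rule mult_le_sum_squares)
      finally show "cmod (f x) * cmod (g x) \<le> (q / p * (cmod (f x))\<^sup>2 + p / q * (cmod (g x))\<^sup>2) / 2"
        by (simp only: power_mult_distrib s)
    qed
    also have "\<dots> = (q / p * A + p / q * B) / 2"
      using f g by (simp add: A_def B_def sq_int_def)
    also have "\<dots> \<le> (q / p * p\<^sup>2 + p / q * q\<^sup>2) / 2"
    proof -
      have "q / p * A \<le> q / p * p\<^sup>2" "p / q * B \<le> p / q * q\<^sup>2"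
        by (rule mult_left_mono; use pq e in simp)+
      then show ?thesis by (intro divide_right_mono add_mono) simp_all
    qed
    also have "\<dots> = p * q" using pq(1,2) by (simp add: power2_eq_square)
    finally show ?thesis by (simp add: p_def q_def)
  qed
  have "((\<lambda>e. sqrt (A + e) * sqrt (B + e)) \<longlongrightarrow> sqrt (A + 0) * sqrt (B + 0)) (at_right 0)"
    by (intro tendsto_intros)
  moreover have "\<forall>\<^sub>F e in at_right 0. (\<integral>x. cmod (f x) * cmod (g x) \<partial>M) \<le> sqrt (A + e) * sqrt (B + e)"
    using * by (auto simp: eventually_at_right_field intro: exI[of _ 1])
  ultimately have "(\<integral>x. cmod (f x) * cmod (g x) \<partial>M) \<le> sqrt (A + 0) * sqrt (B + 0)"
    by (intro tendsto_lowerbound[of _ _ "at_right (0::real)"]) auto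
  then show ?thesis by (simp add: l2norm_def A_def B_def)
qed

lemma cauchy_schwarz_norm:
  assumes f: "sq_int M f" and g: "sq_int M g"
  shows "cmod (\<integral>x. f x * g x \<partial>M) \<le> l2norm M f * l2norm M g"
  using order_trans[OF integral_norm_bound[of M "\<lambda>x. f x * g x"]] cauchy_schwarz_integral[OF f g] by (simp add: norm_mult)

lemma l2norm_add:
  assumes f: "sq_int M f" and g: "sq_int M g"
  shows "l2norm M (\<lambda>x. f x + g x) \<le> l2norm M f + l2norm M g"
proof (rule power2_le_imp_le)
  have i: "integrable M (\<lambda>x. cmod (f x) * cmod (g x))"
    using integrable_norm[OF integrable_sq_int_mult[OF f g]] by (simp add: norm_mult)
  have "(l2norm M (\<lambda>x. f x + g x))\<^sup>2 \<le> (\<integral>x. (cmod (f x))\<^sup>2 + (cmod (g x))\<^sup>2 + 2 * (cmod (f x) * cmod (g x)) \<partial>M)"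
    unfolding l2norm_square
  proof (rule integral_mono)
    show "integrable M (\<lambda>x. (cmod (f x))\<^sup>2 + (cmod (g x))\<^sup>2 + 2 * (cmod (f x) * cmod (g x)))"
      using f g i by (auto simp: sq_int_def)
    fix x
    have "(cmod (f x + g x))\<^sup>2 \<le> (cmod (f x) + cmod (g x))\<^sup>2" by (intro power_mono norm_triangle_ineq) auto
    then show "(cmod (f x + g x))\<^sup>2 \<le> (cmod (f x))\<^sup>2 + (cmod (g x))\<^sup>2 + 2 * (cmod (f x) * cmod (g x))"
      by (simp add: power2_sum mult.assoc)
  qed (use sq_int_add[OF f g] in \<open>simp add: sq_int_def\<close>)
  also have "\<dots> = (l2norm M f)\<^sup>2 + (l2norm M g)\<^sup>2 + 2 * (\<integral>x. cmod (f x) * cmod (g x) \<partial>M)"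
    using f g i by (simp add: sq_int_def l2norm_square)
  also have "\<dots> \<le> (l2norm M f + l2norm M g)\<^sup>2"
    using cauchy_schwarz_integral[OF f g] by (simp add: power2_sum)
  finally show "(l2norm M (\<lambda>x. f x + g x))\<^sup>2 \<le> (l2norm M f + l2norm M g)\<^sup>2" .
qed (simp add: l2norm_nonneg)

lemma l2norm_minus_commute: "l2norm M (\<lambda>x. f x - g x) = l2norm M (\<lambda>x. g x - f x)"
  by (simp add: l2norm_def norm_minus_commute)

lemma l2norm_triangle:
  assumes "sq_int M f" "sq_int M g" "sq_int M h"
  shows "l2norm M (\<lambda>x. f x - h x) \<le> l2norm M (\<lambda>x. f x - g x) + l2norm M (\<lambda>x. g x - h x)"
  using l2norm_add[OF sq_int_diff[OF assms(1,2)] sq_int_diff[OF assms(2,3)]] by simp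

lemma nn_integral_sq_int:
  "sq_int M f \<Longrightarrow> (\<integral>\<^sup>+x. ennreal ((cmod (f x))\<^sup>2) \<partial>M) = ennreal ((l2norm M f)\<^sup>2)"
  unfolding l2norm_square by (rule nn_integral_eq_integral) (auto simp: sq_int_def)

lemma sq_int_nn:
  assumes [measurable]: "f \<in> borel_measurable M" and "(\<integral>\<^sup>+x. ennreal ((cmod (f x))\<^sup>2) \<partial>M) < \<infinity>"
  shows "sq_int M f"
  unfolding sq_int_def using assms by (auto intro!: integrableI_bounded)

lemma l2norm_le_nn:
  assumes "sq_int M f" "(\<integral>\<^sup>+x. ennreal ((cmod (f x))\<^sup>2) \<partial>M) \<le> ennreal (C\<^sup>2)" "0 \<le> C"
  shows "l2norm M f \<le> C"
proof -
  have "(l2norm M f)\<^sup>2 \<le> C\<^sup>2" using assms(2) unfolding nn_integral_sq_int[OF assms(1)] by (simp add: ennreal_le_iff)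
  then show ?thesis using assms(3) by (rule power2_le_imp_le)
qed

lemma l2norm_zero_AE:
  assumes f: "sq_int M f" and "l2norm M f = 0" shows "AE x in M. f x = 0"
proof -
  have "(\<integral>x. (cmod (f x))\<^sup>2 \<partial>M) = 0" using assms(2) l2norm_square[of M f] by simp
  then have "AE x in M. (cmod (f x))\<^sup>2 = 0"
    by (subst (asm) integral_nonneg_eq_0_iff_AE) (use f in \<open>auto simp: sq_int_def\<close>)
  then show ?thesis by eventually_elim simp
qed

lemma l2norm_cong_AE:
  assumes "AE x in M. f x = g x" "f \<in> borel_measurable M" "g \<in> borel_measurable M"
  shows "l2norm M f = l2norm M g"
  unfolding l2norm_def
  by (intro arg_cong[where f=sqrt] integral_cong_AE) (use assms in \<open>auto elim: eventually_mono\<close>)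

lemma sq_int_cong_AE:
  assumes "sq_int M f" "AE x in M. f x = g x" "g \<in> borel_measurable M"
  shows "sq_int M g"
proof -
  have "integrable M (\<lambda>x. (cmod (f x))\<^sup>2) \<longleftrightarrow> integrable M (\<lambda>x. (cmod (g x))\<^sup>2)"
    by (intro integrable_cong_AE) (use assms in \<open>auto simp: sq_int_def elim: eventually_mono\<close>)
  then show ?thesis using assms by (simp add: sq_int_def)
qed

lemma l2_inner_tendsto:
  fixes f g :: "nat \<Rightarrow> 'a \<Rightarrow> complex"
  assumes f: "\<And>n. sq_int M (f n)" "sq_int M F" "(\<lambda>n. l2norm M (\<lambda>x. f n x - F x)) \<longlonglongrightarrow> 0"
    and g: "\<And>n. sq_int M (g n)" "sq_int M G" "(\<lambda>n. l2norm M (\<lambda>x. g n x - G x)) \<longlonglongrightarrow> 0"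
  shows "(\<lambda>n. \<integral>x. f n x * g n x \<partial>M) \<longlonglongrightarrow> (\<integral>x. F x * G x \<partial>M)"
proof -
  let ?a = "\<lambda>n. l2norm M (\<lambda>x. f n x - F x)" and ?b = "\<lambda>n. l2norm M (\<lambda>x. g n x - G x)"
  have "(\<lambda>n. ?a n * ?b n + ?a n * l2norm M G + l2norm M F * ?b n) \<longlonglongrightarrow> 0 * 0 + 0 * l2norm M G + l2norm M F * 0"
    by (intro tendsto_intros f g)
  then have lim: "(\<lambda>n. ?a n * ?b n + ?a n * l2norm M G + l2norm M F * ?b n) \<longlonglongrightarrow> 0" by simp
  have "(\<lambda>n. (\<integral>x. f n x * g n x \<partial>M) - (\<integral>x. F x * G x \<partial>M)) \<longlonglongrightarrow> 0"
  proof (rule Lim_null_comparison[OF _ lim], intro always_eventually allI)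
    fix n
    note d = sq_int_diff[OF f(1,2), of n] sq_int_diff[OF g(1,2), of n]
    have "(\<integral>x. f n x * g n x \<partial>M) - (\<integral>x. F x * G x \<partial>M)
        = (\<integral>x. (f n x - F x) * (g n x - G x) + (f n x - F x) * G x + F x * (g n x - G x) \<partial>M)"
      by (subst Bochner_Integration.integral_diff[symmetric])
        (auto intro!: integrable_sq_int_mult f g Bochner_Integration.integral_cong simp: algebra_simps)
    also have "\<dots> = (\<integral>x. (f n x - F x) * (g n x - G x) \<partial>M) + (\<integral>x. (f n x - F x) * G x \<partial>M) + (\<integral>x. F x * (g n x - G x) \<partial>M)"
      using integrable_sq_int_mult[OF d] integrable_sq_int_mult[OF d(1) g(2)] integrable_sq_int_mult[OF f(2) d(2)]
      by simp
    finally have e: "(\<integral>x. f n x * g n x \<partial>M) - (\<integral>x. F x * G x \<partial>M)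
        = (\<integral>x. (f n x - F x) * (g n x - G x) \<partial>M) + (\<integral>x. (f n x - F x) * G x \<partial>M) + (\<integral>x. F x * (g n x - G x) \<partial>M)" .
    have tri: "cmod (p + q + s) \<le> P + Q + S" if "cmod p \<le> P" "cmod q \<le> Q" "cmod s \<le> S" for p q s P Q S
      using norm_triangle_ineq[of "p + q" s] norm_triangle_ineq[of p q] that by linarith
    show "cmod ((\<integral>x. f n x * g n x \<partial>M) - (\<integral>x. F x * G x \<partial>M)) \<le> ?a n * ?b n + ?a n * l2norm M G + l2norm M F * ?b n"
      unfolding e
      by (rule tri[OF cauchy_schwarz_norm[OF d] cauchy_schwarz_norm[OF d(1) g(2)] cauchy_schwarz_norm[OF f(2) d(2)]])
  qed
  then show ?thesis by (rule LIM_zero_cancel)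
qed

text \<open>The argument of Riesz and Fischer. Along a subsequence with increments D k of norm at
  most 4^(-k), the sum of 4^k |D k|^2 has finite integral, so it is finite almost everywhere. There
  |D k| is at most a constant times 2^(-k), and the subsequence converges. Fatou's lemma carries the
  Cauchy estimate over to the limit.\<close>

theorem l2_complete:
  fixes f :: "nat \<Rightarrow> 'a \<Rightarrow> complex"
  assumes f: "\<And>n. sq_int M (f n)"
    and cauchy: "\<And>e. 0 < e \<Longrightarrow> \<exists>N. \<forall>m\<ge>N. \<forall>n\<ge>N. l2norm M (\<lambda>x. f m x - f n x) < e"
  obtains g where "sq_int M g" "(\<lambda>n. l2norm M (\<lambda>x. f n x - g x)) \<longlonglongrightarrow> 0"
proof -
  note [measurable] = sq_int_measurable[OF f]
  have "\<forall>k. \<exists>N. \<forall>m\<ge>N. \<forall>n\<ge>N. l2norm M (\<lambda>x. f m x - f n x) < (1/4) ^ k"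
    by (intro allI cauchy) simp
  from choice[OF this] obtain N
    where N: "\<And>k m n. N k \<le> m \<Longrightarrow> N k \<le> n \<Longrightarrow> l2norm M (\<lambda>x. f m x - f n x) < (1/4) ^ k"
    by blast
  \<comment> \<open>The sum gives \<open>N k \<le> r k\<close> and monotonicity; the extra summand k
    gives \<open>k \<le> r k\<close>, which the Fatou step uses to push indices beyond any
    \<open>N j\<close>.\<close>
  define r where "r k = (\<Sum>i\<le>k. N i) + k" for k
  have rN: "N k \<le> r k" for k unfolding r_def by (simp add: trans_le_add1 member_le_sum)
  have rS: "r k \<le> r (Suc k)" for k by (simp add: r_def)
  have rk: "k \<le> r k" for k by (simp add: r_def)
  define D where "D k x = f (r (Suc k)) x - f (r k) x" for k x
  have Dsq: "sq_int M (D k)" for k unfolding D_def by (intro sq_int_diff f)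
  note [measurable] = sq_int_measurable[OF Dsq]
  have Dn: "(\<integral>\<^sup>+x. ennreal ((cmod (D k x))\<^sup>2) \<partial>M) \<le> ennreal (((1/4) ^ k)\<^sup>2)" for k
    unfolding nn_integral_sq_int[OF Dsq]
    using N[of k "r (Suc k)" "r k"] rN[of k] rS[of k] l2norm_nonneg
    by (intro ennreal_leI power_mono) (auto simp: D_def[abs_def] intro: less_imp_le)
  have "(\<integral>\<^sup>+x. (\<Sum>k. ennreal (4 ^ k) * ennreal ((cmod (D k x))\<^sup>2)) \<partial>M) = (\<Sum>k. ennreal (4 ^ k) * (\<integral>\<^sup>+x. ennreal ((cmod (D k x))\<^sup>2) \<partial>M))"
    by (subst nn_integral_suminf) (auto simp: nn_integral_cmult)
  also have "\<dots> \<le> (\<Sum>k. ennreal ((1/4) ^ k))"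
  proof (intro suminf_le)
    fix k
    have "ennreal (4 ^ k) * (\<integral>\<^sup>+x. ennreal ((cmod (D k x))\<^sup>2) \<partial>M) \<le> ennreal (4 ^ k) * ennreal (((1/4) ^ k)\<^sup>2)"
      by (intro mult_left_mono Dn) auto
    also have "\<dots> = ennreal ((1/4) ^ k)"
      by (simp add: ennreal_mult[symmetric] power2_eq_square power_mult_distrib[symmetric] mult.assoc[symmetric])
    finally show "ennreal (4 ^ k) * (\<integral>\<^sup>+x. ennreal ((cmod (D k x))\<^sup>2) \<partial>M) \<le> ennreal ((1/4) ^ k)" .
  qed auto
  also have "\<dots> < \<infinity>" by (subst suminf_ennreal2) (auto simp: summable_geometric)
  finally have "AE x in M. (\<Sum>k. ennreal (4 ^ k) * ennreal ((cmod (D k x))\<^sup>2)) \<noteq> \<infinity>"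
    by (intro nn_integral_PInf_AE) auto
  then have conv: "AE x in M. convergent (\<lambda>k. f (r k) x)"
  proof eventually_elim
    case (elim x)
    let ?S = "\<Sum>k. ennreal (4 ^ k) * ennreal ((cmod (D k x))\<^sup>2)"
    obtain C where C: "0 \<le> C" "?S = ennreal C" using elim by (cases ?S) auto
    have "cmod (D k x) \<le> sqrt C * (1/2) ^ k" for k
    proof -
      have "ennreal (4 ^ k * (cmod (D k x))\<^sup>2) \<le> ?S"
        using sum_le_suminf[of "\<lambda>k. ennreal (4 ^ k) * ennreal ((cmod (D k x))\<^sup>2)" "{k}"]
        by (simp add: ennreal_mult)
      then have "4 ^ k * (cmod (D k x))\<^sup>2 \<le> C" using C by (simp add: ennreal_le_iff)
      moreover have "(4::real) ^ k = (2 ^ k)\<^sup>2"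
      proof -
        have "(2 ^ k)\<^sup>2 = ((2::real)\<^sup>2) ^ k" by (simp only: power_mult[symmetric] mult.commute)
        then show ?thesis by simp
      qed
      ultimately have "(2 ^ k * cmod (D k x))\<^sup>2 \<le> C" by (simp add: power_mult_distrib)
      then have "2 ^ k * cmod (D k x) \<le> sqrt C" by (rule real_le_rsqrt)
      then show ?thesis by (simp add: field_simps power_divide)
    qed
    moreover have "summable (\<lambda>k. sqrt C * (1/2) ^ k)"
      by (intro summable_mult summable_geometric) simp
    ultimately have "summable (\<lambda>k. D k x)"
      by (metis summable_comparison_test')
    then have "convergent (\<lambda>n. \<Sum>k<n. D k x)" by (simp add: summable_iff_convergent)
    moreover have "(\<Sum>k<n. D k x) = f (r n) x - f (r 0) x" for n
      unfolding D_def by (rule sum_lessThan_telescope)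
    ultimately have "convergent (\<lambda>n. (f (r n) x - f (r 0) x) + f (r 0) x)"
      by (intro convergent_add convergent_const) simp
    then show ?case by simp
  qed
  define g where "g x = lim (\<lambda>k. f (r k) x)" for x
  have gm[measurable]: "g \<in> borel_measurable M" unfolding g_def by measurable
  have glim: "AE x in M. (\<lambda>k. f (r k) x) \<longlonglongrightarrow> g x"
    using conv by eventually_elim (simp add: g_def convergent_LIMSEQ_iff)
  have fatou: "(\<integral>\<^sup>+x. ennreal ((cmod (f n x - g x))\<^sup>2) \<partial>M) \<le> ennreal (((1/4) ^ j)\<^sup>2)" if n: "N j \<le> n" for n j
  proof -
    have "(\<integral>\<^sup>+x. ennreal ((cmod (f n x - g x))\<^sup>2) \<partial>M) = (\<integral>\<^sup>+x. liminf (\<lambda>k. ennreal ((cmod (f n x - f (r k) x))\<^sup>2)) \<partial>M)"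
    proof (intro nn_integral_cong_AE)
      show "AE x in M. ennreal ((cmod (f n x - g x))\<^sup>2) = liminf (\<lambda>k. ennreal ((cmod (f n x - f (r k) x))\<^sup>2))"
        using glim
      proof eventually_elim
        case (elim x)
        have "(\<lambda>k. ennreal ((cmod (f n x - f (r k) x))\<^sup>2)) \<longlonglongrightarrow> ennreal ((cmod (f n x - g x))\<^sup>2)"
          by (intro tendsto_ennrealI tendsto_intros elim)
        then show ?case using lim_imp_Liminf[OF sequentially_bot] by metis
      qed
    qed
    also have "\<dots> \<le> liminf (\<lambda>k. \<integral>\<^sup>+x. ennreal ((cmod (f n x - f (r k) x))\<^sup>2) \<partial>M)"
      by (rule nn_integral_liminf) measurable
    also have "\<dots> \<le> ennreal (((1/4) ^ j)\<^sup>2)"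
    proof (rule order_trans[OF Liminf_le_Limsup Limsup_bounded], simp, rule eventually_mono[OF eventually_ge_at_top[of "N j"]])
      fix k assume "N j \<le> k"
      then have "N j \<le> r k" using rk[of k] by simp
      then have "l2norm M (\<lambda>x. f n x - f (r k) x) \<le> (1/4) ^ j" using N[OF n] by (simp add: less_imp_le)
      then show "(\<integral>\<^sup>+x. ennreal ((cmod (f n x - f (r k) x))\<^sup>2) \<partial>M) \<le> ennreal (((1/4) ^ j)\<^sup>2)"
        unfolding nn_integral_sq_int[OF sq_int_diff[OF f f]] by (intro ennreal_leI power_mono l2norm_nonneg)
    qed
    finally show ?thesis .
  qed
  have dsq: "sq_int M (\<lambda>x. f (N 0) x - g x)"
    by (rule sq_int_nn, measurable) (rule le_less_trans[OF fatou[of 0 "N 0"]], auto)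
  have gsq: "sq_int M g" using sq_int_diff[OF f[of "N 0"] dsq] by simp
  have "(\<lambda>n. l2norm M (\<lambda>x. f n x - g x)) \<longlonglongrightarrow> 0"
  proof (rule LIMSEQ_I)
    fix e :: real assume "0 < e"
    then obtain j where j: "(1/4) ^ j < e" using real_arch_pow_inv[of e "1/4"] by auto
    have "norm (l2norm M (\<lambda>x. f n x - g x) - 0) < e" if "N j \<le> n" for n
      using l2norm_le_nn[OF sq_int_diff[OF f gsq] fatou[OF that]] j l2norm_nonneg[of M "\<lambda>x. f n x - g x"] by simp
    then show "\<exists>no. \<forall>n\<ge>no. norm (l2norm M (\<lambda>x. f n x - g x) - 0) < e" by blast
  qed
  with gsq show ?thesis by (rule that)
qed

section \<open>The Fourier transform on \<open>L\<^sup>2\<close>\<close>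

lemma l2norm_tendsto:
  assumes f: "\<And>n. sq_int M (f n)" "sq_int M F" "((\<lambda>n. l2norm M (\<lambda>x. f n x - F x)) \<longlongrightarrow> 0) G"
  shows "((\<lambda>n. l2norm M (f n)) \<longlongrightarrow> l2norm M F) G"
proof -
  have "((\<lambda>n. l2norm M (f n) - l2norm M F) \<longlongrightarrow> 0) G"
  proof (rule Lim_null_comparison[OF _ f(3)], intro always_eventually allI)
    fix n
    have 1: "l2norm M (f n) \<le> l2norm M (\<lambda>x. f n x - F x) + l2norm M F"
      using l2norm_add[OF sq_int_diff[OF f(1,2), of n] f(2)] by simp
    have 2: "l2norm M F \<le> l2norm M (\<lambda>x. F x - f n x) + l2norm M (f n)"
      using l2norm_add[OF sq_int_diff[OF f(2,1), of n] f(1)[of n]] by simp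
    show "norm (l2norm M (f n) - l2norm M F) \<le> l2norm M (\<lambda>x. f n x - F x)"
      using 1 2 l2norm_minus_commute[of M "f n" F] by simp
  qed
  then show ?thesis by (rule LIM_zero_cancel)
qed

lemma l2norm_cmult: "l2norm M (\<lambda>x. c * f x) = cmod c * l2norm M f"
  by (simp add: l2norm_def norm_mult power_mult_distrib real_sqrt_mult)

section \<open>Truncation to balls\<close>

definition cutoff :: "real \<Rightarrow> ('a::euclidean_space \<Rightarrow> complex) \<Rightarrow> 'a \<Rightarrow> complex" where
  "cutoff R w x = indicator (cball 0 R) x *\<^sub>R w x"

lemma cball_borel [measurable]: "cball c r \<in> sets borel" by simp

lemma cutoff_measurable [measurable]:
  "w \<in> borel_measurable borel \<Longrightarrow> cutoff R w \<in> borel_measurable borel"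
  unfolding cutoff_def[abs_def] by measurable

lemma cutoff_sq_int: "sq_int lborel w \<Longrightarrow> sq_int lborel (cutoff R w)"
  by (rule sq_int_bound[where C=1], assumption, use sq_int_measurable in force)
    (simp add: cutoff_def indicator_def)

text \<open>On a ball, which has finite measure, |w| \<le> 1 + |w|^2.\<close>

lemma cutoff_integrable:
  assumes w: "sq_int lborel w" shows "integrable lborel (cutoff R (w :: 'a::euclidean_space \<Rightarrow> complex))"
proof -
  note [measurable] = sq_int_measurable[OF w]
  have i: "integrable lborel (\<lambda>x. indicator (cball (0::'a) R) x + (cmod (w x))\<^sup>2)"
    using w by (intro Bochner_Integration.integrable_add integrable_real_indicator)
      (auto simp: sq_int_def emeasure_bounded_finite[unfolded infinity_ennreal_def])
  show ?thesis
  proof (rule Bochner_Integration.integrable_bound[OF i])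
    show "cutoff R w \<in> borel_measurable lborel" by measurable
    show "AE x in lborel. norm (cutoff R w x) \<le> norm (indicator (cball (0::'a) R) x + (cmod (w x))\<^sup>2)"
    proof (rule AE_I2)
      fix x :: 'a
      have "cmod (w x) \<le> 1 + (cmod (w x))\<^sup>2"
        using mult_le_sum_squares[of "cmod (w x)" 1] by (simp add: field_simps)
          (smt (verit) zero_le_power2)
      then show "norm (cutoff R w x) \<le> norm (indicator (cball (0::'a) R) x + (cmod (w x))\<^sup>2)"
        by (simp add: cutoff_def indicator_def)
    qed
  qed
qed

lemma cutoff_tendsto_seq:
  assumes w: "sq_int lborel w"
  shows "(\<lambda>n. l2norm lborel (\<lambda>x. cutoff (real n) w x - w x)) \<longlonglongrightarrow> 0"
proof -
  note [measurable] = sq_int_measurable[OF w]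
  have "(\<lambda>n. \<integral>x. (cmod (cutoff (real n) w x - w x))\<^sup>2 \<partial>lborel) \<longlonglongrightarrow> (\<integral>x. 0 \<partial>(lborel :: 'a measure))"
  proof (rule integral_dominated_convergence[where w="\<lambda>x. (cmod (w x))\<^sup>2"])
    show "AE x in lborel. (\<lambda>n. (cmod (cutoff (real n) w x - w x))\<^sup>2) \<longlonglongrightarrow> 0"
    proof (rule AE_I2, rule tendsto_eventually)
      fix x :: 'a
      obtain N :: nat where "norm x < real N" using reals_Archimedean2 by blast
      then show "\<forall>\<^sub>F n in sequentially. (cmod (cutoff (real n) w x - w x))\<^sup>2 = 0"
        by (intro eventually_mono[OF eventually_ge_at_top[of N]]) (auto simp: cutoff_def)
    qed
    show "integrable lborel (\<lambda>x. (cmod (w x))\<^sup>2)" using w by (simp add: sq_int_def)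
    show "AE x in lborel. norm ((cmod (cutoff (real n) w x - w x))\<^sup>2) \<le> (cmod (w x))\<^sup>2" for n
      by (auto simp: cutoff_def indicator_def)
  qed measurable
  then have "(\<lambda>n. sqrt (\<integral>x. (cmod (cutoff (real n) w x - w x))\<^sup>2 \<partial>lborel)) \<longlonglongrightarrow> sqrt 0"
    by (intro tendsto_intros) simp
  then show ?thesis by (simp add: l2norm_def)
qed

text \<open>The norm of the tail is nonincreasing in the radius, so the limit along integer radii
  determines the limit along real ones.\<close>

lemma cutoff_tendsto:
  assumes w: "sq_int lborel w"
  shows "((\<lambda>R. l2norm lborel (\<lambda>x. cutoff R w x - w x)) \<longlongrightarrow> 0) at_top"
proof (rule tendstoI)
  fix e :: real assume "0 < e"
  then have "\<forall>\<^sub>F n in sequentially. l2norm lborel (\<lambda>x. cutoff (real n) w x - w x) < e"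
    using cutoff_tendsto_seq[OF w] by (intro order_tendstoD) auto
  then obtain n where n: "l2norm lborel (\<lambda>x. cutoff (real n) w x - w x) < e" by (auto simp: eventually_sequentially)
  have "l2norm lborel (\<lambda>x. cutoff R w x - w x) \<le> l2norm lborel (\<lambda>x. cutoff (real n) w x - w x)" if "real n \<le> R" for R
    unfolding l2norm_def
    using sq_int_diff[OF cutoff_sq_int[OF w] w] that
    by (intro real_sqrt_le_mono integral_mono) (auto simp: sq_int_def cutoff_def indicator_def)
  then show "\<forall>\<^sub>F R in at_top. dist (l2norm lborel (\<lambda>x. cutoff R w x - w x)) 0 < e"
    using n by (intro eventually_mono[OF eventually_ge_at_top[of "real n"]]) (force simp: l2norm_nonneg)
qed

text \<open>The factor by which the unnormalised transform multiplies L^2 norms.\<close>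

definition plancherel_const :: "'a::euclidean_space itself \<Rightarrow> real" where
  "plancherel_const _ = sqrt ((2 * pi) ^ DIM('a))"

lemma plancherel_const_pos: "0 < plancherel_const TYPE('a::euclidean_space)"
  by (simp add: plancherel_const_def)

lemma ft_sq_int:
  fixes f :: "'a::euclidean_space \<Rightarrow> complex"
  assumes f: "integrable lborel f" "sq_int lborel f"
  shows "sq_int lborel (ft f)" "l2norm lborel (ft f) = plancherel_const TYPE('a) * l2norm lborel f"
proof -
  note [measurable] = sq_int_measurable[OF f(2)]
  have P: "(\<integral>\<^sup>+\<xi>. ennreal ((cmod (ft f \<xi>))\<^sup>2) \<partial>lborel) = ennreal ((2 * pi) ^ DIM('a) * (l2norm lborel f)\<^sup>2)"
    using plancherel_L1_L2[OF f(1)] f(2) nn_integral_sq_int[OF f(2)] by (simp add: sq_int_def ennreal_mult)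
  show s: "sq_int lborel (ft f)"
    by (rule sq_int_nn) (auto simp: P)
  have "ennreal ((l2norm lborel (ft f))\<^sup>2) = ennreal ((2 * pi) ^ DIM('a) * (l2norm lborel f)\<^sup>2)"
    using P unfolding nn_integral_sq_int[OF s] .
  then have "(l2norm lborel (ft f))\<^sup>2 = (plancherel_const TYPE('a) * l2norm lborel f)\<^sup>2"
    by (simp add: plancherel_const_def power_mult_distrib)
  then show "l2norm lborel (ft f) = plancherel_const TYPE('a) * l2norm lborel f"
    using plancherel_const_pos[where 'a='a] l2norm_nonneg by (intro power2_eq_imp_eq[of "l2norm lborel (ft f)"]) (auto intro!: mult_nonneg_nonneg simp: less_imp_le)
qed

lemma ft_diff:
  assumes "integrable lborel f" "integrable lborel g"
  shows "ft (\<lambda>x. f x - g x) \<xi> = ft f \<xi> - ft g \<xi>"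
  unfolding ft_def right_diff_distrib
  by (rule Bochner_Integration.integral_diff) (auto intro!: integrable_cis_mult assms)

text \<open>The Borel counterpart of \<open>has_fourier\<close>, with norms in \<open>lborel\<close>
  instead of \<open>lebesgue\<close>; \<open>has_fourier_iff\<close> passes between the two.\<close>

definition l2_ft :: "('a::euclidean_space \<Rightarrow> complex) \<Rightarrow> ('a \<Rightarrow> complex) \<Rightarrow> bool" where
  "l2_ft w v \<longleftrightarrow> sq_int lborel w \<and> sq_int lborel v \<and>
     ((\<lambda>R. l2norm lborel (\<lambda>\<xi>. ft (cutoff R w) \<xi> - v \<xi>)) \<longlongrightarrow> 0) at_top"

lemma ft_cutoff_sq_int: "sq_int lborel w \<Longrightarrow> sq_int lborel (ft (cutoff R w))"
  by (intro ft_sq_int cutoff_integrable cutoff_sq_int)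

lemma ft_cutoff_diff:
  fixes w :: "'a::euclidean_space \<Rightarrow> complex"
  assumes w: "sq_int lborel w"
  shows "l2norm lborel (\<lambda>\<xi>. ft (cutoff R w) \<xi> - ft (cutoff S w) \<xi>)
    \<le> plancherel_const TYPE('a) * (l2norm lborel (\<lambda>x. cutoff R w x - w x) + l2norm lborel (\<lambda>x. cutoff S w x - w x))"
proof -
  have "(\<lambda>\<xi>. ft (cutoff R w) \<xi> - ft (cutoff S w) \<xi>) = ft (\<lambda>x. cutoff R w x - cutoff S w x)"
    using cutoff_integrable[OF w] by (auto simp: ft_diff)
  then have "l2norm lborel (\<lambda>\<xi>. ft (cutoff R w) \<xi> - ft (cutoff S w) \<xi>) = plancherel_const TYPE('a) * l2norm lborel (\<lambda>x. cutoff R w x - cutoff S w x)"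
    using ft_sq_int(2)[OF Bochner_Integration.integrable_diff[OF cutoff_integrable[OF w] cutoff_integrable[OF w]] sq_int_diff[OF cutoff_sq_int[OF w] cutoff_sq_int[OF w]]]
    by metis
  also have "\<dots> \<le> plancherel_const TYPE('a) * (l2norm lborel (\<lambda>x. cutoff R w x - w x) + l2norm lborel (\<lambda>x. w x - cutoff S w x))"
    using plancherel_const_pos[where 'a='a] by (intro mult_left_mono l2norm_triangle cutoff_sq_int w) auto
  finally show ?thesis using l2norm_minus_commute[of lborel w "cutoff S w"] by simp
qed

text \<open>On integrable functions in L^2 the transform is a multiple of an isometry, so the
  transforms of the truncations to integer radii form a Cauchy sequence. Real radii are compared
  with one large integer radius.\<close>

lemma l2_ft_exists:
  fixes w :: "'a::euclidean_space \<Rightarrow> complex"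
  assumes w: "sq_int lborel w"
  obtains v where "l2_ft w v"
proof -
  let ?t = "\<lambda>R. l2norm lborel (\<lambda>x. cutoff R w x - w x)"
  let ?c = "plancherel_const TYPE('a)"
  have c: "0 < ?c" by (rule plancherel_const_pos)
  note T = ft_cutoff_sq_int[OF w]
  have cauchy: "\<exists>N. \<forall>m\<ge>N. \<forall>n\<ge>N. l2norm lborel (\<lambda>x. ft (cutoff (real m) w) x - ft (cutoff (real n) w) x) < e" if e: "0 < e" for e
  proof -
    have "\<forall>\<^sub>F n in sequentially. ?t (real n) < e / (2 * ?c)"
      using cutoff_tendsto_seq[OF w] e c by (intro order_tendstoD) auto
    then obtain N where N: "\<And>n. N \<le> n \<Longrightarrow> ?t (real n) < e / (2 * ?c)" by (auto simp: eventually_sequentially)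
    have "l2norm lborel (\<lambda>x. ft (cutoff (real m) w) x - ft (cutoff (real n) w) x) < e" if "N \<le> m" "N \<le> n" for m n
    proof -
      have "?c * (?t (real m) + ?t (real n)) < ?c * (e / (2 * ?c) + e / (2 * ?c))"
        using N[OF that(1)] N[OF that(2)] c by (intro mult_strict_left_mono add_strict_mono)
      also have "\<dots> = e" using c by simp
      finally show ?thesis using ft_cutoff_diff[OF w, of "real m" "real n"] by linarith
    qed
    then show ?thesis by blast
  qed
  obtain v where v: "sq_int lborel v" "(\<lambda>n. l2norm lborel (\<lambda>x. ft (cutoff (real n) w) x - v x)) \<longlonglongrightarrow> 0"
    using l2_complete[of lborel "\<lambda>n. ft (cutoff (real n) w)", OF T cauchy] by blast
  have "((\<lambda>R. l2norm lborel (\<lambda>\<xi>. ft (cutoff R w) \<xi> - v \<xi>)) \<longlongrightarrow> 0) at_top"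
  proof (rule tendstoI)
    fix e :: real assume e: "0 < e"
    have "\<forall>\<^sub>F n in sequentially. ?t (real n) < e / (4 * ?c)" "\<forall>\<^sub>F n in sequentially. l2norm lborel (\<lambda>x. ft (cutoff (real n) w) x - v x) < e / 2"
      by (rule order_tendstoD(2)[OF cutoff_tendsto_seq[OF w]], use e c in simp)
        (rule order_tendstoD(2)[OF v(2)], use e in simp)
    then have "\<forall>\<^sub>F n in sequentially. ?t (real n) < e / (4 * ?c) \<and> l2norm lborel (\<lambda>x. ft (cutoff (real n) w) x - v x) < e / 2"
      by (rule eventually_conj)
    then obtain n where n: "?t (real n) < e / (4 * ?c)" "l2norm lborel (\<lambda>x. ft (cutoff (real n) w) x - v x) < e / 2"
      by (auto simp: eventually_sequentially)
    have "\<forall>\<^sub>F R in at_top. ?t R < e / (4 * ?c)"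
      using cutoff_tendsto[OF w] e c by (intro order_tendstoD) auto
    then show "\<forall>\<^sub>F R in at_top. dist (l2norm lborel (\<lambda>\<xi>. ft (cutoff R w) \<xi> - v \<xi>)) 0 < e"
    proof eventually_elim
      case (elim R)
      have "?c * (?t R + ?t (real n)) < ?c * (e / (4 * ?c) + e / (4 * ?c))"
        using elim n c by (intro mult_strict_left_mono add_strict_mono)
      also have "\<dots> = e / 2" using c by simp
      finally have "l2norm lborel (\<lambda>\<xi>. ft (cutoff R w) \<xi> - ft (cutoff (real n) w) \<xi>) < e / 2"
        using ft_cutoff_diff[OF w, of R "real n"] by linarith
      then have "l2norm lborel (\<lambda>\<xi>. ft (cutoff R w) \<xi> - v \<xi>) < e"
        using l2norm_triangle[OF T T v(1), of R "real n"] n(2) by linarith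
      then show ?case by (simp add: l2norm_nonneg)
    qed
  qed
  then show ?thesis using w v(1) by (intro that) (simp add: l2_ft_def)
qed

lemma l2_ft_seq:
  assumes "l2_ft w v" shows "(\<lambda>n. l2norm lborel (\<lambda>\<xi>. ft (cutoff (real n) w) \<xi> - v \<xi>)) \<longlonglongrightarrow> 0"
proof -
  have "((\<lambda>R. l2norm lborel (\<lambda>\<xi>. ft (cutoff R w) \<xi> - v \<xi>)) \<longlongrightarrow> 0) at_top" using assms by (simp add: l2_ft_def)
  then show ?thesis by (rule filterlim_compose[OF _ filterlim_real_sequentially])
qed

lemma l2_ft_norm:
  fixes w :: "'a::euclidean_space \<Rightarrow> complex"
  assumes h: "l2_ft w v" shows "l2norm lborel v = plancherel_const TYPE('a) * l2norm lborel w"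
proof -
  have w: "sq_int lborel w" and v: "sq_int lborel v" using h by (auto simp: l2_ft_def)
  have 1: "(\<lambda>n. l2norm lborel (ft (cutoff (real n) w))) \<longlonglongrightarrow> l2norm lborel v"
    by (rule l2norm_tendsto[OF ft_cutoff_sq_int[OF w] v l2_ft_seq[OF h]])
  have 2: "(\<lambda>n. plancherel_const TYPE('a) * l2norm lborel (cutoff (real n) w)) \<longlonglongrightarrow> plancherel_const TYPE('a) * l2norm lborel w"
    by (intro tendsto_intros l2norm_tendsto[OF cutoff_sq_int[OF w] w cutoff_tendsto_seq[OF w]])
  have "(\<lambda>n. l2norm lborel (ft (cutoff (real n) w))) = (\<lambda>n. plancherel_const TYPE('a) * l2norm lborel (cutoff (real n) w))"
    by (intro ext ft_sq_int cutoff_integrable cutoff_sq_int w)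
  from 1[unfolded this] 2 show ?thesis by (rule LIMSEQ_unique)
qed

lemma l2_ft_multiplication:
  assumes h1: "l2_ft w z" and h2: "l2_ft u y"
  shows "(\<integral>x. z x * u x \<partial>lborel) = (\<integral>x. w x * y x \<partial>lborel)"
proof -
  have s: "sq_int lborel w" "sq_int lborel z" "sq_int lborel u" "sq_int lborel y" using h1 h2 by (auto simp: l2_ft_def)
  have 1: "(\<lambda>n. \<integral>x. ft (cutoff (real n) w) x * cutoff (real n) u x \<partial>lborel) \<longlonglongrightarrow> (\<integral>x. z x * u x \<partial>lborel)"
    by (rule l2_inner_tendsto[OF ft_cutoff_sq_int[OF s(1)] s(2) l2_ft_seq[OF h1] cutoff_sq_int[OF s(3)] s(3) cutoff_tendsto_seq[OF s(3)]])
  have 2: "(\<lambda>n. \<integral>x. cutoff (real n) w x * ft (cutoff (real n) u) x \<partial>lborel) \<longlonglongrightarrow> (\<integral>x. w x * y x \<partial>lborel)"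
    by (rule l2_inner_tendsto[OF cutoff_sq_int[OF s(1)] s(1) cutoff_tendsto_seq[OF s(1)] ft_cutoff_sq_int[OF s(3)] s(4) l2_ft_seq[OF h2]])
  have "(\<lambda>n. \<integral>x. ft (cutoff (real n) w) x * cutoff (real n) u x \<partial>lborel) = (\<lambda>n. \<integral>x. cutoff (real n) w x * ft (cutoff (real n) u) x \<partial>lborel)"
    by (rule ext, rule ft_multiplication[OF cutoff_integrable[OF s(1)] cutoff_integrable[OF s(3)]])
  from 1[unfolded this] 2 show ?thesis by (rule LIMSEQ_unique)
qed

lemma l2_ft_cong:
  assumes h: "l2_ft w v" and e: "AE x in lborel. v x = v' x" and [measurable]: "v' \<in> borel_measurable borel"
  shows "l2_ft w v'"
proof -
  have v: "sq_int lborel v" and w: "sq_int lborel w" using h by (auto simp: l2_ft_def)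
  note [measurable] = sq_int_measurable[OF v] sq_int_measurable[OF w]
  have "l2norm lborel (\<lambda>\<xi>. ft (cutoff R w) \<xi> - v' \<xi>) = l2norm lborel (\<lambda>\<xi>. ft (cutoff R w) \<xi> - v \<xi>)" for R
    by (rule l2norm_cong_AE) (use e in \<open>auto elim: eventually_mono\<close>)
  then show ?thesis using h sq_int_cong_AE[OF v e] by (simp add: l2_ft_def)
qed

text \<open>The inverse transform of \<open>v\<close> is \<open>(2\<pi>)\<^sup>-\<^sup>n\<close> times the conjugate of the transform of \<open>cnj v\<close>; by the
  isometry it suffices to compare the norms and the inner product of its transform with \<open>v\<close>.\<close>

theorem l2_ft_surj:
  fixes v :: "'a::euclidean_space \<Rightarrow> complex"
  assumes v: "sq_int lborel v"
  obtains w where "l2_ft w v"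
proof -
  let ?c = "plancherel_const TYPE('a)"
  have c: "0 < ?c" by (rule plancherel_const_pos)
  obtain y where y: "l2_ft (\<lambda>x. cnj (v x)) y" using l2_ft_exists[OF sq_int_cnj[OF v]] by blast
  have ys: "sq_int lborel y" using y by (simp add: l2_ft_def)
  define w where "w x = complex_of_real (1 / ?c\<^sup>2) * cnj (y x)" for x
  have ws: "sq_int lborel w" unfolding w_def by (intro sq_int_cmult sq_int_cnj ys)
  obtain z where z: "l2_ft w z" using l2_ft_exists[OF ws] by blast
  have zs: "sq_int lborel z" using z by (simp add: l2_ft_def)
  note [measurable] = sq_int_measurable[OF v] sq_int_measurable[OF zs]
  have ny: "l2norm lborel y = ?c * l2norm lborel v" using l2_ft_norm[OF y] by (simp add: l2norm_def)
  have "l2norm lborel w = 1 / ?c\<^sup>2 * l2norm lborel y"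
    using c l2norm_cmult[of lborel "complex_of_real (1 / ?c\<^sup>2)" "\<lambda>x. cnj (y x)"]
    by (simp add: w_def[abs_def] norm_divide norm_power) (simp add: l2norm_def)
  then have nz: "l2norm lborel z = l2norm lborel v"
    using l2_ft_norm[OF z] ny c by (simp add: power2_eq_square)
  have "(\<integral>x. z x * cnj (v x) \<partial>lborel) = (\<integral>x. w x * y x \<partial>lborel)" by (rule l2_ft_multiplication[OF z y])
  also have "\<dots> = (\<integral>x. complex_of_real (1 / ?c\<^sup>2 * (cmod (y x))\<^sup>2) \<partial>lborel)"
    by (intro Bochner_Integration.integral_cong refl) (simp only: w_def of_real_mult complex_norm_square mult_ac)
  also have "\<dots> = complex_of_real (1 / ?c\<^sup>2 * (l2norm lborel y)\<^sup>2)"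
    unfolding l2norm_square integral_complex_of_real by (simp only: integral_mult_right_zero)
  also have "1 / ?c\<^sup>2 * (l2norm lborel y)\<^sup>2 = (l2norm lborel v)\<^sup>2" using c by (simp add: ny power_mult_distrib)
  finally have ip: "(\<integral>x. z x * cnj (v x) \<partial>lborel) = complex_of_real ((l2norm lborel v)\<^sup>2)" .
  have izv: "integrable lborel (\<lambda>x. z x * cnj (v x))" by (intro integrable_sq_int_mult zs sq_int_cnj v)
  have "(l2norm lborel (\<lambda>x. z x - v x))\<^sup>2 = (\<integral>x. (cmod (z x))\<^sup>2 + (cmod (v x))\<^sup>2 - 2 * Re (z x * cnj (v x)) \<partial>lborel)"
    unfolding l2norm_square
    by (intro Bochner_Integration.integral_cong refl)
      (simp add: cmod_power2, simp add: power2_eq_square algebra_simps)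
  also have "\<dots> = (l2norm lborel z)\<^sup>2 + (l2norm lborel v)\<^sup>2 - 2 * (\<integral>x. Re (z x * cnj (v x)) \<partial>lborel)"
    using zs v integrable_Re[OF izv] by (simp add: l2norm_square sq_int_def del: times_complex.sel)
  also have "(\<integral>x. Re (z x * cnj (v x)) \<partial>lborel) = (l2norm lborel v)\<^sup>2"
    using integral_Re[OF izv] by (simp only: ip Re_complex_of_real)
  finally have "(l2norm lborel (\<lambda>x. z x - v x))\<^sup>2 = 0" by (simp add: nz)
  then have "l2norm lborel (\<lambda>x. z x - v x) = 0" by simp
  then have "AE x in lborel. z x - v x = 0" by (rule l2norm_zero_AE[OF sq_int_diff[OF zs v]])
  then have "l2_ft w v" by (intro l2_ft_cong[OF z]) auto
  then show ?thesis by (rule that)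
qed

lemma l2_ft_unique:
  assumes h: "l2_ft w v" "l2_ft w v'" shows "AE x in lborel. v x = v' x"
proof -
  have s: "sq_int lborel w" "sq_int lborel v" "sq_int lborel v'" using h by (auto simp: l2_ft_def)
  note T = ft_cutoff_sq_int[OF s(1)]
  have lim: "(\<lambda>n. l2norm lborel (\<lambda>\<xi>. ft (cutoff (real n) w) \<xi> - v \<xi>) + l2norm lborel (\<lambda>\<xi>. ft (cutoff (real n) w) \<xi> - v' \<xi>)) \<longlonglongrightarrow> 0 + 0"
    by (intro tendsto_add l2_ft_seq h)
  have "l2norm lborel (\<lambda>x. v x - v' x) \<le> 0 + 0"
  proof (rule LIMSEQ_le_const[OF lim], intro exI allI impI)
    fix n
    show "l2norm lborel (\<lambda>x. v x - v' x) \<le> l2norm lborel (\<lambda>\<xi>. ft (cutoff (real n) w) \<xi> - v \<xi>) + l2norm lborel (\<lambda>\<xi>. ft (cutoff (real n) w) \<xi> - v' \<xi>)"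
      using l2norm_triangle[OF s(2) T s(3), of "real n"] l2norm_minus_commute[of lborel v] by simp
  qed
  then have "l2norm lborel (\<lambda>x. v x - v' x) = 0" using l2norm_nonneg[of lborel "\<lambda>x. v x - v' x"] by simp
  then have "AE x in lborel. v x - v' x = 0" by (rule l2norm_zero_AE[OF sq_int_diff[OF s(2,3)]])
  then show ?thesis by eventually_elim simp
qed

lemma ft_cutoff_lin:
  assumes "sq_int lborel w" "sq_int lborel w'"
  shows "ft (cutoff R (\<lambda>x. c * w x + d * w' x)) \<xi> = c * ft (cutoff R w) \<xi> + d * ft (cutoff R w') \<xi>"
proof -
  have "ft (cutoff R (\<lambda>x. c * w x + d * w' x)) \<xi>
      = (\<integral>x. c * (cis (- (x \<bullet> \<xi>)) * cutoff R w x) + d * (cis (- (x \<bullet> \<xi>)) * cutoff R w' x) \<partial>lborel)"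
    unfolding ft_def by (intro Bochner_Integration.integral_cong refl) (simp add: cutoff_def algebra_simps)
  also have "\<dots> = c * ft (cutoff R w) \<xi> + d * ft (cutoff R w') \<xi>"
    unfolding ft_def
    by (subst Bochner_Integration.integral_add)
      (auto intro!: integrable_mult_right integrable_cis_mult cutoff_integrable assms)
  finally show ?thesis .
qed

lemma l2_ft_lin:
  assumes h: "l2_ft w v" "l2_ft w' v'"
  shows "l2_ft (\<lambda>x. c * w x + d * w' x) (\<lambda>x. c * v x + d * v' x)"
proof -
  have s: "sq_int lborel w" "sq_int lborel v" "sq_int lborel w'" "sq_int lborel v'" using h by (auto simp: l2_ft_def)
  have s': "sq_int lborel (\<lambda>x. c * w x + d * w' x)" "sq_int lborel (\<lambda>x. c * v x + d * v' x)"
    by (intro sq_int_add sq_int_cmult s)+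
  have lim: "((\<lambda>R. cmod c * l2norm lborel (\<lambda>\<xi>. ft (cutoff R w) \<xi> - v \<xi>) + cmod d * l2norm lborel (\<lambda>\<xi>. ft (cutoff R w') \<xi> - v' \<xi>)) \<longlongrightarrow> cmod c * 0 + cmod d * 0) at_top"
    using h by (intro tendsto_intros) (auto simp: l2_ft_def)
  have "((\<lambda>R. l2norm lborel (\<lambda>\<xi>. ft (cutoff R (\<lambda>x. c * w x + d * w' x)) \<xi> - (c * v \<xi> + d * v' \<xi>))) \<longlongrightarrow> 0) at_top"
  proof (rule tendsto_sandwich[OF _ _ tendsto_const])
    show "\<forall>\<^sub>F R in at_top. l2norm lborel (\<lambda>\<xi>. ft (cutoff R (\<lambda>x. c * w x + d * w' x)) \<xi> - (c * v \<xi> + d * v' \<xi>))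
        \<le> cmod c * l2norm lborel (\<lambda>\<xi>. ft (cutoff R w) \<xi> - v \<xi>) + cmod d * l2norm lborel (\<lambda>\<xi>. ft (cutoff R w') \<xi> - v' \<xi>)"
    proof (intro always_eventually allI)
      fix R
      have "(\<lambda>\<xi>. ft (cutoff R (\<lambda>x. c * w x + d * w' x)) \<xi> - (c * v \<xi> + d * v' \<xi>))
          = (\<lambda>\<xi>. c * (ft (cutoff R w) \<xi> - v \<xi>) + d * (ft (cutoff R w') \<xi> - v' \<xi>))"
        by (auto simp: ft_cutoff_lin[OF s(1,3)] algebra_simps)
      then show "l2norm lborel (\<lambda>\<xi>. ft (cutoff R (\<lambda>x. c * w x + d * w' x)) \<xi> - (c * v \<xi> + d * v' \<xi>))
          \<le> cmod c * l2norm lborel (\<lambda>\<xi>. ft (cutoff R w) \<xi> - v \<xi>) + cmod d * l2norm lborel (\<lambda>\<xi>. ft (cutoff R w') \<xi> - v' \<xi>)"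
        using l2norm_add[of lborel "\<lambda>\<xi>. c * (ft (cutoff R w) \<xi> - v \<xi>)" "\<lambda>\<xi>. d * (ft (cutoff R w') \<xi> - v' \<xi>)"]
          sq_int_cmult[OF sq_int_diff[OF ft_cutoff_sq_int[OF s(1)] s(2)]] sq_int_cmult[OF sq_int_diff[OF ft_cutoff_sq_int[OF s(3)] s(4)]]
        by (simp add: l2norm_cmult)
    qed
  qed (use lim in \<open>auto simp: l2norm_nonneg\<close>)
  then show ?thesis using s' by (simp add: l2_ft_def)
qed

subsection \<open>Lebesgue measurable representatives\<close>

lemma complex_borel_rep:
  fixes u :: "'a \<Rightarrow> complex"
  assumes [measurable]: "u \<in> borel_measurable (completion M)"
  obtains u' where "u' \<in> borel_measurable M" "AE x in M. u x = u' x"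
proof -
  have "(\<lambda>x. Re (u x)) \<in> borel_measurable (completion M)" "(\<lambda>x. Im (u x)) \<in> borel_measurable (completion M)" by measurable
  from this[THEN completion_ex_borel_measurable_real] obtain r i
    where r: "r \<in> borel_measurable M" "AE x in M. Re (u x) = r x"
      and i: "i \<in> borel_measurable M" "AE x in M. Im (u x) = i x" by blast
  show ?thesis
  proof
    show "(\<lambda>x. complex_of_real (r x) + \<i> * complex_of_real (i x)) \<in> borel_measurable M" using r i by measurable
    show "AE x in M. u x = complex_of_real (r x) + \<i> * complex_of_real (i x)"
      using r(2) i(2) by eventually_elim (simp add: complex_eq_iff)
  qed
qed

lemma measurable_completion_AE:
  assumes f: "f \<in> M \<rightarrow>\<^sub>M N" and e: "AE x in M. f x = g x" and g: "g \<in> space M \<rightarrow> space N"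
  shows "g \<in> completion M \<rightarrow>\<^sub>M N"
proof (rule measurableI)
  fix A assume A: "A \<in> sets N"
  show "g -` A \<inter> space (completion M) \<in> sets (completion M)"
  proof (rule completion.in_sets_AE)
    show "f -` A \<inter> space M \<in> sets (completion M)" using measurable_sets[OF f A] by (rule sets_completionI_sets)
    show "AE x in completion M. x \<in> f -` A \<inter> space M \<longleftrightarrow> x \<in> g -` A \<inter> space (completion M)"
      using AE_completion[OF e] by eventually_elim auto
  qed simp
qed (use g in auto)

lemma sq_int_lebesgue:
  assumes "u' \<in> borel_measurable lborel"
  shows "sq_int lebesgue u' \<longleftrightarrow> sq_int lborel u'" "l2norm lebesgue u' = l2norm lborel u'"
  using assms by (simp_all add: sq_int_def l2norm_def integrable_completion integral_completion measurable_completion)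

lemma sq_int_lebesgue_rep:
  assumes u: "u \<in> borel_measurable lebesgue" and u': "u' \<in> borel_measurable lborel" "AE x in lborel. u x = u' x"
  shows "sq_int lebesgue u \<longleftrightarrow> sq_int lborel u'" "l2norm lebesgue u = l2norm lborel u'"
proof -
  have m: "u' \<in> borel_measurable lebesgue" using u' by (intro measurable_completion)
  have e: "AE x in lebesgue. u x = u' x" using u'(2) by (rule AE_completion)
  have e': "AE x in lebesgue. u' x = u x" using e by eventually_elim simp
  have "sq_int lebesgue u \<longleftrightarrow> sq_int lebesgue u'"
    using sq_int_cong_AE[OF _ e m] sq_int_cong_AE[OF _ e' u] by blast
  then show "sq_int lebesgue u \<longleftrightarrow> sq_int lborel u'" using sq_int_lebesgue[OF u'(1)] by simp
  show "l2norm lebesgue u = l2norm lborel u'"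
    using l2norm_cong_AE[OF e u m] sq_int_lebesgue[OF u'(1)] by simp
qed

lemma L2_iff: "u \<in> L2 \<longleftrightarrow> sq_int lebesgue u"
  by (simp add: L2_def sq_int_def)

lemma trunc_fourier_eq:
  fixes u :: "real^'n \<Rightarrow> complex"
  assumes u: "u \<in> borel_measurable lebesgue" and u': "u' \<in> borel_measurable lborel" "AE x in lborel. u x = u' x"
  shows "trunc_fourier R u \<xi> = ft (cutoff R u') \<xi>"
proof -
  have [measurable]: "u' \<in> borel_measurable borel" using u' by simp
  have m: "(\<lambda>x. cis (- (x \<bullet> \<xi>)) * cutoff R u' x) \<in> borel_measurable lborel" by measurable
  have m2: "(\<lambda>x. indicator (cball 0 R) x *\<^sub>R (cis (- (x \<bullet> \<xi>)) * u x)) \<in> borel_measurable lebesgue"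
  proof (rule measurable_completion_AE[OF m])
    show "AE x in lborel. cis (- (x \<bullet> \<xi>)) * cutoff R u' x = indicator (cball 0 R) x *\<^sub>R (cis (- (x \<bullet> \<xi>)) * u x)"
      using u'(2) by eventually_elim (simp add: cutoff_def)
  qed simp
  have "trunc_fourier R u \<xi> = (\<integral>x. cis (- (x \<bullet> \<xi>)) * cutoff R u' x \<partial>lebesgue)"
    unfolding trunc_fourier_def set_lebesgue_integral_def
  proof (rule integral_cong_AE[OF m2 measurable_completion[OF m]])
    show "AE x in lebesgue. indicator (cball 0 R) x *\<^sub>R (cis (- (x \<bullet> \<xi>)) * u x) = cis (- (x \<bullet> \<xi>)) * cutoff R u' x"
      using AE_completion[OF u'(2)] by eventually_elim (simp add: cutoff_def)
  qed
  also have "\<dots> = ft (cutoff R u') \<xi>"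
    unfolding ft_def by (rule integral_completion[OF m])
  finally show ?thesis .
qed

text \<open>A change of u on a null set changes the truncated transform at no point, and a change of
  v does not affect the integral. What remains is that a norm and its square tend to 0
  together.\<close>

lemma has_fourier_iff:
  fixes u v :: "real^'n \<Rightarrow> complex"
  assumes u: "u \<in> borel_measurable lebesgue" "u' \<in> borel_measurable lborel" "AE x in lborel. u x = u' x"
    and v: "v \<in> borel_measurable lebesgue" "v' \<in> borel_measurable lborel" "AE x in lborel. v x = v' x"
  shows "has_fourier u v \<longleftrightarrow> l2_ft u' v'"
proof -
  have "((\<lambda>R. \<integral>\<^sup>+\<xi>. ennreal ((cmod (trunc_fourier R u \<xi> - v \<xi>))\<^sup>2) \<partial>lebesgue) \<longlongrightarrow> 0) at_top
      \<longleftrightarrow> ((\<lambda>R. l2norm lborel (\<lambda>\<xi>. ft (cutoff R u') \<xi> - v' \<xi>)) \<longlongrightarrow> 0) at_top"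
    if s: "sq_int lborel u'" "sq_int lborel v'"
  proof -
    have e: "(\<integral>\<^sup>+\<xi>. ennreal ((cmod (trunc_fourier R u \<xi> - v \<xi>))\<^sup>2) \<partial>lebesgue) = ennreal ((l2norm lborel (\<lambda>\<xi>. ft (cutoff R u') \<xi> - v' \<xi>))\<^sup>2)" for R
    proof -
      have "(\<integral>\<^sup>+\<xi>. ennreal ((cmod (trunc_fourier R u \<xi> - v \<xi>))\<^sup>2) \<partial>lebesgue) = (\<integral>\<^sup>+\<xi>. ennreal ((cmod (ft (cutoff R u') \<xi> - v' \<xi>))\<^sup>2) \<partial>lborel)"
        unfolding nn_integral_completion
        by (intro nn_integral_cong_AE eventually_mono[OF v(3)]) (simp add: trunc_fourier_eq[OF u])
      also have "\<dots> = ennreal ((l2norm lborel (\<lambda>\<xi>. ft (cutoff R u') \<xi> - v' \<xi>))\<^sup>2)"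
        by (intro nn_integral_sq_int sq_int_diff ft_cutoff_sq_int s)
      finally show ?thesis .
    qed
    show ?thesis
      unfolding e
    proof
      assume "((\<lambda>R. ennreal ((l2norm lborel (\<lambda>\<xi>. ft (cutoff R u') \<xi> - v' \<xi>))\<^sup>2)) \<longlongrightarrow> 0) at_top"
      then have "((\<lambda>R. (l2norm lborel (\<lambda>\<xi>. ft (cutoff R u') \<xi> - v' \<xi>))\<^sup>2) \<longlongrightarrow> 0) at_top"
        unfolding ennreal_0[symmetric] by (subst (asm) tendsto_ennreal_iff) auto
      then have "((\<lambda>R. sqrt ((l2norm lborel (\<lambda>\<xi>. ft (cutoff R u') \<xi> - v' \<xi>))\<^sup>2)) \<longlongrightarrow> sqrt 0) at_top"
        by (intro tendsto_intros)
      then show "((\<lambda>R. l2norm lborel (\<lambda>\<xi>. ft (cutoff R u') \<xi> - v' \<xi>)) \<longlongrightarrow> 0) at_top"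
        by (simp add: l2norm_nonneg)
    next
      assume "((\<lambda>R. l2norm lborel (\<lambda>\<xi>. ft (cutoff R u') \<xi> - v' \<xi>)) \<longlongrightarrow> 0) at_top"
      then have "((\<lambda>R. ennreal ((l2norm lborel (\<lambda>\<xi>. ft (cutoff R u') \<xi> - v' \<xi>))\<^sup>2)) \<longlongrightarrow> ennreal (0\<^sup>2)) at_top"
        by (intro tendsto_ennrealI tendsto_intros)
      then show "((\<lambda>R. ennreal ((l2norm lborel (\<lambda>\<xi>. ft (cutoff R u') \<xi> - v' \<xi>))\<^sup>2)) \<longlongrightarrow> 0) at_top" by simp
    qed
  qed
  then show ?thesis
    unfolding has_fourier_def L2_iff l2_ft_def sq_int_lebesgue_rep(1)[OF u] sq_int_lebesgue_rep(1)[OF v]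
    by blast
qed

lemma has_fourier_rep:
  assumes h: "has_fourier u v"
  obtains u' v' where "u \<in> borel_measurable lebesgue" "u' \<in> borel_measurable lborel" "AE x in lborel. u x = u' x"
    "v \<in> borel_measurable lebesgue" "v' \<in> borel_measurable lborel" "AE x in lborel. v x = v' x" "l2_ft u' v'"
proof -
  have m: "u \<in> borel_measurable lebesgue" "v \<in> borel_measurable lebesgue" using h by (auto simp: has_fourier_def L2_def)
  obtain u' where u': "u' \<in> borel_measurable lborel" "AE x in lborel. u x = u' x" using complex_borel_rep[OF m(1)] .
  obtain v' where v': "v' \<in> borel_measurable lborel" "AE x in lborel. v x = v' x" using complex_borel_rep[OF m(2)] .
  show ?thesis using that[OF m(1) u' m(2) v'] has_fourier_iff[OF m(1) u' m(2) v'] h by blast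
qed

lemma has_fourier_unique:
  assumes h: "has_fourier u v" "has_fourier u w" shows "AE x in lebesgue. v x = w x"
proof -
  obtain u' v' where 1: "u \<in> borel_measurable lebesgue" "u' \<in> borel_measurable lborel" "AE x in lborel. u x = u' x"
    "v \<in> borel_measurable lebesgue" "v' \<in> borel_measurable lborel" "AE x in lborel. v x = v' x" "l2_ft u' v'"
    using has_fourier_rep[OF h(1)] .
  have w: "w \<in> borel_measurable lebesgue" using h(2) by (auto simp: has_fourier_def L2_def)
  obtain w' where w': "w' \<in> borel_measurable lborel" "AE x in lborel. w x = w' x" using complex_borel_rep[OF w] .
  have "l2_ft u' w'" using has_fourier_iff[OF 1(1-3) w w'] h(2) by blast
  from l2_ft_unique[OF 1(7) this] have "AE x in lborel. v x = w x"
    using 1(6) w'(2) by eventually_elim simp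
  then show ?thesis by (rule AE_completion)
qed

lemma has_fourier_cong:
  assumes h: "has_fourier u v" and e: "AE x in lebesgue. v x = w x" and w: "w \<in> borel_measurable lebesgue"
  shows "has_fourier u w"
proof -
  obtain u' v' where 1: "u \<in> borel_measurable lebesgue" "u' \<in> borel_measurable lborel" "AE x in lborel. u x = u' x"
    "v \<in> borel_measurable lebesgue" "v' \<in> borel_measurable lborel" "AE x in lborel. v x = v' x" "l2_ft u' v'"
    using has_fourier_rep[OF h] .
  have "AE x in lborel. w x = v' x"
    using 1(6) e[unfolded AE_completion_iff] by eventually_elim simp
  then show ?thesis using has_fourier_iff[OF 1(1-3) w 1(5)] 1(7) by blast
qed

text \<open>The source of existence for multipliers: a symbol times a transform, if it is in L^2, is
  the transform of some function.\<close>

lemma has_fourier_surj: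
  fixes v :: "real^'n \<Rightarrow> complex"
  assumes v: "v \<in> L2" obtains w where "has_fourier w v"
proof -
  have m: "v \<in> borel_measurable lebesgue" using v by (simp add: L2_def)
  obtain v' where v': "v' \<in> borel_measurable lborel" "AE x in lborel. v x = v' x" using complex_borel_rep[OF m] .
  have "sq_int lborel v'" using v sq_int_lebesgue_rep(1)[OF m v'] by (simp add: L2_iff)
  then obtain w where w: "l2_ft w v'" using l2_ft_surj by blast
  then have wm: "w \<in> borel_measurable lborel" by (auto simp: l2_ft_def sq_int_def)
  have "has_fourier w v" using has_fourier_iff[OF measurable_completion[OF wm] wm _ m v'] w by simp
  then show ?thesis by (rule that)
qed

lemma has_fourier_lin:
  assumes h: "has_fourier u v" "has_fourier w z"
  shows "has_fourier (\<lambda>x. c * u x + d * w x) (\<lambda>x. c * v x + d * z x)"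
proof -
  obtain u' v' where 1: "u \<in> borel_measurable lebesgue" "u' \<in> borel_measurable lborel" "AE x in lborel. u x = u' x"
    "v \<in> borel_measurable lebesgue" "v' \<in> borel_measurable lborel" "AE x in lborel. v x = v' x" "l2_ft u' v'"
    using has_fourier_rep[OF h(1)] .
  obtain w' z' where 2: "w \<in> borel_measurable lebesgue" "w' \<in> borel_measurable lborel" "AE x in lborel. w x = w' x"
    "z \<in> borel_measurable lebesgue" "z' \<in> borel_measurable lborel" "AE x in lborel. z x = z' x" "l2_ft w' z'"
    using has_fourier_rep[OF h(2)] .
  note [measurable] = 1(1,2,4,5) 2(1,2,4,5)
  have "has_fourier (\<lambda>x. c * u x + d * w x) (\<lambda>x. c * v x + d * z x) \<longleftrightarrow> l2_ft (\<lambda>x. c * u' x + d * w' x) (\<lambda>x. c * v' x + d * z' x)"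
  proof (rule has_fourier_iff)
    show "AE x in lborel. c * u x + d * w x = c * u' x + d * w' x"
      using 1(3) 2(3) by eventually_elim simp
    show "AE x in lborel. c * v x + d * z x = c * v' x + d * z' x"
      using 1(6) 2(6) by eventually_elim simp
  qed measurable
  then show ?thesis using l2_ft_lin[OF 1(7) 2(7)] by blast
qed

lemma has_fourier_fourier: "has_fourier u v \<Longrightarrow> has_fourier u (fourier u)"
  unfolding fourier_def by (rule someI[of "has_fourier u"])

section \<open>Convolution on the half line\<close>

text \<open>The convolution of absolute values, with possible value infinity; its finiteness at t
  certifies that \<open>conv\<close> is a convergent integral at t.\<close>

definition nconv :: "(real \<Rightarrow> ennreal) \<Rightarrow> (real \<Rightarrow> ennreal) \<Rightarrow> real \<Rightarrow> ennreal" where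
  "nconv f g t = (\<integral>\<^sup>+\<tau>. f (t - \<tau>) * g \<tau> \<partial>lborel)"

text \<open>For functions on the half line this exponentially weighted L^1 norm is submultiplicative
  under convolution for every l, and large l makes the norm of a fixed kernel small. So the Neumann
  series converges on every bounded interval without a smallness condition on \<nu> or T.\<close>

definition wnorm :: "real \<Rightarrow> real \<Rightarrow> (real \<Rightarrow> ennreal) \<Rightarrow> ennreal" where
  "wnorm l T f = (\<integral>\<^sup>+t. ennreal (exp (- l * t)) * f t * indicator {..T} t \<partial>lborel)"

text \<open>For functions that vanish on the negative axis the integrand lives on [0, t]. Where the
  integral diverges, the value is 0.\<close>

definition conv :: "(real \<Rightarrow> real) \<Rightarrow> (real \<Rightarrow> real) \<Rightarrow> real \<Rightarrow> real" where
  "conv f g t = (\<integral>\<tau>. f (t - \<tau>) * g \<tau> \<partial>lborel)"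

text \<open>Borel representatives of locally integrable functions on the half line, extended by 0,
  so that convolutions may be written over the whole line.\<close>

definition loc_int :: "(real \<Rightarrow> real) \<Rightarrow> bool" where
  "loc_int f \<longleftrightarrow> f \<in> borel_measurable borel \<and> (\<forall>t<0. f t = 0) \<and>
     (\<forall>T. (\<integral>\<^sup>+t. ennreal \<bar>f t\<bar> * indicator {..T} t \<partial>lborel) < \<infinity>)"

lemma nn_integral_lborel_reflect:
  fixes h :: "real \<Rightarrow> ennreal"
  assumes [measurable]: "h \<in> borel_measurable borel"
  shows "(\<integral>\<^sup>+x. h (t - x) \<partial>lborel) = (\<integral>\<^sup>+x. h x \<partial>lborel)"
  using nn_integral_real_affine[of h "-1" t] by simp

lemma integral_lborel_reflect:
  fixes h :: "real \<Rightarrow> real"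
  shows "(\<integral>x. h (t - x) \<partial>lborel) = (\<integral>x. h x \<partial>lborel)"
  using lborel_integral_real_affine[of "-1" h t] by simp

lemma integral_lborel_shift:
  fixes h :: "real \<Rightarrow> real"
  shows "(\<integral>x. h (x - c) \<partial>lborel) = (\<integral>x. h x \<partial>lborel)"
  using lborel_integral_real_affine[of 1 h "-c"] by simp

lemma AE_lborel_reflect:
  assumes "AE x in lborel. P (x::real)"
  shows "AE x in lborel. P (t - x)"
proof -
  obtain N where N: "{x. \<not> P x} \<subseteq> N" "N \<in> null_sets lborel"
    using assms by (auto elim!: AE_E simp: null_sets_def)
  then have [measurable]: "N \<in> sets borel" by auto
  have "(\<integral>\<^sup>+x. indicator N (t - x) \<partial>lborel) = (\<integral>\<^sup>+x. indicator N x \<partial>lborel)"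
    by (rule nn_integral_lborel_reflect) auto
  also have "\<dots> = 0" using N by (simp add: null_sets_def)
  finally have "AE x in lborel. indicator N (t - x) = (0::ennreal)"
    by (subst (asm) nn_integral_0_iff_AE) auto
  then show ?thesis
    by eventually_elim (use N in \<open>auto simp: indicator_def split: if_splits\<close>)
qed

lemma nconv_measurable [measurable]:
  assumes [measurable]: "f \<in> borel_measurable borel" "g \<in> borel_measurable borel"
  shows "nconv f g \<in> borel_measurable borel"
  unfolding nconv_def by measurable

lemma conv_measurable [measurable]:
  assumes [measurable]: "f \<in> borel_measurable borel" "g \<in> borel_measurable borel"
  shows "conv f g \<in> borel_measurable borel"
  unfolding conv_def by measurable

lemma nconv_neg:
  assumes "\<And>t. t < 0 \<Longrightarrow> f t = 0" "\<And>t. t < 0 \<Longrightarrow> g t = 0" "t < 0"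
  shows "nconv f g t = 0"
proof -
  have "f (t - \<tau>) * g \<tau> = 0" for \<tau>
    using assms by (cases "\<tau> < 0") auto
  then show ?thesis unfolding nconv_def by (simp only: nn_integral_const) simp
qed

lemma conv_neg:
  assumes "\<And>t. t < 0 \<Longrightarrow> f t = 0" "\<And>t. t < 0 \<Longrightarrow> g t = 0" "t < 0"
  shows "conv f g t = 0"
proof -
  have "f (t - \<tau>) * g \<tau> = 0" for \<tau>
    using assms by (cases "\<tau> < 0") auto
  then show ?thesis unfolding conv_def by (simp only: Bochner_Integration.integral_zero)
qed

lemma conv_commute: "conv f g t = conv g f t"
  using integral_lborel_reflect[of "\<lambda>\<tau>. f \<tau> * g (t - \<tau>)" t]
  by (simp add: conv_def mult.commute)

lemma conv_cong_AE:
  assumes "AE t in lborel. f t = f' t" "AE t in lborel. g t = g' t"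
    and [measurable]: "f \<in> borel_measurable borel" "g \<in> borel_measurable borel"
      "f' \<in> borel_measurable borel" "g' \<in> borel_measurable borel"
  shows "conv f g t = conv f' g' t"
  unfolding conv_def
  by (intro integral_cong_AE) (use AE_lborel_reflect[OF assms(1), of t] assms(2) in \<open>auto elim: eventually_elim2\<close>)

text \<open>The weight factorises as exp (- l (t - \<tau>)) exp (- l \<tau>), and for t \<le> T both
  t - \<tau> and \<tau> are at most T wherever the integrand is nonzero. Tonelli's theorem does the
  rest.\<close>

lemma wnorm_nconv:
  assumes [measurable]: "f \<in> borel_measurable borel" "g \<in> borel_measurable borel"
    and f: "\<And>t. t < 0 \<Longrightarrow> f t = 0" and g: "\<And>t. t < 0 \<Longrightarrow> g t = 0"
  shows "wnorm l T (nconv f g) \<le> wnorm l T f * wnorm l T g"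
proof -
  define F where "F t = ennreal (exp (- l * t)) * f t * indicator {..T} t" for t
  define G where "G t = ennreal (exp (- l * t)) * g t * indicator {..T} t" for t
  have [measurable]: "F \<in> borel_measurable borel" "G \<in> borel_measurable borel"
    unfolding F_def G_def by measurable
  have "wnorm l T (nconv f g) =
      (\<integral>\<^sup>+t. \<integral>\<^sup>+\<tau>. ennreal (exp (- l * t)) * (f (t - \<tau>) * g \<tau>) * indicator {..T} t \<partial>lborel \<partial>lborel)"
    unfolding wnorm_def nconv_def by (simp add: nn_integral_cmult nn_integral_multc)
  also have "\<dots> \<le> (\<integral>\<^sup>+t. \<integral>\<^sup>+\<tau>. F (t - \<tau>) * G \<tau> \<partial>lborel \<partial>lborel)"
  proof (intro nn_integral_mono)
    fix t \<tau> :: real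
    have e: "ennreal (exp (- l * t)) = ennreal (exp (- l * (t - \<tau>))) * ennreal (exp (- l * \<tau>))"
      by (simp add: ennreal_mult[symmetric] exp_add[symmetric] algebra_simps)
    show "ennreal (exp (- l * t)) * (f (t - \<tau>) * g \<tau>) * indicator {..T} t \<le> F (t - \<tau>) * G \<tau>"
    proof (cases "t - \<tau> < 0 \<or> \<tau> < 0 \<or> t > T")
      case True then show ?thesis using f g by (auto simp: indicator_def)
    next
      case False
      then show ?thesis unfolding e F_def G_def by (simp add: indicator_def mult_ac)
    qed
  qed
  also have "\<dots> = (\<integral>\<^sup>+\<tau>. \<integral>\<^sup>+t. F (t - \<tau>) * G \<tau> \<partial>lborel \<partial>lborel)"
    by (rule lborel_pair.Fubini') measurable
  also have "\<dots> = (\<integral>\<^sup>+\<tau>. (\<integral>\<^sup>+t. F t \<partial>lborel) * G \<tau> \<partial>lborel)"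
    using lborel_nn_integral_shift[of F "- _"] by (simp add: nn_integral_multc)
  also have "\<dots> = wnorm l T f * wnorm l T g"
    by (simp add: nn_integral_cmult wnorm_def F_def G_def)
  finally show ?thesis .
qed

lemma wnorm_finite_AE:
  assumes [measurable]: "f \<in> borel_measurable borel" and fin: "\<And>T. \<exists>l. wnorm l T f < \<infinity>"
  shows "AE t in lborel. f t < \<infinity>"
proof -
  have "AE t in lborel. t \<le> real n \<longrightarrow> f t < \<infinity>" for n
  proof -
    obtain l where "wnorm l (real n) f < \<infinity>" using fin by blast
    then have "AE t in lborel. ennreal (exp (- l * t)) * f t * indicator {..real n} t \<noteq> \<infinity>"
      unfolding wnorm_def by (intro nn_integral_PInf_AE) auto
    then show ?thesis
      by eventually_elim (auto simp: indicator_def ennreal_mult_eq_top_iff less_top)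
  qed
  then have "AE t in lborel. \<forall>n. t \<le> real n \<longrightarrow> f t < \<infinity>" unfolding AE_all_countable by blast
  then show ?thesis
    by eventually_elim (meson real_arch_simple)
qed

lemma loc_int_wnorm:
  "loc_int f \<longleftrightarrow> f \<in> borel_measurable borel \<and> (\<forall>t<0. f t = 0) \<and> (\<forall>T. wnorm 0 T (\<lambda>t. ennreal \<bar>f t\<bar>) < \<infinity>)"
  by (simp add: loc_int_def wnorm_def)

lemma loc_int_measurable [measurable_dest]: "loc_int f \<Longrightarrow> f \<in> borel_measurable borel"
  by (simp add: loc_int_def)

lemma loc_int_neg: "loc_int f \<Longrightarrow> t < 0 \<Longrightarrow> f t = 0"
  by (simp add: loc_int_def)

lemma loc_int_set_integrable:
  assumes f: "loc_int f" and A: "A \<subseteq> {..T}" "A \<in> sets borel"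
  shows "set_integrable lborel A f"
proof -
  have [measurable]: "f \<in> borel_measurable borel" "A \<in> sets borel" using f A by (auto dest: loc_int_measurable)
  have "(\<integral>\<^sup>+t. ennreal (norm (indicat_real A t *\<^sub>R f t)) \<partial>lborel) \<le> (\<integral>\<^sup>+t. ennreal \<bar>f t\<bar> * indicator {..T} t \<partial>lborel)"
    by (intro nn_integral_mono) (use A in \<open>auto simp: indicator_def\<close>)
  also have "\<dots> < \<infinity>" using f by (simp add: loc_int_def)
  finally show ?thesis
    unfolding set_integrable_def by (intro integrableI_bounded) auto
qed

text \<open>The bound needs no convergence: where the integral diverges, \<open>conv\<close> has the
  default value 0.\<close>

lemma abs_conv_le: "ennreal \<bar>conv f g t\<bar> \<le> nconv (\<lambda>t. ennreal \<bar>f t\<bar>) (\<lambda>t. ennreal \<bar>g t\<bar>) t"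
proof (cases "integrable lborel (\<lambda>\<tau>. f (t - \<tau>) * g \<tau>)")
  case True
  then show ?thesis unfolding conv_def nconv_def
    using integral_norm_bound_ennreal[OF True] by (simp add: abs_mult ennreal_mult)
next
  case False
  then show ?thesis by (simp add: conv_def not_integrable_integral_eq)
qed

lemma wnorm_mono:
  assumes "\<And>t. f t \<le> g t" shows "wnorm l T f \<le> wnorm l T g"
  unfolding wnorm_def by (intro nn_integral_mono mult_right_mono mult_left_mono assms) auto

lemma wnorm_nconv_finite:
  assumes f: "loc_int f" and g: "loc_int g"
  shows "wnorm 0 T (nconv (\<lambda>t. ennreal \<bar>f t\<bar>) (\<lambda>t. ennreal \<bar>g t\<bar>)) < \<infinity>"
proof -
  note [measurable] = loc_int_measurable[OF f] loc_int_measurable[OF g]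
  have "wnorm 0 T (nconv (\<lambda>t. ennreal \<bar>f t\<bar>) (\<lambda>t. ennreal \<bar>g t\<bar>)) \<le> wnorm 0 T (\<lambda>t. ennreal \<bar>f t\<bar>) * wnorm 0 T (\<lambda>t. ennreal \<bar>g t\<bar>)"
    by (rule wnorm_nconv) (auto simp: loc_int_neg[OF f] loc_int_neg[OF g])
  also have "\<dots> < \<infinity>"
    using f g by (auto simp: loc_int_wnorm ennreal_mult_less_top)
  finally show ?thesis .
qed

lemma loc_int_conv:
  assumes f: "loc_int f" and g: "loc_int g" shows "loc_int (conv f g)"
proof -
  note [measurable] = loc_int_measurable[OF f] loc_int_measurable[OF g]
  have "wnorm 0 T (\<lambda>t. ennreal \<bar>conv f g t\<bar>) < \<infinity>" for T
    by (rule le_less_trans[OF wnorm_mono[OF abs_conv_le] wnorm_nconv_finite[OF f g]])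
  then show ?thesis
    using conv_neg[of f g] f g by (auto simp: loc_int_wnorm)
qed

lemma conv_integrable_iff:
  assumes [measurable]: "f \<in> borel_measurable borel" "g \<in> borel_measurable borel"
  shows "integrable lborel (\<lambda>\<tau>. f (t - \<tau>) * g \<tau>) \<longleftrightarrow> nconv (\<lambda>t. ennreal \<bar>f t\<bar>) (\<lambda>t. ennreal \<bar>g t\<bar>) t < \<infinity>"
  by (simp add: integrable_iff_bounded nconv_def abs_mult ennreal_mult)

lemma conv_integrable_AE:
  assumes f: "loc_int f" and g: "loc_int g"
  shows "AE t in lborel. integrable lborel (\<lambda>\<tau>. f (t - \<tau>) * g \<tau>)"
proof -
  note [measurable] = loc_int_measurable[OF f] loc_int_measurable[OF g]
  have "AE t in lborel. nconv (\<lambda>t. ennreal \<bar>f t\<bar>) (\<lambda>t. ennreal \<bar>g t\<bar>) t < \<infinity>"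
    by (rule wnorm_finite_AE, measurable) (use wnorm_nconv_finite[OF f g] in blast)
  then show ?thesis by (subst conv_integrable_iff) auto
qed

lemma nconv_assoc:
  assumes [measurable]: "f \<in> borel_measurable borel" "g \<in> borel_measurable borel" "h \<in> borel_measurable borel"
  shows "nconv f (nconv g h) t = nconv (nconv f g) h t"
proof -
  have "nconv f (nconv g h) t = (\<integral>\<^sup>+s. \<integral>\<^sup>+\<tau>. f (t - s) * (g (s - \<tau>) * h \<tau>) \<partial>lborel \<partial>lborel)"
    by (simp add: nconv_def nn_integral_cmult)
  also have "\<dots> = (\<integral>\<^sup>+\<tau>. \<integral>\<^sup>+s. f (t - s) * (g (s - \<tau>) * h \<tau>) \<partial>lborel \<partial>lborel)"
    by (rule lborel_pair.Fubini') measurable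
  also have "\<dots> = (\<integral>\<^sup>+\<tau>. (\<integral>\<^sup>+s. f (t - s) * g (s - \<tau>) \<partial>lborel) * h \<tau> \<partial>lborel)"
    by (simp add: nn_integral_multc[symmetric] mult.assoc)
  also have "\<dots> = nconv (nconv f g) h t"
    unfolding nconv_def
  proof (intro nn_integral_cong)
    fix \<tau> :: real
    have "(\<integral>\<^sup>+s. f (t - s) * g (s - \<tau>) \<partial>lborel) = (\<integral>\<^sup>+s. f (t - \<tau> - s) * g s \<partial>lborel)"
      using lborel_nn_integral_shift[of "\<lambda>s. f (t - \<tau> - s) * g s" "- \<tau>"] by simp
    then show "(\<integral>\<^sup>+s. f (t - s) * g (s - \<tau>) \<partial>lborel) * h \<tau> = (\<integral>\<^sup>+s. f (t - \<tau> - s) * g s \<partial>lborel) * h \<tau>" by simp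
  qed
  finally show ?thesis .
qed

text \<open>Fubini on the triple product. The finite absolute triple convolution is demanded at the
  single point t only, which permits statements at every t when one factor is bounded.\<close>

lemma conv_assoc:
  assumes [measurable]: "f \<in> borel_measurable borel" "g \<in> borel_measurable borel" "h \<in> borel_measurable borel"
    and fin: "nconv (\<lambda>t. ennreal \<bar>f t\<bar>) (nconv (\<lambda>t. ennreal \<bar>g t\<bar>) (\<lambda>t. ennreal \<bar>h t\<bar>)) t < \<infinity>"
  shows "conv f (conv g h) t = conv (conv f g) h t"
proof -
  have "(\<integral>\<^sup>+p. ennreal (norm (case p of (s, \<tau>) \<Rightarrow> f (t - s) * (g (s - \<tau>) * h \<tau>))) \<partial>(lborel \<Otimes>\<^sub>M lborel))
      = nconv (\<lambda>t. ennreal \<bar>f t\<bar>) (nconv (\<lambda>t. ennreal \<bar>g t\<bar>) (\<lambda>t. ennreal \<bar>h t\<bar>)) t"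
    by (subst lborel.nn_integral_fst[symmetric])
      (auto simp: nconv_def nn_integral_cmult[symmetric] abs_mult ennreal_mult split_beta')
  then have int: "integrable (lborel \<Otimes>\<^sub>M lborel) (\<lambda>(s, \<tau>). f (t - s) * (g (s - \<tau>) * h \<tau>))"
    using fin by (intro integrableI_bounded) auto
  have "conv f (conv g h) t = (\<integral>s. \<integral>\<tau>. f (t - s) * (g (s - \<tau>) * h \<tau>) \<partial>lborel \<partial>lborel)"
    by (simp add: conv_def)
  also have "\<dots> = (\<integral>\<tau>. \<integral>s. f (t - s) * (g (s - \<tau>) * h \<tau>) \<partial>lborel \<partial>lborel)"
    using lborel_pair.Fubini_integral[OF int] by simp
  also have "\<dots> = (\<integral>\<tau>. (\<integral>s. f (t - s) * g (s - \<tau>) \<partial>lborel) * h \<tau> \<partial>lborel)"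
    by (simp add: mult.assoc[symmetric])
  also have "\<dots> = conv (conv f g) h t"
    unfolding conv_def
  proof (intro Bochner_Integration.integral_cong refl)
    fix \<tau> :: real
    have "(\<integral>s. f (t - s) * g (s - \<tau>) \<partial>lborel) = (\<integral>s. f (t - \<tau> - s) * g s \<partial>lborel)"
      using integral_lborel_shift[of "\<lambda>s. f (t - \<tau> - s) * g s" \<tau>] by simp
    then show "(\<integral>s. f (t - s) * g (s - \<tau>) \<partial>lborel) * h \<tau> = (\<integral>s. f (t - \<tau> - s) * g s \<partial>lborel) * h \<tau>" by simp
  qed
  finally show ?thesis .
qed

lemma conv_assoc_AE:
  assumes f: "loc_int f" and g: "loc_int g" and h: "loc_int h"
  shows "AE t in lborel. conv f (conv g h) t = conv (conv f g) h t"
proof -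
  note [measurable] = loc_int_measurable[OF f] loc_int_measurable[OF g] loc_int_measurable[OF h]
  let ?f = "\<lambda>t. ennreal \<bar>f t\<bar>" and ?g = "\<lambda>t. ennreal \<bar>g t\<bar>" and ?h = "\<lambda>t. ennreal \<bar>h t\<bar>"
  note neg = loc_int_neg[OF f] loc_int_neg[OF g] loc_int_neg[OF h]
  have "wnorm 0 T (nconv ?f (nconv ?g ?h)) < \<infinity>" for T
  proof -
    have "wnorm 0 T (nconv ?f (nconv ?g ?h)) \<le> wnorm 0 T ?f * wnorm 0 T (nconv ?g ?h)"
      by (rule wnorm_nconv) (auto simp: neg intro!: nconv_neg)
    also have "\<dots> \<le> wnorm 0 T ?f * (wnorm 0 T ?g * wnorm 0 T ?h)"
      by (intro mult_left_mono wnorm_nconv) (auto simp: neg)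
    also have "\<dots> < \<infinity>"
      using f g h by (auto simp: loc_int_wnorm ennreal_mult_less_top)
    finally show ?thesis .
  qed
  then have "AE t in lborel. nconv ?f (nconv ?g ?h) t < \<infinity>"
    by (intro wnorm_finite_AE) auto
  then show ?thesis by eventually_elim (rule conv_assoc, auto)
qed

lemma nconv_commute:
  assumes [measurable]: "f \<in> borel_measurable borel" "g \<in> borel_measurable borel"
  shows "nconv f g t = nconv g f t"
  using nn_integral_lborel_reflect[of "\<lambda>\<tau>. f \<tau> * g (t - \<tau>)" t]
  by (simp add: nconv_def mult.commute)

lemma nconv_bounded:
  assumes [measurable]: "g \<in> borel_measurable borel"
    and f: "\<And>s. s < 0 \<Longrightarrow> f s = 0" and g: "\<And>s. s < 0 \<Longrightarrow> g s = 0" and C: "\<And>s. s \<le> t \<Longrightarrow> f s \<le> C"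
  shows "nconv f g t \<le> C * wnorm 0 t g"
proof -
  have "nconv f g t \<le> (\<integral>\<^sup>+\<tau>. C * (ennreal (exp (- 0 * \<tau>)) * g \<tau> * indicator {..t} \<tau>) \<partial>lborel)"
    unfolding nconv_def
  proof (intro nn_integral_mono)
    fix \<tau> :: real
    show "f (t - \<tau>) * g \<tau> \<le> C * (ennreal (exp (- 0 * \<tau>)) * g \<tau> * indicator {..t} \<tau>)"
      using f[of "t - \<tau>"] g[of \<tau>] C[of "t - \<tau>"] by (cases "\<tau> < 0"; cases "\<tau> > t") (auto simp: mult_right_mono)
  qed
  then show ?thesis by (simp add: wnorm_def nn_integral_cmult)
qed

lemma nconv_bounded_finite:
  assumes f: "loc_int f" and g: "loc_int g" and C: "\<And>s. s \<le> t \<Longrightarrow> \<bar>f s\<bar> \<le> C"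
  shows "nconv (\<lambda>t. ennreal \<bar>f t\<bar>) (\<lambda>t. ennreal \<bar>g t\<bar>) t < \<infinity>"
proof -
  note [measurable] = loc_int_measurable[OF f] loc_int_measurable[OF g]
  have "nconv (\<lambda>t. ennreal \<bar>f t\<bar>) (\<lambda>t. ennreal \<bar>g t\<bar>) t \<le> ennreal C * wnorm 0 t (\<lambda>t. ennreal \<bar>g t\<bar>)"
    by (rule nconv_bounded) (auto simp: loc_int_neg[OF f] loc_int_neg[OF g] C ennreal_leI)
  also have "\<dots> < \<infinity>"
    using g by (auto simp: loc_int_wnorm ennreal_mult_less_top)
  finally show ?thesis .
qed

lemma conv_integrable_bounded:
  assumes f: "loc_int f" and g: "loc_int g" and C: "\<And>s. s \<le> t \<Longrightarrow> \<bar>f s\<bar> \<le> C"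
  shows "integrable lborel (\<lambda>\<tau>. f (t - \<tau>) * g \<tau>)"
  using nconv_bounded_finite[OF f g C] loc_int_measurable[OF f] loc_int_measurable[OF g]
  by (subst conv_integrable_iff) auto

lemma nconv_nconv_bounded_finite:
  assumes f: "loc_int f" and g: "loc_int g" and h: "loc_int h" and C: "\<And>s. s \<le> t \<Longrightarrow> \<bar>f s\<bar> \<le> C"
  shows "nconv (\<lambda>t. ennreal \<bar>f t\<bar>) (nconv (\<lambda>t. ennreal \<bar>g t\<bar>) (\<lambda>t. ennreal \<bar>h t\<bar>)) t < \<infinity>"
proof -
  note [measurable] = loc_int_measurable[OF f] loc_int_measurable[OF g] loc_int_measurable[OF h]
  have "nconv (\<lambda>t. ennreal \<bar>f t\<bar>) (nconv (\<lambda>t. ennreal \<bar>g t\<bar>) (\<lambda>t. ennreal \<bar>h t\<bar>)) t \<le> ennreal C * wnorm 0 t (nconv (\<lambda>t. ennreal \<bar>g t\<bar>) (\<lambda>t. ennreal \<bar>h t\<bar>))"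
    by (rule nconv_bounded)
      (auto simp: loc_int_neg[OF f] loc_int_neg[OF g] loc_int_neg[OF h] C ennreal_leI intro!: nconv_neg)
  also have "\<dots> < \<infinity>"
    using wnorm_nconv_finite[OF g h] by (auto simp: ennreal_mult_less_top)
  finally show ?thesis .
qed

text \<open>Boundedness of f on (-\<infinity>, t] yields the identity at this t and not just almost
  everywhere; \<open>conv_relax\<close> and the minimum principle evaluate it at given
  points.\<close>

lemma conv_left_commute:
  assumes f: "loc_int f" and g: "loc_int g" and h: "loc_int h" and C: "\<And>s. s \<le> t \<Longrightarrow> \<bar>f s\<bar> \<le> C"
  shows "conv f (conv g h) t = conv g (conv f h) t"
proof -
  note [measurable] = loc_int_measurable[OF f] loc_int_measurable[OF g] loc_int_measurable[OF h]
  let ?f = "\<lambda>t. ennreal \<bar>f t\<bar>" and ?g = "\<lambda>t. ennreal \<bar>g t\<bar>" and ?h = "\<lambda>t. ennreal \<bar>h t\<bar>"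
  note fin = nconv_nconv_bounded_finite[OF f g h C]
  have "nconv ?g (nconv ?f ?h) t = nconv (nconv ?g ?f) ?h t"
    by (rule nconv_assoc) auto
  also have "nconv ?g ?f = nconv ?f ?g"
    by (intro ext nconv_commute) auto
  also have "nconv (nconv ?f ?g) ?h t = nconv ?f (nconv ?g ?h) t"
    by (rule nconv_assoc[symmetric]) auto
  finally have fin': "nconv ?g (nconv ?f ?h) t < \<infinity>" using fin by simp
  have "conv f (conv g h) t = conv (conv f g) h t"
    by (rule conv_assoc) (use fin in auto)
  also have "conv f g = conv g f" by (intro ext conv_commute)
  also have "conv (conv g f) h t = conv g (conv f h) t"
    by (rule conv_assoc[symmetric]) (use fin' in auto)
  finally show ?thesis .
qed

section \<open>Integration from 0 as convolution with the constant 1 of the half line\<close>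

definition heaviside :: "real \<Rightarrow> real" where "heaviside = indicator {0..}"

lemma heaviside_measurable [measurable]: "heaviside \<in> borel_measurable borel"
  unfolding heaviside_def by measurable

lemma loc_int_bounded:
  assumes [measurable]: "f \<in> borel_measurable borel" and "\<And>t. t < 0 \<Longrightarrow> f t = 0"
    and C: "\<And>T. \<exists>C. \<forall>t\<in>{0..T}. \<bar>f t\<bar> \<le> C"
  shows "loc_int f"
  unfolding loc_int_def
proof (intro conjI allI)
  fix T :: real
  obtain C where C: "\<forall>t\<in>{0..T}. \<bar>f t\<bar> \<le> C" using C by blast
  have "(\<integral>\<^sup>+t. ennreal \<bar>f t\<bar> * indicator {..T} t \<partial>lborel) \<le> (\<integral>\<^sup>+t. ennreal C * indicator {0..T} t \<partial>lborel)"
  proof (intro nn_integral_mono)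
    fix t :: real
    show "ennreal \<bar>f t\<bar> * indicator {..T} t \<le> ennreal C * indicator {0..T} t"
      using C assms(2)[of t] by (cases "t < 0"; cases "t \<le> T") (auto intro!: ennreal_leI)
  qed
  also have "\<dots> < \<infinity>" by (cases "0 \<le> T") (auto simp: nn_integral_cmult_indicator ennreal_mult_less_top)
  finally show "(\<integral>\<^sup>+t. ennreal \<bar>f t\<bar> * indicator {..T} t \<partial>lborel) < \<infinity>" .
qed (use assms in auto)

lemma loc_int_heaviside: "loc_int heaviside"
  by (rule loc_int_bounded) (auto simp: heaviside_def indicator_def intro!: exI[of _ 1])

lemma conv_heaviside:
  assumes f: "loc_int f"
  shows "conv f heaviside t = (LBINT \<tau>:{0..t}. f \<tau>)"
proof -
  have "conv f heaviside t = conv heaviside f t" by (rule conv_commute)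
  also have "\<dots> = (LBINT \<tau>:{0..t}. f \<tau>)"
    unfolding conv_def set_lebesgue_integral_def
    by (intro Bochner_Integration.integral_cong refl)
      (use loc_int_neg[OF f] in \<open>auto simp: heaviside_def indicator_def not_le\<close>)
  finally show ?thesis .
qed

lemma loc_int_integral_small:
  assumes f: "loc_int f" and e: "0 < e"
  obtains d where "0 < d" "\<And>h. 0 < h \<Longrightarrow> h \<le> d \<Longrightarrow> (LBINT \<tau>:{0..h}. \<bar>f \<tau>\<bar>) < e"
proof -
  note [measurable] = loc_int_measurable[OF f]
  have int: "set_integrable lborel {0..1} (\<lambda>t. \<bar>f t\<bar>)"
    using loc_int_set_integrable[OF f, of "{0..1}" 1] by (intro set_integrable_abs) auto
  have "(\<lambda>n. LBINT \<tau>:{0..1/Suc n}. \<bar>f \<tau>\<bar>) \<longlonglongrightarrow> (\<integral>\<tau>. 0 \<partial>(lborel::real measure))"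
    unfolding set_lebesgue_integral_def
  proof (rule integral_dominated_convergence)
    show "integrable lborel (\<lambda>t. indicat_real {0..1} t *\<^sub>R \<bar>f t\<bar>)" using int by (simp add: set_integrable_def)
    show "AE x in lborel. (\<lambda>n. indicat_real {0..1 / real (Suc n)} x *\<^sub>R \<bar>f x\<bar>) \<longlonglongrightarrow> 0"
      using AE_lborel_singleton[of "0::real"]
    proof eventually_elim
      case (elim x)
      show ?case
      proof (cases "x < 0")
        case False
        then obtain N :: nat where N: "1 / real (Suc N) < x" using elim
          by (metis linorder_cases nat_approx_posE)
        have "\<forall>\<^sub>F n in sequentially. indicat_real {0..1 / real (Suc n)} x *\<^sub>R \<bar>f x\<bar> = 0"
          using eventually_ge_at_top[of N]
        proof eventually_elim
          case (elim n)
          then have "1 / real (Suc n) \<le> 1 / real (Suc N)" by (simp add: frac_le)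
          then show ?case using N by (auto simp: indicator_def)
        qed
        then show ?thesis by (rule tendsto_eventually)
      qed (auto simp: indicator_def)
    qed
    show "AE x in lborel. norm (indicat_real {0..1 / real (Suc n)} x *\<^sub>R \<bar>f x\<bar>) \<le> indicat_real {0..1} x *\<^sub>R \<bar>f x\<bar>" for n
      by (rule AE_I2) (use order_trans[of _ "1 / real (Suc n)" 1] in \<open>auto simp: indicator_def\<close>)
  qed auto
  then have "\<forall>\<^sub>F n in sequentially. (LBINT \<tau>:{0..1/Suc n}. \<bar>f \<tau>\<bar>) < e"
    using e by (intro order_tendstoD) auto
  then obtain n where n: "(LBINT \<tau>:{0..1/Suc n}. \<bar>f \<tau>\<bar>) < e" by (auto simp: eventually_sequentially)
  show ?thesis
  proof
    fix h :: real assume h: "0 < h" "h \<le> 1 / Suc n"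
    have n1: "1 / real (Suc n) \<le> 1" by simp
    have *: "set_integrable lborel {0..1/Suc n} (\<lambda>t. \<bar>f t\<bar>)" "set_integrable lborel {0..h} (\<lambda>t. \<bar>f t\<bar>)"
      by (rule set_integrable_subset[OF int]; use h order_trans[OF h(2) n1] in \<open>auto simp del: of_nat_Suc\<close>)+
    have "(LBINT \<tau>:{0..h}. \<bar>f \<tau>\<bar>) \<le> (LBINT \<tau>:{0..1/Suc n}. \<bar>f \<tau>\<bar>)"
      unfolding set_lebesgue_integral_def
      by (intro integral_mono) (use * h in \<open>auto simp: set_integrable_def indicator_def\<close>)
    then show "(LBINT \<tau>:{0..h}. \<bar>f \<tau>\<bar>) < e" using n by simp
  qed auto
qed

section \<open>Positivity of Sonine kernels\<close>

lemma integral_lower_bound: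
  fixes \<phi> :: "real \<Rightarrow> real"
  assumes "set_integrable lborel {a..b} \<phi>" "a \<le> b" "\<And>x. x \<in> {a..b} \<Longrightarrow> c \<le> \<phi> x"
  shows "(b - a) * c \<le> (LBINT x:{a..b}. \<phi> x)"
proof -
  have "(LBINT x:{a..b}. c) \<le> (LBINT x:{a..b}. \<phi> x)"
    by (rule set_integral_mono) (use assms in \<open>auto simp: set_integrable_def\<close>)
  then show ?thesis using assms(2) by (simp add: set_lebesgue_integral_def)
qed

lemma loc_int_lipschitz:
  assumes 0: "\<And>t. t \<le> 0 \<Longrightarrow> \<phi> t = 0" and L: "\<And>x y. \<bar>\<phi> x - \<phi> y\<bar> \<le> L * \<bar>x - y\<bar>"
  shows "loc_int \<phi>" and "\<And>s t. s \<le> t \<Longrightarrow> \<bar>\<phi> s\<bar> \<le> L * \<bar>t\<bar>"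
proof -
  have "0 \<le> L" using L[of 1 0] by simp
  show b: "\<bar>\<phi> s\<bar> \<le> L * \<bar>t\<bar>" if "s \<le> t" for s t
  proof (cases "s \<le> 0")
    case False
    have "\<bar>\<phi> s\<bar> \<le> L * \<bar>s\<bar>" using L[of s 0] 0[of 0] by simp
    also have "\<dots> \<le> L * \<bar>t\<bar>" using False that \<open>0 \<le> L\<close> by (intro mult_left_mono) auto
    finally show ?thesis .
  qed (use 0 \<open>0 \<le> L\<close> in auto)
  have "L-lipschitz_on UNIV \<phi>" by (rule lipschitz_onI) (use L \<open>0 \<le> L\<close> in \<open>auto simp: dist_real_def\<close>)
  then have "continuous_on UNIV \<phi>" by (rule lipschitz_on_continuous_on)
  then have "\<phi> \<in> borel_measurable borel" by (rule borel_measurable_continuous_onI)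
  then show "loc_int \<phi>" by (rule loc_int_bounded) (use 0 b in \<open>auto intro!: exI\<close>)
qed

text \<open>A minimum principle: at a negative minimum of \<open>v = \<phi> * m\<close> the difference quotients of
  \<open>\<beta> v + k * v\<close> are almost nonpositive, although this function equals \<open>\<phi> * 1\<close>, which increases strictly.\<close>

lemma conv_test_nonneg_strict:
  assumes m: "loc_int m" and k: "loc_int k" and k_nonneg: "\<And>t. 0 < t \<Longrightarrow> 0 \<le> k t"
    and k_antimono: "\<And>s t. 0 < s \<Longrightarrow> s \<le> t \<Longrightarrow> k t \<le> k s" and \<beta>: "0 \<le> \<beta>"
    and eq: "AE t in lborel. 0 < t \<longrightarrow> \<beta> * m t + conv k m t = 1"
    and \<phi>0: "\<And>t. t \<le> 0 \<Longrightarrow> \<phi> t = 0" and \<phi>p: "\<And>t. 0 < t \<Longrightarrow> 0 < \<phi> t"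
    and L: "\<And>x y. \<bar>\<phi> x - \<phi> y\<bar> \<le> L * \<bar>x - y\<bar>" and T0: "0 \<le> T0"
  shows "0 \<le> conv \<phi> m T0"
proof (rule ccontr)
  assume neg: "\<not> 0 \<le> conv \<phi> m T0"
  have L0: "0 \<le> L" using L[of 1 0] by simp
  note \<phi> = loc_int_lipschitz(1)[OF \<phi>0 L] and \<phi>b = loc_int_lipschitz(2)[OF \<phi>0 L]
  note [measurable] = loc_int_measurable[OF m] loc_int_measurable[OF k] loc_int_measurable[OF \<phi>]
  define v where "v = conv \<phi> m"
  have v_li: "loc_int v" unfolding v_def by (rule loc_int_conv[OF \<phi> m])
  \<comment> \<open>The Sonine identity convolved with \<phi>. It now holds at every t, because
    \<phi> is bounded on (-\<infinity>, t].\<close>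
  have eq': "\<beta> * v t + conv k v t = (LBINT \<tau>:{0..t}. \<phi> \<tau>)" for t
  proof -
    have e: "AE t in lborel. \<beta> * m t + conv k m t = heaviside t"
      using eq AE_lborel_singleton[of "0::real"]
    proof eventually_elim
      case (elim t)
      show ?case
      proof (cases "t < 0")
        case True
        then show ?thesis using loc_int_neg[OF m] loc_int_neg[OF loc_int_conv[OF k m]] by (simp add: heaviside_def)
      qed (use elim in \<open>auto simp: heaviside_def\<close>)
    qed
    have "(LBINT \<tau>:{0..t}. \<phi> \<tau>) = conv \<phi> heaviside t" by (simp add: conv_heaviside[OF \<phi>])
    also have "\<dots> = conv \<phi> (\<lambda>t. \<beta> * m t + conv k m t) t"
      by (rule conv_cong_AE) (use e in \<open>auto elim: eventually_mono\<close>)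
    also have "\<dots> = (\<integral>\<tau>. \<beta> * (\<phi> (t - \<tau>) * m \<tau>) + \<phi> (t - \<tau>) * conv k m \<tau> \<partial>lborel)"
      unfolding conv_def[of \<phi>] by (simp add: algebra_simps)
    also have "\<dots> = \<beta> * conv \<phi> m t + conv \<phi> (conv k m) t"
      unfolding conv_def[of \<phi>]
      by (subst Bochner_Integration.integral_add)
        (auto intro!: integrable_mult_right conv_integrable_bounded[OF \<phi> m \<phi>b[of _ t]] conv_integrable_bounded[OF \<phi> loc_int_conv[OF k m] \<phi>b[of _ t]])
    also have "conv \<phi> (conv k m) t = conv k (conv \<phi> m) t"
      by (rule conv_left_commute[OF \<phi> k m \<phi>b[of _ t]])
    finally show ?thesis by (simp add: v_def)
  qed
  \<comment> \<open>A Lipschitz constant of v on [0, T0], inherited from \<phi>.\<close>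
  define M where "M = L * (LBINT \<tau>:{0..T0}. \<bar>m \<tau>\<bar>)"
  have mint: "set_integrable lborel {0..T0} (\<lambda>t. \<bar>m t\<bar>)"
    using loc_int_set_integrable[OF m, of "{0..T0}" T0] by (intro set_integrable_abs) auto
  have M0: "0 \<le> M" unfolding M_def set_lebesgue_integral_def by (intro mult_nonneg_nonneg L0 Bochner_Integration.integral_nonneg) auto
  have vL: "\<bar>v t - v s\<bar> \<le> M * \<bar>t - s\<bar>" if "s \<in> {0..T0}" "t \<in> {0..T0}" for s t
  proof -
    have "v t - v s = (\<integral>\<tau>. \<phi> (t - \<tau>) * m \<tau> - \<phi> (s - \<tau>) * m \<tau> \<partial>lborel)"
      unfolding v_def conv_def
      by (rule Bochner_Integration.integral_diff[symmetric]) (intro conv_integrable_bounded[OF \<phi> m \<phi>b]; assumption)+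
    also have "\<bar>\<dots>\<bar> \<le> (\<integral>\<tau>. (L * \<bar>t - s\<bar>) * (indicator {0..T0} \<tau> *\<^sub>R \<bar>m \<tau>\<bar>) \<partial>lborel)"
      unfolding real_norm_def[symmetric]
    proof (rule Bochner_Integration.integral_norm_bound_integral)
      show "integrable lborel (\<lambda>\<tau>. \<phi> (t - \<tau>) * m \<tau> - \<phi> (s - \<tau>) * m \<tau>)"
        by (intro Bochner_Integration.integrable_diff; intro conv_integrable_bounded[OF \<phi> m \<phi>b]; assumption)
      show "integrable lborel (\<lambda>\<tau>. (L * norm (t - s)) * (indicator {0..T0} \<tau> *\<^sub>R norm (m \<tau>)))"
        using mint by (intro integrable_mult_right) (simp add: set_integrable_def)
      fix \<tau> :: real
      have "\<bar>\<phi> (t - \<tau>) - \<phi> (s - \<tau>)\<bar> * \<bar>m \<tau>\<bar> \<le> (L * \<bar>t - s\<bar>) * \<bar>m \<tau>\<bar>"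
        using L[of "t - \<tau>" "s - \<tau>"] by (intro mult_right_mono) auto
      then show "norm (\<phi> (t - \<tau>) * m \<tau> - \<phi> (s - \<tau>) * m \<tau>) \<le> (L * norm (t - s)) * (indicator {0..T0} \<tau> *\<^sub>R norm (m \<tau>))"
        using loc_int_neg[OF m, of \<tau>] \<phi>0[of "t - \<tau>"] \<phi>0[of "s - \<tau>"] that
        by (cases "\<tau> < 0"; cases "\<tau> > T0") (auto simp: left_diff_distrib[symmetric] abs_mult)
    qed
    also have "\<dots> = M * \<bar>t - s\<bar>" by (simp add: M_def set_lebesgue_integral_def)
    finally show ?thesis .
  qed
  have "M-lipschitz_on {0..T0} v" by (rule lipschitz_onI) (use vL M0 in \<open>auto simp: dist_real_def\<close>)
  then have "continuous_on {0..T0} v" by (rule lipschitz_on_continuous_on)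
  then obtain t where t: "t \<in> {0..T0}" and tmin: "\<And>x. x \<in> {0..T0} \<Longrightarrow> v t \<le> v x"
    using continuous_attains_inf[of "{0..T0}" v] T0 by auto
  define \<mu> where "\<mu> = - v t"
  have \<mu>: "0 < \<mu>" using tmin[of T0] neg T0 by (auto simp: \<mu>_def v_def)
  have v0: "v 0 = 0"
  proof -
    have "\<phi> (0 - \<tau>) * m \<tau> = 0" for \<tau> using \<phi>0[of "-\<tau>"] loc_int_neg[OF m, of \<tau>] by (cases "\<tau> < 0") auto
    then show ?thesis unfolding v_def conv_def by (simp only: Bochner_Integration.integral_zero)
  qed
  have tpos: "0 < t" using t \<mu> v0 by (cases "t = 0") (auto simp: \<mu>_def)
  \<comment> \<open>On [0, T0] this is v minus its minimum: unlike v it has a sign, so that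
    monotonicity of k can be exploited, and it vanishes at t, where the minimum is attained.\<close>
  define w where "w x = (v x + \<mu>) * indicator {0..T0} x" for x
  have w0: "0 \<le> w x" for x using tmin by (auto simp: w_def \<mu>_def indicator_def)
  have [measurable]: "v \<in> borel_measurable borel" using v_li by (rule loc_int_measurable)
  have wm[measurable]: "w \<in> borel_measurable borel" unfolding w_def by measurable
  have wneg: "w s = 0" if "s < 0" for s using that by (simp add: w_def)
  have wb: "\<bar>w s\<bar> \<le> M * T0" for s
  proof (cases "s \<in> {0..T0}")
    case True
    then have "\<bar>w s\<bar> = \<bar>v s - v t\<bar>" by (simp add: w_def \<mu>_def)
    also have "\<dots> \<le> M * \<bar>s - t\<bar>" using vL[OF t True] by simp
    also have "\<dots> \<le> M * T0" using True t by (intro mult_left_mono M0) auto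
    finally show ?thesis .
  qed (use M0 T0 in \<open>auto simp: w_def\<close>)
  have w_li: "loc_int w" by (rule loc_int_bounded) (use wneg wb in \<open>auto intro!: exI\<close>)
  have kw: "conv k v x = conv k w x - \<mu> * (LBINT \<tau>:{0..x}. k \<tau>)" if "x \<in> {0..T0}" for x
  proof -
    have "conv k v x = (\<integral>\<tau>. w (x - \<tau>) * k \<tau> - \<mu> * (indicator {0..x} \<tau> *\<^sub>R k \<tau>) \<partial>lborel)"
      unfolding conv_commute[of k v]
      unfolding conv_def
    proof (intro Bochner_Integration.integral_cong refl)
      fix \<tau> :: real
      show "v (x - \<tau>) * k \<tau> = w (x - \<tau>) * k \<tau> - \<mu> * (indicator {0..x} \<tau> *\<^sub>R k \<tau>)"
        using that loc_int_neg[OF k, of \<tau>] loc_int_neg[OF v_li, of "x - \<tau>"] wneg[of "x - \<tau>"]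
        by (cases "\<tau> < 0"; cases "\<tau> > x") (auto simp: w_def algebra_simps)
    qed
    also have "\<dots> = conv w k x - \<mu> * (LBINT \<tau>:{0..x}. k \<tau>)"
      unfolding conv_def set_lebesgue_integral_def
      by (subst Bochner_Integration.integral_diff; simp?)
        (use loc_int_set_integrable[OF k, of "{0..x}" x] conv_integrable_bounded[OF w_li k wb, of x] in \<open>auto simp: set_integrable_def\<close>)
    finally show ?thesis by (simp only: conv_commute[of w])
  qed
  \<comment> \<open>The left side is the increment of \<beta> v + k * v over [t - h, t]. Times
    \<tau> < t - h contribute nonpositively, as k is nonincreasing and w \<ge> 0; on the last
    interval w is at most M h because it vanishes at t.\<close>
  have key: "(LBINT \<tau>:{0..t}. \<phi> \<tau>) - (LBINT \<tau>:{0..t-h}. \<phi> \<tau>) \<le> M * h * (LBINT \<tau>:{0..h}. \<bar>k \<tau>\<bar>)"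
    if h: "0 < h" "h < t" for h
  proof -
    have x: "t - h \<in> {0..T0}" using h t by auto
    have 1: "v t \<le> v (t - h)" using tmin[OF x] .
    have 2: "(LBINT \<tau>:{0..t-h}. k \<tau>) \<le> (LBINT \<tau>:{0..t}. k \<tau>)"
      unfolding set_lebesgue_integral_def
    proof (rule integral_mono_AE)
      show "AE \<tau> in lborel. indicat_real {0..t - h} \<tau> *\<^sub>R k \<tau> \<le> indicat_real {0..t} \<tau> *\<^sub>R k \<tau>"
        using AE_lborel_singleton[of "0::real"] by eventually_elim (use k_nonneg h in \<open>auto simp: indicator_def\<close>)
    qed (use loc_int_set_integrable[OF k, of "{0..t}" t] loc_int_set_integrable[OF k, of "{0..t-h}" t] h in \<open>auto simp: set_integrable_def\<close>)
    have i: "integrable lborel (\<lambda>\<tau>. k (x - \<tau>) * w \<tau>)" for x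
    proof -
      have "integrable lborel (\<lambda>\<tau>. w (x - \<tau>) * k \<tau>)" by (rule conv_integrable_bounded[OF w_li k wb])
      from lborel_integrable_real_affine[OF this, of "-1" x] show ?thesis by (simp add: mult.commute)
    qed
    have kint: "integrable lborel (\<lambda>\<tau>. indicator {0..h} (t - \<tau>) *\<^sub>R \<bar>k (t - \<tau>)\<bar>)"
    proof -
      have "set_integrable lborel {0..h} (\<lambda>t. \<bar>k t\<bar>)"
        using loc_int_set_integrable[OF k, of "{0..h}" h] by (intro set_integrable_abs) auto
      then have "integrable lborel (\<lambda>\<tau>. indicator {0..h} \<tau> *\<^sub>R \<bar>k \<tau>\<bar>)" by (simp add: set_integrable_def)
      from lborel_integrable_real_affine[OF this, of "-1" t] show ?thesis by simp
    qed
    have "conv k w t - conv k w (t - h) = (\<integral>\<tau>. k (t - \<tau>) * w \<tau> - k (t - h - \<tau>) * w \<tau> \<partial>lborel)"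
      unfolding conv_def by (rule Bochner_Integration.integral_diff[OF i i, symmetric])
    also have "\<dots> \<le> (\<integral>\<tau>. M * h * (indicator {0..h} (t - \<tau>) *\<^sub>R \<bar>k (t - \<tau>)\<bar>) \<partial>lborel)"
    proof (rule integral_mono_AE)
      show "integrable lborel (\<lambda>\<tau>. k (t - \<tau>) * w \<tau> - k (t - h - \<tau>) * w \<tau>)"
        by (rule Bochner_Integration.integrable_diff[OF i i])
      show "integrable lborel (\<lambda>\<tau>. M * h * (indicator {0..h} (t - \<tau>) *\<^sub>R \<bar>k (t - \<tau>)\<bar>))"
        by (rule integrable_mult_right) (rule kint)
      show "AE \<tau> in lborel. k (t - \<tau>) * w \<tau> - k (t - h - \<tau>) * w \<tau> \<le> M * h * (indicator {0..h} (t - \<tau>) *\<^sub>R \<bar>k (t - \<tau>)\<bar>)"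
        using AE_lborel_singleton[of t] AE_lborel_singleton[of "t - h"]
      proof eventually_elim
        case (elim \<tau>)
        consider "\<tau> > t" | "\<tau> < t - h" | "t - h < \<tau>" "\<tau> < t" using elim by linarith
        then show ?case
        proof cases
          case 1
          then show ?thesis using h loc_int_neg[OF k, of "t - \<tau>"] loc_int_neg[OF k, of "t - h - \<tau>"] by simp
        next
          case 2
          have "(k (t - \<tau>) - k (t - h - \<tau>)) * w \<tau> \<le> 0"
            using k_antimono[of "t - h - \<tau>" "t - \<tau>"] 2 h w0[of \<tau>] by (intro mult_nonpos_nonneg) auto
          then show ?thesis using 2 by (simp add: algebra_simps)
        next
          case 3
          then have kz: "k (t - h - \<tau>) = 0" by (intro loc_int_neg[OF k]) auto
          have \<tau>: "\<tau> \<in> {0..T0}" using 3 h t by auto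
          have "w \<tau> = v \<tau> - v t" using \<tau> by (simp add: w_def \<mu>_def)
          also have "\<dots> \<le> M * \<bar>\<tau> - t\<bar>" using vL[OF t \<tau>] by simp
          also have "\<dots> \<le> M * h" using 3 by (intro mult_left_mono M0) auto
          finally have "k (t - \<tau>) * w \<tau> \<le> k (t - \<tau>) * (M * h)"
            using k_nonneg[of "t - \<tau>"] 3 by (intro mult_left_mono) auto
          then show ?thesis using kz 3 k_nonneg[of "t - \<tau>"] by (simp add: mult_ac)
        qed
      qed
    qed
    also have "\<dots> = M * h * (LBINT \<tau>:{0..h}. \<bar>k \<tau>\<bar>)"
      using integral_lborel_reflect[of "\<lambda>\<tau>. indicator {0..h} \<tau> *\<^sub>R \<bar>k \<tau>\<bar>" t]
      by (simp add: set_lebesgue_integral_def)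
    finally have 3: "conv k w t - conv k w (t - h) \<le> M * h * (LBINT \<tau>:{0..h}. \<bar>k \<tau>\<bar>)" .
    have "\<mu> * (LBINT \<tau>:{0..t-h}. k \<tau>) \<le> \<mu> * (LBINT \<tau>:{0..t}. k \<tau>)" using 2 \<mu> by simp
    moreover have "\<beta> * v t \<le> \<beta> * v (t - h)" using 1 \<beta> by (rule mult_left_mono)
    ultimately show ?thesis
      using eq'[of t] eq'[of "t - h"] kw[OF t] kw[OF x] 3 by linarith
  qed
  \<comment> \<open>Strict positivity of \<phi> gives a lower bound c > 0 on [t/2, t]. So the left
    side of \<open>key\<close> is at least h c, while the right side is h times a quantity that
    tends to 0 with h.\<close>
  have "continuous_on {t/2..t} \<phi>"
  proof (rule lipschitz_on_continuous_on)
    show "L-lipschitz_on {t/2..t} \<phi>" by (rule lipschitz_onI) (use L L0 in \<open>auto simp: dist_real_def\<close>)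
  qed
  then obtain x0 where x0: "x0 \<in> {t/2..t}" "\<And>x. x \<in> {t/2..t} \<Longrightarrow> \<phi> x0 \<le> \<phi> x"
    using continuous_attains_inf[of "{t/2..t}" \<phi>] tpos by auto
  define c where "c = \<phi> x0"
  have c: "0 < c" using x0(1) tpos \<phi>p by (auto simp: c_def)
  obtain d where d: "0 < d" "\<And>h. 0 < h \<Longrightarrow> h \<le> d \<Longrightarrow> (LBINT \<tau>:{0..h}. \<bar>k \<tau>\<bar>) < c / (M + 1)"
    using loc_int_integral_small[OF k, of "c / (M + 1)"] c M0 by auto
  define h where "h = min d (t / 2)"
  have h: "0 < h" "h \<le> t / 2" "h \<le> d" using d tpos by (auto simp: h_def)
  have si: "set_integrable lborel {a..b} \<phi>" for a b
    by (rule loc_int_set_integrable[OF \<phi>, of _ b]) auto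
  have "(LBINT \<tau>:{0..t}. \<phi> \<tau>) = (LBINT \<tau>:{0..t-h}. \<phi> \<tau>) + (LBINT \<tau>:{t-h..t}. \<phi> \<tau>)"
  proof -
    have "{0..t} = {0..t-h} \<union> {t-h..t}" using h tpos by auto
    moreover have "(LBINT \<tau>:{0..t-h} \<union> {t-h..t}. \<phi> \<tau>) = (LBINT \<tau>:{0..t-h}. \<phi> \<tau>) + (LBINT \<tau>:{t-h..t}. \<phi> \<tau>)"
    proof (rule set_integral_Un_AE)
      show "AE x in lborel. \<not> (x \<in> {0..t - h} \<and> x \<in> {t - h..t})"
        using AE_lborel_singleton[of "t - h"] by eventually_elim auto
    qed (auto simp: si)
    ultimately show ?thesis by simp
  qed
  moreover have "h * c \<le> (LBINT \<tau>:{t-h..t}. \<phi> \<tau>)"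
    using integral_lower_bound[OF si, of "t - h" t c] h x0(2) by (auto simp: c_def)
  ultimately have "h * c \<le> M * h * (LBINT \<tau>:{0..h}. \<bar>k \<tau>\<bar>)"
    using key[of h] h tpos by linarith
  then have "h * c \<le> h * (M * (LBINT \<tau>:{0..h}. \<bar>k \<tau>\<bar>))" by (simp add: mult_ac)
  then have "c \<le> M * (LBINT \<tau>:{0..h}. \<bar>k \<tau>\<bar>)" using h(1) by (simp only: mult_le_cancel_left_pos)
  also have "\<dots> \<le> M * (c / (M + 1))" using d(2)[OF h(1,3)] by (intro mult_left_mono M0) auto
  also have "\<dots> < c" using c M0 by (simp add: field_simps)
  finally show False by simp
qed

text \<open>Adding e times the positive part of t makes the test function strictly positive on
  (0,\<infinity>); then e tends to 0.\<close>

lemma conv_test_nonneg: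
  assumes m: "loc_int m" and k: "loc_int k" and k_nonneg: "\<And>t. 0 < t \<Longrightarrow> 0 \<le> k t"
    and k_antimono: "\<And>s t. 0 < s \<Longrightarrow> s \<le> t \<Longrightarrow> k t \<le> k s" and \<beta>: "0 \<le> \<beta>"
    and eq: "AE t in lborel. 0 < t \<longrightarrow> \<beta> * m t + conv k m t = 1"
    and \<phi>0: "\<And>t. t \<le> 0 \<Longrightarrow> \<phi> t = 0" and \<phi>p: "\<And>t. 0 \<le> \<phi> t"
    and L: "\<And>x y. \<bar>\<phi> x - \<phi> y\<bar> \<le> L * \<bar>x - y\<bar>" and T: "0 \<le> T"
  shows "0 \<le> conv \<phi> m T"
proof -
  let ?i = "\<lambda>t::real. max 0 t"
  note \<phi> = loc_int_lipschitz(1)[OF \<phi>0 L] and \<phi>b = loc_int_lipschitz(2)[OF \<phi>0 L]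
  have i1: "\<And>x y. \<bar>?i x - ?i y\<bar> \<le> 1 * \<bar>x - y\<bar>" by auto
  have i0: "\<And>t. t \<le> 0 \<Longrightarrow> ?i t = 0" by simp
  note i = loc_int_lipschitz(1)[OF i0 i1] and ib = loc_int_lipschitz(2)[OF i0 i1]
  have "0 \<le> conv \<phi> m T + e * conv ?i m T" if e: "0 < e" for e
  proof -
    have "0 \<le> conv (\<lambda>t. \<phi> t + e * ?i t) m T"
    proof (rule conv_test_nonneg_strict[OF m k k_nonneg k_antimono \<beta> eq])
      show "0 < \<phi> t + e * ?i t" if "0 < t" for t using \<phi>p[of t] that e by (simp add: add_nonneg_pos)
      show "\<bar>\<phi> x + e * ?i x - (\<phi> y + e * ?i y)\<bar> \<le> (L + e) * \<bar>x - y\<bar>" for x y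
      proof -
        have "\<bar>e * ?i x - e * ?i y\<bar> \<le> e * \<bar>x - y\<bar>"
          using mult_left_mono[OF i1[of x y], of e] e by (simp add: abs_mult right_diff_distrib[symmetric])
        moreover have "\<bar>a + b - (c + d)\<bar> \<le> p + q" if "\<bar>a - c\<bar> \<le> p" "\<bar>b - d\<bar> \<le> q" for a b c d p q :: real
          using that by linarith
        ultimately show ?thesis using L[of x y] by (simp add: distrib_right)
      qed
    qed (use \<phi>0 T in auto)
    also have "conv (\<lambda>t. \<phi> t + e * ?i t) m T = (\<integral>\<tau>. \<phi> (T - \<tau>) * m \<tau> + e * (?i (T - \<tau>) * m \<tau>) \<partial>lborel)"
      unfolding conv_def by (simp add: algebra_simps)
    also have "\<dots> = conv \<phi> m T + e * conv ?i m T"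
      unfolding conv_def
      by (subst Bochner_Integration.integral_add)
        (auto intro!: integrable_mult_right conv_integrable_bounded[OF \<phi> m \<phi>b[of _ T]] conv_integrable_bounded[OF i m ib[of _ T]])
    finally show ?thesis .
  qed
  then have "\<forall>\<^sub>F e in at_right 0. 0 \<le> conv \<phi> m T + e * conv ?i m T"
    by (auto simp: eventually_at_right_field intro: exI[of _ 1])
  moreover have "((\<lambda>e. conv \<phi> m T + e * conv ?i m T) \<longlongrightarrow> conv \<phi> m T + 0 * conv ?i m T) (at_right 0)"
    by (intro tendsto_intros)
  ultimately have "0 \<le> conv \<phi> m T + 0 * conv ?i m T"
    by (intro tendsto_lowerbound[of _ _ "at_right (0::real)"]) auto
  then show ?thesis by simp
qed

text \<open>If m were negative on a set of positive measure, that set would contain a closed K of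
  positive measure. The reflected bumps of K are admissible test functions, and their limit gives a
  nonnegative integral of m over K.\<close>

theorem sonine_nonneg:
  assumes m: "loc_int m" and k: "loc_int k" and k_nonneg: "\<And>t. 0 < t \<Longrightarrow> 0 \<le> k t"
    and k_antimono: "\<And>s t. 0 < s \<Longrightarrow> s \<le> t \<Longrightarrow> k t \<le> k s" and \<beta>: "0 \<le> \<beta>"
    and eq: "AE t in lborel. 0 < t \<longrightarrow> \<beta> * m t + conv k m t = 1"
  shows "AE t in lborel. 0 \<le> m t"
proof (rule ccontr)
  assume nAE: "\<not> (AE t in lborel. 0 \<le> m t)"
  note [measurable] = loc_int_measurable[OF m]
  obtain n :: nat where n: "\<not> (AE t in lborel. t \<le> real n \<longrightarrow> 0 \<le> m t)"
  proof (rule ccontr)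
    assume "\<not> thesis"
    then have "\<And>n::nat. AE t in lborel. t \<le> real n \<longrightarrow> 0 \<le> m t" using that by blast
    then have "AE t in lborel. \<forall>n::nat. t \<le> real n \<longrightarrow> 0 \<le> m t" unfolding AE_all_countable by blast
    then have "AE t in lborel. 0 \<le> m t" by eventually_elim (meson real_arch_simple)
    then show False using nAE by simp
  qed
  define E where "E = {t. t \<le> real n \<and> m t < 0}"
  have E[measurable]: "E \<in> sets borel" unfolding E_def by measurable
  have E0: "E \<subseteq> {0..real n}" using loc_int_neg[OF m] by (force simp: E_def not_le[symmetric])
  have Efin: "emeasure lborel E < \<infinity>"
    by (rule le_less_trans[OF emeasure_mono[OF E0]]) auto
  have "E \<notin> null_sets lborel"
  proof
    assume "E \<in> null_sets lborel"
    then have "AE t in lborel. t \<notin> E" by (rule AE_not_in)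
    then have "AE t in lborel. t \<le> real n \<longrightarrow> 0 \<le> m t" by eventually_elim (auto simp: E_def not_less)
    then show False using n by simp
  qed
  then have mE: "0 < measure lebesgue E"
    using Efin E by (auto simp: null_sets_def measure_def enn2real_positive_iff zero_less_iff_neq_zero less_top)
  have El: "E \<in> sets lebesgue" using E by (simp add: sets_completionI_sets)
  obtain K where K: "closed K" "K \<subseteq> E" "E - K \<in> lmeasurable" "emeasure lebesgue (E - K) < ennreal (measure lebesgue E)"
    using sets_lebesgue_inner_closed[OF El mE] by metis
  have Km[measurable]: "K \<in> sets borel" using K(1) by auto
  have Kn: "K \<notin> null_sets lborel"
  proof
    assume "K \<in> null_sets lborel"
    then have "K \<in> null_sets lebesgue" by (rule null_sets_completionI)
    then have "emeasure lebesgue (E - K) = emeasure lebesgue E"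
      using El by (intro emeasure_Diff_null_set)
    moreover have "emeasure lebesgue E = ennreal (measure lebesgue E)"
      using Efin E by (intro emeasure_eq_ennreal_measure) auto
    ultimately show False using K(4) by simp
  qed
  then have Kne: "K \<noteq> {}" by auto
  \<comment> \<open>K lies in [0, n], so T = n + 1 keeps distance 1 from it. Hence a bump reflected
    at T vanishes at nonpositive arguments, as a test function must, and its convolution with m at T
    is the integral of the bump against m.\<close>
  define T where "T = real n + 1"
  have far: "1 \<le> dist \<tau> y" if "T \<le> \<tau>" "y \<in> K" for \<tau> y
    using K(2) E0 that by (force simp: dist_real_def T_def)
  define p where "p j x = bump K j (T - x)" for j x
  have pos: "0 \<le> (\<integral>\<tau>. p j (T - \<tau>) * m \<tau> \<partial>lborel)" for j
  proof -
    have "0 \<le> conv (p j) m T"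
    proof (rule conv_test_nonneg[OF m k k_nonneg k_antimono \<beta> eq])
      show "p j t = 0" if "t \<le> 0" for t
        unfolding p_def using that by (intro bump_eq_0[OF Kne] far) auto
      show "\<bar>p j x - p j y\<bar> \<le> real (Suc j) * \<bar>x - y\<bar>" for x y
        using bump_lipschitz[of K j "T - x" "T - y"] by (simp add: p_def dist_real_def abs_minus_commute)
    qed (auto simp: p_def T_def bump_range)
    then show ?thesis by (simp add: conv_def)
  qed
  have mint: "integrable lborel (\<lambda>t. indicator {0..T} t *\<^sub>R \<bar>m t\<bar>)"
    using set_integrable_abs[OF loc_int_set_integrable[OF m, of "{0..T}" T]] by (auto simp: set_integrable_def)
  have pm[measurable]: "(\<lambda>\<tau>. p j (T - \<tau>)) \<in> borel_measurable borel" for j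
    unfolding p_def by measurable
  have lim: "(\<lambda>j. \<integral>\<tau>. p j (T - \<tau>) * m \<tau> \<partial>lborel) \<longlonglongrightarrow> (\<integral>\<tau>. indicator K \<tau> * m \<tau> \<partial>lborel)"
  proof (rule integral_dominated_convergence[OF _ _ mint])
    show "AE \<tau> in lborel. (\<lambda>j. p j (T - \<tau>) * m \<tau>) \<longlonglongrightarrow> indicator K \<tau> * m \<tau>"
      using bump_tendsto[OF K(1) Kne] by (intro AE_I2 tendsto_mult tendsto_const) (simp add: p_def)
    show "AE \<tau> in lborel. norm (p j (T - \<tau>) * m \<tau>) \<le> indicator {0..T} \<tau> *\<^sub>R \<bar>m \<tau>\<bar>" for j
    proof (rule AE_I2)
      fix \<tau> :: real
      have "p j (T - \<tau>) = 0" if "\<tau> > T"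
        unfolding p_def using that by (intro bump_eq_0[OF Kne] far) auto
      then show "norm (p j (T - \<tau>) * m \<tau>) \<le> indicator {0..T} \<tau> *\<^sub>R \<bar>m \<tau>\<bar>"
        using bump_range[of K j \<tau>] loc_int_neg[OF m, of \<tau>]
        by (cases "\<tau> < 0"; cases "\<tau> > T") (auto simp: p_def abs_mult mult_left_le_one_le)
    qed
  qed auto
  have "0 \<le> (\<integral>\<tau>. indicator K \<tau> * m \<tau> \<partial>lborel)"
    by (rule LIMSEQ_le_const[OF lim]) (use pos in auto)
  have KT: "K \<subseteq> {0..T}" using K(2) E0 by (force simp: T_def)
  have ng: "\<And>\<tau>. \<tau> \<in> K \<Longrightarrow> m \<tau> < 0" using K(2) by (auto simp: E_def)
  have iK: "integrable lborel (\<lambda>\<tau>. - (indicator K \<tau> * m \<tau>))"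
    by (rule Bochner_Integration.integrable_bound[OF mint], measurable, rule AE_I2)
      (use KT in \<open>auto simp: indicator_def\<close>)
  have "(\<integral>\<tau>. - (indicator K \<tau> * m \<tau>) \<partial>lborel) = 0"
  proof (rule antisym)
    show "(\<integral>\<tau>. - (indicator K \<tau> * m \<tau>) \<partial>lborel) \<le> 0" using \<open>0 \<le> (\<integral>\<tau>. indicator K \<tau> * m \<tau> \<partial>lborel)\<close> by simp
    show "0 \<le> (\<integral>\<tau>. - (indicator K \<tau> * m \<tau>) \<partial>lborel)"
      by (rule Bochner_Integration.integral_nonneg) (use ng in \<open>auto simp: indicator_def less_imp_le\<close>)
  qed
  then have "AE \<tau> in lborel. - (indicator K \<tau> * m \<tau>) = 0"
    by (subst (asm) integral_nonneg_eq_0_iff_AE[OF iK]) (use ng in \<open>auto simp: indicator_def less_imp_le\<close>)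
  then have "AE \<tau> in lborel. \<tau> \<notin> K"
    by eventually_elim (use ng in \<open>force simp: indicator_def\<close>)
  then show False using Kn by (simp add: AE_iff_null_sets)
qed

section \<open>Resolvents\<close>

lemma loc_int_lin:
  assumes f: "loc_int f" and g: "loc_int g" shows "loc_int (\<lambda>t. c * f t + d * g t)"
proof -
  note [measurable] = loc_int_measurable[OF f] loc_int_measurable[OF g]
  have "(\<integral>\<^sup>+t. ennreal \<bar>c * f t + d * g t\<bar> * indicator {..T} t \<partial>lborel) < \<infinity>" for T
  proof -
    have "(\<integral>\<^sup>+t. ennreal \<bar>c * f t + d * g t\<bar> * indicator {..T} t \<partial>lborel)
      \<le> (\<integral>\<^sup>+t. ennreal \<bar>c\<bar> * (ennreal \<bar>f t\<bar> * indicator {..T} t) + ennreal \<bar>d\<bar> * (ennreal \<bar>g t\<bar> * indicator {..T} t) \<partial>lborel)"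
    proof (intro nn_integral_mono)
      fix t :: real
      have "ennreal \<bar>c * f t + d * g t\<bar> \<le> ennreal (\<bar>c\<bar> * \<bar>f t\<bar> + \<bar>d\<bar> * \<bar>g t\<bar>)"
        by (intro ennreal_leI) (simp add: abs_mult[symmetric])
      then show "ennreal \<bar>c * f t + d * g t\<bar> * indicator {..T} t
         \<le> ennreal \<bar>c\<bar> * (ennreal \<bar>f t\<bar> * indicator {..T} t) + ennreal \<bar>d\<bar> * (ennreal \<bar>g t\<bar> * indicator {..T} t)"
        by (simp add: indicator_def ennreal_mult ennreal_plus)
    qed
    also have "\<dots> < \<infinity>" using f g
      by (simp add: nn_integral_add nn_integral_cmult loc_int_def ennreal_mult_less_top)
    finally show ?thesis .
  qed
  then show ?thesis using loc_int_neg[OF f] loc_int_neg[OF g] by (simp add: loc_int_def)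
qed

lemma loc_int_AE_eq:
  assumes "loc_int f" "AE t in lborel. f t = g t" "g \<in> borel_measurable borel" "\<And>t. t < 0 \<Longrightarrow> g t = 0"
  shows "loc_int g"
proof -
  have "(\<integral>\<^sup>+t. ennreal \<bar>g t\<bar> * indicator {..T} t \<partial>lborel) = (\<integral>\<^sup>+t. ennreal \<bar>f t\<bar> * indicator {..T} t \<partial>lborel)" for T
    by (intro nn_integral_cong_AE) (use assms(2) in \<open>auto elim: eventually_mono\<close>)
  then show ?thesis using assms by (simp add: loc_int_def)
qed

lemma conv_lin:
  assumes "integrable lborel (\<lambda>\<tau>. f (t - \<tau>) * g \<tau>)" "integrable lborel (\<lambda>\<tau>. f (t - \<tau>) * h \<tau>)"
  shows "conv f (\<lambda>t. c * g t + d * h t) t = c * conv f g t + d * conv f h t"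
proof -
  have "conv f (\<lambda>t. c * g t + d * h t) t = (\<integral>\<tau>. c * (f (t - \<tau>) * g \<tau>) + d * (f (t - \<tau>) * h \<tau>) \<partial>lborel)"
    by (simp add: conv_def algebra_simps)
  also have "\<dots> = c * conv f g t + d * conv f h t"
    unfolding conv_def by (subst Bochner_Integration.integral_add) (auto intro!: integrable_mult_right assms)
  finally show ?thesis .
qed

lemma conv_lin_AE:
  assumes "loc_int f" "loc_int g" "loc_int h"
  shows "AE t in lborel. conv f (\<lambda>t. c * g t + d * h t) t = c * conv f g t + d * conv f h t"
  using conv_integrable_AE[OF assms(1,2)] conv_integrable_AE[OF assms(1,3)]
  by eventually_elim (rule conv_lin)

lemma heaviside_bound: "\<bar>heaviside s\<bar> \<le> 1" by (simp add: heaviside_def indicator_def)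

lemma conv_heaviside_lin:
  assumes "loc_int g" "loc_int h"
  shows "conv heaviside (\<lambda>t. c * g t + d * h t) t = c * conv heaviside g t + d * conv heaviside h t"
  by (intro conv_lin conv_integrable_bounded[OF loc_int_heaviside _ heaviside_bound] assms)

section \<open>The Neumann series in exponentially weighted norms\<close>

lemma wnorm_small:
  assumes a: "loc_int a" and e: "0 < (e::real)"
  obtains l where "0 \<le> l" "wnorm l T (\<lambda>t. ennreal \<bar>a t\<bar>) < ennreal e"
proof -
  note [measurable] = loc_int_measurable[OF a]
  have "(\<lambda>n. wnorm (real n) T (\<lambda>t. ennreal \<bar>a t\<bar>)) \<longlonglongrightarrow> (\<integral>\<^sup>+t. 0 \<partial>(lborel::real measure))"
    unfolding wnorm_def
  proof (rule nn_integral_dominated_convergence[where w="\<lambda>t. ennreal \<bar>a t\<bar> * indicator {..T} t"])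
    show "AE t in lborel. ennreal (exp (- real n * t)) * ennreal \<bar>a t\<bar> * indicator {..T} t \<le> ennreal \<bar>a t\<bar> * indicator {..T} t" for n
    proof (rule AE_I2)
      fix t :: real
      show "ennreal (exp (- real n * t)) * ennreal \<bar>a t\<bar> * indicator {..T} t \<le> ennreal \<bar>a t\<bar> * indicator {..T} t"
        using loc_int_neg[OF a, of t]
        by (cases "t < 0") (auto simp: indicator_def ennreal_mult[symmetric] intro!: ennreal_leI mult_left_le_one_le)
    qed
    show "AE t in lborel. (\<lambda>n. ennreal (exp (- real n * t)) * ennreal \<bar>a t\<bar> * indicator {..T} t) \<longlonglongrightarrow> 0"
      using AE_lborel_singleton[of "0::real"]
    proof eventually_elim
      case (elim t)
      show ?case
      proof (cases "t < 0")
        case False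
        then have t: "exp (- t) < 1" using elim by simp
        have "(\<lambda>n. exp (- t) ^ n) \<longlonglongrightarrow> 0" using t by (intro LIMSEQ_realpow_zero) auto
        then have "(\<lambda>n. exp (- t) ^ n * (\<bar>a t\<bar> * indicator {..T} t)) \<longlonglongrightarrow> 0 * (\<bar>a t\<bar> * indicator {..T} t)"
          by (intro tendsto_mult tendsto_const)
        then have "(\<lambda>n. ennreal (exp (- t) ^ n * (\<bar>a t\<bar> * indicator {..T} t))) \<longlonglongrightarrow> ennreal 0"
          by (intro tendsto_ennrealI) simp
        moreover have "ennreal (exp (- t) ^ n * (\<bar>a t\<bar> * indicator {..T} t)) = ennreal (exp (- real n * t)) * ennreal \<bar>a t\<bar> * indicator {..T} t" for n
          by (simp add: exp_of_nat_mult[symmetric] ennreal_mult[symmetric] indicator_def)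
        ultimately show ?thesis by simp
      qed (use loc_int_neg[OF a] in auto)
    qed
  qed (use a in \<open>auto simp: loc_int_def\<close>)
  then have "\<forall>\<^sub>F n in sequentially. wnorm (real n) T (\<lambda>t. ennreal \<bar>a t\<bar>) < ennreal e"
    using e by (intro order_tendstoD) auto
  then obtain n where "wnorm (real n) T (\<lambda>t. ennreal \<bar>a t\<bar>) < ennreal e" by (auto simp: eventually_sequentially)
  then show ?thesis by (intro that[of "real n"]) auto
qed

lemma wnorm_0_le:
  assumes "0 \<le> l" and [measurable]: "f \<in> borel_measurable borel"
  shows "wnorm 0 T f \<le> ennreal (exp (l * \<bar>T\<bar>)) * wnorm l T f"
proof -
  have "wnorm 0 T f \<le> (\<integral>\<^sup>+t. ennreal (exp (l * \<bar>T\<bar>)) * (ennreal (exp (- l * t)) * f t * indicator {..T} t) \<partial>lborel)"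
    unfolding wnorm_def
  proof (intro nn_integral_mono)
    fix t :: real
    show "ennreal (exp (- 0 * t)) * f t * indicator {..T} t \<le> ennreal (exp (l * \<bar>T\<bar>)) * (ennreal (exp (- l * t)) * f t * indicator {..T} t)"
    proof (cases "t \<le> T")
      case True
      then have "l * t \<le> l * \<bar>T\<bar>" using assms(1) by (intro mult_left_mono) auto
      then have "1 \<le> exp (l * \<bar>T\<bar>) * exp (- l * t)" by (simp add: exp_add[symmetric])
      then have "1 * f t \<le> ennreal (exp (l * \<bar>T\<bar>) * exp (- l * t)) * f t"
        by (intro mult_right_mono) (auto simp: ennreal_1[symmetric] simp del: ennreal_1 intro: ennreal_leI)
      then show ?thesis using True by (simp add: ennreal_mult mult.assoc)
    qed auto
  qed
  also have "\<dots> = ennreal (exp (l * \<bar>T\<bar>)) * wnorm l T f"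
    by (simp add: wnorm_def nn_integral_cmult)
  finally show ?thesis .
qed

text \<open>\<open>conv_pow a n\<close> has n + 1 factors |a|, so it belongs to the power \<nu>^n in
  the resolvent series.\<close>

primrec conv_pow :: "(real \<Rightarrow> real) \<Rightarrow> nat \<Rightarrow> real \<Rightarrow> ennreal" where
  "conv_pow a 0 = (\<lambda>t. ennreal \<bar>a t\<bar>)"
| "conv_pow a (Suc n) = nconv (\<lambda>t. ennreal \<bar>a t\<bar>) (conv_pow a n)"

text \<open>Sums of nonnegative extended reals always exist and are jointly measurable in \<nu> and
  t. Signs are introduced only afterwards, in the difference of the even and the odd part.\<close>

definition res_even :: "(real \<Rightarrow> real) \<Rightarrow> real \<Rightarrow> real \<Rightarrow> ennreal" where
  "res_even a \<nu> t = (\<Sum>n. ennreal \<nu> ^ (2 * n) * conv_pow a (2 * n) t)"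

definition res_odd :: "(real \<Rightarrow> real) \<Rightarrow> real \<Rightarrow> real \<Rightarrow> ennreal" where
  "res_odd a \<nu> t = (\<Sum>n. ennreal \<nu> ^ Suc (2 * n) * conv_pow a (Suc (2 * n)) t)"

text \<open>The Neumann series \<open>\<Sum>n. (-\<nu>)\<^sup>n a\<^sup>*\<^sup>(\<^sup>n\<^sup>+\<^sup>1\<^sup>)\<close> of the resolvent of \<open>a \<ge> 0\<close>, split into its positive
  and negative terms. The truncation only affects a null set.\<close>

definition resolvent :: "(real \<Rightarrow> real) \<Rightarrow> real \<Rightarrow> real \<Rightarrow> real" where
  "resolvent a \<nu> t = max 0 (enn2real (res_even a \<nu> t) - enn2real (res_odd a \<nu> t))"

lemma conv_pow_measurable [measurable]:
  assumes [measurable]: "a \<in> borel_measurable borel"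
  shows "conv_pow a n \<in> borel_measurable borel"
  by (induction n) auto

lemma res_even_measurable [measurable]:
  assumes [measurable]: "a \<in> borel_measurable borel"
  shows "(\<lambda>p. res_even a (fst p) (snd p)) \<in> borel_measurable (borel \<Otimes>\<^sub>M borel)"
  unfolding res_even_def by measurable

lemma res_odd_measurable [measurable]:
  assumes [measurable]: "a \<in> borel_measurable borel"
  shows "(\<lambda>p. res_odd a (fst p) (snd p)) \<in> borel_measurable (borel \<Otimes>\<^sub>M borel)"
  unfolding res_odd_def by measurable

lemma resolvent_measurable_pair [measurable]:
  assumes [measurable]: "a \<in> borel_measurable borel"
  shows "(\<lambda>p. resolvent a (fst p) (snd p)) \<in> borel_measurable (borel \<Otimes>\<^sub>M borel)"
  unfolding resolvent_def by measurable

lemma res_measurable1 [measurable]: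
  assumes [measurable]: "a \<in> borel_measurable borel"
  shows "res_even a \<nu> \<in> borel_measurable borel" "res_odd a \<nu> \<in> borel_measurable borel"
    "resolvent a \<nu> \<in> borel_measurable borel"
  unfolding res_even_def res_odd_def resolvent_def by measurable

lemma conv_pow_neg:
  assumes "loc_int a" "t < 0" shows "conv_pow a n t = 0"
  using assms(2)
proof (induction n arbitrary: t)
  case (Suc n)
  show ?case using Suc loc_int_neg[OF assms(1)] by (simp, intro nconv_neg) auto
qed (simp add: loc_int_neg[OF assms(1)])

lemma wnorm_conv_pow:
  assumes a: "loc_int a" shows "wnorm l T (conv_pow a n) \<le> wnorm l T (\<lambda>t. ennreal \<bar>a t\<bar>) ^ Suc n"
proof (induction n)
  case (Suc n)
  note [measurable] = loc_int_measurable[OF a]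
  have "wnorm l T (conv_pow a (Suc n)) \<le> wnorm l T (\<lambda>t. ennreal \<bar>a t\<bar>) * wnorm l T (conv_pow a n)"
    unfolding conv_pow.simps by (rule wnorm_nconv) (auto simp: loc_int_neg[OF a] conv_pow_neg[OF a])
  also have "\<dots> \<le> wnorm l T (\<lambda>t. ennreal \<bar>a t\<bar>) * wnorm l T (\<lambda>t. ennreal \<bar>a t\<bar>) ^ Suc n"
    by (intro mult_left_mono Suc) auto
  finally show ?case by simp
qed simp

lemma wnorm_suminf:
  assumes [measurable]: "\<And>n. f n \<in> borel_measurable borel"
  shows "wnorm l T (\<lambda>t. \<Sum>n. f n t) = (\<Sum>n. wnorm l T (f n))"
proof -
  have "wnorm l T (\<lambda>t. \<Sum>n. f n t) = (\<integral>\<^sup>+t. (\<Sum>n. ennreal (exp (- l * t)) * f n t * indicator {..T} t) \<partial>lborel)"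
    unfolding wnorm_def by (simp only: ennreal_suminf_multc ennreal_suminf_cmult)
  also have "\<dots> = (\<Sum>n. wnorm l T (f n))"
    unfolding wnorm_def by (rule nn_integral_suminf) measurable
  finally show ?thesis .
qed

lemma wnorm_cmult:
  assumes [measurable]: "f \<in> borel_measurable borel"
  shows "wnorm l T (\<lambda>t. c * f t) = c * wnorm l T f"
  unfolding wnorm_def by (simp add: nn_integral_cmult[symmetric] mult_ac)

text \<open>For l large the weighted norm of a is below 1 / (2 \<nu>'), so the terms are dominated
  by a geometric series of ratio 1/2. On a bounded interval the weight is then removed at the cost
  of a constant.\<close>

lemma res_wnorm_finite:
  assumes a: "loc_int a"
  shows "wnorm 0 T (res_even a \<nu>) < \<infinity>" "wnorm 0 T (res_odd a \<nu>) < \<infinity>"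
proof -
  note [measurable] = loc_int_measurable[OF a]
  \<comment> \<open>The maximum with 1 avoids division by \<nu> = 0 and makes the factor 1 / (2
    \<nu>') left over from the n + 1 factors a at most 1.\<close>
  define \<nu>' where "\<nu>' = max \<nu> 1"
  have \<nu>': "1 \<le> \<nu>'" "ennreal \<nu> \<le> ennreal \<nu>'" by (auto simp: \<nu>'_def intro!: ennreal_leI)
  obtain l where l: "0 \<le> l" "wnorm l T (\<lambda>t. ennreal \<bar>a t\<bar>) < ennreal (1 / (2 * \<nu>'))"
    using wnorm_small[OF a, of "1 / (2 * \<nu>')" T] \<nu>' by auto
  let ?q = "wnorm l T (\<lambda>t. ennreal \<bar>a t\<bar>)"
  have trm: "wnorm l T (\<lambda>t. ennreal \<nu> ^ n * conv_pow a n t) \<le> ennreal ((1/2) ^ n)" for n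
  proof -
    have "wnorm l T (\<lambda>t. ennreal \<nu> ^ n * conv_pow a n t) = ennreal \<nu> ^ n * wnorm l T (conv_pow a n)"
      by (rule wnorm_cmult) measurable
    also have "\<dots> \<le> ennreal \<nu>' ^ n * ennreal (1 / (2 * \<nu>')) ^ Suc n"
      by (intro mult_mono power_mono order_trans[OF wnorm_conv_pow[OF a]] \<nu>' less_imp_le[OF l(2)]) auto
    also have "\<dots> = ennreal (\<nu>' ^ n * (1 / (2 * \<nu>')) ^ Suc n)"
      using \<nu>'(1) by (simp add: ennreal_power ennreal_mult[symmetric] del: power_Suc)
    also have "\<nu>' ^ n * (1 / (2 * \<nu>')) ^ Suc n = (1/2) ^ n * (1 / (2 * \<nu>'))"
      using \<nu>'(1) by (simp add: power_divide power_mult_distrib field_simps)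
    also have "ennreal \<dots> \<le> ennreal ((1/2) ^ n)"
      using \<nu>'(1) by (intro ennreal_leI) (simp add: field_simps)
    finally show ?thesis .
  qed
  have "(\<Sum>n. ennreal ((1/2) ^ (2 * n))) \<le> (\<Sum>n. ennreal ((1/2) ^ n))" "(\<Sum>n. ennreal ((1/2) ^ Suc (2 * n))) \<le> (\<Sum>n. ennreal ((1/2) ^ n))"
    by (intro suminf_le ennreal_leI power_decreasing; auto)+
  moreover have "(\<Sum>n. ennreal ((1/2::real) ^ n)) < \<infinity>"
    by (subst suminf_ennreal2) (auto simp: summable_geometric)
  ultimately have fin: "(\<Sum>n. ennreal ((1/2) ^ (2 * n))) < \<infinity>" "(\<Sum>n. ennreal ((1/2) ^ Suc (2 * n))) < \<infinity>"
    by (auto intro: le_less_trans)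
  have "wnorm l T (res_even a \<nu>) \<le> (\<Sum>n. ennreal ((1/2) ^ (2 * n)))"
    unfolding res_even_def by (subst wnorm_suminf, measurable) (intro suminf_le trm; auto)
  then have 1: "wnorm l T (res_even a \<nu>) < \<infinity>" using fin(1) by (rule le_less_trans)
  have "wnorm l T (res_odd a \<nu>) \<le> (\<Sum>n. ennreal ((1/2) ^ Suc (2 * n)))"
    unfolding res_odd_def by (subst wnorm_suminf, measurable) (intro suminf_le trm; auto)
  then have 2: "wnorm l T (res_odd a \<nu>) < \<infinity>" using fin(2) by (rule le_less_trans)
  show "wnorm 0 T (res_even a \<nu>) < \<infinity>" "wnorm 0 T (res_odd a \<nu>) < \<infinity>"
    by (rule le_less_trans[OF wnorm_0_le[OF l(1)]]; use 1 2 in \<open>auto simp: ennreal_mult_less_top\<close>)+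
qed

lemma res_neg:
  assumes "loc_int a" "t < 0" shows "res_even a \<nu> t = 0" "res_odd a \<nu> t = 0" "resolvent a \<nu> t = 0"
  unfolding resolvent_def res_even_def res_odd_def by (simp_all add: conv_pow_neg[OF assms] del: conv_pow.simps)

lemma res_finite_AE:
  assumes a: "loc_int a"
  shows "AE t in lborel. res_even a \<nu> t < \<infinity>" "AE t in lborel. res_odd a \<nu> t < \<infinity>"
proof -
  note [measurable] = loc_int_measurable[OF a]
  show "AE t in lborel. res_even a \<nu> t < \<infinity>" "AE t in lborel. res_odd a \<nu> t < \<infinity>"
    by (rule wnorm_finite_AE, measurable, use res_wnorm_finite[OF a] in blast)+
qed

lemma loc_int_enn2real:
  assumes [measurable]: "f \<in> borel_measurable borel" and "\<And>t. t < 0 \<Longrightarrow> f t = 0" and fin: "\<And>T. wnorm 0 T f < \<infinity>"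
  shows "loc_int (\<lambda>t. enn2real (f t))"
proof -
  have "wnorm 0 T (\<lambda>t. ennreal \<bar>enn2real (f t)\<bar>) \<le> wnorm 0 T f" for T
    by (intro wnorm_mono) (simp add: ennreal_enn2real_if)
  then show ?thesis using assms le_less_trans by (fastforce simp: loc_int_wnorm)
qed

lemma res_odd_eq:
  assumes [measurable]: "a \<in> borel_measurable borel"
  shows "res_odd a \<nu> t = ennreal \<nu> * nconv (\<lambda>t. ennreal \<bar>a t\<bar>) (res_even a \<nu>) t"
proof -
  have "nconv (\<lambda>t. ennreal \<bar>a t\<bar>) (res_even a \<nu>) t
      = (\<integral>\<^sup>+\<tau>. (\<Sum>n. ennreal \<nu> ^ (2 * n) * (ennreal \<bar>a (t - \<tau>)\<bar> * conv_pow a (2 * n) \<tau>)) \<partial>lborel)"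
    unfolding nconv_def res_even_def
    by (intro nn_integral_cong) (simp only: ennreal_suminf_cmult[symmetric] mult.left_commute)
  also have "\<dots> = (\<Sum>n. ennreal \<nu> ^ (2 * n) * conv_pow a (Suc (2 * n)) t)"
    by (subst nn_integral_suminf) (auto simp: nn_integral_cmult nconv_def)
  finally show ?thesis
    unfolding res_odd_def by (simp only: ennreal_suminf_cmult[symmetric] power_Suc mult.assoc)
qed

text \<open>Convolution with |a| shifts the series by one term. Together with
  \<open>res_odd_eq\<close> this couples the two parts, and their difference satisfies the resolvent
  equation wherever both are finite.\<close>

lemma res_even_eq:
  assumes [measurable]: "a \<in> borel_measurable borel"
  shows "res_even a \<nu> t = ennreal \<bar>a t\<bar> + ennreal \<nu> * nconv (\<lambda>t. ennreal \<bar>a t\<bar>) (res_odd a \<nu>) t"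
proof -
  have "nconv (\<lambda>t. ennreal \<bar>a t\<bar>) (res_odd a \<nu>) t
      = (\<integral>\<^sup>+\<tau>. (\<Sum>n. ennreal \<nu> ^ Suc (2 * n) * (ennreal \<bar>a (t - \<tau>)\<bar> * conv_pow a (Suc (2 * n)) \<tau>)) \<partial>lborel)"
    unfolding nconv_def res_odd_def
    by (intro nn_integral_cong) (simp only: ennreal_suminf_cmult[symmetric] mult.left_commute)
  also have "\<dots> = (\<Sum>n. ennreal \<nu> ^ Suc (2 * n) * conv_pow a (Suc (Suc (2 * n))) t)"
    by (subst nn_integral_suminf) (auto simp: nn_integral_cmult nconv_def[of _ "nconv _ _"] nconv_def[of _ "conv_pow _ _"])
  finally have *: "ennreal \<nu> * nconv (\<lambda>t. ennreal \<bar>a t\<bar>) (res_odd a \<nu>) t = (\<Sum>n. ennreal \<nu> ^ (2 * Suc n) * conv_pow a (2 * Suc n) t)"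
    by (simp only: ennreal_suminf_cmult[symmetric] power_Suc mult.assoc mult_Suc_right add_2_eq_Suc)
  have "res_even a \<nu> t = (\<Sum>n. ennreal \<nu> ^ (2 * Suc n) * conv_pow a (2 * Suc n) t) + ennreal \<bar>a t\<bar>"
    unfolding res_even_def
    using suminf_offset[of "\<lambda>n. ennreal \<nu> ^ (2 * n) * conv_pow a (2 * n) t" 1] by (simp add: add.commute)
  then show ?thesis using * by (simp add: add.commute)
qed

lemma nconv_enn2real:
  assumes [measurable]: "a \<in> borel_measurable borel" "f \<in> borel_measurable borel"
    and a: "\<And>t. 0 \<le> a t" and fin: "AE t in lborel. f t < \<infinity>"
  shows "conv a (\<lambda>t. enn2real (f t)) t = enn2real (nconv (\<lambda>t. ennreal \<bar>a t\<bar>) f t)"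
proof -
  have "conv a (\<lambda>t. enn2real (f t)) t = enn2real (\<integral>\<^sup>+\<tau>. ennreal (a (t - \<tau>) * enn2real (f \<tau>)) \<partial>lborel)"
    unfolding conv_def by (intro integral_eq_nn_integral) (auto simp: a)
  also have "(\<integral>\<^sup>+\<tau>. ennreal (a (t - \<tau>) * enn2real (f \<tau>)) \<partial>lborel) = nconv (\<lambda>t. ennreal \<bar>a t\<bar>) f t"
    unfolding nconv_def
  proof (intro nn_integral_cong_AE)
    show "AE \<tau> in lborel. ennreal (a (t - \<tau>) * enn2real (f \<tau>)) = ennreal \<bar>a (t - \<tau>)\<bar> * f \<tau>"
      using fin by eventually_elim (simp add: ennreal_mult a)
  qed
  finally show ?thesis .
qed

text \<open>The equations of the even and the odd part, subtracted. The coefficients 1 and -1 in R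
  match the form of \<open>loc_int_lin\<close> and \<open>conv_lin_AE\<close>.\<close>

lemma resolvent_raw_eq:
  assumes a: "loc_int a" and a_nonneg: "\<And>t. 0 \<le> a t" and \<nu>: "0 \<le> \<nu>"
  defines "R \<equiv> \<lambda>t. 1 * enn2real (res_even a \<nu> t) + (-1) * enn2real (res_odd a \<nu> t)"
  shows "loc_int R" "AE t in lborel. R t + \<nu> * conv a R t = a t"
proof -
  note [measurable] = loc_int_measurable[OF a]
  have P: "loc_int (\<lambda>t. enn2real (res_even a \<nu> t))" and N: "loc_int (\<lambda>t. enn2real (res_odd a \<nu> t))"
    by (rule loc_int_enn2real; use res_neg[OF a] res_wnorm_finite[OF a] in simp)+
  show "loc_int R" unfolding R_def by (rule loc_int_lin[OF P N])
  note fin = res_finite_AE[OF a, of \<nu>]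
  show "AE t in lborel. R t + \<nu> * conv a R t = a t"
    using fin conv_lin_AE[OF a P N, of 1 "-1"]
  proof eventually_elim
    case (elim t)
    have 1: "enn2real (res_odd a \<nu> t) = \<nu> * conv a (\<lambda>t. enn2real (res_even a \<nu> t)) t"
      by (subst res_odd_eq, simp, subst nconv_enn2real) (use fin \<nu> a_nonneg in \<open>auto simp: enn2real_mult\<close>)
    have "ennreal \<nu> * nconv (\<lambda>t. ennreal \<bar>a t\<bar>) (res_odd a \<nu>) t < \<infinity>"
      using elim(1) by (subst (asm) res_even_eq) auto
    then have "enn2real (res_even a \<nu> t) = a t + \<nu> * enn2real (nconv (\<lambda>t. ennreal \<bar>a t\<bar>) (res_odd a \<nu>) t)"
      by (subst res_even_eq, simp, subst enn2real_plus) (use \<nu> a_nonneg in \<open>auto simp: enn2real_mult\<close>)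
    then have 2: "enn2real (res_even a \<nu> t) = a t + \<nu> * conv a (\<lambda>t. enn2real (res_odd a \<nu> t)) t"
      by (subst nconv_enn2real) (use fin a_nonneg in auto)
    show ?case using elim(3) 1 2 unfolding R_def by algebra
  qed
qed

section \<open>Completely positive kernels\<close>

lemma conv_nonneg:
  assumes "\<And>t. 0 \<le> f t" "\<And>t. 0 \<le> g t" shows "0 \<le> conv f g t"
  unfolding conv_def by (intro Bochner_Integration.integral_nonneg mult_nonneg_nonneg assms)

lemma resolvent_nonneg: "0 \<le> resolvent a \<nu> t"
  by (simp add: resolvent_def)

lemma resolvent_measurable2 [measurable (raw)]:
  assumes [measurable]: "a \<in> borel_measurable borel" "f \<in> borel_measurable M" "g \<in> borel_measurable M"
  shows "(\<lambda>x. resolvent a (f x) (g x)) \<in> borel_measurable M"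
proof -
  have "(\<lambda>x. (f x, g x)) \<in> M \<rightarrow>\<^sub>M borel \<Otimes>\<^sub>M borel" by measurable
  from measurable_compose[OF this resolvent_measurable_pair[OF assms(1)]] show ?thesis by simp
qed

text \<open>Signs and monotonicity are demanded at every point in question, which a choice of
  representatives achieves, while the Sonine identity holds almost everywhere only. For m_\<gamma>
  the assumption a \<ge> 0 is a consequence of (H), by \<open>sonine_nonneg\<close>.\<close>

locale sonine_kernel =
  fixes a k :: "real \<Rightarrow> real" and \<beta> :: real
  assumes a: "loc_int a" and a_nonneg: "0 \<le> a t"
    and k: "loc_int k" and k_nonneg: "0 \<le> k t" and k_antimono: "0 < s \<Longrightarrow> s \<le> t \<Longrightarrow> k t \<le> k s"
    and \<beta>: "0 \<le> \<beta>"
    and sonine: "AE t in lborel. 0 < t \<longrightarrow> \<beta> * a t + conv k a t = 1"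
begin

lemma a_measurable [measurable]: "a \<in> borel_measurable borel" by (rule loc_int_measurable[OF a])
lemma k_measurable [measurable]: "k \<in> borel_measurable borel" by (rule loc_int_measurable[OF k])

lemma sonine_heaviside: "AE t in lborel. \<beta> * a t + conv k a t = heaviside t"
  using sonine AE_lborel_singleton[of "0::real"]
proof eventually_elim
  case (elim t)
  then show ?case
    using loc_int_neg[OF a, of t] loc_int_neg[OF loc_int_conv[OF k a], of t]
    by (cases "t < 0") (auto simp: heaviside_def)
qed

text \<open>Convolve the equation of R with k and the Sonine identity with R, then eliminate k * a
  and k * a * R. The result is a Sonine identity for R with the kernel k + \<nu>, which is again
  nonnegative and nonincreasing on (0,\<infinity>).\<close>

lemma resolvent_sonine:
  assumes R: "loc_int R" and eq: "AE t in lborel. R t + \<nu> * conv a R t = a t"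
  shows "AE t in lborel. \<beta> * R t + conv k R t + \<nu> * conv heaviside R t = heaviside t"
proof -
  note [measurable] = loc_int_measurable[OF R]
  have 1: "conv k (\<lambda>t. 1 * R t + \<nu> * conv a R t) t = conv k a t" for t
    by (rule conv_cong_AE) (use eq in auto)
  have 2: "conv (\<lambda>t. \<beta> * a t + 1 * conv k a t) R t = conv heaviside R t" for t
    by (rule conv_cong_AE) (use sonine_heaviside in auto)
  show ?thesis
    using eq sonine_heaviside conv_lin_AE[OF k R loc_int_conv[OF a R], of 1 \<nu>]
      conv_lin_AE[OF R a loc_int_conv[OF k a], of \<beta> 1] conv_assoc_AE[OF k a R]
  proof eventually_elim
    case (elim t)
    have "conv heaviside R t = \<beta> * conv a R t + conv (conv k a) R t"
      using elim(4) 2[of t] by (simp add: conv_commute[of R])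
    moreover have "conv k a t = conv k R t + \<nu> * conv k (conv a R) t"
      using elim(3) 1[of t] by simp
    ultimately show ?case using elim(1,2,5) by algebra
  qed
qed

text \<open>The raw series R is nonnegative almost everywhere by \<open>sonine_nonneg\<close> with
  the kernel k + \<nu>. So \<open>resolvent\<close> differs from it on a null set only and inherits
  its equation.\<close>

lemma resolvent_props:
  assumes \<nu>: "0 \<le> \<nu>"
  shows resolvent_loc_int: "loc_int (resolvent a \<nu>)"
    and resolvent_eq: "AE t in lborel. resolvent a \<nu> t + \<nu> * conv a (resolvent a \<nu>) t = a t"
proof -
  define R where "R = (\<lambda>t. 1 * enn2real (res_even a \<nu> t) + (-1) * enn2real (res_odd a \<nu> t))"
  have R: "loc_int R" "AE t in lborel. R t + \<nu> * conv a R t = a t"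
    unfolding R_def by (rule resolvent_raw_eq[OF a a_nonneg \<nu>])+
  note [measurable] = loc_int_measurable[OF R(1)]
  have "AE t in lborel. 0 \<le> R t"
  proof (rule sonine_nonneg[OF R(1) loc_int_lin[OF k loc_int_heaviside, of 1 \<nu>] _ _ \<beta>])
    show "0 \<le> 1 * k t + \<nu> * heaviside t" for t using k_nonneg \<nu> by (simp add: heaviside_def)
    show "1 * k t + \<nu> * heaviside t \<le> 1 * k s + \<nu> * heaviside s" if "0 < s" "s \<le> t" for s t
      using k_antimono[OF that] that \<nu> by (simp add: heaviside_def)
    show "AE t in lborel. 0 < t \<longrightarrow> \<beta> * R t + conv (\<lambda>t. 1 * k t + \<nu> * heaviside t) R t = 1"
      using resolvent_sonine[OF R] conv_lin_AE[OF R(1) k loc_int_heaviside, of 1 \<nu>]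
      by eventually_elim (auto simp: conv_commute[of R] heaviside_def add.assoc[symmetric])
  qed
  then have AE: "AE t in lborel. R t = resolvent a \<nu> t"
    by eventually_elim (simp add: R_def resolvent_def)
  show "loc_int (resolvent a \<nu>)"
    by (rule loc_int_AE_eq[OF R(1) AE]) (use res_neg[OF a] in auto)
  have "conv a (resolvent a \<nu>) t = conv a R t" for t
    by (rule conv_cong_AE) (use AE in auto)
  then show "AE t in lborel. resolvent a \<nu> t + \<nu> * conv a (resolvent a \<nu>) t = a t"
    using R(2) AE by (auto elim: eventually_elim2)
qed

text \<open>The function s(t, \<nu>), obtained by integrating s' = - \<nu> r from s(0) = 1. It
  equals 1 for t < 0, hence the factor \<open>heaviside\<close> wherever it is convolved.\<close>

definition relax :: "real \<Rightarrow> real \<Rightarrow> real" where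
  "relax \<nu> t = 1 - \<nu> * (LBINT \<tau>:{0..t}. resolvent a \<nu> \<tau>)"

lemma relax_measurable_pair [measurable]: "(\<lambda>p. relax (fst p) (snd p)) \<in> borel_measurable (borel \<Otimes>\<^sub>M borel)"
proof -
  have "(\<lambda>p. LBINT \<tau>:{0..snd p}. resolvent a (fst p) \<tau>)
      = (\<lambda>p. \<integral>\<tau>. (if 0 \<le> \<tau> \<and> \<tau> \<le> snd p then resolvent a (fst p) \<tau> else 0) \<partial>lborel)"
    by (auto simp: set_lebesgue_integral_def indicator_def intro!: Bochner_Integration.integral_cong)
  moreover have "\<dots> \<in> borel_measurable (borel \<Otimes>\<^sub>M borel)" by measurable
  ultimately have [measurable]: "(\<lambda>p. LBINT \<tau>:{0..snd p}. resolvent a (fst p) \<tau>) \<in> borel_measurable (borel \<Otimes>\<^sub>M borel)"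
    by simp
  show ?thesis unfolding relax_def by measurable
qed

lemma relax_measurable2 [measurable (raw)]:
  assumes [measurable]: "f \<in> borel_measurable M" "g \<in> borel_measurable M"
  shows "(\<lambda>x. relax (f x) (g x)) \<in> borel_measurable M"
proof -
  have "(\<lambda>x. (f x, g x)) \<in> M \<rightarrow>\<^sub>M borel \<Otimes>\<^sub>M borel" by measurable
  from measurable_compose[OF this relax_measurable_pair] show ?thesis by simp
qed

lemma relax_heaviside:
  assumes "0 \<le> \<nu>"
  shows "relax \<nu> t * heaviside t = 1 * heaviside t + (- \<nu>) * conv heaviside (resolvent a \<nu>) t"
proof -
  have "conv heaviside (resolvent a \<nu>) t = (LBINT \<tau>:{0..t}. resolvent a \<nu> \<tau>)"
    using conv_heaviside[OF resolvent_loc_int[OF assms], of t] by (simp only: conv_commute[of heaviside])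
  then show ?thesis by (cases "t < 0") (simp_all add: heaviside_def relax_def set_lebesgue_integral_def)
qed

lemma relax_loc_int: "0 \<le> \<nu> \<Longrightarrow> loc_int (\<lambda>t. relax \<nu> t * heaviside t)"
  unfolding relax_heaviside by (intro loc_int_lin loc_int_heaviside loc_int_conv resolvent_loc_int)

text \<open>With s = 1 - \<nu> (1 * r) the left side is 1 * (a - \<nu> (a * r)), which is 1 * r by
  the equation of r. Reordering is legitimate at every t because 1 and 1 * r are bounded on bounded
  intervals. The identity serves both the equation of s and the derivative of a * s.\<close>

lemma conv_relax:
  assumes \<nu>: "0 \<le> \<nu>"
  shows "conv a (\<lambda>t. relax \<nu> t * heaviside t) t = (LBINT \<tau>:{0..t}. resolvent a \<nu> \<tau>)"
proof -
  note R = resolvent_loc_int[OF \<nu>]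
  note [measurable] = loc_int_measurable[OF R]
  have hR: "loc_int (conv heaviside (resolvent a \<nu>))" by (rule loc_int_conv[OF loc_int_heaviside R])
  have aR: "loc_int (conv a (resolvent a \<nu>))" by (rule loc_int_conv[OF a R])
  have "\<bar>conv heaviside (resolvent a \<nu>) s\<bar> \<le> (LBINT \<tau>:{0..t}. resolvent a \<nu> \<tau>)" if "s \<le> t" for s
  proof -
    have "conv heaviside (resolvent a \<nu>) s = (LBINT \<tau>:{0..s}. resolvent a \<nu> \<tau>)"
      using conv_heaviside[OF R, of s] by (simp only: conv_commute[of heaviside])
    moreover have "0 \<le> (LBINT \<tau>:{0..s}. resolvent a \<nu> \<tau>)"
      unfolding set_lebesgue_integral_def by (intro Bochner_Integration.integral_nonneg) (auto simp: resolvent_nonneg)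
    moreover have "(LBINT \<tau>:{0..s}. resolvent a \<nu> \<tau>) \<le> (LBINT \<tau>:{0..t}. resolvent a \<nu> \<tau>)"
      unfolding set_lebesgue_integral_def
      by (intro integral_mono; (rule loc_int_set_integrable[OF R, unfolded set_integrable_def])?)
        (use that in \<open>auto simp: indicator_def resolvent_nonneg\<close>)
    ultimately show ?thesis by simp
  qed
  note hb = this
  have i1: "integrable lborel (\<lambda>\<tau>. a (t - \<tau>) * heaviside \<tau>)"
    using lborel_integrable_real_affine[OF conv_integrable_bounded[OF loc_int_heaviside a heaviside_bound, of t], of "-1" t]
    by (simp add: mult.commute)
  have i2: "integrable lborel (\<lambda>\<tau>. a (t - \<tau>) * conv heaviside (resolvent a \<nu>) \<tau>)"
    using lborel_integrable_real_affine[OF conv_integrable_bounded[OF hR a hb, of t], of "-1" t]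
    by (simp add: mult.commute)
  have "conv a (\<lambda>t. relax \<nu> t * heaviside t) t = 1 * conv a heaviside t + (-\<nu>) * conv a (conv heaviside (resolvent a \<nu>)) t"
    unfolding relax_heaviside[OF \<nu>] by (rule conv_lin[OF i1 i2])
  also have "conv a heaviside t = conv heaviside a t" by (rule conv_commute)
  also have "conv a (conv heaviside (resolvent a \<nu>)) t = conv heaviside (conv a (resolvent a \<nu>)) t"
    by (rule conv_left_commute[OF loc_int_heaviside a R heaviside_bound, symmetric])
  also have "1 * conv heaviside a t + (-\<nu>) * conv heaviside (conv a (resolvent a \<nu>)) t
      = conv heaviside (\<lambda>t. 1 * a t + (-\<nu>) * conv a (resolvent a \<nu>) t) t"
    by (rule conv_heaviside_lin[OF a aR, symmetric])
  also have "\<dots> = conv heaviside (resolvent a \<nu>) t"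
    by (rule conv_cong_AE) (use resolvent_eq[OF \<nu>] in \<open>auto elim!: eventually_mono simp: algebra_simps\<close>)
  also have "\<dots> = (LBINT \<tau>:{0..t}. resolvent a \<nu> \<tau>)"
    using conv_heaviside[OF R, of t] by (simp only: conv_commute[of heaviside])
  finally show ?thesis .
qed

lemma relax_eq:
  assumes "0 \<le> \<nu>" shows "relax \<nu> t + \<nu> * conv a (\<lambda>t. relax \<nu> t * heaviside t) t = 1"
  by (simp add: conv_relax[OF assms]) (simp add: relax_def)

lemma resolvent_set_integrable: "0 \<le> \<nu> \<Longrightarrow> set_integrable lborel {x..y} (resolvent a \<nu>)"
  by (rule loc_int_set_integrable[OF resolvent_loc_int, of _ _ y]) auto

lemma a_set_integrable: "set_integrable lborel {x..y} a"
  by (rule loc_int_set_integrable[OF a, of _ y]) auto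

lemma resolvent_integral_mono:
  assumes \<nu>: "0 \<le> \<nu>" and "s \<le> t"
  shows "(LBINT \<tau>:{0..s}. resolvent a \<nu> \<tau>) \<le> (LBINT \<tau>:{0..t}. resolvent a \<nu> \<tau>)"
  unfolding set_lebesgue_integral_def
  by (intro integral_mono; (rule resolvent_set_integrable[OF \<nu>, unfolded set_integrable_def])?)
    (use assms(2) in \<open>auto simp: indicator_def resolvent_nonneg\<close>)

lemma relax_antimono:
  assumes "0 \<le> \<nu>" "s \<le> t" shows "relax \<nu> t \<le> relax \<nu> s"
  using mult_left_mono[OF resolvent_integral_mono[OF assms] assms(1)] by (simp add: relax_def)

lemma relax_le_1: "0 \<le> \<nu> \<Longrightarrow> relax \<nu> t \<le> 1"
  unfolding relax_def set_lebesgue_integral_def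
  by (simp add: resolvent_nonneg Bochner_Integration.integral_nonneg)

text \<open>Almost everywhere on the half line s = \<beta> r + k * r, a sum of nonnegative terms. A
  negative value at t would persist on [t, t + 1] by monotonicity, a set of positive
  measure.\<close>

lemma relax_nonneg:
  assumes \<nu>: "0 \<le> \<nu>" shows "0 \<le> relax \<nu> t"
proof (rule ccontr)
  assume neg: "\<not> 0 \<le> relax \<nu> t"
  have "AE x in lborel. 0 \<le> relax \<nu> x"
    using resolvent_sonine[OF resolvent_loc_int[OF \<nu>] resolvent_eq[OF \<nu>]]
  proof eventually_elim
    case (elim x)
    show ?case
    proof (cases "x < 0")
      case False
      then have "relax \<nu> x = \<beta> * resolvent a \<nu> x + conv k (resolvent a \<nu>) x"
        using elim relax_heaviside[OF \<nu>, of x] by (simp add: heaviside_def)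
      then show ?thesis
        by (simp add: \<beta> conv_nonneg k_nonneg resolvent_nonneg)
    qed (simp add: relax_def set_lebesgue_integral_def)
  qed
  then have "AE x in lborel. x \<notin> {t..t+1}"
    by eventually_elim (use neg relax_antimono[OF \<nu>, of t] in force)
  then have "{t..t+1} \<in> null_sets lborel" by (simp add: AE_iff_null_sets)
  then show False by (simp add: null_sets_def)
qed

text \<open>As s is nonincreasing, (a * s)(t) is at least s(t) times the integral of a over [0, t];
  and \<nu> (a * s)(t) = 1 - s(t) \<le> 1.\<close>

lemma relax_le_integral:
  assumes \<nu>: "0 \<le> \<nu>" and t: "0 \<le> t"
  shows "\<nu> * relax \<nu> t * (LBINT \<tau>:{0..t}. a \<tau>) \<le> 1"
proof -
  have ai: "integrable lborel (\<lambda>\<tau>. a (t - \<tau>) * (relax \<nu> \<tau> * heaviside \<tau>))"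
  proof -
    have "\<bar>relax \<nu> s * heaviside s\<bar> \<le> 1" for s
      using relax_nonneg[OF \<nu>, of s] relax_le_1[OF \<nu>, of s] by (simp add: heaviside_def indicator_def)
    from lborel_integrable_real_affine[OF conv_integrable_bounded[OF relax_loc_int[OF \<nu>] a this, of t], of "-1" t]
    show ?thesis by (simp add: mult.commute)
  qed
  have a': "integrable lborel (\<lambda>\<tau>. relax \<nu> t * (indicator {0..t} (t - \<tau>) *\<^sub>R a (t - \<tau>)))"
    using lborel_integrable_real_affine[OF a_set_integrable[of 0 t, unfolded set_integrable_def], of "-1" t]
    by simp
  have "relax \<nu> t * (LBINT \<tau>:{0..t}. a \<tau>) = (\<integral>\<tau>. relax \<nu> t * (indicator {0..t} (t - \<tau>) *\<^sub>R a (t - \<tau>)) \<partial>lborel)"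
    using integral_lborel_reflect[of "\<lambda>\<tau>. indicator {0..t} \<tau> *\<^sub>R a \<tau>" t] by (simp add: set_lebesgue_integral_def)
  also have "\<dots> \<le> conv a (\<lambda>t. relax \<nu> t * heaviside t) t"
    unfolding conv_def
  proof (rule integral_mono[OF a' ai])
    fix \<tau> :: real
    show "relax \<nu> t * (indicator {0..t} (t - \<tau>) *\<^sub>R a (t - \<tau>)) \<le> a (t - \<tau>) * (relax \<nu> \<tau> * heaviside \<tau>)"
      using relax_antimono[OF \<nu>, of \<tau> t] a_nonneg[of "t - \<tau>"] loc_int_neg[OF a, of "t - \<tau>"]
      by (auto simp: indicator_def heaviside_def mult.commute intro: mult_left_mono mult_right_mono)
  qed
  finally have "\<nu> * (relax \<nu> t * (LBINT \<tau>:{0..t}. a \<tau>)) \<le> \<nu> * conv a (\<lambda>t. relax \<nu> t * heaviside t) t"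
    using \<nu> by (rule mult_left_mono)
  then show ?thesis using relax_eq[OF \<nu>, of t] relax_nonneg[OF \<nu>, of t] by (simp add: mult.assoc)
qed

text \<open>If a vanished almost everywhere on (0, t), so would \<beta> a + k * a, which equals 1
  there.\<close>

lemma a_integral_pos:
  assumes t: "0 < t" shows "0 < (LBINT \<tau>:{0..t}. a \<tau>)"
proof (rule ccontr)
  assume "\<not> ?thesis"
  moreover have "0 \<le> (LBINT \<tau>:{0..t}. a \<tau>)"
    unfolding set_lebesgue_integral_def by (intro Bochner_Integration.integral_nonneg) (simp add: a_nonneg)
  ultimately have "(\<integral>\<tau>. indicator {0..t} \<tau> *\<^sub>R a \<tau> \<partial>lborel) = 0" by (simp add: set_lebesgue_integral_def)
  then have z: "AE \<tau> in lborel. indicator {0..t} \<tau> *\<^sub>R a \<tau> = 0"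
    by (subst (asm) integral_nonneg_eq_0_iff_AE) (use a_set_integrable[of 0 t] a_nonneg in \<open>auto simp: set_integrable_def\<close>)
  have "AE x in lborel. x \<notin> {0<..<t}"
    using z sonine
  proof eventually_elim
    case (elim x)
    show ?case
    proof
      assume x: "x \<in> {0<..<t}"
      have "conv k a x = 0"
        unfolding conv_def
      proof (rule integral_eq_zero_AE)
        show "AE \<tau> in lborel. k (x - \<tau>) * a \<tau> = 0"
          using z by eventually_elim (use x loc_int_neg[OF k] loc_int_neg[OF a] in \<open>force simp: indicator_def split: if_splits\<close>)
      qed
      then show False using elim x by (auto simp: indicator_def)
    qed
  qed
  then have "{0<..<t} \<in> null_sets lborel" by (simp add: AE_iff_null_sets)
  then show False using t by (simp add: null_sets_def)
qed

text \<open>Convolving a = r + \<nu> (a * r) with f gives a * f = r * (f + \<nu> (a * f)) = 0, and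
  the equation then leaves f = 0.\<close>

lemma volterra_unique:
  assumes f: "loc_int f" and eq: "AE t in lborel. f t + \<nu> * conv a f t = 0" and \<nu>: "0 \<le> \<nu>"
  shows "AE t in lborel. f t = 0"
proof -
  note R = resolvent_loc_int[OF \<nu>]
  note [measurable] = loc_int_measurable[OF R] loc_int_measurable[OF f]
  have 1: "conv (\<lambda>t. 1 * resolvent a \<nu> t + \<nu> * conv a (resolvent a \<nu>) t) f t = conv a f t" for t
    by (rule conv_cong_AE) (use resolvent_eq[OF \<nu>] in auto)
  have 2: "conv (resolvent a \<nu>) (\<lambda>t. 1 * f t + \<nu> * conv a f t) t = 0" for t
  proof -
    have "conv (resolvent a \<nu>) (\<lambda>t. 1 * f t + \<nu> * conv a f t) t = conv (resolvent a \<nu>) (\<lambda>t. 0) t"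
      by (rule conv_cong_AE) (use eq in auto)
    then show ?thesis by (simp add: conv_def)
  qed
  have comm: "conv a (resolvent a \<nu>) = conv (resolvent a \<nu>) a" by (intro ext conv_commute)
  show ?thesis
    using eq conv_lin_AE[OF f R loc_int_conv[OF a R], of 1 \<nu>] conv_lin_AE[OF R f loc_int_conv[OF a f], of 1 \<nu>]
      conv_assoc_AE[OF R a f]
  proof eventually_elim
    case (elim t)
    have "conv a f t = conv (resolvent a \<nu>) f t + \<nu> * conv (conv a (resolvent a \<nu>)) f t"
      using elim(2) 1[of t] by (simp add: conv_commute[of f])
    also have "\<dots> = conv (resolvent a \<nu>) f t + \<nu> * conv (resolvent a \<nu>) (conv a f) t"
      using elim(4) comm by simp
    also have "\<dots> = 0" using elim(3) 2[of t] by simp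
    finally show ?case using elim(1) by simp
  qed
qed

end

section \<open>Continuity and monotonicity in time\<close>

lemma integrable_indicator_Icc: "integrable lborel (\<lambda>\<tau>::real. indicator {x..y} \<tau> *\<^sub>R (c::real))"
  by (intro integrable_scaleR_left integrable_real_indicator) (auto intro: emeasure_bounded_finite[unfolded infinity_ennreal_def])

text \<open>The increment of the convolution under a shift z is at most C times the L^1 distance of
  f from its translate by z.\<close>

lemma conv_bounded_continuous:
  assumes f: "integrable lborel f" and [measurable]: "g \<in> borel_measurable borel" and C: "\<And>x. \<bar>g x\<bar> \<le> C"
  shows "integrable lborel (\<lambda>\<tau>. f (t - \<tau>) * g \<tau>)" and "continuous_on UNIV (conv f g)"
proof -
  have [measurable]: "f \<in> borel_measurable borel" using f by auto
  have C0: "0 \<le> C" using C[of 0] by simp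
  have fr: "integrable lborel (\<lambda>\<tau>. f (s - \<tau>))" for s
    using lborel_integrable_real_affine[OF f, of "-1" s] by simp
  have i: "integrable lborel (\<lambda>\<tau>. f (s - \<tau>) * g \<tau>)" for s
  proof (rule Bochner_Integration.integrable_bound)
    show "integrable lborel (\<lambda>\<tau>. C * f (s - \<tau>))" using fr by (rule integrable_mult_right)
    show "AE \<tau> in lborel. norm (f (s - \<tau>) * g \<tau>) \<le> norm (C * f (s - \<tau>))"
      using C C0 by (intro AE_I2) (simp add: abs_mult mult.commute mult_right_mono)
  qed measurable
  show "integrable lborel (\<lambda>\<tau>. f (t - \<tau>) * g \<tau>)" by (rule i)
  show "continuous_on UNIV (conv f g)"
    unfolding continuous_on_eq_continuous_at[OF open_UNIV]
  proof (intro ballI)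
    fix t
    have lim: "((\<lambda>z. C * (\<integral>x. norm (f (x + z) - f x) \<partial>lborel)) \<longlongrightarrow> C * 0) (at 0)"
      using translation_cont_integrable[OF f] unfolding translation_cont_def by (intro tendsto_intros)
    have "((\<lambda>z. conv f g (t + z) - conv f g t) \<longlongrightarrow> 0) (at 0)"
    proof (rule Lim_null_comparison)
      show "((\<lambda>z. C * (\<integral>x. norm (f (x + z) - f x) \<partial>lborel)) \<longlongrightarrow> 0) (at 0)" using lim by simp
      show "\<forall>\<^sub>F z in at 0. norm (conv f g (t + z) - conv f g t) \<le> C * (\<integral>x. norm (f (x + z) - f x) \<partial>lborel)"
      proof (intro always_eventually allI)
        fix z
        have s: "integrable lborel (\<lambda>x. C * norm (f (x + z) - f x))"
          by (intro integrable_mult_right integrable_norm Bochner_Integration.integrable_diff lborel_integrable_shift f)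
        have s': "integrable lborel (\<lambda>\<tau>. C * norm (f (t - \<tau> + z) - f (t - \<tau>)))"
          using lborel_integrable_real_affine[OF s, of "-1" t] by simp
        have "conv f g (t + z) - conv f g t = (\<integral>\<tau>. f (t + z - \<tau>) * g \<tau> - f (t - \<tau>) * g \<tau> \<partial>lborel)"
          unfolding conv_def by (rule Bochner_Integration.integral_diff[OF i i, symmetric])
        also have "norm \<dots> \<le> (\<integral>\<tau>. C * norm (f (t - \<tau> + z) - f (t - \<tau>)) \<partial>lborel)"
        proof (rule Bochner_Integration.integral_norm_bound_integral[OF Bochner_Integration.integrable_diff[OF i i] s'])
          fix \<tau>
          have "norm (f (t + z - \<tau>) * g \<tau> - f (t - \<tau>) * g \<tau>) = \<bar>f (t - \<tau> + z) - f (t - \<tau>)\<bar> * \<bar>g \<tau>\<bar>"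
            by (simp only: left_diff_distrib[symmetric] abs_mult real_norm_def add_diff_eq diff_add_eq)
          also have "\<dots> \<le> \<bar>f (t - \<tau> + z) - f (t - \<tau>)\<bar> * C" by (intro mult_left_mono C) auto
          finally show "norm (f (t + z - \<tau>) * g \<tau> - f (t - \<tau>) * g \<tau>) \<le> C * norm (f (t - \<tau> + z) - f (t - \<tau>))"
            by (simp add: mult.commute)
        qed
        also have "\<dots> = C * (\<integral>x. norm (f (x + z) - f x) \<partial>lborel)"
          using integral_lborel_reflect[of "\<lambda>x. C * norm (f (x + z) - f x)" t] by simp
        finally show "norm (conv f g (t + z) - conv f g t) \<le> C * (\<integral>x. norm (f (x + z) - f x) \<partial>lborel)" .
      qed
    qed
    then have "((\<lambda>z. conv f g (t + z)) \<longlongrightarrow> conv f g t) (at 0)" by (rule LIM_zero_cancel)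
    then show "isCont (conv f g) t" by (simp add: isCont_iff)
  qed
qed

definition locally_bounded_pos :: "(real \<Rightarrow> real) \<Rightarrow> bool" where
  "locally_bounded_pos f \<longleftrightarrow> (\<forall>d>0. \<forall>T. \<exists>C. \<forall>t\<in>{d..T}. \<bar>f t\<bar> \<le> C)"

text \<open>Near \<open>t\<close> at most one of the factors \<open>f (t - \<tau>)\<close>, \<open>g \<tau>\<close> is close to its singularity at \<open>0\<close>.\<close>

lemma conv_continuous_pos:
  assumes f: "loc_int f" "locally_bounded_pos f" and g: "loc_int g" "locally_bounded_pos g"
  shows "0 < t \<Longrightarrow> integrable lborel (\<lambda>\<tau>. f (t - \<tau>) * g \<tau>)" and "continuous_on {0<..} (conv f g)"
proof -
  note [measurable] = loc_int_measurable[OF f(1)] loc_int_measurable[OF g(1)]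
  have main: "integrable lborel (\<lambda>\<tau>. f (t - \<tau>) * g \<tau>) \<and> isCont (conv f g) t" if t: "0 < t" for t
  proof -
    \<comment> \<open>For x > t / 2 the inequalities x - \<tau> < d and \<tau> < d exclude each
      other. Hence the product of the two singular pieces f1 and g1 is absent from the decomposition
      \<open>pw\<close>, and every remaining product has a bounded factor.\<close>
    define d where "d = t / 4"
    define T where "T = 2 * t"
    have d: "0 < d" using t by (simp add: d_def)
    obtain Cf Cg where C: "\<And>x. x \<in> {d..T} \<Longrightarrow> \<bar>f x\<bar> \<le> Cf" "\<And>x. x \<in> {d..T} \<Longrightarrow> \<bar>g x\<bar> \<le> Cg"
      using f(2) g(2) d unfolding locally_bounded_pos_def by meson
    define f1 where "f1 x = indicator {0..<d} x *\<^sub>R f x" for x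
    define f2 where "f2 x = indicator {d..T} x *\<^sub>R f x" for x
    define g1 where "g1 x = indicator {0..<d} x *\<^sub>R g x" for x
    define g2 where "g2 x = indicator {d..T} x *\<^sub>R g x" for x
    have [measurable]: "f1 \<in> borel_measurable borel" "f2 \<in> borel_measurable borel" "g1 \<in> borel_measurable borel" "g2 \<in> borel_measurable borel"
      unfolding f1_def f2_def g1_def g2_def by measurable
    have "{0..<d} \<subseteq> {..T}" "{d..T} \<subseteq> {..T}" using t by (auto simp: d_def T_def)
    then have i: "integrable lborel f1" "integrable lborel f2" "integrable lborel g1" "integrable lborel g2"
      unfolding f1_def f2_def g1_def g2_def
      by (intro loc_int_set_integrable[OF f(1), of _ T, unfolded set_integrable_def] loc_int_set_integrable[OF g(1), of _ T, unfolded set_integrable_def]; simp)+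
    have b: "\<bar>f2 x\<bar> \<le> \<bar>Cf\<bar>" "\<bar>g2 x\<bar> \<le> \<bar>Cg\<bar>" for x
      using C[of x] by (auto simp: f2_def g2_def indicator_def)
    have pw: "f (x - \<tau>) * g \<tau> = f1 (x - \<tau>) * g2 \<tau> + f2 (x - \<tau>) * g1 \<tau> + f2 (x - \<tau>) * g2 \<tau>"
      if x: "x \<in> {t/2<..<3*t/2}" for x \<tau>
    proof -
      consider "\<tau> < 0" | "\<tau> > x" | "0 \<le> \<tau>" "\<tau> \<le> x" by linarith
      then show ?thesis
      proof cases
        case 3
        have dT: "d = t / 4" "T = 2 * t" by (simp_all add: d_def T_def)
        have "f1 (x - \<tau>) = (if x - \<tau> < d then f (x - \<tau>) else 0)" "f2 (x - \<tau>) = (if x - \<tau> < d then 0 else f (x - \<tau>))"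
          "g1 \<tau> = (if \<tau> < d then g \<tau> else 0)" "g2 \<tau> = (if \<tau> < d then 0 else g \<tau>)"
          using x 3 t by (auto simp: f1_def f2_def g1_def g2_def indicator_def dT)
        moreover have "\<not> (x - \<tau> < d \<and> \<tau> < d)" using x by (auto simp: dT)
        ultimately show ?thesis by (auto split: if_splits)
      qed (auto simp: f1_def f2_def g1_def g2_def loc_int_neg[OF f(1)] loc_int_neg[OF g(1)])
    qed
    have i12: "integrable lborel (\<lambda>\<tau>. f1 (x - \<tau>) * g2 \<tau>)" for x
      by (rule conv_bounded_continuous(1)[OF i(1) _ b(2)]) measurable
    have i22: "integrable lborel (\<lambda>\<tau>. f2 (x - \<tau>) * g2 \<tau>)" for x
      by (rule conv_bounded_continuous(1)[OF i(2) _ b(2)]) measurable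
    have i21: "integrable lborel (\<lambda>\<tau>. f2 (x - \<tau>) * g1 \<tau>)" for x
    proof -
      have "integrable lborel (\<lambda>\<tau>. g1 (x - \<tau>) * f2 \<tau>)"
        by (rule conv_bounded_continuous(1)[OF i(3) _ b(1)]) measurable
      from lborel_integrable_real_affine[OF this, of "-1" x] show ?thesis by (simp add: mult.commute)
    qed
    have eq: "conv f g x = conv f1 g2 x + conv g1 f2 x + conv f2 g2 x" if x: "x \<in> {t/2<..<3*t/2}" for x
    proof -
      have "conv f g x = (\<integral>\<tau>. f1 (x - \<tau>) * g2 \<tau> + f2 (x - \<tau>) * g1 \<tau> + f2 (x - \<tau>) * g2 \<tau> \<partial>lborel)"
        unfolding conv_def by (simp only: pw[OF x])
      also have "\<dots> = conv f1 g2 x + conv f2 g1 x + conv f2 g2 x"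
        unfolding conv_def using i12 i21 i22 by simp
      finally show ?thesis by (simp only: conv_commute[of f2 g1])
    qed
    have c: "continuous_on UNIV (conv f1 g2)" "continuous_on UNIV (conv g1 f2)" "continuous_on UNIV (conv f2 g2)"
      by (rule conv_bounded_continuous(2)[OF i(1) _ b(2)], measurable, rule conv_bounded_continuous(2)[OF i(3) _ b(1)], measurable,
          rule conv_bounded_continuous(2)[OF i(2) _ b(2)], measurable)
    have "continuous_on {t/2<..<3*t/2} (\<lambda>x. conv f1 g2 x + conv g1 f2 x + conv f2 g2 x)"
      by (intro continuous_on_add continuous_on_subset[OF c(1)] continuous_on_subset[OF c(2)] continuous_on_subset[OF c(3)]) auto
    then have "continuous_on {t/2<..<3*t/2} (conv f g)"
      by (rule continuous_on_eq) (simp add: eq)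
    then have "isCont (conv f g) t"
      using t by (simp add: continuous_on_eq_continuous_at)
    moreover have "integrable lborel (\<lambda>\<tau>. f (t - \<tau>) * g \<tau>)"
    proof -
      have "t \<in> {t/2<..<3*t/2}" using t by simp
      from pw[OF this] show ?thesis using i12 i21 i22 by simp
    qed
    ultimately show ?thesis by simp
  qed
  show "0 < t \<Longrightarrow> integrable lborel (\<lambda>\<tau>. f (t - \<tau>) * g \<tau>)" using main by simp
  show "continuous_on {0<..} (conv f g)"
    using main by (simp add: continuous_on_eq_continuous_at)
qed

lemma AE_interval_pick:
  assumes "AE t in lborel. P t" "x < (y::real)" obtains t where "x < t" "t < y" "P t"
proof (rule ccontr)
  assume "\<not> thesis"
  then have "\<And>t. x < t \<Longrightarrow> t < y \<Longrightarrow> \<not> P t" using that by blast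
  then have "AE t in lborel. t \<notin> {x<..<y}" using assms(1) by (auto elim: eventually_mono)
  then have "{x<..<y} \<in> null_sets lborel" by (simp add: AE_iff_null_sets)
  then show False using assms(2) by (simp add: null_sets_def)
qed

locale sonine_kernel_mono = sonine_kernel +
  assumes a_antimono: "0 < s \<Longrightarrow> s \<le> t \<Longrightarrow> a t \<le> a s"
begin

lemma a_bdd: "locally_bounded_pos a"
  unfolding locally_bounded_pos_def using a_antimono a_nonneg by (fastforce intro: exI[of _ "a _"])

lemma k_bdd: "locally_bounded_pos k"
  unfolding locally_bounded_pos_def using k_antimono k_nonneg by (fastforce intro: exI[of _ "k _"])

lemma a_int0: "integrable lborel (\<lambda>\<tau>. indicator {x..y} \<tau> *\<^sub>R a \<tau>)"
  using a_set_integrable by (simp add: set_integrable_def)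

lemma k_set_integrable: "set_integrable lborel {x..y} k"
  by (rule loc_int_set_integrable[OF k, of _ y]) auto

text \<open>With \<beta> = 0 and k < M the convolution k * a would be at most M times the integral
  of a over [0, t], which tends to 0 with t, although it equals 1 almost everywhere.\<close>

lemma k_unbounded:
  assumes "\<beta> = 0" obtains d where "0 < d" "M \<le> k d"
proof (rule ccontr)
  assume "\<not> thesis"
  then have kM: "\<And>x. 0 < x \<Longrightarrow> k x < M" using that by (meson not_le)
  have M: "0 < M" using kM[of 1] k_nonneg[of 1] by simp
  obtain d where d: "0 < d" "\<And>h. 0 < h \<Longrightarrow> h \<le> d \<Longrightarrow> (LBINT \<tau>:{0..h}. \<bar>a \<tau>\<bar>) < 1 / M"
    using loc_int_integral_small[OF a, of "1 / M"] M by auto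
  obtain t where t: "0 < t" "t < d" "0 < t \<longrightarrow> \<beta> * a t + conv k a t = 1"
    using AE_interval_pick[OF sonine d(1)] by blast
  have "conv k a t \<le> M * (LBINT \<tau>:{0..t}. \<bar>a \<tau>\<bar>)"
  proof -
    have "conv k a t \<le> (\<integral>\<tau>. M * (indicator {0..t} \<tau> *\<^sub>R a \<tau>) \<partial>lborel)"
      unfolding conv_def
    proof (rule integral_mono_AE)
      show "AE \<tau> in lborel. k (t - \<tau>) * a \<tau> \<le> M * (indicator {0..t} \<tau> *\<^sub>R a \<tau>)"
        using AE_lborel_singleton[of t]
      proof eventually_elim
        case (elim \<tau>)
        consider "\<tau> < 0" | "\<tau> > t" | "0 \<le> \<tau>" "\<tau> < t" using elim by linarith
        then show ?case
        proof cases
          case 3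
          then have "k (t - \<tau>) * a \<tau> \<le> M * a \<tau>" using kM[of "t - \<tau>"] a_nonneg[of \<tau>] by (intro mult_right_mono) auto
          then show ?thesis using 3 by simp
        qed (auto simp: loc_int_neg[OF a] loc_int_neg[OF k])
      qed
      show "integrable lborel (\<lambda>\<tau>. k (t - \<tau>) * a \<tau>)" by (rule conv_continuous_pos(1)[OF k k_bdd a a_bdd t(1)])
      show "integrable lborel (\<lambda>\<tau>. M * (indicator {0..t} \<tau> *\<^sub>R a \<tau>))" by (rule integrable_mult_right[OF a_int0])
    qed
    then show ?thesis using a_nonneg by (simp add: set_lebesgue_integral_def)
  qed
  also have "\<dots> < M * (1 / M)" using d(2)[of t] t M by (intro mult_strict_left_mono) auto
  finally show False using t assms M by simp
qed

text \<open>Either \<beta> alone exceeds M h for small h, or \<beta> = 0 and k is above M near 0.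
  This gain over every linear function is what excludes jumps of a.\<close>

lemma k_integral_large:
  obtains d where "0 < d" "\<And>h. 0 < h \<Longrightarrow> h \<le> d \<Longrightarrow> M * h \<le> \<beta> + (LBINT \<tau>:{0..h}. k \<tau>)"
proof (cases "\<beta> = 0")
  case False
  then have b: "0 < \<beta>" using \<beta> by simp
  have nn: "0 \<le> (LBINT \<tau>:{0..h}. k \<tau>)" for h
    unfolding set_lebesgue_integral_def by (intro Bochner_Integration.integral_nonneg) (simp add: k_nonneg)
  show ?thesis
  proof (rule that[of "\<beta> / (\<bar>M\<bar> + 1)"])
    show "M * h \<le> \<beta> + (LBINT \<tau>:{0..h}. k \<tau>)" if "0 < h" "h \<le> \<beta> / (\<bar>M\<bar> + 1)" for h
    proof -
      have "M * h \<le> (\<bar>M\<bar> + 1) * h" using that by (intro mult_right_mono) auto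
      also have "\<dots> \<le> \<beta>" using that by (simp add: field_simps)
      finally show ?thesis using nn[of h] by simp
    qed
  qed (use b in simp)
next
  case True
  obtain d where d: "0 < d" "M \<le> k d" using k_unbounded[OF True] .
  show ?thesis
  proof (rule that[OF d(1)])
    fix h assume h: "0 < h" "h \<le> d"
    have "M * h = (\<integral>\<tau>. indicator {0..h} \<tau> *\<^sub>R M \<partial>lborel)" using h by simp
    also have "\<dots> \<le> (\<integral>\<tau>. indicator {0..h} \<tau> *\<^sub>R k \<tau> \<partial>lborel)"
    proof (rule integral_mono_AE)
      show "AE \<tau> in lborel. indicator {0..h} \<tau> *\<^sub>R M \<le> indicator {0..h} \<tau> *\<^sub>R k \<tau>"
        using AE_lborel_singleton[of "0::real"]
      proof eventually_elim
        case (elim \<tau>)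
        then show ?case using k_antimono[of \<tau> d] d h by (auto simp: indicator_def)
      qed
      show "integrable lborel (\<lambda>\<tau>. indicator {0..h} \<tau> *\<^sub>R M)"
        by (rule integrable_indicator_Icc)
      show "integrable lborel (\<lambda>\<tau>. indicator {0..h} \<tau> *\<^sub>R k \<tau>)" using k_set_integrable[of 0 h] by (simp add: set_integrable_def)
    qed
    finally show "M * h \<le> \<beta> + (LBINT \<tau>:{0..h}. k \<tau>)" using True by (simp add: set_lebesgue_integral_def)
  qed
qed

text \<open>A jump of \<open>a\<close> at \<open>t0\<close> would contribute at least its height times \<open>\<beta> + \<integral>\<^bsub>0\<^esub>\<^bsup>\<eta>\<^esup> k\<close> to the decrease of
  \<open>\<beta> a + k * a\<close> across \<open>t0\<close>, while the increase is only \<open>O(\<eta>)\<close>.\<close>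

lemma a_continuous: "continuous_on {0<..} a"
  unfolding continuous_on_eq_continuous_at[OF open_greaterThan]
proof (intro ballI, rule ccontr)
  fix t0 :: real assume "t0 \<in> {0<..}" and nc: "\<not> isCont a t0"
  then have t0: "0 < t0" by simp
  obtain e where e: "0 < e" "\<And>d. 0 < d \<Longrightarrow> \<exists>x. \<bar>x - t0\<bar> < d \<and> e \<le> \<bar>a x - a t0\<bar>"
    using nc unfolding continuous_at_eps_delta dist_real_def by (meson not_less)
  \<comment> \<open>Discontinuity gives a deviation of size e arbitrarily close to t0, on an unknown
    side; monotonicity turns it into a drop of at least e across t0.\<close>
  have jump: "e \<le> a x - a y" if xy: "0 < x" "x < t0" "t0 < y" for x y
  proof -
    obtain z where z: "\<bar>z - t0\<bar> < min (t0 - x) (y - t0)" "e \<le> \<bar>a z - a t0\<bar>"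
      using e(2)[of "min (t0 - x) (y - t0)"] xy by auto
    have "x < z" "z < y" using z(1) by auto
    then have "a z \<le> a x" "a y \<le> a z" "a t0 \<le> a x" "a y \<le> a t0"
      using xy t0 by (auto intro!: a_antimono)
    then show ?thesis using z(2) by linarith
  qed
  define p where "p = t0 / 2"
  define C where "C = k p * a (t0 / 4)"
  have C0: "0 \<le> C" using k_nonneg a_nonneg by (simp add: C_def)
  \<comment> \<open>The rate 2 C / e + 1 is chosen against \<open>part2\<close>: the increase there
    is at most C h \<le> 2 C \<eta>, so the contribution of the jump wins by e \<eta>.\<close>
  obtain d where d: "0 < d" "\<And>h. 0 < h \<Longrightarrow> h \<le> d \<Longrightarrow> (2 * C / e + 1) * h \<le> \<beta> + (LBINT \<tau>:{0..h}. k \<tau>)"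
    using k_integral_large by blast
  \<comment> \<open>The Sonine identity is known almost everywhere only, so t1 and t2 are picked on
    the two sides of t0 among the points where it holds, less than 2 \<eta> apart.\<close>
  obtain t2 where t2: "t0 < t2" "t2 < t0 + min d (t0 / 4)" "0 < t2 \<longrightarrow> \<beta> * a t2 + conv k a t2 = 1"
    using AE_interval_pick[OF sonine, of t0 "t0 + min d (t0 / 4)"] d t0 by auto
  define \<eta> where "\<eta> = t2 - t0"
  have \<eta>: "0 < \<eta>" "\<eta> \<le> d" "\<eta> \<le> t0 / 4" using t2 by (auto simp: \<eta>_def)
  obtain t1 where t1: "t0 - \<eta> < t1" "t1 < t0" "0 < t1 \<longrightarrow> \<beta> * a t1 + conv k a t1 = 1"
    using AE_interval_pick[OF sonine, of "t0 - \<eta>" t0] \<eta> by auto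
  have t1p: "3 / 4 * t0 < t1" using t1 \<eta> by linarith
  define h where "h = t2 - t1"
  have h: "0 < h" "h \<le> 2 * \<eta>" using t1 t2 by (auto simp: h_def \<eta>_def)
  have p: "0 < p" "p < t1" using t0 t1p by (auto simp: p_def)
  have ki: "integrable lborel (\<lambda>\<tau>. a (t - \<tau>) * k \<tau>)" "integrable lborel (\<lambda>\<tau>. k (t - \<tau>) * a \<tau>)" if "0 < t" for t
    using conv_continuous_pos(1)[OF a a_bdd k k_bdd that] conv_continuous_pos(1)[OF k k_bdd a a_bdd that] by auto
  have t12: "0 < t1" "0 < t2" using p t2 t0 by auto
  \<comment> \<open>split both convolutions at \<open>\<tau> = p\<close>, with \<open>k\<close> carrying \<open>\<tau>\<close> below and the difference above\<close>
  have split: "conv k a t = (\<integral>\<tau>. indicator {..p} \<tau> * (a (t - \<tau>) * k \<tau>) \<partial>lborel) + (\<integral>\<sigma>. indicator {..<t - p} \<sigma> * (k (t - \<sigma>) * a \<sigma>) \<partial>lborel)"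
    if "0 < t" for t
  proof -
    have i1: "integrable lborel (\<lambda>\<tau>. indicator {..p} \<tau> * (a (t - \<tau>) * k \<tau>))"
      and i2: "integrable lborel (\<lambda>\<tau>. indicator {p<..} \<tau> * (a (t - \<tau>) * k \<tau>))"
      using integrable_mult_indicator[OF _ ki(1)[OF that], of "{..p}"] integrable_mult_indicator[OF _ ki(1)[OF that], of "{p<..}"] by auto
    have "conv k a t = (\<integral>\<tau>. indicator {..p} \<tau> * (a (t - \<tau>) * k \<tau>) + indicator {p<..} \<tau> * (a (t - \<tau>) * k \<tau>) \<partial>lborel)"
      unfolding conv_commute[of k a] unfolding conv_def
      by (intro Bochner_Integration.integral_cong refl) (auto simp: indicator_def)
    also have "\<dots> = (\<integral>\<tau>. indicator {..p} \<tau> * (a (t - \<tau>) * k \<tau>) \<partial>lborel) + (\<integral>\<tau>. indicator {p<..} \<tau> * (a (t - \<tau>) * k \<tau>) \<partial>lborel)"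
      by (rule Bochner_Integration.integral_add[OF i1 i2])
    also have "(\<integral>\<tau>. indicator {p<..} \<tau> * (a (t - \<tau>) * k \<tau>) \<partial>lborel) = (\<integral>\<sigma>. indicator {..<t - p} \<sigma> * (k (t - \<sigma>) * a \<sigma>) \<partial>lborel)"
      using integral_lborel_reflect[of "\<lambda>\<tau>. indicator {p<..} \<tau> * (a (t - \<tau>) * k \<tau>)" t]
      by (simp add: indicator_def mult.commute less_diff_eq add.commute)
    finally show ?thesis .
  qed
  \<comment> \<open>For 0 < \<tau> < \<eta> = t2 - t0 the points t1 - \<tau> and t2 - \<tau> lie on
    opposite sides of t0, so the difference of a contains the whole jump. For \<eta> < \<tau> \<le>
    p monotonicity of a gives the right sign.\<close>
  have part1: "(\<integral>\<tau>. indicator {..p} \<tau> * (a (t2 - \<tau>) * k \<tau>) \<partial>lborel) - (\<integral>\<tau>. indicator {..p} \<tau> * (a (t1 - \<tau>) * k \<tau>) \<partial>lborel)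
      \<le> - e * (LBINT \<tau>:{0..\<eta>}. k \<tau>)"
  proof -
    have i: "integrable lborel (\<lambda>\<tau>. indicator {..p} \<tau> * (a (t - \<tau>) * k \<tau>))" if "0 < t" for t
      using integrable_mult_indicator[OF _ ki(1)[OF that], of "{..p}"] by auto
    have "(\<integral>\<tau>. indicator {..p} \<tau> * (a (t2 - \<tau>) * k \<tau>) \<partial>lborel) - (\<integral>\<tau>. indicator {..p} \<tau> * (a (t1 - \<tau>) * k \<tau>) \<partial>lborel)
      = (\<integral>\<tau>. indicator {..p} \<tau> * (a (t2 - \<tau>) * k \<tau>) - indicator {..p} \<tau> * (a (t1 - \<tau>) * k \<tau>) \<partial>lborel)"
      by (rule Bochner_Integration.integral_diff[OF i[OF t12(2)] i[OF t12(1)], symmetric])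
    also have "\<dots> \<le> (\<integral>\<tau>. - e * (indicator {0..\<eta>} \<tau> *\<^sub>R k \<tau>) \<partial>lborel)"
    proof (rule integral_mono_AE)
      show "integrable lborel (\<lambda>\<tau>. indicator {..p} \<tau> * (a (t2 - \<tau>) * k \<tau>) - indicator {..p} \<tau> * (a (t1 - \<tau>) * k \<tau>))"
        by (rule Bochner_Integration.integrable_diff[OF i[OF t12(2)] i[OF t12(1)]])
      show "integrable lborel (\<lambda>\<tau>. - e * (indicator {0..\<eta>} \<tau> *\<^sub>R k \<tau>))"
        using k_set_integrable[of 0 \<eta>] by (intro integrable_mult_right) (simp add: set_integrable_def)
      show "AE \<tau> in lborel. indicator {..p} \<tau> * (a (t2 - \<tau>) * k \<tau>) - indicator {..p} \<tau> * (a (t1 - \<tau>) * k \<tau>) \<le> - e * (indicator {0..\<eta>} \<tau> *\<^sub>R k \<tau>)"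
        using AE_lborel_singleton[of "0::real"] AE_lborel_singleton[of \<eta>]
      proof eventually_elim
        case (elim \<tau>)
        consider "\<tau> < 0" | "\<tau> > p" | "0 < \<tau>" "\<tau> < \<eta>" | "\<eta> < \<tau>" "\<tau> \<le> p" using elim by linarith
        then show ?case
        proof cases
          case 1
          then show ?thesis by (simp add: loc_int_neg[OF k])
        next
          case 2
          then show ?thesis using \<eta> t0 by (simp add: p_def)
        next
          case 3
          have "e \<le> a (t1 - \<tau>) - a (t2 - \<tau>)"
            using 3 t1 t2 \<eta> t1p t0 by (intro jump) (auto simp: \<eta>_def)
          then have "e * k \<tau> \<le> (a (t1 - \<tau>) - a (t2 - \<tau>)) * k \<tau>" by (intro mult_right_mono k_nonneg)
          moreover have "\<tau> \<le> p" using 3 \<eta> t0 by (simp add: p_def)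
          ultimately show ?thesis using 3 by (simp add: algebra_simps)
        next
          case 4
          have "a (t2 - \<tau>) \<le> a (t1 - \<tau>)" using 4 p h by (intro a_antimono) (auto simp: h_def)
          then have "a (t2 - \<tau>) * k \<tau> \<le> a (t1 - \<tau>) * k \<tau>" by (intro mult_right_mono k_nonneg)
          then show ?thesis using 4 by simp
        qed
      qed
    qed
    also have "\<dots> = - e * (LBINT \<tau>:{0..\<eta>}. k \<tau>)" by (simp add: set_lebesgue_integral_def)
    finally show ?thesis .
  qed
  \<comment> \<open>Where both integrands are present, monotonicity of k makes the difference
    nonpositive. The increase comes only from a window of length h in which t2 - \<sigma> > p and
    \<sigma> \<ge> t0 / 4, so that C bounds the product.\<close>
  have part2: "(\<integral>\<sigma>. indicator {..<t2 - p} \<sigma> * (k (t2 - \<sigma>) * a \<sigma>) \<partial>lborel) - (\<integral>\<sigma>. indicator {..<t1 - p} \<sigma> * (k (t1 - \<sigma>) * a \<sigma>) \<partial>lborel)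
      \<le> C * h"
  proof -
    have i: "integrable lborel (\<lambda>\<sigma>. indicator {..<t - p} \<sigma> * (k (t - \<sigma>) * a \<sigma>))" if "0 < t" for t
      using integrable_mult_indicator[OF _ ki(2)[OF that], of "{..<t - p}"] by auto
    have "(\<integral>\<sigma>. indicator {..<t2 - p} \<sigma> * (k (t2 - \<sigma>) * a \<sigma>) \<partial>lborel) - (\<integral>\<sigma>. indicator {..<t1 - p} \<sigma> * (k (t1 - \<sigma>) * a \<sigma>) \<partial>lborel)
      = (\<integral>\<sigma>. indicator {..<t2 - p} \<sigma> * (k (t2 - \<sigma>) * a \<sigma>) - indicator {..<t1 - p} \<sigma> * (k (t1 - \<sigma>) * a \<sigma>) \<partial>lborel)"
      by (rule Bochner_Integration.integral_diff[OF i[OF t12(2)] i[OF t12(1)], symmetric])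
    also have "\<dots> \<le> (\<integral>\<sigma>. indicator {t1 - p..t2 - p} \<sigma> *\<^sub>R C \<partial>lborel)"
    proof (rule integral_mono)
      show "integrable lborel (\<lambda>\<sigma>. indicator {..<t2 - p} \<sigma> * (k (t2 - \<sigma>) * a \<sigma>) - indicator {..<t1 - p} \<sigma> * (k (t1 - \<sigma>) * a \<sigma>))"
        by (rule Bochner_Integration.integrable_diff[OF i[OF t12(2)] i[OF t12(1)]])
      show "integrable lborel (\<lambda>\<sigma>. indicator {t1 - p..t2 - p} \<sigma> *\<^sub>R C)" by (rule integrable_indicator_Icc)
      fix \<sigma> :: real
      consider "\<sigma> < t1 - p" | "t1 - p \<le> \<sigma>" "\<sigma> < t2 - p" | "t2 - p \<le> \<sigma>" by linarith
      then show "indicator {..<t2 - p} \<sigma> * (k (t2 - \<sigma>) * a \<sigma>) - indicator {..<t1 - p} \<sigma> * (k (t1 - \<sigma>) * a \<sigma>) \<le> indicator {t1 - p..t2 - p} \<sigma> *\<^sub>R C"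
      proof cases
        case 1
        have "k (t2 - \<sigma>) * a \<sigma> \<le> k (t1 - \<sigma>) * a \<sigma>"
          using 1 p h by (intro mult_right_mono a_nonneg k_antimono) (auto simp: h_def)
        then show ?thesis using 1 h by (simp add: h_def)
      next
        case 2
        have "k (t2 - \<sigma>) * a \<sigma> \<le> k p * a (t0 / 4)"
          using 2 p t1p t0 by (intro mult_mono k_antimono a_antimono k_nonneg a_nonneg) (auto simp: p_def)
        then show ?thesis using 2 by (simp add: C_def)
      next
        case 3
        then show ?thesis using h C0 by (simp add: h_def)
      qed
    qed
    also have "\<dots> = C * h" using h by (simp add: h_def)
    finally show ?thesis .
  qed
  have "e \<le> a t1 - a t2" using jump t1 t2 t12 by simp
  then have "\<beta> * e \<le> \<beta> * (a t1 - a t2)" using \<beta> by (rule mult_left_mono)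
  also have "\<dots> = conv k a t2 - conv k a t1" using t1(3) t2(3) t12 by (simp add: algebra_simps)
  also have "\<dots> \<le> - e * (LBINT \<tau>:{0..\<eta>}. k \<tau>) + C * h"
    using part1 part2 split[OF t12(1)] split[OF t12(2)] by linarith
  finally have "e * (\<beta> + (LBINT \<tau>:{0..\<eta>}. k \<tau>)) \<le> C * h" by (simp add: algebra_simps)
  also have "\<dots> \<le> C * (2 * \<eta>)" using h C0 by (intro mult_left_mono)
  finally have "e * (\<beta> + (LBINT \<tau>:{0..\<eta>}. k \<tau>)) \<le> 2 * C * \<eta>" by simp
  moreover have "e * ((2 * C / e + 1) * \<eta>) \<le> e * (\<beta> + (LBINT \<tau>:{0..\<eta>}. k \<tau>))"
    using d(2)[OF \<eta>(1,2)] e by (intro mult_left_mono) auto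
  moreover have "e * ((2 * C / e + 1) * \<eta>) = 2 * C * \<eta> + e * \<eta>" using e by (simp add: field_simps)
  ultimately show False using e \<eta> mult_pos_pos[of e \<eta>] by linarith
qed

text \<open>The representative of the resolvent that is continuous on \<open>(0,\<infinity>)\<close>.\<close>

definition res_cont :: "real \<Rightarrow> real \<Rightarrow> real" where
  "res_cont \<nu> t = a t - \<nu> * conv a (resolvent a \<nu>) t"

lemma res_cont_measurable [measurable]: "(\<lambda>\<nu>. res_cont \<nu> t) \<in> borel_measurable borel" "res_cont \<nu> \<in> borel_measurable borel"
  unfolding res_cont_def conv_def by measurable

lemma resolvent_AE_res_cont: "0 \<le> \<nu> \<Longrightarrow> AE t in lborel. resolvent a \<nu> t = res_cont \<nu> t"
  using resolvent_eq[of \<nu>] by (auto elim!: eventually_mono simp: res_cont_def)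

text \<open>\<open>conv_continuous_pos\<close> asks for a bound at every point away from 0, whereas
  \<open>resolvent\<close> is known to be at most a only almost everywhere; the minimum with a is a
  representative with this bound.\<close>

lemma resolvent_truncation:
  assumes \<nu>: "0 \<le> \<nu>"
  obtains R' where "loc_int R'" "locally_bounded_pos R'" "AE t in lborel. resolvent a \<nu> t = R' t"
proof -
  define R' where "R' t = min (resolvent a \<nu> t) (a t)" for t
  note R = resolvent_loc_int[OF \<nu>]
  have AE: "AE t in lborel. resolvent a \<nu> t = R' t"
    using resolvent_eq[OF \<nu>]
  proof eventually_elim
    case (elim t)
    have "0 \<le> \<nu> * conv a (resolvent a \<nu>) t" using \<nu> by (intro mult_nonneg_nonneg conv_nonneg a_nonneg resolvent_nonneg)
    then have "resolvent a \<nu> t \<le> a t" using elim by linarith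
    then show ?case by (simp add: R'_def)
  qed
  have [measurable]: "R' \<in> borel_measurable borel" unfolding R'_def by measurable
  have R': "loc_int R'" by (rule loc_int_AE_eq[OF R AE]) (auto simp: R'_def loc_int_neg[OF a] res_neg[OF a])
  have "\<bar>R' t\<bar> \<le> \<bar>a t\<bar>" for t using a_nonneg[of t] resolvent_nonneg[of a \<nu> t] by (auto simp: R'_def)
  then have bdd: "locally_bounded_pos R'"
    using a_bdd unfolding locally_bounded_pos_def by (meson order_trans)
  show ?thesis by (rule that[OF R' bdd AE])
qed

lemma res_cont_continuous:
  assumes \<nu>: "0 \<le> \<nu>" shows "continuous_on {0<..} (res_cont \<nu>)"
proof -
  obtain R' where R': "loc_int R'" and bdd: "locally_bounded_pos R'" and AE: "AE t in lborel. resolvent a \<nu> t = R' t"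
    using resolvent_truncation[OF \<nu>] .
  note [measurable] = loc_int_measurable[OF resolvent_loc_int[OF \<nu>]] loc_int_measurable[OF R']
  have "conv a (resolvent a \<nu>) = conv a R'"
    by (intro ext conv_cong_AE) (use AE in auto)
  then show ?thesis
    unfolding res_cont_def by (intro continuous_intros a_continuous) (simp add: conv_continuous_pos(2)[OF a a_bdd R' bdd])
qed

lemma res_cont_nonneg:
  assumes \<nu>: "0 \<le> \<nu>" and t: "0 < t" shows "0 \<le> res_cont \<nu> t"
proof (rule ccontr)
  assume neg: "\<not> 0 \<le> res_cont \<nu> t"
  have "isCont (res_cont \<nu>) t" using res_cont_continuous[OF \<nu>] t by (simp add: continuous_on_eq_continuous_at)
  then obtain d where d: "0 < d" "\<And>x. \<bar>x - t\<bar> < d \<Longrightarrow> \<bar>res_cont \<nu> x - res_cont \<nu> t\<bar> < - res_cont \<nu> t"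
    unfolding continuous_at_eps_delta dist_real_def using neg by (metis neg_0_less_iff_less not_le)
  obtain x where x: "t < x" "x < t + d" "resolvent a \<nu> x = res_cont \<nu> x"
    using AE_interval_pick[OF resolvent_AE_res_cont[OF \<nu>], of t "t + d"] d by auto
  show False using d(2)[of x] x resolvent_nonneg[of a \<nu> x] by simp
qed

lemma res_cont_le:
  assumes \<nu>: "0 \<le> \<nu>" and t: "0 < t" shows "res_cont \<nu> t \<le> a t * relax \<nu> t"
proof -
  obtain R' where R': "loc_int R'" and bdd: "locally_bounded_pos R'" and AE: "AE t in lborel. resolvent a \<nu> t = R' t"
    using resolvent_truncation[OF \<nu>] .
  note [measurable] = loc_int_measurable[OF resolvent_loc_int[OF \<nu>]] loc_int_measurable[OF R']
  have "a t * (LBINT \<tau>:{0..t}. resolvent a \<nu> \<tau>) = (\<integral>\<tau>. a t * (indicator {0..t} \<tau> *\<^sub>R resolvent a \<nu> \<tau>) \<partial>lborel)"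
    by (simp add: set_lebesgue_integral_def)
  \<comment> \<open>The representative R' is used because its convolution integral with a is known
    to converge at the given t, which the comparison of integrals requires.\<close>
  also have "\<dots> \<le> (\<integral>\<tau>. a (t - \<tau>) * R' \<tau> \<partial>lborel)"
  proof (rule integral_mono_AE)
    show "integrable lborel (\<lambda>\<tau>. a (t - \<tau>) * R' \<tau>)" by (rule conv_continuous_pos(1)[OF a a_bdd R' bdd t])
    show "integrable lborel (\<lambda>\<tau>. a t * (indicator {0..t} \<tau> *\<^sub>R resolvent a \<nu> \<tau>))"
      using resolvent_set_integrable[OF \<nu>, of 0 t] by (intro integrable_mult_right) (simp add: set_integrable_def)
    show "AE \<tau> in lborel. a t * (indicator {0..t} \<tau> *\<^sub>R resolvent a \<nu> \<tau>) \<le> a (t - \<tau>) * R' \<tau>"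
      using AE AE_lborel_singleton[of t]
    proof eventually_elim
      case (elim \<tau>)
      consider "\<tau> < 0" | "\<tau> > t" | "0 \<le> \<tau>" "\<tau> < t" using elim by linarith
      then show ?case
      proof cases
        case 3
        have "a t * resolvent a \<nu> \<tau> \<le> a (t - \<tau>) * resolvent a \<nu> \<tau>"
          using 3 by (intro mult_right_mono a_antimono resolvent_nonneg) auto
        then show ?thesis using 3 elim by simp
      qed (auto simp: loc_int_neg[OF a] loc_int_neg[OF R'])
    qed
  qed
  also have "\<dots> = conv a (resolvent a \<nu>) t"
    unfolding conv_def[symmetric] by (rule conv_cong_AE) (use AE in \<open>auto elim: eventually_mono\<close>)
  finally have "\<nu> * (a t * (LBINT \<tau>:{0..t}. resolvent a \<nu> \<tau>)) \<le> \<nu> * conv a (resolvent a \<nu>) t"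
    using \<nu> by (rule mult_left_mono)
  then show ?thesis by (simp add: res_cont_def relax_def algebra_simps)
qed

lemma res_cont_le_a: "0 \<le> \<nu> \<Longrightarrow> res_cont \<nu> t \<le> a t"
  unfolding res_cont_def by (simp add: conv_nonneg a_nonneg resolvent_nonneg)

lemma a_integral_mono: "s \<le> t \<Longrightarrow> (LBINT \<tau>:{0..s}. a \<tau>) \<le> (LBINT \<tau>:{0..t}. a \<tau>)"
  unfolding set_lebesgue_integral_def
  by (intro integral_mono a_int0) (auto simp: indicator_def a_nonneg)

lemma mult_relax_le:
  assumes "0 \<le> \<nu>" "0 < b" "b \<le> t" shows "\<nu> * relax \<nu> t \<le> 1 / (LBINT \<tau>:{0..b}. a \<tau>)"
proof -
  have I: "0 < (LBINT \<tau>:{0..b}. a \<tau>)" using assms by (intro a_integral_pos)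
  have "\<nu> * relax \<nu> t * (LBINT \<tau>:{0..b}. a \<tau>) \<le> \<nu> * relax \<nu> t * (LBINT \<tau>:{0..t}. a \<tau>)"
    using assms by (intro mult_left_mono a_integral_mono mult_nonneg_nonneg relax_nonneg)
  also have "\<dots> \<le> 1" using assms by (intro relax_le_integral) auto
  finally show ?thesis using I by (simp add: field_simps)
qed

text \<open>The bound is uniform in \<nu> and in t \<ge> b; with b = t / 2 it dominates the
  difference quotients of s in time.\<close>

lemma mult_res_cont_le:
  assumes "0 \<le> \<nu>" "0 < b" "b \<le> t" shows "\<nu> * res_cont \<nu> t \<le> a b / (LBINT \<tau>:{0..b}. a \<tau>)"
proof -
  have "\<nu> * res_cont \<nu> t \<le> \<nu> * (a t * relax \<nu> t)" using assms by (intro mult_left_mono res_cont_le) auto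
  also have "\<dots> = a t * (\<nu> * relax \<nu> t)" by simp
  also have "\<dots> \<le> a b * (1 / (LBINT \<tau>:{0..b}. a \<tau>))"
    using assms by (intro mult_mono a_antimono mult_relax_le a_nonneg mult_nonneg_nonneg relax_nonneg) auto
  finally show ?thesis by simp
qed

text \<open>The integral is split at t / 2, away from a possible singularity at 0. Beyond that point
  \<open>resolvent\<close> may be replaced by its continuous representative, and the fundamental
  theorem of calculus applies.\<close>

lemma resolvent_integral_derivative:
  assumes \<nu>: "0 \<le> \<nu>" and t: "0 < t"
  shows "((\<lambda>x. LBINT \<tau>:{0..x}. resolvent a \<nu> \<tau>) has_real_derivative res_cont \<nu> t) (at t)"
proof -
  define b where "b = t / 2"
  have b: "0 < b" "b < t" using t by (auto simp: b_def)
  have F: "(LBINT \<tau>:{0..x}. resolvent a \<nu> \<tau>) = (LBINT \<tau>:{0..b}. resolvent a \<nu> \<tau>) + integral {b..x} (res_cont \<nu>)" if x: "b < x" for x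
  proof -
    have "(LBINT \<tau>:{0..b} \<union> {b..x}. resolvent a \<nu> \<tau>) = (LBINT \<tau>:{0..b}. resolvent a \<nu> \<tau>) + (LBINT \<tau>:{b..x}. resolvent a \<nu> \<tau>)"
    proof (rule set_integral_Un_AE)
      show "AE x' in lborel. \<not> (x' \<in> {0..b} \<and> x' \<in> {b..x})"
        using AE_lborel_singleton[of b] by eventually_elim auto
    qed (auto simp: resolvent_set_integrable[OF \<nu>])
    moreover have "{0..b} \<union> {b..x} = {0..x}" using b x by auto
    moreover have "(LBINT \<tau>:{b..x}. resolvent a \<nu> \<tau>) = (LBINT \<tau>:{b..x}. res_cont \<nu> \<tau>)"
      unfolding set_lebesgue_integral_def
      by (rule integral_cong_AE) (use resolvent_AE_res_cont[OF \<nu>] in \<open>auto elim!: eventually_mono\<close>)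
    moreover have "set_integrable lborel {b..x} (res_cont \<nu>)"
      by (rule borel_integrable_atLeastAtMost') (rule continuous_on_subset[OF res_cont_continuous[OF \<nu>]], use b in auto)
    ultimately show ?thesis by (simp add: set_borel_integral_eq_integral)
  qed
  have "((\<lambda>x. integral {b..x} (res_cont \<nu>)) has_real_derivative res_cont \<nu> t) (at t within {b..t + 1})"
    by (rule integral_has_real_derivative) (use b in \<open>auto intro!: continuous_on_subset[OF res_cont_continuous[OF \<nu>]]\<close>)
  then have "((\<lambda>x. integral {b..x} (res_cont \<nu>)) has_real_derivative res_cont \<nu> t) (at t)"
    using b by (simp add: at_within_Icc_at)
  then have "((\<lambda>x. (LBINT \<tau>:{0..b}. resolvent a \<nu> \<tau>) + integral {b..x} (res_cont \<nu>)) has_real_derivative res_cont \<nu> t) (at t)"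
    by (auto intro!: derivative_eq_intros)
  then show ?thesis
    by (rule has_field_derivative_transform_within_open[where S="{b<..}"]) (use b F in auto)
qed

text \<open>The mean value theorem for either sign of h. The restriction |h| < t / 2 keeps z in [t /
  2,\<infinity>), where the bounds on \<open>res_cont\<close> are uniform in \<nu>.\<close>

lemma resolvent_integral_quotient:
  assumes \<nu>: "0 \<le> \<nu>" and t: "0 < t" and h: "h \<noteq> 0" "\<bar>h\<bar> < t / 2"
  obtains z where "t / 2 \<le> z"
    "((LBINT \<tau>:{0..t + h}. resolvent a \<nu> \<tau>) - (LBINT \<tau>:{0..t}. resolvent a \<nu> \<tau>)) / h = res_cont \<nu> z"
proof -
  let ?F = "\<lambda>x. LBINT \<tau>:{0..x}. resolvent a \<nu> \<tau>"
  show ?thesis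
  proof (cases "0 < h")
    case True
    have "\<exists>z. t < z \<and> z < t + h \<and> ?F (t + h) - ?F t = (t + h - t) * res_cont \<nu> z"
      by (rule MVT2) (use True t in \<open>auto intro!: resolvent_integral_derivative[OF \<nu>]\<close>)
    then obtain z where "t < z" "?F (t + h) - ?F t = h * res_cont \<nu> z" by auto
    then show ?thesis using h t by (intro that[of z]) auto
  next
    case False
    have "\<exists>z. t + h < z \<and> z < t \<and> ?F t - ?F (t + h) = (t - (t + h)) * res_cont \<nu> z"
      by (rule MVT2) (use False h t in \<open>auto intro!: resolvent_integral_derivative[OF \<nu>]\<close>)
    then obtain z where z: "t + h < z" "?F t - ?F (t + h) = - h * res_cont \<nu> z" by auto
    have q: "?F (t + h) - ?F t = h * res_cont \<nu> z" using z(2) by linarith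
    show ?thesis
    proof
      show "t / 2 \<le> z" using h z(1) by auto
      show "(?F (t + h) - ?F t) / h = res_cont \<nu> z" unfolding q using h(1) by simp
    qed
  qed
qed

end

section \<open>The relaxation functions\<close>

text \<open>\<open>L1_loc\<close> does not constrain f at negative arguments; the representative is
  0 there, and agreement is claimed on the half line only.\<close>

lemma L1_loc_rep:
  assumes f: "L1_loc f"
  obtains f' where "loc_int f'" "AE t in lborel. 0 \<le> t \<longrightarrow> f t = f' t"
proof -
  have fi: "integrable lebesgue (\<lambda>t. indicator {0..real (Suc n)} t *\<^sub>R f t)" for n
    using f by (simp add: L1_loc_def set_integrable_def)
  define g where "g t = indicator {0..} t *\<^sub>R f t" for t
  have gm: "g \<in> borel_measurable lebesgue"
  proof (rule borel_measurable_LIMSEQ_real)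
    show "(\<lambda>t. indicator {0..real (Suc n)} t *\<^sub>R f t) \<in> borel_measurable lebesgue" for n using fi by blast
    fix t :: real
    obtain N :: nat where "t < real N" using reals_Archimedean2 by blast
    then have "\<forall>\<^sub>F n in sequentially. indicator {0..real (Suc n)} t *\<^sub>R f t = g t"
      by (intro eventually_mono[OF eventually_ge_at_top[of N]]) (auto simp: g_def indicator_def)
    then show "(\<lambda>n. indicator {0..real (Suc n)} t *\<^sub>R f t) \<longlonglongrightarrow> g t" by (rule tendsto_eventually)
  qed
  obtain f1 where f1[measurable]: "f1 \<in> borel_measurable lborel" and e: "AE t in lborel. g t = f1 t"
    using completion_ex_borel_measurable_real[OF gm] by blast
  define f' where "f' t = indicator {0..} t *\<^sub>R f1 t" for t
  have f'm[measurable]: "f' \<in> borel_measurable borel" unfolding f'_def by measurable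
  have e': "AE t in lborel. 0 \<le> t \<longrightarrow> f t = f' t"
    using e by eventually_elim (auto simp: g_def f'_def)
  have "(\<integral>\<^sup>+t. ennreal \<bar>f' t\<bar> * indicator {..T} t \<partial>lborel) < \<infinity>" for T
  proof -
    obtain n :: nat where n: "T < real n" using reals_Archimedean2 by blast
    have "(\<integral>\<^sup>+t. ennreal \<bar>f' t\<bar> * indicator {..T} t \<partial>lborel) \<le> (\<integral>\<^sup>+t. ennreal (norm (indicator {0..real (Suc n)} t *\<^sub>R f t)) \<partial>lborel)"
      by (intro nn_integral_mono_AE eventually_mono[OF e']) (use n in \<open>auto simp: f'_def indicator_def\<close>)
    also have "\<dots> = (\<integral>\<^sup>+t. ennreal (norm (indicator {0..real (Suc n)} t *\<^sub>R f t)) \<partial>lebesgue)"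
      by (rule nn_integral_completion[symmetric])
    also have "\<dots> < \<infinity>" using fi[of n] unfolding integrable_iff_bounded by blast
    finally show ?thesis .
  qed
  then have "loc_int f'" unfolding loc_int_def by (auto simp: f'_def)
  then show ?thesis using e' by (rule that)
qed

lemma loc_int_L1_loc:
  assumes f': "loc_int f'" and e: "AE t in lborel. 0 \<le> t \<longrightarrow> f t = f' t"
  shows "L1_loc f"
  unfolding L1_loc_def set_integrable_def
proof (intro allI impI)
  fix T :: real assume "0 < T"
  have i: "integrable lborel (\<lambda>t. indicator {0..T} t *\<^sub>R f' t)"
    using loc_int_set_integrable[OF f', of "{0..T}" T] by (simp add: set_integrable_def)
  then have m: "(\<lambda>t. indicator {0..T} t *\<^sub>R f' t) \<in> borel_measurable lborel" by (rule borel_measurable_integrable)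
  have e': "AE t in lborel. indicator {0..T} t *\<^sub>R f' t = indicator {0..T} t *\<^sub>R f t"
    using e by eventually_elim (auto simp: indicator_def)
  have "integrable lebesgue (\<lambda>t. indicator {0..T} t *\<^sub>R f' t)" using i m by (simp only: integrable_completion)
  then show "integrable lebesgue (\<lambda>t. indicator {0..T} t *\<^sub>R f t)"
    by (rule integrable_cong_AE_imp) (use measurable_completion_AE[OF m e'] AE_completion[OF e'] in \<open>auto elim: eventually_mono\<close>)
qed

text \<open>The integral over [0, t] evaluates both functions on the half line only, where they
  agree with their representatives almost everywhere. The conclusion thus holds at every t.\<close>

lemma time_conv_eq:
  assumes f: "loc_int f'" "AE t in lborel. 0 \<le> t \<longrightarrow> f t = f' t"
    and g: "loc_int g'" "AE t in lborel. 0 \<le> t \<longrightarrow> g t = g' t"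
  shows "time_conv f g t = conv f' g' t"
proof -
  note [measurable] = loc_int_measurable[OF f(1)] loc_int_measurable[OF g(1)]
  have m: "(\<lambda>\<tau>. f' (t - \<tau>) * g' \<tau>) \<in> borel_measurable lborel" by measurable
  have e: "AE \<tau> in lborel. f' (t - \<tau>) * g' \<tau> = indicator {0..t} \<tau> *\<^sub>R (f (t - \<tau>) * g \<tau>)"
    using AE_lborel_reflect[OF f(2), of t] g(2)
  proof eventually_elim
    case (elim \<tau>)
    then show ?case
      using loc_int_neg[OF f(1), of "t - \<tau>"] loc_int_neg[OF g(1), of \<tau>] by (auto simp: indicator_def)
  qed
  have "time_conv f g t = (\<integral>\<tau>. f' (t - \<tau>) * g' \<tau> \<partial>lebesgue)"
    unfolding time_conv_def set_lebesgue_integral_def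
    by (rule integral_cong_AE[OF measurable_completion_AE[OF m e] measurable_completion[OF m]])
      (use AE_completion[OF e] in \<open>auto elim!: eventually_mono\<close>)
  then show ?thesis unfolding conv_def by (simp add: integral_completion[OF m])
qed

context sonine_kernel
begin

text \<open>The description operator needs uniqueness at every point. Two solutions agree almost
  everywhere by \<open>volterra_unique\<close>, hence their convolutions with a agree everywhere,
  and the equation at each t \<ge> 0 then forces equal values.\<close>

lemma relax_s_eq:
  assumes m: "AE t in lborel. 0 \<le> t \<longrightarrow> m_gam \<gamma> m t = a t" and \<nu>: "0 \<le> \<nu>" and t: "0 \<le> t"
  shows "relax_s \<gamma> m \<nu> t = relax \<nu> t"
proof -
  define f0 where "f0 t = relax \<nu> t * heaviside t" for t
  have f0: "loc_int f0" unfolding f0_def by (rule relax_loc_int[OF \<nu>])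
  have conv0: "conv a f0 t = (LBINT \<tau>:{0..t}. resolvent a \<nu> \<tau>)" for t
    unfolding f0_def by (rule conv_relax[OF \<nu>])
  have e0: "relax \<nu> t + \<nu> * conv a f0 t = 1" for t
    unfolding f0_def[abs_def] by (rule relax_eq[OF \<nu>])
  have "relax_s \<gamma> m \<nu> = f0"
    unfolding relax_s_def
  proof (rule the_equality)
    have "f0 t + \<nu> * time_conv (m_gam \<gamma> m) f0 t = 1" if "0 \<le> t" for t
      using that e0[of t] time_conv_eq[OF a m f0, of f0 t] by (simp add: f0_def heaviside_def)
    then show "L1_loc f0 \<and> (\<forall>t<0. f0 t = 0) \<and> (\<forall>t\<ge>0. f0 t + \<nu> * time_conv (m_gam \<gamma> m) f0 t = 1)"
      using loc_int_L1_loc[OF f0, of f0] loc_int_neg[OF f0] by auto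
  next
    fix f assume f: "L1_loc f \<and> (\<forall>t<0. f t = 0) \<and> (\<forall>t\<ge>0. f t + \<nu> * time_conv (m_gam \<gamma> m) f t = 1)"
    obtain f' where f': "loc_int f'" "AE t in lborel. 0 \<le> t \<longrightarrow> f t = f' t"
      using L1_loc_rep[of f] f by blast
    note [measurable] = loc_int_measurable[OF f'(1)] loc_int_measurable[OF f0]
    have eq: "f t + \<nu> * conv a f' t = 1" if "0 \<le> t" for t
      using f that time_conv_eq[OF a m f', of t] by auto
    have z: "AE t in lborel. (1 * f' t + (-1) * f0 t) + \<nu> * conv a (\<lambda>t. 1 * f' t + (-1) * f0 t) t = 0"
      using f'(2) conv_lin_AE[OF a f'(1) f0, of 1 "-1"]
    proof eventually_elim
      case (elim t)
      show ?case
      proof (cases "0 \<le> t")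
        case True
        have "f0 t + \<nu> * conv a f0 t = 1" using e0[of t] True by (simp add: f0_def heaviside_def)
        moreover have "f' t + \<nu> * conv a f' t = 1" using elim(1) eq[OF True] True by simp
        moreover have "\<nu> * (1 * conv a f' t + (-1) * conv a f0 t) = \<nu> * conv a f' t - \<nu> * conv a f0 t"
          by (simp add: right_diff_distrib)
        ultimately show ?thesis unfolding elim(2) by linarith
      next
        case False
        then have "f' t = 0" "f0 t = 0" "conv a f' t = 0" "conv a f0 t = 0"
          using loc_int_neg[OF f'(1)] loc_int_neg[OF f0] loc_int_neg[OF loc_int_conv[OF a f'(1)]] loc_int_neg[OF loc_int_conv[OF a f0]] by auto
        then show ?thesis using elim by simp
      qed
    qed
    have ae: "AE t in lborel. f' t = f0 t"
      using volterra_unique[OF loc_int_lin[OF f'(1) f0] z \<nu>] by (auto elim: eventually_mono)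
    have "conv a f' t = conv a f0 t" for t by (rule conv_cong_AE) (use ae in auto)
    then have "f t = f0 t" if "0 \<le> t" for t
      using eq[OF that] e0[of t] that by (simp add: f0_def heaviside_def)
    then show "f = f0" using f loc_int_neg[OF f0] by (intro ext) (metis not_le)
  qed
  then show ?thesis using t by (simp add: f0_def heaviside_def)
qed

end

context sonine_kernel_mono
begin

text \<open>As for s, except that the right side of the equation is now m_\<gamma> t itself.
  Therefore a has to equal m_\<gamma> at every t > 0 and not just almost everywhere.\<close>

lemma relax_r_eq:
  assumes m: "\<And>t. 0 < t \<Longrightarrow> m_gam \<gamma> m t = a t" and \<nu>: "0 \<le> \<nu>" and t: "0 < t"
  shows "relax_r \<gamma> m \<nu> t = res_cont \<nu> t"
proof -
  have m': "AE t in lborel. 0 \<le> t \<longrightarrow> m_gam \<gamma> m t = a t"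
    using AE_lborel_singleton[of "0::real"] by eventually_elim (use m in auto)
  note R = resolvent_loc_int[OF \<nu>]
  define f0 where "f0 t = (if 0 < t then res_cont \<nu> t else 0)" for t
  have f0R: "AE t in lborel. 0 \<le> t \<longrightarrow> f0 t = resolvent a \<nu> t"
    using resolvent_AE_res_cont[OF \<nu>] AE_lborel_singleton[of "0::real"] by eventually_elim (auto simp: f0_def)
  have "relax_r \<gamma> m \<nu> = f0"
    unfolding relax_r_def
  proof (rule the_equality)
    have L: "L1_loc f0" by (rule loc_int_L1_loc[OF R f0R])
    have "time_conv (m_gam \<gamma> m) f0 t = conv a (resolvent a \<nu>) t" for t
      by (rule time_conv_eq[OF a m' R f0R])
    then have "f0 t + \<nu> * time_conv (m_gam \<gamma> m) f0 t = m_gam \<gamma> m t" if "0 < t" for t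
      using that m by (simp add: f0_def res_cont_def)
    then show "L1_loc f0 \<and> (\<forall>t\<le>0. f0 t = 0) \<and> (\<forall>t>0. f0 t + \<nu> * time_conv (m_gam \<gamma> m) f0 t = m_gam \<gamma> m t)"
      using L by (simp add: f0_def)
  next
    fix f assume f: "L1_loc f \<and> (\<forall>t\<le>0. f t = 0) \<and> (\<forall>t>0. f t + \<nu> * time_conv (m_gam \<gamma> m) f t = m_gam \<gamma> m t)"
    obtain f' where f': "loc_int f'" "AE t in lborel. 0 \<le> t \<longrightarrow> f t = f' t"
      using L1_loc_rep[of f] f by blast
    note [measurable] = loc_int_measurable[OF f'(1)] loc_int_measurable[OF R]
    have eq: "f t + \<nu> * conv a f' t = a t" if "0 < t" for t
      using f that m time_conv_eq[OF a m' f', of t] by auto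
    have z: "AE t in lborel. (1 * f' t + (-1) * resolvent a \<nu> t) + \<nu> * conv a (\<lambda>t. 1 * f' t + (-1) * resolvent a \<nu> t) t = 0"
      using f'(2) conv_lin_AE[OF a f'(1) R, of 1 "-1"] resolvent_eq[OF \<nu>] AE_lborel_singleton[of "0::real"]
    proof eventually_elim
      case (elim t)
      show ?case
      proof (cases "0 < t")
        case True
        then have "f' t + \<nu> * conv a f' t = a t" using elim(1) eq[OF True] by simp
        moreover have "\<nu> * (1 * conv a f' t + (-1) * conv a (resolvent a \<nu>) t) = \<nu> * conv a f' t - \<nu> * conv a (resolvent a \<nu>) t"
          by (simp add: right_diff_distrib)
        ultimately show ?thesis unfolding elim(2) using elim(3) by linarith
      next
        case False
        then have "t < 0" using elim by simp
        then have "f' t = 0" "resolvent a \<nu> t = 0" "conv a f' t = 0" "conv a (resolvent a \<nu>) t = 0"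
          using loc_int_neg[OF f'(1)] loc_int_neg[OF R] loc_int_neg[OF loc_int_conv[OF a f'(1)]] loc_int_neg[OF loc_int_conv[OF a R]] by auto
        then show ?thesis using elim by simp
      qed
    qed
    have ae: "AE t in lborel. f' t = resolvent a \<nu> t"
      using volterra_unique[OF loc_int_lin[OF f'(1) R] z \<nu>] by (auto elim: eventually_mono)
    have "conv a f' t = conv a (resolvent a \<nu>) t" for t by (rule conv_cong_AE) (use ae in auto)
    then have "f t = f0 t" if "0 < t" for t
      using eq[OF that] that by (simp add: f0_def res_cont_def)
    then show "f = f0" using f by (intro ext) (auto simp: f0_def not_less)
  qed
  then show ?thesis using t by (simp add: f0_def)
qed

end

section \<open>Kernels obtained from condition (H)\<close>

lemma antimono_borel:
  fixes f :: "real \<Rightarrow> real"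
  assumes "antimono_on {0<..} f" shows "(\<lambda>t. indicator {0<..} t *\<^sub>R f t) \<in> borel_measurable borel"
proof -
  have "mono_on {0<..} (\<lambda>t. - f t)" using assms by (auto simp: monotone_on_def)
  then have "(\<lambda>t. - f t) \<in> borel_measurable (restrict_space borel {0<..})" by (rule borel_measurable_mono_on_fnc)
  then have "(\<lambda>t. indicator {0<..} t *\<^sub>R (- f t)) \<in> borel_measurable borel"
    by (subst (asm) borel_measurable_restrict_space_iff) (auto simp: mult.commute)
  then have "(\<lambda>t. - (indicator {0<..} t *\<^sub>R (- f t))) \<in> borel_measurable borel" by measurable
  then show ?thesis by simp
qed

text \<open>Positivity of the arbitrary representative a is known only up to null sets, and only
  after \<open>sonine_nonneg\<close> has been applied inside this proof. Hence the hypotheses on the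
  final representative a' are implications from it. The two uses take the positive part of a, and
  m_\<gamma> itself when m is nonincreasing.\<close>

lemma cond_H_kernel:
  assumes H: "cond_H \<gamma> m \<beta> k" and a: "loc_int a" "AE t in lborel. 0 \<le> t \<longrightarrow> m_gam \<gamma> m t = a t"
    and a_nonneg: "(AE t in lborel. 0 \<le> a t) \<Longrightarrow> \<forall>t. 0 \<le> a' t"
    and a': "loc_int a'" "(AE t in lborel. 0 \<le> a t) \<Longrightarrow> AE t in lborel. a t = a' t"
  shows "sonine_kernel a' (\<lambda>t. indicator {0<..} t *\<^sub>R k t) \<beta> \<and> (AE t in lborel. 0 \<le> t \<longrightarrow> m_gam \<gamma> m t = a' t)"
proof -
  have k: "L1_loc k" "\<And>t. 0 < t \<Longrightarrow> 0 \<le> k t" "antimono_on {0<..} k" and \<beta>: "0 \<le> \<beta>"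
    and eq: "AE t in lebesgue. 0 < t \<longrightarrow> \<beta> * m_gam \<gamma> m t + time_conv k (m_gam \<gamma> m) t = 1"
    using H by (auto simp: cond_H_def)
  \<comment> \<open>The given k, cut off at 0, keeps its sign and monotonicity at every point; the
    Borel representative k1 has them only almost everywhere and serves to show local
    integrability.\<close>
  define k' where "k' t = indicator {0<..} t *\<^sub>R k t" for t
  obtain k1 where k1: "loc_int k1" "AE t in lborel. 0 \<le> t \<longrightarrow> k t = k1 t" using L1_loc_rep[OF k(1)] .
  have ke: "AE t in lborel. 0 \<le> t \<longrightarrow> k t = k' t"
    using AE_lborel_singleton[of "0::real"] by eventually_elim (auto simp: k'_def)
  have "AE t in lborel. k1 t = k' t"
    using k1(2) ke AE_lborel_singleton[of "0::real"]
  proof eventually_elim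
    case (elim t)
    show ?case
    proof (cases "t < 0")
      case True
      then have "k' t = 0" by (simp add: k'_def)
      then show ?thesis using loc_int_neg[OF k1(1) True] by simp
    next
      case False
      then show ?thesis using elim by (metis not_le)
    qed
  qed
  then have k': "loc_int k'"
    by (rule loc_int_AE_eq[OF k1(1)]) (use antimono_borel[OF k(3)] in \<open>auto simp: k'_def[abs_def]\<close>)
  have k'0: "0 \<le> k' t" for t using k(2) by (simp add: k'_def indicator_def)
  have k'd: "k' t \<le> k' s" if "0 < s" "s \<le> t" for s t
    using monotone_onD[OF k(3), of s t] that by (simp add: k'_def)
  have eq': "AE t in lborel. 0 < t \<longrightarrow> \<beta> * a t + conv k' a t = 1"
    using eq[unfolded AE_completion_iff] a(2) by eventually_elim (auto simp: time_conv_eq[OF k' ke a])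
  have nn: "AE t in lborel. 0 \<le> a t" by (rule sonine_nonneg[OF a(1) k' k'0 k'd \<beta> eq'])
  from a_nonneg[OF nn] have a'0: "0 \<le> a' t" for t by blast
  note ae = a'(2)[OF nn]
  note [measurable] = loc_int_measurable[OF a(1)] loc_int_measurable[OF a'(1)] loc_int_measurable[OF k']
  have "conv k' a t = conv k' a' t" for t by (rule conv_cong_AE) (use ae in auto)
  then have eq'': "AE t in lborel. 0 < t \<longrightarrow> \<beta> * a' t + conv k' a' t = 1"
    using eq' ae by (auto elim: eventually_elim2)
  have "sonine_kernel a' k' \<beta>"
    by unfold_locales (use a'(1) a'0 k' k'0 k'd \<beta> eq'' in auto)
  moreover have "AE t in lborel. 0 \<le> t \<longrightarrow> m_gam \<gamma> m t = a' t"
    using a(2) ae by eventually_elim auto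
  ultimately show ?thesis unfolding k'_def by blast
qed

lemma m_gam_rep:
  assumes H: "cond_H \<gamma> m \<beta> k"
  obtains a where "loc_int a" "AE t in lborel. 0 \<le> t \<longrightarrow> m_gam \<gamma> m t = a t"
proof -
  have "L1_loc m" using H by (simp add: cond_H_def)
  then obtain m' where m': "loc_int m'" "AE t in lborel. 0 \<le> t \<longrightarrow> m t = m' t" using L1_loc_rep by blast
  show ?thesis
  proof
    show "loc_int (\<lambda>t. 1 * heaviside t + \<gamma> * m' t)" by (rule loc_int_lin[OF loc_int_heaviside m'(1)])
    show "AE t in lborel. 0 \<le> t \<longrightarrow> m_gam \<gamma> m t = 1 * heaviside t + \<gamma> * m' t"
      using m'(2) by eventually_elim (simp add: m_gam_def heaviside_def)
  qed
qed

theorem cond_H_sonine_kernel: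
  assumes H: "cond_H \<gamma> m \<beta> k"
  obtains a k' where "sonine_kernel a k' \<beta>" "AE t in lborel. 0 \<le> t \<longrightarrow> m_gam \<gamma> m t = a t"
proof -
  obtain a where a: "loc_int a" "AE t in lborel. 0 \<le> t \<longrightarrow> m_gam \<gamma> m t = a t" using m_gam_rep[OF H] .
  have i: "loc_int (\<lambda>t. max 0 (a t))"
    using a(1) unfolding loc_int_def
  proof (intro conjI allI impI; (elim conjE)?)
    fix T
    assume fin: "\<forall>T. (\<integral>\<^sup>+t. ennreal \<bar>a t\<bar> * indicator {..T} t \<partial>lborel) < \<infinity>"
    have "(\<integral>\<^sup>+t. ennreal \<bar>max 0 (a t)\<bar> * indicator {..T} t \<partial>lborel) \<le> (\<integral>\<^sup>+t. ennreal \<bar>a t\<bar> * indicator {..T} t \<partial>lborel)"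
      by (intro nn_integral_mono mult_right_mono ennreal_leI) auto
    then show "(\<integral>\<^sup>+t. ennreal \<bar>max 0 (a t)\<bar> * indicator {..T} t \<partial>lborel) < \<infinity>" using fin le_less_trans by blast
  qed auto
  have "sonine_kernel (\<lambda>t. max 0 (a t)) (\<lambda>t. indicator {0<..} t *\<^sub>R k t) \<beta> \<and> (AE t in lborel. 0 \<le> t \<longrightarrow> m_gam \<gamma> m t = max 0 (a t))"
    by (rule cond_H_kernel[OF H a _ i]) (auto elim!: eventually_mono)
  then show ?thesis using that by blast
qed

text \<open>A monotone m_\<gamma> is Borel on (0,\<infinity>), so it can be kept there unchanged, as
  \<open>relax_r_eq\<close> demands. Its sign is correct at every point because a nonincreasing
  function dominates its later values, almost all of which are nonnegative.\<close>

theorem cond_H_sonine_kernel_mono: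
  assumes H: "cond_H \<gamma> m \<beta> k" and \<gamma>: "0 < \<gamma>" and m: "antimono_on {0<..} m"
  obtains a k' where "sonine_kernel_mono a k' \<beta>" "\<And>t. 0 < t \<Longrightarrow> m_gam \<gamma> m t = a t"
proof -
  obtain a where a: "loc_int a" "AE t in lborel. 0 \<le> t \<longrightarrow> m_gam \<gamma> m t = a t" using m_gam_rep[OF H] .
  define a' where "a' t = indicator {0<..} t *\<^sub>R m_gam \<gamma> m t" for t
  have anti: "antimono_on {0<..} (m_gam \<gamma> m)"
    using m \<gamma> by (auto simp: monotone_on_def m_gam_def intro!: mult_left_mono)
  have ae: "AE t in lborel. a t = a' t"
    using a(2) AE_lborel_singleton[of "0::real"]
  proof eventually_elim
    case (elim t)
    then show ?case using loc_int_neg[OF a(1), of t] by (cases "t < 0") (auto simp: a'_def)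
  qed
  have i: "loc_int a'"
    by (rule loc_int_AE_eq[OF a(1) ae]) (use antimono_borel[OF anti] in \<open>auto simp: a'_def[abs_def]\<close>)
  have a'd: "a' t \<le> a' s" if "0 < s" "s \<le> t" for s t
    using monotone_onD[OF anti, of s t] that by (simp add: a'_def)
  have a'0: "\<forall>t. 0 \<le> a' t" if nn: "AE t in lborel. 0 \<le> a t"
  proof
    fix t
    show "0 \<le> a' t"
    proof (cases "0 < t")
      case True
      have "AE x in lborel. 0 \<le> a' x" using nn ae by eventually_elim simp
      from AE_interval_pick[OF this, of t "t + 1"] obtain x where "t \<le> x" "0 \<le> a' x" by force
      then show ?thesis using a'd[OF True] by (meson order_trans)
    qed (simp add: a'_def)
  qed
  have *: "sonine_kernel a' (\<lambda>t. indicator {0<..} t *\<^sub>R k t) \<beta>"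
    using cond_H_kernel[OF H a a'0 i ae] by blast
  then interpret sonine_kernel a' "\<lambda>t. indicator {0<..} t *\<^sub>R k t" \<beta> .
  have "sonine_kernel_mono a' (\<lambda>t. indicator {0<..} t *\<^sub>R k t) \<beta>"
    by unfold_locales (rule a'd)
  then show ?thesis by (rule that) (simp add: a'_def)
qed

section \<open>The spaces \<open>H\<^sup>s\<close>\<close>

text \<open>Applied to a transform, this turns the H^s norm into a plain L^2 norm, so that results
  on \<open>l2norm\<close> carry over.\<close>

definition hs_weight :: "real \<Rightarrow> (real^'n \<Rightarrow> complex) \<Rightarrow> real^'n \<Rightarrow> complex" where
  "hs_weight s v \<xi> = complex_of_real (sqrt ((1 + (norm \<xi>)\<^sup>2) powr s)) * v \<xi>"

lemma hs_weight_measurable [measurable]: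
  assumes [measurable]: "v \<in> borel_measurable lebesgue" shows "hs_weight s v \<in> borel_measurable lebesgue"
proof -
  have "(\<lambda>\<xi>::real^'n. complex_of_real (sqrt ((1 + (norm \<xi>)\<^sup>2) powr s))) \<in> borel_measurable borel" by measurable
  then have [measurable]: "(\<lambda>\<xi>::real^'n. complex_of_real (sqrt ((1 + (norm \<xi>)\<^sup>2) powr s))) \<in> borel_measurable lebesgue"
    by (intro measurable_completion) simp
  show ?thesis unfolding hs_weight_def[abs_def] by measurable
qed

lemma hs_weight_square: "(cmod (hs_weight s v \<xi>))\<^sup>2 = (1 + (norm \<xi>)\<^sup>2) powr s * (cmod (v \<xi>))\<^sup>2"
  by (simp add: hs_weight_def norm_mult power_mult_distrib)

lemma hs_weight_lin: "hs_weight s (\<lambda>\<xi>. c * v \<xi> + d * z \<xi>) \<xi> = c * hs_weight s v \<xi> + d * hs_weight s z \<xi>"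
  by (simp add: hs_weight_def algebra_simps)

lemma has_fourier_measurable: "has_fourier x v \<Longrightarrow> v \<in> borel_measurable lebesgue"
  by (simp add: has_fourier_def L2_def)

lemma hs_weight_fourier_AE:
  assumes "has_fourier x v" shows "AE \<xi> in lebesgue. hs_weight s (fourier x) \<xi> = hs_weight s v \<xi>"
  using has_fourier_unique[OF has_fourier_fourier[OF assms] assms]
  by eventually_elim (simp add: hs_weight_def)

text \<open>\<open>fourier x\<close> is an arbitrary choice, but two transforms of x agree almost
  everywhere, so membership and norm may be computed from any of them.\<close>

lemma Hs_iff:
  assumes h: "has_fourier x v"
  shows "x \<in> Hs s \<longleftrightarrow> sq_int lebesgue (hs_weight s v)" "Hs_norm s x = l2norm lebesgue (hs_weight s v)"
proof -
  note h' = has_fourier_fourier[OF h]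
  note m[measurable] = has_fourier_measurable[OF h] has_fourier_measurable[OF h']
  note ae = hs_weight_fourier_AE[OF h, of s]
  have ae': "AE \<xi> in lebesgue. hs_weight s v \<xi> = hs_weight s (fourier x) \<xi>" using ae by eventually_elim simp
  have "x \<in> Hs s \<longleftrightarrow> sq_int lebesgue (hs_weight s (fourier x))"
    using h' hs_weight_measurable[OF m(2), of s] by (simp add: Hs_def sq_int_def hs_weight_square)
  also have "\<dots> \<longleftrightarrow> sq_int lebesgue (hs_weight s v)"
    using sq_int_cong_AE[OF _ ae] sq_int_cong_AE[OF _ ae'] m by auto
  finally show "x \<in> Hs s \<longleftrightarrow> sq_int lebesgue (hs_weight s v)" .
  have "Hs_norm s x = l2norm lebesgue (hs_weight s (fourier x))"
    by (simp add: Hs_norm_def l2norm_def hs_weight_square)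
  also have "\<dots> = l2norm lebesgue (hs_weight s v)" by (rule l2norm_cong_AE[OF ae]) (use m in auto)
  finally show "Hs_norm s x = l2norm lebesgue (hs_weight s v)" .
qed

lemma Hs_has_fourier: "x \<in> Hs s \<Longrightarrow> has_fourier x (fourier x)"
  by (simp add: Hs_def)

lemma Hs_sq_int: "x \<in> Hs s \<Longrightarrow> sq_int lebesgue (hs_weight s (fourier x))"
  using Hs_iff(1)[OF Hs_has_fourier] by blast

lemma Hs_lin:
  assumes x: "x \<in> Hs s" and y: "y \<in> Hs s"
  shows "(\<lambda>z. c * x z + d * y z) \<in> Hs s"
    and "AE \<xi> in lebesgue. hs_weight s (fourier (\<lambda>z. c * x z + d * y z)) \<xi> = c * hs_weight s (fourier x) \<xi> + d * hs_weight s (fourier y) \<xi>"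
proof -
  note h = has_fourier_lin[OF Hs_has_fourier[OF x] Hs_has_fourier[OF y], of c d]
  show "(\<lambda>z. c * x z + d * y z) \<in> Hs s"
    unfolding Hs_iff(1)[OF h] hs_weight_lin by (intro sq_int_add sq_int_cmult Hs_sq_int x y)
  show "AE \<xi> in lebesgue. hs_weight s (fourier (\<lambda>z. c * x z + d * y z)) \<xi> = c * hs_weight s (fourier x) \<xi> + d * hs_weight s (fourier y) \<xi>"
    using hs_weight_fourier_AE[OF h, of s] by (simp only: hs_weight_lin)
qed

subsection \<open>Uniqueness of the \<open>H\<^sup>s\<close>-valued integral\<close>

text \<open>The inner product of H^s, up to order and scaling conventions; pairing with a fixed v
  reduces H^s-valued integrals to scalar ones.\<close>

definition Hs_pair :: "real \<Rightarrow> (real^'n \<Rightarrow> complex) \<Rightarrow> (real^'n \<Rightarrow> complex) \<Rightarrow> complex" where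
  "Hs_pair s v x = (\<integral>\<xi>. hs_weight s (fourier x) \<xi> * cnj (hs_weight s (fourier v) \<xi>) \<partial>lebesgue)"

lemma Hs_pair_lin:
  assumes v: "v \<in> Hs s" and x: "x \<in> Hs s" and y: "y \<in> Hs s"
  shows "Hs_pair s v (\<lambda>z. c * x z + d * y z) = c * Hs_pair s v x + d * Hs_pair s v y"
proof -
  note v' = sq_int_cnj[OF Hs_sq_int[OF v]]
  note ix = integrable_sq_int_mult[OF Hs_sq_int[OF x] v'] and iy = integrable_sq_int_mult[OF Hs_sq_int[OF y] v']
  note [measurable] = sq_int_measurable[OF v'] sq_int_measurable[OF Hs_sq_int[OF x]] sq_int_measurable[OF Hs_sq_int[OF y]]
    sq_int_measurable[OF Hs_sq_int[OF Hs_lin(1)[OF x y, of c d]]]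
  have "Hs_pair s v (\<lambda>z. c * x z + d * y z) = (\<integral>\<xi>. c * (hs_weight s (fourier x) \<xi> * cnj (hs_weight s (fourier v) \<xi>))
      + d * (hs_weight s (fourier y) \<xi> * cnj (hs_weight s (fourier v) \<xi>)) \<partial>lebesgue)"
    unfolding Hs_pair_def
  proof (rule integral_cong_AE)
    show "AE \<xi> in lebesgue. hs_weight s (fourier (\<lambda>z. c * x z + d * y z)) \<xi> * cnj (hs_weight s (fourier v) \<xi>)
      = c * (hs_weight s (fourier x) \<xi> * cnj (hs_weight s (fourier v) \<xi>)) + d * (hs_weight s (fourier y) \<xi> * cnj (hs_weight s (fourier v) \<xi>))"
      using Hs_lin(2)[OF x y, of c d] by eventually_elim (simp add: algebra_simps)
  qed measurable
  also have "\<dots> = c * Hs_pair s v x + d * Hs_pair s v y"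
    unfolding Hs_pair_def using ix iy by simp
  finally show ?thesis .
qed

lemma Hs_pair_diff:
  assumes "v \<in> Hs s" "x \<in> Hs s" "y \<in> Hs s"
  shows "Hs_pair s v (\<lambda>z. x z - y z) = Hs_pair s v x - Hs_pair s v y"
  using Hs_pair_lin[OF assms, of 1 "-1"] by simp

lemma Hs_diff: "x \<in> Hs s \<Longrightarrow> y \<in> Hs s \<Longrightarrow> (\<lambda>z. x z - y z) \<in> Hs s"
  using Hs_lin(1)[of x s y 1 "-1"] by simp

lemma Hs_pair_bound:
  assumes v: "v \<in> Hs s" and x: "x \<in> Hs s"
  shows "cmod (Hs_pair s v x) \<le> Hs_norm s x * Hs_norm s v"
proof -
  have "l2norm lebesgue (\<lambda>\<xi>. cnj (hs_weight s (fourier v) \<xi>)) = l2norm lebesgue (hs_weight s (fourier v))"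
    by (simp add: l2norm_def)
  then show ?thesis
    unfolding Hs_pair_def Hs_iff(2)[OF Hs_has_fourier[OF x]] Hs_iff(2)[OF Hs_has_fourier[OF v]]
    using cauchy_schwarz_norm[OF Hs_sq_int[OF x] sq_int_cnj[OF Hs_sq_int[OF v]]] by simp
qed

lemma Hs_pair_self:
  assumes v: "v \<in> Hs s" shows "Hs_pair s v v = complex_of_real ((Hs_norm s v)\<^sup>2)"
  unfolding Hs_pair_def Hs_iff(2)[OF Hs_has_fourier[OF v]] l2norm_square complex_norm_square[symmetric] integral_complex_of_real
  ..

lemma zero_in_Hs: "x \<in> Hs s \<Longrightarrow> (\<lambda>_::real^'n. 0) \<in> Hs s" for x :: "real^'n \<Rightarrow> complex"
  using Hs_lin(1)[of x s x 0 0] by simp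

lemma Hs_pair_zero: "v \<in> Hs s \<Longrightarrow> Hs_pair s v (\<lambda>_. 0) = 0"
  using Hs_pair_lin[of v s v v 0 0] by simp

lemma Hs_pair_sum:
  assumes v: "v \<in> Hs s" and J: "finite J" and c: "\<And>j. j \<in> J \<Longrightarrow> c j \<in> Hs s"
  shows "(\<lambda>x. \<Sum>j\<in>J. r j *\<^sub>R c j x) \<in> Hs s \<and> Hs_pair s v (\<lambda>x. \<Sum>j\<in>J. r j *\<^sub>R c j x) = (\<Sum>j\<in>J. r j *\<^sub>R Hs_pair s v (c j))"
  using J c
proof (induction J)
  case empty
  then show ?case using zero_in_Hs[OF v] Hs_pair_zero[OF v] by simp
next
  case (insert i J)
  have IH: "(\<lambda>x. \<Sum>j\<in>J. r j *\<^sub>R c j x) \<in> Hs s" "Hs_pair s v (\<lambda>x. \<Sum>j\<in>J. r j *\<^sub>R c j x) = (\<Sum>j\<in>J. r j *\<^sub>R Hs_pair s v (c j))"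
    using insert by auto
  have e: "(\<lambda>x. \<Sum>j\<in>insert i J. r j *\<^sub>R c j x) = (\<lambda>x. complex_of_real (r i) * c i x + 1 * (\<Sum>j\<in>J. r j *\<^sub>R c j x))"
    using insert by (auto simp: scaleR_conv_of_real)
  have ci: "c i \<in> Hs s" using insert by simp
  show ?case
    unfolding e using Hs_lin(1)[OF ci IH(1), of "complex_of_real (r i)" 1] Hs_pair_lin[OF v ci IH(1), of "complex_of_real (r i)" 1] IH(2) insert
    by (simp add: scaleR_conv_of_real)
qed

lemma Hs_simple_integral_pair:
  assumes g: "has_Hs_simple_integral s S g I" and v: "v \<in> Hs s"
  shows "g \<tau> \<in> Hs s" "I \<in> Hs s" "integrable lebesgue (\<lambda>\<tau>. Hs_pair s v (g \<tau>))"
    "(\<integral>\<tau>. Hs_pair s v (g \<tau>) \<partial>lebesgue) = Hs_pair s v I" "\<tau> \<notin> S \<Longrightarrow> Hs_pair s v (g \<tau>) = 0"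
proof -
  obtain J :: "nat set" and A c where J: "finite J"
    and A: "\<And>j. j \<in> J \<Longrightarrow> A j \<in> sets lebesgue \<and> A j \<subseteq> S \<and> emeasure lebesgue (A j) < \<infinity> \<and> c j \<in> Hs s"
    and g: "g = (\<lambda>\<tau> x. \<Sum>j\<in>J. indicat_real (A j) \<tau> *\<^sub>R c j x)"
    and I: "I = (\<lambda>x. \<Sum>j\<in>J. measure lebesgue (A j) *\<^sub>R c j x)"
    using g unfolding has_Hs_simple_integral_def by blast
  have c: "\<And>j. j \<in> J \<Longrightarrow> c j \<in> Hs s" using A by blast
  note P = Hs_pair_sum[OF v J c]
  show "g \<tau> \<in> Hs s" "I \<in> Hs s" using P unfolding g I by auto
  have e: "Hs_pair s v (g \<tau>) = (\<Sum>j\<in>J. indicat_real (A j) \<tau> *\<^sub>R Hs_pair s v (c j))" for \<tau>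
    using P[where r="\<lambda>j. indicat_real (A j) \<tau>"] unfolding g by auto
  have i: "integrable lebesgue (\<lambda>\<tau>. indicat_real (A j) \<tau> *\<^sub>R Hs_pair s v (c j))" if "j \<in> J" for j
    using A[OF that] by (intro integrable_scaleR_left integrable_real_indicator) auto
  show "integrable lebesgue (\<lambda>\<tau>. Hs_pair s v (g \<tau>))" unfolding e by (rule Bochner_Integration.integrable_sum[OF i])
  have "(\<integral>\<tau>. Hs_pair s v (g \<tau>) \<partial>lebesgue) = (\<Sum>j\<in>J. \<integral>\<tau>. indicat_real (A j) \<tau> *\<^sub>R Hs_pair s v (c j) \<partial>lebesgue)"
    unfolding e by (rule Bochner_Integration.integral_sum[OF i])
  also have "\<dots> = (\<Sum>j\<in>J. measure lebesgue (A j) *\<^sub>R Hs_pair s v (c j))"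
  proof (intro sum.cong refl)
    fix j assume j: "j \<in> J"
    have "integrable lebesgue (indicat_real (A j))" using A[OF j] by (intro integrable_real_indicator) auto
    then have "(\<integral>\<tau>. indicat_real (A j) \<tau> *\<^sub>R Hs_pair s v (c j) \<partial>lebesgue) = (\<integral>\<tau>. indicat_real (A j) \<tau> \<partial>lebesgue) *\<^sub>R Hs_pair s v (c j)"
      by (intro integral_scaleR_left)
    then show "(\<integral>\<tau>. indicat_real (A j) \<tau> *\<^sub>R Hs_pair s v (c j) \<partial>lebesgue) = measure lebesgue (A j) *\<^sub>R Hs_pair s v (c j)" by simp
  qed
  also have "\<dots> = Hs_pair s v I" using P[where r="\<lambda>j. measure lebesgue (A j)"] unfolding I by auto
  finally show "(\<integral>\<tau>. Hs_pair s v (g \<tau>) \<partial>lebesgue) = Hs_pair s v I" .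
  show "Hs_pair s v (g \<tau>) = 0" if "\<tau> \<notin> S"
    unfolding e by (intro sum.neutral ballI) (use A that in \<open>auto simp: indicator_def\<close>)
qed

text \<open>Pair with v = w1 - w2, so that the squared norm of v is the difference of the pairings
  of w1 and w2. Only pairings of simple functions are integrated; f enters through the norms of its
  differences from them.\<close>

lemma has_Hs_integral_unique:
  assumes h1: "has_Hs_integral s S f w1" and h2: "has_Hs_integral s S f w2"
  shows "Hs_norm s (\<lambda>x. w1 x - w2 x) = 0"
proof -
  have w: "w1 \<in> Hs s" "w2 \<in> Hs s" and f: "\<And>\<tau>. \<tau> \<in> S \<Longrightarrow> f \<tau> \<in> Hs s"
    using h1 h2 by (auto simp: has_Hs_integral_def)
  obtain g1 I1 where 1: "\<And>n::nat. has_Hs_simple_integral s S (g1 n) (I1 n)"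
    "\<And>n. set_integrable lebesgue S (\<lambda>\<tau>. Hs_norm s (\<lambda>x. f \<tau> x - g1 n \<tau> x))"
    "(\<lambda>n. LINT \<tau>:S|lebesgue. Hs_norm s (\<lambda>x. f \<tau> x - g1 n \<tau> x)) \<longlonglongrightarrow> 0"
    "(\<lambda>n. Hs_norm s (\<lambda>x. I1 n x - w1 x)) \<longlonglongrightarrow> 0"
    using h1 unfolding has_Hs_integral_def by blast
  obtain g2 I2 where 2: "\<And>n::nat. has_Hs_simple_integral s S (g2 n) (I2 n)"
    "\<And>n. set_integrable lebesgue S (\<lambda>\<tau>. Hs_norm s (\<lambda>x. f \<tau> x - g2 n \<tau> x))"
    "(\<lambda>n. LINT \<tau>:S|lebesgue. Hs_norm s (\<lambda>x. f \<tau> x - g2 n \<tau> x)) \<longlonglongrightarrow> 0"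
    "(\<lambda>n. Hs_norm s (\<lambda>x. I2 n x - w2 x)) \<longlonglongrightarrow> 0"
    using h2 unfolding has_Hs_integral_def by blast
  define v where "v = (\<lambda>x. w1 x - w2 x)"
  have v: "v \<in> Hs s" unfolding v_def by (rule Hs_diff[OF w])
  define V where "V = Hs_norm s v"
  let ?L = "Hs_pair s v"
  note p1 = Hs_simple_integral_pair[OF 1(1) v] and p2 = Hs_simple_integral_pair[OF 2(1) v]
  let ?d1 = "\<lambda>n. LINT \<tau>:S|lebesgue. Hs_norm s (\<lambda>x. f \<tau> x - g1 n \<tau> x)"
  let ?d2 = "\<lambda>n. LINT \<tau>:S|lebesgue. Hs_norm s (\<lambda>x. f \<tau> x - g2 n \<tau> x)"
  let ?e1 = "\<lambda>n. Hs_norm s (\<lambda>x. I1 n x - w1 x)" and ?e2 = "\<lambda>n. Hs_norm s (\<lambda>x. I2 n x - w2 x)"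
  have b: "V\<^sup>2 \<le> ?e1 n * V + ((?d1 n + ?d2 n) * V + ?e2 n * V)" for n
  proof -
    have i: "integrable lebesgue (\<lambda>\<tau>. (indicat_real S \<tau> *\<^sub>R Hs_norm s (\<lambda>x. f \<tau> x - g1 n \<tau> x) + indicat_real S \<tau> *\<^sub>R Hs_norm s (\<lambda>x. f \<tau> x - g2 n \<tau> x)) * V)"
      using 1(2)[of n] 2(2)[of n] unfolding set_integrable_def by (intro integrable_mult_left Bochner_Integration.integrable_add)
    have "?L (I1 n) - ?L (I2 n) = (\<integral>\<tau>. ?L (g1 n \<tau>) - ?L (g2 n \<tau>) \<partial>lebesgue)"
      using p1(3,4)[of n] p2(3,4)[of n] by simp
    also have "cmod \<dots> \<le> (\<integral>\<tau>. (indicat_real S \<tau> *\<^sub>R Hs_norm s (\<lambda>x. f \<tau> x - g1 n \<tau> x) + indicat_real S \<tau> *\<^sub>R Hs_norm s (\<lambda>x. f \<tau> x - g2 n \<tau> x)) * V \<partial>lebesgue)"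
    proof (rule Bochner_Integration.integral_norm_bound_integral[OF _ i])
      show "integrable lebesgue (\<lambda>\<tau>. ?L (g1 n \<tau>) - ?L (g2 n \<tau>))" using p1(3) p2(3) by (rule Bochner_Integration.integrable_diff)
      fix \<tau> :: real
      show "cmod (?L (g1 n \<tau>) - ?L (g2 n \<tau>)) \<le> (indicat_real S \<tau> *\<^sub>R Hs_norm s (\<lambda>x. f \<tau> x - g1 n \<tau> x) + indicat_real S \<tau> *\<^sub>R Hs_norm s (\<lambda>x. f \<tau> x - g2 n \<tau> x)) * V"
      proof (cases "\<tau> \<in> S")
        case True
        note d = Hs_diff[OF f[OF True] p1(1)[of n \<tau>]] Hs_diff[OF f[OF True] p2(1)[of n \<tau>]]
        have "?L (g1 n \<tau>) - ?L (g2 n \<tau>) = ?L (\<lambda>x. f \<tau> x - g2 n \<tau> x) - ?L (\<lambda>x. f \<tau> x - g1 n \<tau> x)"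
          using Hs_pair_diff[OF v f[OF True] p1(1)[of n \<tau>]] Hs_pair_diff[OF v f[OF True] p2(1)[of n \<tau>]] by simp
        also have "cmod \<dots> \<le> cmod (?L (\<lambda>x. f \<tau> x - g2 n \<tau> x)) + cmod (?L (\<lambda>x. f \<tau> x - g1 n \<tau> x))" by (rule norm_triangle_ineq4)
        finally show ?thesis using True Hs_pair_bound[OF v d(1)] Hs_pair_bound[OF v d(2)] by (simp add: V_def algebra_simps)
      qed (use p1(5) p2(5) in simp)
    qed
    also have "\<dots> = (?d1 n + ?d2 n) * V"
      using 1(2)[of n] 2(2)[of n] by (simp add: set_lebesgue_integral_def set_integrable_def)
    finally have q: "cmod (?L (I1 n) - ?L (I2 n)) \<le> (?d1 n + ?d2 n) * V" .
    have "complex_of_real (V\<^sup>2) = ?L w1 - ?L w2"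
      using Hs_pair_self[OF v] Hs_pair_diff[OF v w] by (simp add: V_def v_def)
    also have "\<dots> = - ?L (\<lambda>x. I1 n x - w1 x) + ((?L (I1 n) - ?L (I2 n)) + ?L (\<lambda>x. I2 n x - w2 x))"
      using Hs_pair_diff[OF v p1(2) w(1), of n] Hs_pair_diff[OF v p2(2) w(2), of n] by simp
    finally have "cmod (complex_of_real (V\<^sup>2)) \<le> cmod (?L (\<lambda>x. I1 n x - w1 x)) + (cmod (?L (I1 n) - ?L (I2 n)) + cmod (?L (\<lambda>x. I2 n x - w2 x)))"
      using norm_triangle_ineq[of "- ?L (\<lambda>x. I1 n x - w1 x)" "(?L (I1 n) - ?L (I2 n)) + ?L (\<lambda>x. I2 n x - w2 x)"]
        norm_triangle_ineq[of "?L (I1 n) - ?L (I2 n)" "?L (\<lambda>x. I2 n x - w2 x)"] by simp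
    then show ?thesis
      using q Hs_pair_bound[OF v Hs_diff[OF p1(2) w(1)], of n] Hs_pair_bound[OF v Hs_diff[OF p2(2) w(2)], of n]
      by (simp add: V_def norm_power)
  qed
  have "(\<lambda>n. ?e1 n * V + ((?d1 n + ?d2 n) * V + ?e2 n * V)) \<longlonglongrightarrow> 0 * V + ((0 + 0) * V + 0 * V)"
    by (intro tendsto_add tendsto_mult tendsto_const 1 2)
  then have "V\<^sup>2 \<le> 0 * V + ((0 + 0) * V + 0 * V)"
    by (rule LIMSEQ_le_const) (use b in auto)
  then show ?thesis by (simp add: V_def v_def)
qed

section \<open>Symbols relative to a fixed element of \<open>H\<^sup>s\<close>\<close>

locale Hs_element =
  fixes s :: real and u :: "real^'n \<Rightarrow> complex"
  assumes s: "0 \<le> s" and u: "u \<in> Hs s"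
begin

text \<open>Functions are described by the real factor between their transform and that of the fixed
  u. Composition of multipliers becomes multiplication of symbols, and all norms become integrals
  against one finite measure.\<close>

definition has_symbol :: "(real^'n \<Rightarrow> real) \<Rightarrow> (real^'n \<Rightarrow> complex) \<Rightarrow> bool" where
  "has_symbol p w \<longleftrightarrow> has_fourier w (\<lambda>\<xi>. p \<xi> *\<^sub>R fourier u \<xi>)"

definition bounded_symbol :: "(real^'n \<Rightarrow> real) \<Rightarrow> bool" where
  "bounded_symbol p \<longleftrightarrow> p \<in> borel_measurable borel \<and> (\<exists>C. \<forall>\<xi>. \<bar>p \<xi>\<bar> \<le> C)"

lemma u_fourier: "has_fourier u (fourier u)" by (rule Hs_has_fourier[OF u])

lemma u_hat_measurable [measurable]: "fourier u \<in> borel_measurable lebesgue"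
  by (rule has_fourier_measurable[OF u_fourier])

lemma symbol_measurable: "bounded_symbol p \<Longrightarrow> (\<lambda>\<xi>. p \<xi> *\<^sub>R fourier u \<xi>) \<in> borel_measurable lebesgue"
proof -
  assume "bounded_symbol p"
  then have [measurable]: "p \<in> borel_measurable lebesgue" by (intro measurable_completion) (simp add: bounded_symbol_def)
  show ?thesis by measurable
qed

lemma has_symbol_exists:
  assumes p: "bounded_symbol p" obtains w where "has_symbol p w"
proof -
  obtain C where C: "\<And>\<xi>. \<bar>p \<xi>\<bar> \<le> C" using p by (auto simp: bounded_symbol_def)
  have "sq_int lebesgue (fourier u)" using u_fourier by (simp add: has_fourier_def L2_iff)
  then have "sq_int lebesgue (\<lambda>\<xi>. p \<xi> *\<^sub>R fourier u \<xi>)"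
    by (rule sq_int_bound[where C=C, OF _ symbol_measurable[OF p]]) (use C in \<open>simp add: mult_right_mono\<close>)
  then show ?thesis using has_fourier_surj that unfolding has_symbol_def L2_iff[symmetric] by blast
qed

lemma has_symbol_cong: "has_symbol p w \<Longrightarrow> (\<And>\<xi>. p \<xi> = q \<xi>) \<Longrightarrow> has_symbol q w"
  by (simp add: has_symbol_def)

lemma has_symbol_u: "has_symbol (\<lambda>_. 1) u"
  using u_fourier by (simp add: has_symbol_def)

text \<open>Boundedness is asked of the product only: the symbol q = |\<xi>|^\<alpha> of the
  fractional Laplacian is unbounded, and the decay of s or r in \<nu> compensates for it.\<close>

lemma has_symbol_multiplier_comp:
  assumes w: "has_symbol p w" and q: "q \<in> borel_measurable borel" and qp: "bounded_symbol (\<lambda>\<xi>. q \<xi> * p \<xi>)"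
  shows "has_symbol (\<lambda>\<xi>. q \<xi> * p \<xi>) (fourier_multiplier q w)"
proof -
  have hw: "has_fourier w (\<lambda>\<xi>. p \<xi> *\<^sub>R fourier u \<xi>)" using w by (simp add: has_symbol_def)
  have fw: "has_fourier w (fourier w)" by (rule has_fourier_fourier[OF hw])
  have ae: "AE \<xi> in lebesgue. fourier w \<xi> = p \<xi> *\<^sub>R fourier u \<xi>" by (rule has_fourier_unique[OF fw hw])
  have e1: "AE \<xi> in lebesgue. q \<xi> *\<^sub>R fourier w \<xi> = (q \<xi> * p \<xi>) *\<^sub>R fourier u \<xi>"
    using ae by eventually_elim simp
  have e2: "AE \<xi> in lebesgue. (q \<xi> * p \<xi>) *\<^sub>R fourier u \<xi> = q \<xi> *\<^sub>R fourier w \<xi>"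
    using ae by eventually_elim simp
  have [measurable]: "q \<in> borel_measurable lebesgue" "fourier w \<in> borel_measurable lebesgue"
    using q has_fourier_measurable[OF fw] by (auto intro: measurable_completion)
  have iff: "is_multiplier q w z \<longleftrightarrow> has_symbol (\<lambda>\<xi>. q \<xi> * p \<xi>) z" for z
    unfolding is_multiplier_def has_symbol_def
    using fw has_fourier_cong[OF _ e1 symbol_measurable[OF qp]] has_fourier_cong[OF _ e2] by auto
  obtain z where "has_symbol (\<lambda>\<xi>. q \<xi> * p \<xi>) z" using has_symbol_exists[OF qp] .
  then have ex: "\<exists>z. is_multiplier q w z" unfolding iff by blast
  then have "is_multiplier q w (fourier_multiplier q w)"
    unfolding fourier_multiplier_def by (simp add: someI_ex[OF ex])
  then show ?thesis unfolding iff .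
qed

lemma has_symbol_multiplier:
  assumes "bounded_symbol p" shows "has_symbol p (fourier_multiplier p u)"
  using has_symbol_multiplier_comp[OF has_symbol_u, of p] assms by (simp add: bounded_symbol_def)

lemma has_symbol_lin:
  assumes "has_symbol p w" "has_symbol q z"
  shows "has_symbol (\<lambda>\<xi>. c * p \<xi> + d * q \<xi>) (\<lambda>x. c *\<^sub>R w x + d *\<^sub>R z x)"
  using has_fourier_lin[OF assms[unfolded has_symbol_def], of "complex_of_real c" "complex_of_real d"]
  by (simp add: has_symbol_def scaleR_conv_of_real algebra_simps)

lemma has_symbol_scaleR: "has_symbol p w \<Longrightarrow> has_symbol (\<lambda>\<xi>. c * p \<xi>) (\<lambda>x. c *\<^sub>R w x)"
  using has_symbol_lin[of p w p w c 0] by simp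

lemma has_symbol_diff: "has_symbol p w \<Longrightarrow> has_symbol q z \<Longrightarrow> has_symbol (\<lambda>\<xi>. p \<xi> - q \<xi>) (\<lambda>x. w x - z x)"
  using has_symbol_lin[of p w q z 1 "-1"] by simp

lemma has_symbol_zero: "has_symbol (\<lambda>_. 0) (\<lambda>_. 0)"
  using has_symbol_scaleR[OF has_symbol_u, of 0] by simp

lemma has_symbol_sum:
  assumes "finite J" "\<And>j. j \<in> J \<Longrightarrow> has_symbol (p j) (w j)"
  shows "has_symbol (\<lambda>\<xi>. \<Sum>j\<in>J. c j * p j \<xi>) (\<lambda>x. \<Sum>j\<in>J. c j *\<^sub>R w j x)"
  using assms
proof (induction J)
  case (insert i J)
  have "has_symbol (\<lambda>\<xi>. c i * p i \<xi> + 1 * (\<Sum>j\<in>J. c j * p j \<xi>)) (\<lambda>x. c i *\<^sub>R w i x + 1 *\<^sub>R (\<Sum>j\<in>J. c j *\<^sub>R w j x))"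
    using insert by (intro has_symbol_lin) auto
  then show ?case using insert by simp
qed (simp add: has_symbol_zero)

lemma energy_density:
  obtains \<rho> :: "real^'n \<Rightarrow> real" where "\<rho> \<in> borel_measurable borel" "\<And>\<xi>. 0 \<le> \<rho> \<xi>" "integrable lborel \<rho>"
    "AE \<xi> in lborel. (1 + (norm \<xi>)\<^sup>2) powr s * (cmod (fourier u \<xi>))\<^sup>2 = \<rho> \<xi>"
proof -
  let ?r = "\<lambda>\<xi>. (1 + (norm \<xi>)\<^sup>2) powr s * (cmod (fourier u \<xi>))\<^sup>2"
  have i: "integrable lebesgue ?r" using u by (simp add: Hs_def)
  then have "?r \<in> borel_measurable lebesgue" by blast
  then obtain r where r: "r \<in> borel_measurable lborel" "AE \<xi> in lborel. ?r \<xi> = r \<xi>"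
    using completion_ex_borel_measurable_real by blast
  have ae: "AE \<xi> in lborel. ?r \<xi> = max 0 (r \<xi>)"
    using r(2)
  proof eventually_elim
    case (elim \<xi>)
    have "0 \<le> r \<xi>" unfolding elim[symmetric] by simp
    then show ?case using elim by simp
  qed
  have m: "(\<lambda>\<xi>. max 0 (r \<xi>)) \<in> borel_measurable lborel" using r(1) by measurable
  have "integrable lebesgue (\<lambda>\<xi>. max 0 (r \<xi>))"
    by (rule integrable_cong_AE_imp[OF i measurable_completion[OF m] AE_completion[OF ae]])
  then have "integrable lborel (\<lambda>\<xi>. max 0 (r \<xi>))" using m by (simp add: integrable_completion)
  then show ?thesis using that[of "\<lambda>\<xi>. max 0 (r \<xi>)"] m ae by simp
qed

text \<open>A Borel version, nonnegative everywhere, of the density defining the H^s norm of u. With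
  it norms are integrals over \<open>lborel\<close>, whose joint measurability in additional
  parameters such as time is accessible.\<close>

definition \<rho> :: "real^'n \<Rightarrow> real" where
  "\<rho> = (SOME \<rho>. \<rho> \<in> borel_measurable borel \<and> (\<forall>\<xi>. 0 \<le> \<rho> \<xi>) \<and> integrable lborel \<rho> \<and>
    (AE \<xi> in lborel. (1 + (norm \<xi>)\<^sup>2) powr s * (cmod (fourier u \<xi>))\<^sup>2 = \<rho> \<xi>))"

lemma \<rho>: "\<rho> \<in> borel_measurable borel" "0 \<le> \<rho> \<xi>" "integrable lborel \<rho>"
    "AE \<xi> in lborel. (1 + (norm \<xi>)\<^sup>2) powr s * (cmod (fourier u \<xi>))\<^sup>2 = \<rho> \<xi>"
proof -
  have "\<exists>\<rho>. \<rho> \<in> borel_measurable borel \<and> (\<forall>\<xi>. 0 \<le> \<rho> \<xi>) \<and> integrable lborel \<rho> \<and>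
    (AE \<xi> in lborel. (1 + (norm \<xi>)\<^sup>2) powr s * (cmod (fourier u \<xi>))\<^sup>2 = \<rho> \<xi>)"
    by (rule energy_density) blast
  from someI_ex[OF this, folded \<rho>_def]
  show "\<rho> \<in> borel_measurable borel" "0 \<le> \<rho> \<xi>" "integrable lborel \<rho>"
    "AE \<xi> in lborel. (1 + (norm \<xi>)\<^sup>2) powr s * (cmod (fourier u \<xi>))\<^sup>2 = \<rho> \<xi>" by auto
qed

lemmas \<rho>_measurable [measurable] = \<rho>(1)

definition snorm :: "(real^'n \<Rightarrow> real) \<Rightarrow> real" where
  "snorm p = sqrt (\<integral>\<xi>. (p \<xi>)\<^sup>2 * \<rho> \<xi> \<partial>lborel)"

lemma symbol_integrable:
  assumes "bounded_symbol p" shows "integrable lborel (\<lambda>\<xi>. (p \<xi>)\<^sup>2 * \<rho> \<xi>)"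
proof -
  obtain C where C: "\<And>\<xi>. \<bar>p \<xi>\<bar> \<le> C" and [measurable]: "p \<in> borel_measurable borel" using assms by (auto simp: bounded_symbol_def)
  have C2: "(p \<xi>)\<^sup>2 \<le> C\<^sup>2" for \<xi> using power_mono[OF C, of \<xi> 2] by simp
  show ?thesis
    by (rule Bochner_Integration.integrable_bound[OF integrable_mult_right[OF \<rho>(3), of "C\<^sup>2"]], measurable, rule AE_I2)
      (use C2 \<rho>(2) in \<open>simp add: mult_right_mono\<close>)
qed

lemma has_symbol_Hs:
  assumes w: "has_symbol p w" and p: "bounded_symbol p"
  shows "w \<in> Hs s" "Hs_norm s w = snorm p"
proof -
  have hw: "has_fourier w (\<lambda>\<xi>. p \<xi> *\<^sub>R fourier u \<xi>)" using w by (simp add: has_symbol_def)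
  let ?v = "hs_weight s (\<lambda>\<xi>. p \<xi> *\<^sub>R fourier u \<xi>)"
  have [measurable]: "p \<in> borel_measurable borel" using p by (simp add: bounded_symbol_def)
  have vm[measurable]: "?v \<in> borel_measurable lebesgue" by (rule hs_weight_measurable[OF symbol_measurable[OF p]])
  have pm: "(\<lambda>\<xi>. (p \<xi>)\<^sup>2 * \<rho> \<xi>) \<in> borel_measurable lborel" by measurable
  have ae: "AE \<xi> in lebesgue. (p \<xi>)\<^sup>2 * \<rho> \<xi> = (cmod (?v \<xi>))\<^sup>2"
    using AE_completion[OF \<rho>(4)]
    by eventually_elim (simp add: hs_weight_square power_mult_distrib mult_ac)
  have "integrable lebesgue (\<lambda>\<xi>. (p \<xi>)\<^sup>2 * \<rho> \<xi>)" using symbol_integrable[OF p] pm by (simp add: integrable_completion)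
  then have "integrable lebesgue (\<lambda>\<xi>. (cmod (?v \<xi>))\<^sup>2)"
    by (rule integrable_cong_AE_imp) (use ae in \<open>auto elim: eventually_mono\<close>)
  then show "w \<in> Hs s" unfolding Hs_iff(1)[OF hw] by (simp add: sq_int_def)
  have "(\<integral>\<xi>. (cmod (?v \<xi>))\<^sup>2 \<partial>lebesgue) = (\<integral>\<xi>. (p \<xi>)\<^sup>2 * \<rho> \<xi> \<partial>lebesgue)"
    by (rule integral_cong_AE) (use ae measurable_completion[OF pm] in \<open>auto elim: eventually_mono\<close>)
  also have "\<dots> = (\<integral>\<xi>. (p \<xi>)\<^sup>2 * \<rho> \<xi> \<partial>lborel)" by (rule integral_completion[OF pm])
  finally show "Hs_norm s w = snorm p" unfolding Hs_iff(2)[OF hw] by (simp add: l2norm_def snorm_def)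
qed

lemma snorm_le:
  assumes p: "bounded_symbol p" and C: "\<And>\<xi>. \<bar>p \<xi>\<bar> \<le> C"
  shows "snorm p \<le> C * sqrt (\<integral>\<xi>. \<rho> \<xi> \<partial>lborel)"
proof -
  have C0: "0 \<le> C" using C[of 0] by linarith
  have C2: "(p \<xi>)\<^sup>2 \<le> C\<^sup>2" for \<xi> using power_mono[OF C, of \<xi> 2] by simp
  have "(\<integral>\<xi>. (p \<xi>)\<^sup>2 * \<rho> \<xi> \<partial>lborel) \<le> (\<integral>\<xi>. C\<^sup>2 * \<rho> \<xi> \<partial>lborel)"
    by (intro integral_mono symbol_integrable p integrable_mult_right \<rho> mult_right_mono C2)
  then have "snorm p \<le> sqrt (C\<^sup>2 * (\<integral>\<xi>. \<rho> \<xi> \<partial>lborel))" unfolding snorm_def by simp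
  then show ?thesis using C0 by (simp add: real_sqrt_mult)
qed

lemma snorm_tendsto_0:
  assumes p: "\<And>n. p n \<in> borel_measurable borel" and C: "\<And>n \<xi>. \<bar>p n \<xi>\<bar> \<le> C" and lim: "\<And>\<xi>. (\<lambda>n. p n \<xi>) \<longlonglongrightarrow> 0"
  shows "(\<lambda>n. snorm (p n)) \<longlonglongrightarrow> 0"
proof -
  note [measurable] = p
  have C2: "(p n \<xi>)\<^sup>2 \<le> C\<^sup>2" for n \<xi> using power_mono[OF C, of n \<xi> 2] by simp
  have "(\<lambda>n. \<integral>\<xi>. (p n \<xi>)\<^sup>2 * \<rho> \<xi> \<partial>lborel) \<longlonglongrightarrow> (\<integral>\<xi>. 0 \<partial>(lborel :: (real^'n) measure))"
  proof (rule integral_dominated_convergence[OF _ _ integrable_mult_right[OF \<rho>(3), of "C\<^sup>2"]])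
    show "AE \<xi> in lborel. (\<lambda>n. (p n \<xi>)\<^sup>2 * \<rho> \<xi>) \<longlonglongrightarrow> 0"
    proof (rule AE_I2)
      fix \<xi>
      have "(\<lambda>n. (p n \<xi>)\<^sup>2 * \<rho> \<xi>) \<longlonglongrightarrow> 0\<^sup>2 * \<rho> \<xi>" by (intro tendsto_intros lim)
      then show "(\<lambda>n. (p n \<xi>)\<^sup>2 * \<rho> \<xi>) \<longlonglongrightarrow> 0" by simp
    qed
    show "AE \<xi> in lborel. norm ((p n \<xi>)\<^sup>2 * \<rho> \<xi>) \<le> C\<^sup>2 * \<rho> \<xi>" for n
      using C2 \<rho>(2) by (intro AE_I2) (simp add: mult_right_mono)
  qed measurable
  then have "(\<lambda>n. sqrt (\<integral>\<xi>. (p n \<xi>)\<^sup>2 * \<rho> \<xi> \<partial>lborel)) \<longlonglongrightarrow> sqrt 0" by (intro tendsto_real_sqrt) simp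
  then show ?thesis by (simp add: snorm_def)
qed

text \<open>The symbol of a difference quotient is the difference quotient of the symbols. It
  converges at each \<xi> and is bounded uniformly in \<xi> and h, so dominated convergence in the
  measure with density \<rho> gives convergence in H^s.\<close>

theorem has_symbol_derivative:
  assumes d: "0 < d" and F: "\<And>\<tau>. \<bar>\<tau> - t\<bar> < d \<Longrightarrow> has_symbol (p \<tau>) (F \<tau>) \<and> bounded_symbol (p \<tau>)"
    and D: "has_symbol q D" "bounded_symbol q"
    and deriv: "\<And>\<xi>. ((\<lambda>\<tau>. p \<tau> \<xi>) has_real_derivative q \<xi>) (at t)"
    and C: "\<And>\<xi> h. h \<noteq> 0 \<Longrightarrow> \<bar>h\<bar> < d \<Longrightarrow> \<bar>(p (t + h) \<xi> - p t \<xi>) / h\<bar> \<le> C"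
  shows "has_Hs_derivative s F D t"
  unfolding has_Hs_derivative_def
proof (intro conjI)
  have "\<forall>\<^sub>F \<tau> in nhds t. \<tau> \<in> ball t d" using d by (intro eventually_nhds_in_open) auto
  then show "\<forall>\<^sub>F \<tau> in nhds t. F \<tau> \<in> Hs s"
    by eventually_elim (use F has_symbol_Hs(1) in \<open>auto simp: dist_real_def abs_minus_commute\<close>)
  show "D \<in> Hs s" by (rule has_symbol_Hs[OF D])
  define r where "r h \<xi> = (p (t + h) \<xi> - p t \<xi>) / h - q \<xi>" for h \<xi>
  obtain B where B: "\<And>\<xi>. \<bar>q \<xi>\<bar> \<le> B" using D(2) by (auto simp: bounded_symbol_def)
  have rb: "\<bar>r h \<xi>\<bar> \<le> C + B" if "h \<noteq> 0" "\<bar>h\<bar> < d" for h \<xi>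
    using C[OF that, of \<xi>] B[of \<xi>] unfolding r_def by linarith
  have rm: "r h \<in> borel_measurable borel" if "\<bar>h\<bar> < d" for h
  proof -
    have [measurable]: "p (t + h) \<in> borel_measurable borel" "p t \<in> borel_measurable borel" "q \<in> borel_measurable borel"
      using F[of "t + h"] F[of t] D(2) that d by (auto simp: bounded_symbol_def)
    show ?thesis unfolding r_def by measurable
  qed
  have nrm: "Hs_norm s (\<lambda>x. (F (t + h) x - F t x) /\<^sub>R h - D x) = snorm (r h)" if h: "h \<noteq> 0" "\<bar>h\<bar> < d" for h
  proof (rule has_symbol_Hs(2))
    have "has_symbol (\<lambda>\<xi>. inverse h * (p (t + h) \<xi> - p t \<xi>) - q \<xi>) (\<lambda>x. (F (t + h) x - F t x) /\<^sub>R h - D x)"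
      using F[of "t + h"] F[of t] D h d by (intro has_symbol_diff has_symbol_scaleR) auto
    then show "has_symbol (r h) (\<lambda>x. (F (t + h) x - F t x) /\<^sub>R h - D x)"
      by (rule has_symbol_cong) (simp add: r_def divide_inverse mult.commute)
    show "bounded_symbol (r h)" unfolding bounded_symbol_def using rm[OF h(2)] rb[OF h] by blast
  qed
  have rlim: "((\<lambda>h. r h \<xi>) \<longlongrightarrow> 0) (at 0)" for \<xi>
    using LIM_zero[OF deriv[of \<xi>, unfolded DERIV_def]] unfolding r_def .
  \<comment> \<open>Measurability and the bound hold for |h| < d only. Restricting to the ball makes
    them available along every admissible sequence and does not change the filter at 0.\<close>
  have "((\<lambda>h. snorm (r h)) \<longlongrightarrow> 0) (at 0 within ball 0 d)"
    unfolding tendsto_at_iff_sequentially comp_def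
  proof (intro allI impI)
    fix X :: "nat \<Rightarrow> real" assume X: "\<forall>i. X i \<in> ball 0 d - {0}" "X \<longlonglongrightarrow> 0"
    then have X': "X i \<noteq> 0" "\<bar>X i\<bar> < d" for i by (auto simp: dist_real_def)
    show "(\<lambda>i. snorm (r (X i))) \<longlonglongrightarrow> 0"
    proof (rule snorm_tendsto_0[OF rm[OF X'(2)] rb[OF X']])
      fix \<xi>
      show "(\<lambda>n. r (X n) \<xi>) \<longlonglongrightarrow> 0"
        using rlim[of \<xi>] X(2) X'(1) unfolding tendsto_at_iff_sequentially comp_def by blast
    qed
  qed
  moreover have "at (0::real) within ball 0 d = at 0" using d by (intro at_within_open) auto
  ultimately have "((\<lambda>h. snorm (r h)) \<longlongrightarrow> 0) (at 0)" by (simp only:)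
  then show "((\<lambda>h. Hs_norm s (\<lambda>x. (F (t + h) x - F t x) /\<^sub>R h - D x)) \<longlongrightarrow> 0) (at 0)"
  proof (rule Lim_transform_eventually)
    show "\<forall>\<^sub>F h in at 0. snorm (r h) = Hs_norm s (\<lambda>x. (F (t + h) x - F t x) /\<^sub>R h - D x)"
      unfolding eventually_at using d nrm by (auto intro!: exI[of _ d] simp: dist_real_def)
  qed
qed

end

section \<open>Integration of symbols in time\<close>

context Hs_element
begin

text \<open>The approximating simple functions take the value of the integrand with \<open>b \<tau>\<close> and \<open>\<tau>\<close> rounded down to
  multiples of \<open>1 / n\<close>.\<close>

theorem has_symbol_integral:
  fixes b :: "real \<Rightarrow> real" and \<sigma> :: "real \<Rightarrow> real^'n \<Rightarrow> real"
  assumes t: "0 < t" and S: "S = {0<..<t}"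
    and b[measurable]: "b \<in> borel_measurable borel" and b0: "\<And>\<tau>. 0 \<le> b \<tau>" and bi: "set_integrable lborel S b"
    and \<sigma>[measurable]: "(\<lambda>p. \<sigma> (fst p) (snd p)) \<in> borel_measurable (borel \<Otimes>\<^sub>M borel)"
    and \<sigma>01: "\<And>\<tau> \<xi>. 0 \<le> \<sigma> \<tau> \<xi>" "\<And>\<tau> \<xi>. \<sigma> \<tau> \<xi> \<le> 1"
    and \<sigma>c: "\<And>\<xi>. continuous_on {0..t} (\<lambda>\<tau>. \<sigma> \<tau> \<xi>)"
    and F: "\<And>\<tau>. 0 \<le> \<tau> \<Longrightarrow> has_symbol (\<sigma> \<tau>) (F \<tau>)"
    and f: "\<And>\<tau>. \<tau> \<in> S \<Longrightarrow> f \<tau> = (\<lambda>x. b \<tau> *\<^sub>R F \<tau> x)"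
    and w: "has_symbol (\<lambda>\<xi>. LBINT \<tau>:S. b \<tau> * \<sigma> \<tau> \<xi>) w"
  shows "has_Hs_integral s S f w"
proof -
  have Sm[measurable]: "S \<in> sets borel" by (simp add: S)
  have \<sigma>2[measurable (raw)]: "(\<lambda>x. \<sigma> (g x) (h x)) \<in> borel_measurable M"
    if "g \<in> borel_measurable M" "h \<in> borel_measurable M" for g h and M :: "'c measure"
  proof -
    have "(\<lambda>x. (g x, h x)) \<in> M \<rightarrow>\<^sub>M borel \<Otimes>\<^sub>M borel" using that by measurable
    from measurable_compose[OF this \<sigma>] show ?thesis by simp
  qed
  have \<sigma>m[measurable]: "\<sigma> \<tau> \<in> borel_measurable borel" for \<tau> by measurable
  have \<sigma>b: "bounded_symbol (\<lambda>\<xi>. c * \<sigma> \<tau> \<xi>)" for c \<tau>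
  proof -
    have "\<bar>c * \<sigma> \<tau> \<xi>\<bar> \<le> \<bar>c\<bar> * 1" for \<xi> using \<sigma>01[of \<tau> \<xi>] unfolding abs_mult by (intro mult_left_mono) auto
    then show ?thesis unfolding bounded_symbol_def by (intro conjI exI[of _ "\<bar>c\<bar> * 1"]) auto
  qed
  define P where "P n \<tau> = (nat \<lfloor>real (Suc n) * b \<tau>\<rfloor>, nat \<lfloor>real (Suc n) * \<tau>\<rfloor>)" for n :: nat and \<tau>
  \<comment> \<open>A simple function may take finitely many values, but b may be unbounded: only
    indices with b \<tau> up to about n + 1 are kept, and \<open>bn\<close> is 0 elsewhere. The
    second range covers all times up to the ceiling of t.\<close>
  define I where "I n = {..Suc n * Suc n} \<times> {..Suc n * nat \<lceil>t\<rceil>}" for n :: nat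
  define val where "val n p = real (fst p) / real (Suc n)" for n and p :: "nat \<times> nat"
  define tim where "tim n p = real (snd p) / real (Suc n)" for n and p :: "nat \<times> nat"
  define A where "A n p = {\<tau> \<in> S. P n \<tau> = p}" for n p
  define c where "c n p = (\<lambda>x. val n p *\<^sub>R F (tim n p) x)" for n p
  define bn where "bn n \<tau> = (if P n \<tau> \<in> I n then val n (P n \<tau>) else 0)" for n \<tau>
  define \<tau>n where "\<tau>n n \<tau> = tim n (P n \<tau>)" for n \<tau>
  define q where "q n \<tau> \<xi> = b \<tau> * \<sigma> \<tau> \<xi> - bn n \<tau> * \<sigma> (\<tau>n n \<tau>) \<xi>" for n \<tau> \<xi>
  have Pm[measurable]: "P n \<in> borel \<rightarrow>\<^sub>M count_space UNIV" for n
    unfolding P_def by measurable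
  have Am[measurable]: "A n p \<in> sets borel" for n p unfolding A_def by measurable
  have bnm[measurable]: "bn n \<in> borel_measurable borel" for n unfolding bn_def by measurable
  have \<tau>nm[measurable]: "\<tau>n n \<in> borel_measurable borel" for n unfolding \<tau>n_def by measurable
  have qm[measurable]: "(\<lambda>p. q n (fst p) (snd p)) \<in> borel_measurable (borel \<Otimes>\<^sub>M borel)" for n
    unfolding q_def by measurable
  have qm1[measurable]: "q n \<tau> \<in> borel_measurable borel" for n \<tau> unfolding q_def by measurable
  have qm2[measurable]: "(\<lambda>\<tau>. q n \<tau> \<xi>) \<in> borel_measurable borel" for n \<xi> unfolding q_def by measurable
  have S_ivl: "emeasure lborel S < \<infinity>" by (simp add: S emeasure_bounded_finite[unfolded infinity_ennreal_def])
  have val: "0 \<le> val n (P n \<tau>)" "val n (P n \<tau>) \<le> b \<tau>" "b \<tau> - 1 / real (Suc n) \<le> val n (P n \<tau>)" for n \<tau>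
  proof -
    have "0 \<le> real (Suc n) * b \<tau>" using b0 by simp
    then have 1: "real (nat \<lfloor>real (Suc n) * b \<tau>\<rfloor>) \<le> real (Suc n) * b \<tau>" "real (Suc n) * b \<tau> - 1 \<le> real (nat \<lfloor>real (Suc n) * b \<tau>\<rfloor>)"
      by linarith+
    show "0 \<le> val n (P n \<tau>)" by (simp add: val_def)
    show "val n (P n \<tau>) \<le> b \<tau>" using 1(1) by (simp add: val_def P_def divide_le_eq mult.commute del: of_nat_Suc)
    have "b \<tau> - 1 / real (Suc n) = (real (Suc n) * b \<tau> - 1) / real (Suc n)" by (simp add: field_simps)
    also have "\<dots> \<le> val n (P n \<tau>)" using 1(2) unfolding val_def P_def fst_conv by (intro divide_right_mono) auto
    finally show "b \<tau> - 1 / real (Suc n) \<le> val n (P n \<tau>)" .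
  qed
  have \<tau>n: "0 \<le> \<tau>n n \<tau>" "\<tau>n n \<tau> \<le> \<tau>" "\<tau> - 1 / real (Suc n) \<le> \<tau>n n \<tau>" if "0 \<le> \<tau>" for n \<tau>
  proof -
    have "0 \<le> real (Suc n) * \<tau>" using that by simp
    then have 1: "real (nat \<lfloor>real (Suc n) * \<tau>\<rfloor>) \<le> real (Suc n) * \<tau>" "real (Suc n) * \<tau> - 1 \<le> real (nat \<lfloor>real (Suc n) * \<tau>\<rfloor>)"
      by linarith+
    show "0 \<le> \<tau>n n \<tau>" by (simp add: tim_def \<tau>n_def)
    show "\<tau>n n \<tau> \<le> \<tau>" using 1(1) by (simp add: \<tau>n_def tim_def P_def divide_le_eq mult.commute del: of_nat_Suc)
    have "\<tau> - 1 / real (Suc n) = (real (Suc n) * \<tau> - 1) / real (Suc n)" by (simp add: field_simps)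
    also have "\<dots> \<le> \<tau>n n \<tau>" using 1(2) unfolding \<tau>n_def tim_def P_def snd_conv by (intro divide_right_mono) auto
    finally show "\<tau> - 1 / real (Suc n) \<le> \<tau>n n \<tau>" .
  qed
  have bn: "0 \<le> bn n \<tau>" "bn n \<tau> \<le> b \<tau>" for n \<tau> using val b0 by (auto simp: bn_def)
  have inv0: "(\<lambda>n. 1 / real (Suc n)) \<longlonglongrightarrow> 0"
    using LIMSEQ_inverse_real_of_nat by (simp add: inverse_eq_divide)
  have \<tau>n_lim: "(\<lambda>n. \<tau>n n \<tau>) \<longlonglongrightarrow> \<tau>" if "0 \<le> \<tau>" for \<tau>
  proof (rule tendsto_sandwich[of "\<lambda>n. \<tau> - 1 / real (Suc n)" _ _ "\<lambda>_. \<tau>"])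
    show "(\<lambda>n. \<tau> - 1 / real (Suc n)) \<longlonglongrightarrow> \<tau>" using tendsto_diff[OF tendsto_const inv0] by simp
  qed (use \<tau>n[OF that] in auto)
  have PI: "P n \<tau> \<in> I n" if "\<tau> \<in> S" "b \<tau> \<le> real (Suc n)" for n \<tau>
  proof -
    have "real (Suc n) * b \<tau> \<le> real (Suc n * Suc n)"
      unfolding of_nat_mult by (rule mult_left_mono[OF that(2)]) simp
    then have 1: "nat \<lfloor>real (Suc n) * b \<tau>\<rfloor> \<le> Suc n * Suc n" by linarith
    have "\<tau> \<le> real (nat \<lceil>t\<rceil>)" using that by (simp add: S) linarith
    then have "real (Suc n) * \<tau> \<le> real (Suc n * nat \<lceil>t\<rceil>)"
      unfolding of_nat_mult by (rule mult_left_mono) simp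
    then have "nat \<lfloor>real (Suc n) * \<tau>\<rfloor> \<le> Suc n * nat \<lceil>t\<rceil>" by linarith
    with 1 show ?thesis by (simp add: P_def I_def)
  qed
  have bn_lim: "(\<lambda>n. bn n \<tau>) \<longlonglongrightarrow> b \<tau>" if "\<tau> \<in> S" for \<tau>
  proof (rule tendsto_sandwich[of "\<lambda>n. b \<tau> - 1 / real (Suc n)" _ _ "\<lambda>_. b \<tau>"])
    show "(\<lambda>n. b \<tau> - 1 / real (Suc n)) \<longlonglongrightarrow> b \<tau>" using tendsto_diff[OF tendsto_const inv0] by simp
    obtain N :: nat where N: "b \<tau> < real N" using reals_Archimedean2 by blast
    show "\<forall>\<^sub>F n in sequentially. b \<tau> - 1 / real (Suc n) \<le> bn n \<tau>"
      using eventually_ge_at_top[of N]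
    proof eventually_elim
      case (elim n)
      then have "P n \<tau> \<in> I n" using N that by (intro PI) auto
      then show ?case using val(3) by (simp add: bn_def)
    qed
  qed (use bn in auto)
  have q_bound: "\<bar>q n \<tau> \<xi>\<bar> \<le> b \<tau>" for n \<tau> \<xi>
  proof -
    have "b \<tau> * \<sigma> \<tau> \<xi> \<le> b \<tau> * 1" "bn n \<tau> * \<sigma> (\<tau>n n \<tau>) \<xi> \<le> b \<tau> * 1"
      using \<sigma>01 b0 bn[of n \<tau>] by (auto intro!: mult_mono simp del: mult_1_right)
    moreover have "0 \<le> b \<tau> * \<sigma> \<tau> \<xi>" "0 \<le> bn n \<tau> * \<sigma> (\<tau>n n \<tau>) \<xi>" using \<sigma>01 b0 bn by auto
    ultimately show ?thesis unfolding q_def by linarith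
  qed
  have q_lim: "(\<lambda>n. q n \<tau> \<xi>) \<longlonglongrightarrow> 0" if \<tau>: "\<tau> \<in> S" for \<tau> \<xi>
  proof -
    have \<tau>t: "0 \<le> \<tau>" "\<tau> \<in> {0..t}" using \<tau> by (auto simp: S)
    have "\<tau>n n \<tau> \<in> {0..t}" for n using \<tau>n[OF \<tau>t(1), of n] \<tau>t by auto
    then have "(\<lambda>n. \<sigma> (\<tau>n n \<tau>) \<xi>) \<longlonglongrightarrow> \<sigma> \<tau> \<xi>"
      by (intro continuous_on_tendsto_compose[OF \<sigma>c \<tau>n_lim[OF \<tau>t(1)] \<tau>t(2)]) auto
    then have "(\<lambda>n. b \<tau> * \<sigma> \<tau> \<xi> - bn n \<tau> * \<sigma> (\<tau>n n \<tau>) \<xi>) \<longlonglongrightarrow> b \<tau> * \<sigma> \<tau> \<xi> - b \<tau> * \<sigma> \<tau> \<xi>"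
      by (intro tendsto_intros bn_lim \<tau>)
    then show ?thesis by (simp add: q_def)
  qed
  have q_symbol: "bounded_symbol (q n \<tau>)" for n \<tau>
    unfolding bounded_symbol_def using q_bound qm1 by blast
  \<comment> \<open>Simple functions are indexed by natural numbers in
    \<open>has_Hs_simple_integral\<close>, hence the encoding of index pairs.\<close>
  define g where "g n = (\<lambda>\<tau> x. \<Sum>j\<in>prod_encode ` I n. indicat_real (A n (prod_decode j)) \<tau> *\<^sub>R c n (prod_decode j) x)" for n
  define G where "G n = (\<lambda>x. \<Sum>j\<in>prod_encode ` I n. measure lebesgue (A n (prod_decode j)) *\<^sub>R c n (prod_decode j) x)" for n
  have finI: "finite (I n)" for n by (simp add: I_def)
  have reindex: "(\<Sum>j\<in>prod_encode ` I n. h (prod_decode j)) = (\<Sum>p\<in>I n. h p)" for n and h :: "nat \<times> nat \<Rightarrow> 'd::comm_monoid_add"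
    by (subst sum.reindex) (auto simp: inj_prod_encode)
  have tim0: "0 \<le> tim n p" for n p by (simp add: tim_def)
  have c_symbol: "has_symbol (\<lambda>\<xi>. val n p * \<sigma> (tim n p) \<xi>) (c n p)" for n p
    unfolding c_def by (intro has_symbol_scaleR F tim0)
  have Afin: "emeasure lborel (A n p) < \<infinity>" for n p
    by (rule le_less_trans[OF emeasure_mono[of _ S] S_ivl]) (auto simp: A_def)
  have simple: "has_Hs_simple_integral s S (g n) (G n)" for n
    unfolding has_Hs_simple_integral_def
  proof (intro exI conjI ballI)
    show "finite (prod_encode ` I n)" using finI by simp
    fix j
    show "A n (prod_decode j) \<in> sets lebesgue" by (rule sets_completionI_sets) simp
    show "A n (prod_decode j) \<subseteq> S" by (auto simp: A_def)
    show "emeasure lebesgue (A n (prod_decode j)) < \<infinity>" using Afin by simp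
    show "c n (prod_decode j) \<in> Hs s" by (rule has_symbol_Hs(1)[OF c_symbol \<sigma>b])
  qed (simp_all add: g_def G_def)
  have g_eq: "g n \<tau> = (\<lambda>x. bn n \<tau> *\<^sub>R F (\<tau>n n \<tau>) x)" if "\<tau> \<in> S" for n \<tau>
  proof
    fix x
    have "g n \<tau> x = (\<Sum>p\<in>I n. indicat_real (A n p) \<tau> *\<^sub>R c n p x)" unfolding g_def by (rule reindex)
    also have "\<dots> = (\<Sum>p\<in>I n. if P n \<tau> = p then c n p x else 0)"
      using that by (intro sum.cong refl) (auto simp: A_def)
    also have "\<dots> = bn n \<tau> *\<^sub>R F (\<tau>n n \<tau>) x"
      using finI[of n] by (simp add: bn_def c_def \<tau>n_def)
    finally show "g n \<tau> x = bn n \<tau> *\<^sub>R F (\<tau>n n \<tau>) x" .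
  qed
  have diff_norm: "Hs_norm s (\<lambda>x. f \<tau> x - g n \<tau> x) = snorm (q n \<tau>)" if \<tau>: "\<tau> \<in> S" for n \<tau>
  proof (rule has_symbol_Hs(2)[OF _ q_symbol])
    have "0 \<le> \<tau>" using \<tau> by (simp add: S)
    then show "has_symbol (q n \<tau>) (\<lambda>x. f \<tau> x - g n \<tau> x)"
      unfolding f[OF \<tau>] g_eq[OF \<tau>] q_def using \<tau>n(1) by (intro has_symbol_diff has_symbol_scaleR F) auto
  qed
  have b_int: "integrable lborel (\<lambda>\<tau>. indicator S \<tau> * b \<tau>)" using bi by (simp add: set_integrable_def)
  define K where "K = sqrt (\<integral>\<xi>. \<rho> \<xi> \<partial>lborel)"
  have K0: "0 \<le> K" unfolding K_def by (intro real_sqrt_ge_zero Bochner_Integration.integral_nonneg \<rho>)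
  have sn0: "0 \<le> snorm p" for p unfolding snorm_def by (intro real_sqrt_ge_zero Bochner_Integration.integral_nonneg) (simp add: \<rho>)
  define N where "N n \<tau> = indicator S \<tau> * snorm (q n \<tau>)" for n \<tau>
  have Nm[measurable]: "N n \<in> borel_measurable lborel" for n
    unfolding N_def snorm_def by measurable
  have N_bound: "norm (N n \<tau>) \<le> indicator S \<tau> * b \<tau> * K" for n \<tau>
    using snorm_le[OF q_symbol q_bound, of n \<tau>] sn0[of "q n \<tau>"] by (simp add: N_def K_def indicator_def)
  have K_int: "integrable lborel (\<lambda>\<tau>. indicator S \<tau> * b \<tau> * K)" by (rule integrable_mult_left[OF b_int])
  have N_int: "integrable lborel (N n)" for n
    by (rule Bochner_Integration.integrable_bound[OF K_int Nm], rule AE_I2)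
      (use N_bound b0 K0 in \<open>simp add: abs_mult\<close>)
  have N_lim: "(\<lambda>n. \<integral>\<tau>. N n \<tau> \<partial>lborel) \<longlonglongrightarrow> (\<integral>\<tau>. 0 \<partial>(lborel :: real measure))"
  proof (rule integral_dominated_convergence[OF _ Nm K_int])
    show "AE \<tau> in lborel. (\<lambda>n. N n \<tau>) \<longlonglongrightarrow> 0"
    proof (rule AE_I2)
      fix \<tau> :: real
      show "(\<lambda>n. N n \<tau>) \<longlonglongrightarrow> 0"
      proof (cases "\<tau> \<in> S")
        case True
        have "(\<lambda>n. snorm (q n \<tau>)) \<longlonglongrightarrow> 0"
          by (rule snorm_tendsto_0[OF qm1 q_bound q_lim[OF True]])
        then show ?thesis using True by (simp add: N_def)
      qed (simp add: N_def)
    qed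
  qed (use N_bound in auto)
  have N_eq: "indicat_real S \<tau> *\<^sub>R Hs_norm s (\<lambda>x. f \<tau> x - g n \<tau> x) = N n \<tau>" for n \<tau>
    using diff_norm by (simp add: N_def indicator_def)
  \<comment> \<open>The symbol of G n - w. By \<open>D_eq\<close> it is minus the time integral of q
    n, so the same bound b and the same pointwise limit also control the error of the
    integrals.\<close>
  define D where "D n \<xi> = (\<Sum>p\<in>I n. measure lebesgue (A n p) * (val n p * \<sigma> (tim n p) \<xi>)) - (LBINT \<tau>:S. b \<tau> * \<sigma> \<tau> \<xi>)" for n \<xi>
  have Dm: "D n \<in> borel_measurable borel" for n
    unfolding D_def set_lebesgue_integral_def by measurable
  have D_eq: "D n \<xi> = - (\<integral>\<tau>. indicator S \<tau> * q n \<tau> \<xi> \<partial>lborel)" for n \<xi>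
  proof -
    have iA: "integrable lborel (\<lambda>\<tau>. indicat_real (A n p) \<tau> * (val n p * \<sigma> (tim n p) \<xi>))" for p
      using Afin by (intro integrable_mult_left integrable_real_indicator) auto
    have "(\<Sum>p\<in>I n. measure lebesgue (A n p) * (val n p * \<sigma> (tim n p) \<xi>)) = (\<integral>\<tau>. (\<Sum>p\<in>I n. indicat_real (A n p) \<tau> * (val n p * \<sigma> (tim n p) \<xi>)) \<partial>lborel)"
      by (subst Bochner_Integration.integral_sum[OF iA]) simp
    also have "\<dots> = (\<integral>\<tau>. indicator S \<tau> * (bn n \<tau> * \<sigma> (\<tau>n n \<tau>) \<xi>) \<partial>lborel)"
    proof (intro Bochner_Integration.integral_cong refl)
      fix \<tau>
      have "(\<Sum>p\<in>I n. indicat_real (A n p) \<tau> * (val n p * \<sigma> (tim n p) \<xi>)) = (\<Sum>p\<in>I n. if P n \<tau> = p then indicator S \<tau> * (val n p * \<sigma> (tim n p) \<xi>) else 0)"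
        by (intro sum.cong refl) (auto simp: A_def indicator_def)
      also have "\<dots> = indicator S \<tau> * (bn n \<tau> * \<sigma> (\<tau>n n \<tau>) \<xi>)"
        using finI[of n] by (simp add: bn_def \<tau>n_def)
      finally show "(\<Sum>p\<in>I n. indicat_real (A n p) \<tau> * (val n p * \<sigma> (tim n p) \<xi>)) = indicator S \<tau> * (bn n \<tau> * \<sigma> (\<tau>n n \<tau>) \<xi>)" .
    qed
    finally have 1: "(\<Sum>p\<in>I n. measure lebesgue (A n p) * (val n p * \<sigma> (tim n p) \<xi>)) = (\<integral>\<tau>. indicator S \<tau> * (bn n \<tau> * \<sigma> (\<tau>n n \<tau>) \<xi>) \<partial>lborel)" .
    have i1: "integrable lborel (\<lambda>\<tau>. indicator S \<tau> * (bn n \<tau> * \<sigma> (\<tau>n n \<tau>) \<xi>))"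
    proof (rule Bochner_Integration.integrable_bound[OF b_int], measurable, rule AE_I2)
      fix \<tau>
      have "bn n \<tau> * \<sigma> (\<tau>n n \<tau>) \<xi> \<le> b \<tau> * 1" using \<sigma>01 b0 bn[of n \<tau>] by (intro mult_mono) auto
      then show "norm (indicator S \<tau> * (bn n \<tau> * \<sigma> (\<tau>n n \<tau>) \<xi>)) \<le> norm (indicator S \<tau> * b \<tau>)"
        using \<sigma>01 bn b0 by (simp add: indicator_def)
    qed
    have i2: "integrable lborel (\<lambda>\<tau>. indicator S \<tau> * (b \<tau> * \<sigma> \<tau> \<xi>))"
    proof (rule Bochner_Integration.integrable_bound[OF b_int], measurable, rule AE_I2)
      fix \<tau>
      have "b \<tau> * \<sigma> \<tau> \<xi> \<le> b \<tau> * 1" using \<sigma>01 b0 by (intro mult_left_mono) auto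
      then show "norm (indicator S \<tau> * (b \<tau> * \<sigma> \<tau> \<xi>)) \<le> norm (indicator S \<tau> * b \<tau>)"
        using \<sigma>01 b0 by (simp add: indicator_def)
    qed
    have "D n \<xi> = (\<integral>\<tau>. indicator S \<tau> * (bn n \<tau> * \<sigma> (\<tau>n n \<tau>) \<xi>) - indicator S \<tau> * (b \<tau> * \<sigma> \<tau> \<xi>) \<partial>lborel)"
      unfolding D_def 1 using i1 i2 by (simp add: set_lebesgue_integral_def)
    also have "\<dots> = (\<integral>\<tau>. - (indicator S \<tau> * q n \<tau> \<xi>) \<partial>lborel)"
      by (intro Bochner_Integration.integral_cong refl) (simp add: q_def right_diff_distrib)
    finally show ?thesis by simp
  qed
  have qb': "norm (indicator S \<tau> * q n \<tau> \<xi>) \<le> indicator S \<tau> * b \<tau>" for n \<tau> \<xi>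
    using q_bound by (simp add: indicator_def)
  have q_int: "integrable lborel (\<lambda>\<tau>. indicator S \<tau> * q n \<tau> \<xi>)" for n \<xi>
    by (rule Bochner_Integration.integrable_bound[OF b_int], measurable, rule AE_I2) (use q_bound b0 in \<open>simp add: indicator_def\<close>)
  have D_bound: "\<bar>D n \<xi>\<bar> \<le> (\<integral>\<tau>. indicator S \<tau> * b \<tau> \<partial>lborel)" for n \<xi>
    using Bochner_Integration.integral_norm_bound_integral[OF q_int b_int qb'] by (simp add: D_eq)
  have D_lim: "(\<lambda>n. D n \<xi>) \<longlonglongrightarrow> 0" for \<xi>
  proof -
    have "(\<lambda>n. \<integral>\<tau>. indicator S \<tau> * q n \<tau> \<xi> \<partial>lborel) \<longlonglongrightarrow> (\<integral>\<tau>. 0 \<partial>(lborel :: real measure))"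
    proof (rule integral_dominated_convergence[OF _ _ b_int])
      show "AE \<tau> in lborel. (\<lambda>n. indicator S \<tau> * q n \<tau> \<xi>) \<longlonglongrightarrow> 0"
        using q_lim by (intro AE_I2) (auto simp: indicator_def)
    qed (use qb' in auto)
    from tendsto_minus[OF this] show ?thesis by (simp add: D_eq)
  qed
  have D_symbol: "has_symbol (D n) (\<lambda>x. G n x - w x)" for n
  proof -
    have "has_symbol (\<lambda>\<xi>. \<Sum>p\<in>I n. measure lebesgue (A n p) * (val n p * \<sigma> (tim n p) \<xi>)) (\<lambda>x. \<Sum>p\<in>I n. measure lebesgue (A n p) *\<^sub>R c n p x)"
      by (rule has_symbol_sum[OF finI c_symbol])
    also have "(\<lambda>x. \<Sum>p\<in>I n. measure lebesgue (A n p) *\<^sub>R c n p x) = G n"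
      unfolding G_def by (intro ext reindex[symmetric])
    finally show ?thesis unfolding D_def by (rule has_symbol_diff[OF _ w])
  qed
  have D_bs: "bounded_symbol (D n)" for n unfolding bounded_symbol_def using Dm D_bound by blast
  have wb: "bounded_symbol (\<lambda>\<xi>. LBINT \<tau>:S. b \<tau> * \<sigma> \<tau> \<xi>)"
    unfolding bounded_symbol_def
  proof (intro conjI exI allI)
    show "(\<lambda>\<xi>. LBINT \<tau>:S. b \<tau> * \<sigma> \<tau> \<xi>) \<in> borel_measurable borel" unfolding set_lebesgue_integral_def by measurable
    fix \<xi>
    have "norm (LBINT \<tau>:S. b \<tau> * \<sigma> \<tau> \<xi>) \<le> (\<integral>\<tau>. norm (indicator S \<tau> *\<^sub>R (b \<tau> * \<sigma> \<tau> \<xi>)) \<partial>lborel)"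
      unfolding set_lebesgue_integral_def by (rule integral_norm_bound)
    also have "\<dots> \<le> (\<integral>\<tau>. indicator S \<tau> * b \<tau> \<partial>lborel)"
    proof (rule integral_mono'[OF b_int])
      fix \<tau>
      have "b \<tau> * \<sigma> \<tau> \<xi> \<le> b \<tau> * 1" using \<sigma>01 b0 by (intro mult_left_mono) auto
      then show "norm (indicator S \<tau> *\<^sub>R (b \<tau> * \<sigma> \<tau> \<xi>)) \<le> indicator S \<tau> * b \<tau>"
        using \<sigma>01 b0 by (simp add: indicator_def)
    qed (simp add: b0)
    finally show "\<bar>LBINT \<tau>:S. b \<tau> * \<sigma> \<tau> \<xi>\<bar> \<le> (\<integral>\<tau>. indicator S \<tau> * b \<tau> \<partial>lborel)" by simp
  qed
  show ?thesis
    unfolding has_Hs_integral_def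
  proof (intro conjI ballI exI[of _ g] exI[of _ G] allI)
    show "w \<in> Hs s" by (rule has_symbol_Hs(1)[OF w wb])
    show "f \<tau> \<in> Hs s" if "\<tau> \<in> S" for \<tau>
      unfolding f[OF that] using that by (intro has_symbol_Hs(1)[OF has_symbol_scaleR[OF F] \<sigma>b]) (simp add: S)
    show "has_Hs_simple_integral s S (g n) (G n)" for n by (rule simple)
    show "set_integrable lebesgue S (\<lambda>\<tau>. Hs_norm s (\<lambda>x. f \<tau> x - g n \<tau> x))" for n
      unfolding set_integrable_def N_eq using N_int Nm by (simp add: integrable_completion)
    show "(\<lambda>n. LINT \<tau>:S|lebesgue. Hs_norm s (\<lambda>x. f \<tau> x - g n \<tau> x)) \<longlonglongrightarrow> 0"
      unfolding set_lebesgue_integral_def N_eq using N_lim Nm by (simp add: integral_completion)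
    show "(\<lambda>n. Hs_norm s (\<lambda>x. G n x - w x)) \<longlonglongrightarrow> 0"
      unfolding has_symbol_Hs(2)[OF D_symbol D_bs] by (rule snorm_tendsto_0[OF Dm D_bound D_lim])
  qed
qed

text \<open>\<open>Hs_integral\<close> selects some integral. It has H^s distance 0 from w, and
  since the weight is positive its transform agrees with that of w almost everywhere.\<close>

lemma has_symbol_Hs_integral:
  assumes h: "has_Hs_integral s S f w" and w: "has_symbol p w" and p: "bounded_symbol p"
  shows "has_symbol p (Hs_integral s S f)"
proof -
  have ex: "\<exists>w. has_Hs_integral s S f w" using h by blast
  define z where "z = Hs_integral s S f"
  have z: "has_Hs_integral s S f z"
    using someI_ex[OF ex] ex by (simp add: z_def Hs_integral_def)
  have Hs: "z \<in> Hs s" "w \<in> Hs s" using z h by (auto simp: has_Hs_integral_def)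
  note fz = Hs_has_fourier[OF Hs(1)]
  note fw = w[unfolded has_symbol_def]
  have d: "has_fourier (\<lambda>x. z x - w x) (\<lambda>\<xi>. fourier z \<xi> - p \<xi> *\<^sub>R fourier u \<xi>)"
    using has_fourier_lin[OF fz fw, of 1 "-1"] by simp
  have "l2norm lebesgue (hs_weight s (\<lambda>\<xi>. fourier z \<xi> - p \<xi> *\<^sub>R fourier u \<xi>)) = 0"
    using has_Hs_integral_unique[OF z h] Hs_iff(2)[OF d] by simp
  moreover have "sq_int lebesgue (hs_weight s (\<lambda>\<xi>. fourier z \<xi> - p \<xi> *\<^sub>R fourier u \<xi>))"
    using Hs_diff[OF Hs] Hs_iff(1)[OF d] by simp
  ultimately have "AE \<xi> in lebesgue. hs_weight s (\<lambda>\<xi>. fourier z \<xi> - p \<xi> *\<^sub>R fourier u \<xi>) \<xi> = 0"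
    by (intro l2norm_zero_AE)
  then have "AE \<xi> in lebesgue. fourier z \<xi> = p \<xi> *\<^sub>R fourier u \<xi>"
  proof eventually_elim
    case (elim \<xi>)
    have "0 < 1 + (norm \<xi>)\<^sup>2" by (simp add: add_pos_nonneg)
    then show ?case using elim by (simp add: hs_weight_def)
  qed
  then have "has_symbol p z" unfolding has_symbol_def by (rule has_fourier_cong[OF fz _ symbol_measurable[OF p]])
  then show ?thesis by (simp add: z_def)
qed

end

section \<open>The evolution operators\<close>

locale relax_hs = sonine_kernel a k \<beta> + Hs_element s u
  for a k :: "real \<Rightarrow> real" and \<beta> s :: real and u :: "real^'n \<Rightarrow> complex" +
  fixes \<gamma> \<alpha> :: real and m :: "real \<Rightarrow> real"
  assumes m_eq: "AE t in lborel. 0 \<le> t \<longrightarrow> m_gam \<gamma> m t = a t"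
begin

definition \<nu> :: "real^'n \<Rightarrow> real" where "\<nu> \<xi> = norm \<xi> powr \<alpha>"

lemma \<nu>_nonneg [simp]: "0 \<le> \<nu> \<xi>" by (simp add: \<nu>_def)

lemma \<nu>_measurable [measurable]: "\<nu> \<in> borel_measurable borel"
  unfolding \<nu>_def by measurable

lemma bounded_symbolI:
  "p \<in> borel_measurable borel \<Longrightarrow> (\<And>\<xi>. 0 \<le> p \<xi>) \<Longrightarrow> (\<And>\<xi>. p \<xi> \<le> C) \<Longrightarrow> bounded_symbol p"
  unfolding bounded_symbol_def by (auto intro!: exI[of _ C])

lemma relax_symbol: "bounded_symbol (\<lambda>\<xi>. relax (\<nu> \<xi>) t)"
  by (rule bounded_symbolI[of _ 1], measurable) (auto intro: relax_nonneg relax_le_1)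

lemma Q_symbol:
  assumes "0 \<le> t" shows "has_symbol (\<lambda>\<xi>. relax (\<nu> \<xi>) t) (Q_star \<gamma> m \<alpha> t u)"
proof -
  have "Q_star \<gamma> m \<alpha> t u = fourier_multiplier (\<lambda>\<xi>. relax (\<nu> \<xi>) t) u"
    unfolding Q_star_def using relax_s_eq[OF m_eq _ assms] by (simp add: \<nu>_def)
  then show ?thesis using has_symbol_multiplier[OF relax_symbol] by simp
qed

lemma mult_relax_symbol:
  assumes t: "0 < t" shows "bounded_symbol (\<lambda>\<xi>. \<nu> \<xi> * relax (\<nu> \<xi>) t)"
proof (rule bounded_symbolI)
  show "(\<lambda>\<xi>. \<nu> \<xi> * relax (\<nu> \<xi>) t) \<in> borel_measurable borel" by measurable
  fix \<xi>
  show "0 \<le> \<nu> \<xi> * relax (\<nu> \<xi>) t" by (simp add: relax_nonneg)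
  show "\<nu> \<xi> * relax (\<nu> \<xi>) t \<le> 1 / (LBINT \<tau>:{0..t}. a \<tau>)"
    using relax_le_integral[of "\<nu> \<xi>" t] a_integral_pos[OF t] t by (simp add: field_simps)
qed

lemma frac_Q_Hs:
  assumes t: "0 < t" shows "frac_laplacian \<alpha> (Q_star \<gamma> m \<alpha> t u) \<in> Hs s"
proof -
  have "has_symbol (\<lambda>\<xi>. \<nu> \<xi> * relax (\<nu> \<xi>) t) (fourier_multiplier \<nu> (Q_star \<gamma> m \<alpha> t u))"
    by (rule has_symbol_multiplier_comp[OF Q_symbol \<nu>_measurable mult_relax_symbol[OF t]]) (use t in simp)
  then show ?thesis
    using has_symbol_Hs(1)[OF _ mult_relax_symbol[OF t]] by (simp add: frac_laplacian_def \<nu>_def[abs_def])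
qed

end

locale relax_hs_mono = relax_hs a k \<beta> s u \<gamma> \<alpha> m + sonine_kernel_mono a k \<beta>
  for a k :: "real \<Rightarrow> real" and \<beta> s :: real and u :: "real^'n \<Rightarrow> complex" and \<gamma> \<alpha> :: real and m :: "real \<Rightarrow> real" +
  assumes m_pos: "0 < t \<Longrightarrow> m_gam \<gamma> m t = a t"
begin

lemma res_cont_symbol: "0 < t \<Longrightarrow> bounded_symbol (\<lambda>\<xi>. res_cont (\<nu> \<xi>) t)"
  by (rule bounded_symbolI[of _ "a t"], measurable) (auto intro: res_cont_nonneg res_cont_le_a)

lemma G_symbol:
  assumes t: "0 < t" shows "has_symbol (\<lambda>\<xi>. res_cont (\<nu> \<xi>) t) (G_star \<gamma> m \<alpha> t u)"
proof -
  have "G_star \<gamma> m \<alpha> t u = fourier_multiplier (\<lambda>\<xi>. res_cont (\<nu> \<xi>) t) u"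
    unfolding G_star_def using relax_r_eq[OF m_pos _ t] by (simp add: \<nu>_def)
  then show ?thesis using has_symbol_multiplier[OF res_cont_symbol[OF t]] by simp
qed

lemma mult_res_cont_symbol:
  assumes t: "0 < t" shows "bounded_symbol (\<lambda>\<xi>. \<nu> \<xi> * res_cont (\<nu> \<xi>) t)"
proof (rule bounded_symbolI)
  show "(\<lambda>\<xi>. \<nu> \<xi> * res_cont (\<nu> \<xi>) t) \<in> borel_measurable borel" by measurable
  show "0 \<le> \<nu> \<xi> * res_cont (\<nu> \<xi>) t" for \<xi> by (intro mult_nonneg_nonneg res_cont_nonneg \<nu>_nonneg t)
  show "\<nu> \<xi> * res_cont (\<nu> \<xi>) t \<le> a t / (LBINT \<tau>:{0..t}. a \<tau>)" for \<xi> by (intro mult_res_cont_le \<nu>_nonneg t order_refl)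
qed

lemma frac_G_symbol:
  assumes t: "0 < t" shows "has_symbol (\<lambda>\<xi>. \<nu> \<xi> * res_cont (\<nu> \<xi>) t) (frac_laplacian \<alpha> (G_star \<gamma> m \<alpha> t u))"
  using has_symbol_multiplier_comp[OF G_symbol[OF t] \<nu>_measurable mult_res_cont_symbol[OF t]]
  by (simp add: frac_laplacian_def \<nu>_def[abs_def])

text \<open>The symbol of the difference quotient is - \<nu> r at an intermediate time z \<ge> t /
  2. The constant C is \<open>mult_res_cont_le\<close> with b = t / 2, which absorbs the unbounded
  factor \<nu>.\<close>

lemma Q_derivative:
  assumes t: "0 < t"
  shows "has_Hs_derivative s (\<lambda>\<tau>. Q_star \<gamma> m \<alpha> \<tau> u) (\<lambda>x. - frac_laplacian \<alpha> (G_star \<gamma> m \<alpha> t u) x) t"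
proof (rule has_symbol_derivative[where d="t / 2" and p="\<lambda>\<tau> \<xi>. relax (\<nu> \<xi>) \<tau>" and q="\<lambda>\<xi>. - (\<nu> \<xi> * res_cont (\<nu> \<xi>) t)"
      and C="a (t / 2) / (LBINT \<tau>:{0..t / 2}. a \<tau>)"])
  show "0 < t / 2" using t by simp
  show "has_symbol (\<lambda>\<xi>. relax (\<nu> \<xi>) \<tau>) (Q_star \<gamma> m \<alpha> \<tau> u) \<and> bounded_symbol (\<lambda>\<xi>. relax (\<nu> \<xi>) \<tau>)" if "\<bar>\<tau> - t\<bar> < t / 2" for \<tau>
    using that by (intro conjI Q_symbol relax_symbol) (simp add: abs_if split: if_splits)
  show "has_symbol (\<lambda>\<xi>. - (\<nu> \<xi> * res_cont (\<nu> \<xi>) t)) (\<lambda>x. - frac_laplacian \<alpha> (G_star \<gamma> m \<alpha> t u) x)"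
    using has_symbol_scaleR[OF frac_G_symbol[OF t], of "-1"] by simp
  show "bounded_symbol (\<lambda>\<xi>. - (\<nu> \<xi> * res_cont (\<nu> \<xi>) t))"
    using mult_res_cont_symbol[OF t] by (auto simp: bounded_symbol_def)
  show "((\<lambda>\<tau>. relax (\<nu> \<xi>) \<tau>) has_real_derivative - (\<nu> \<xi> * res_cont (\<nu> \<xi>) t)) (at t)" for \<xi>
    unfolding relax_def by (auto intro!: derivative_eq_intros resolvent_integral_derivative t)
  fix \<xi> h assume h: "h \<noteq> 0" "\<bar>h\<bar> < t / 2"
  obtain z where z: "t / 2 \<le> z"
    "((LBINT \<tau>:{0..t + h}. resolvent a (\<nu> \<xi>) \<tau>) - (LBINT \<tau>:{0..t}. resolvent a (\<nu> \<xi>) \<tau>)) / h = res_cont (\<nu> \<xi>) z"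
    using resolvent_integral_quotient[OF \<nu>_nonneg t h] by blast
  have "(relax (\<nu> \<xi>) (t + h) - relax (\<nu> \<xi>) t) / h
      = - (\<nu> \<xi> * (((LBINT \<tau>:{0..t + h}. resolvent a (\<nu> \<xi>) \<tau>) - (LBINT \<tau>:{0..t}. resolvent a (\<nu> \<xi>) \<tau>)) / h))"
    using h(1) by (simp add: relax_def field_simps)
  also have "\<dots> = - (\<nu> \<xi> * res_cont (\<nu> \<xi>) z)" by (simp only: z(2))
  finally have "\<bar>(relax (\<nu> \<xi>) (t + h) - relax (\<nu> \<xi>) t) / h\<bar> = \<nu> \<xi> * res_cont (\<nu> \<xi>) z"
    using res_cont_nonneg[of "\<nu> \<xi>" z] z(1) t by simp
  also have "\<dots> \<le> a (t / 2) / (LBINT \<tau>:{0..t / 2}. a \<tau>)"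
    using z(1) t by (intro mult_res_cont_le) auto
  finally show "\<bar>(relax (\<nu> \<xi>) (t + h) - relax (\<nu> \<xi>) t) / h\<bar> \<le> a (t / 2) / (LBINT \<tau>:{0..t / 2}. a \<tau>)" .
qed

lemma relax_continuous: "0 \<le> \<mu> \<Longrightarrow> continuous_on {0..T} (relax \<mu>)"
proof -
  assume \<mu>: "0 \<le> \<mu>"
  have "resolvent a \<mu> integrable_on {0..T}"
    by (rule set_borel_integral_eq_integral(1)[OF resolvent_set_integrable[OF \<mu>]])
  then have "continuous_on {0..T} (\<lambda>x. integral {0..x} (resolvent a \<mu>))" by (rule indefinite_integral_continuous_1)
  then show ?thesis
    unfolding relax_def by (simp add: set_borel_integral_eq_integral(2)[OF resolvent_set_integrable[OF \<mu>]] continuous_intros)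
qed

lemma resolvent_integral_le:
  assumes \<mu>: "0 \<le> \<mu>" shows "(LBINT \<tau>:{0..t}. resolvent a \<mu> \<tau>) \<le> (LBINT \<tau>:{0..t}. a \<tau>)"
  unfolding set_lebesgue_integral_def
proof (rule integral_mono_AE)
  show "AE \<tau> in lborel. indicat_real {0..t} \<tau> *\<^sub>R resolvent a \<mu> \<tau> \<le> indicat_real {0..t} \<tau> *\<^sub>R a \<tau>"
    using resolvent_AE_res_cont[OF \<mu>] by eventually_elim (use res_cont_le_a[OF \<mu>] in \<open>auto simp: indicator_def\<close>)
qed (use resolvent_set_integrable[OF \<mu>] a_set_integrable in \<open>auto simp: set_integrable_def\<close>)

lemma resolvent_integral_symbol: "bounded_symbol (\<lambda>\<xi>. LBINT \<tau>:{0..t}. resolvent a (\<nu> \<xi>) \<tau>)"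
proof (rule bounded_symbolI)
  show "(\<lambda>\<xi>. LBINT \<tau>:{0..t}. resolvent a (\<nu> \<xi>) \<tau>) \<in> borel_measurable borel"
    unfolding set_lebesgue_integral_def by measurable
  show "0 \<le> (LBINT \<tau>:{0..t}. resolvent a (\<nu> \<xi>) \<tau>)" for \<xi>
    unfolding set_lebesgue_integral_def by (intro Bochner_Integration.integral_nonneg) (simp add: resolvent_nonneg)
qed (rule resolvent_integral_le, simp)

text \<open>The symbol of the H^s-valued integral is (a * s)(t), computed for each \<xi>, and
  \<open>conv_relax\<close> rewrites it as the integral of r, which is bounded by that of a
  uniformly in \<xi>.\<close>

lemma time_conv_symbol:
  assumes t: "0 < t"
  shows "has_symbol (\<lambda>\<xi>. LBINT \<tau>:{0..t}. resolvent a (\<nu> \<xi>) \<tau>) (Hs_time_conv s (m_gam \<gamma> m) (\<lambda>\<tau>. Q_star \<gamma> m \<alpha> \<tau> u) t)"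
proof -
  obtain w where w: "has_symbol (\<lambda>\<xi>. LBINT \<tau>:{0..t}. resolvent a (\<nu> \<xi>) \<tau>) w"
    using has_symbol_exists[OF resolvent_integral_symbol] .
  have e: "(LBINT \<tau>:{0<..<t}. a (t - \<tau>) * relax (\<nu> \<xi>) \<tau>) = (LBINT \<tau>:{0..t}. resolvent a (\<nu> \<xi>) \<tau>)" for \<xi>
  proof -
    have "(LBINT \<tau>:{0<..<t}. a (t - \<tau>) * relax (\<nu> \<xi>) \<tau>) = conv a (\<lambda>t. relax (\<nu> \<xi>) t * heaviside t) t"
      unfolding conv_def set_lebesgue_integral_def
    proof (rule integral_cong_AE)
      show "AE \<tau> in lborel. indicat_real {0<..<t} \<tau> *\<^sub>R (a (t - \<tau>) * relax (\<nu> \<xi>) \<tau>) = a (t - \<tau>) * (relax (\<nu> \<xi>) \<tau> * heaviside \<tau>)"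
        using AE_lborel_singleton[of "0::real"] AE_lborel_singleton[of t]
      proof eventually_elim
        case (elim \<tau>)
        then show ?case using loc_int_neg[OF a, of "t - \<tau>"] by (auto simp: indicator_def heaviside_def)
      qed
    qed measurable
    then show ?thesis by (simp only: conv_relax[OF \<nu>_nonneg])
  qed
  have h: "has_Hs_integral s {0<..<t} (\<lambda>\<tau> x. m_gam \<gamma> m (t - \<tau>) *\<^sub>R Q_star \<gamma> m \<alpha> \<tau> u x) w"
  proof (rule has_symbol_integral[OF t refl, where b="\<lambda>\<tau>. a (t - \<tau>)" and \<sigma>="\<lambda>\<tau> \<xi>. relax (\<nu> \<xi>) \<tau>" and F="\<lambda>\<tau>. Q_star \<gamma> m \<alpha> \<tau> u"])
    show "(\<lambda>\<tau>. a (t - \<tau>)) \<in> borel_measurable borel" by measurable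
    show "0 \<le> a (t - \<tau>)" for \<tau> by (rule a_nonneg)
    show "set_integrable lborel {0<..<t} (\<lambda>\<tau>. a (t - \<tau>))"
    proof (rule set_integrable_subset)
      show "set_integrable lborel {0..t} (\<lambda>\<tau>. a (t - \<tau>))"
        using lborel_integrable_real_affine[OF a_int0[of 0 t], of "-1" t]
        by (simp add: set_integrable_def indicator_def conj_commute)
    qed auto
    show "(\<lambda>p. relax (\<nu> (snd p)) (fst p)) \<in> borel_measurable (borel \<Otimes>\<^sub>M borel)" by measurable
    show "0 \<le> relax (\<nu> \<xi>) \<tau>" "relax (\<nu> \<xi>) \<tau> \<le> 1" for \<tau> \<xi> by (auto intro: relax_nonneg relax_le_1)
    show "continuous_on {0..t} (\<lambda>\<tau>. relax (\<nu> \<xi>) \<tau>)" for \<xi> by (rule relax_continuous) simp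
    show "has_symbol (\<lambda>\<xi>. relax (\<nu> \<xi>) \<tau>) (Q_star \<gamma> m \<alpha> \<tau> u)" if "0 \<le> \<tau>" for \<tau> by (rule Q_symbol[OF that])
    show "(\<lambda>x. m_gam \<gamma> m (t - \<tau>) *\<^sub>R Q_star \<gamma> m \<alpha> \<tau> u x) = (\<lambda>x. a (t - \<tau>) *\<^sub>R Q_star \<gamma> m \<alpha> \<tau> u x)" if "\<tau> \<in> {0<..<t}" for \<tau>
      using that by (simp add: m_pos)
    show "has_symbol (\<lambda>\<xi>. LBINT \<tau>:{0<..<t}. a (t - \<tau>) * relax (\<nu> \<xi>) \<tau>) w" unfolding e by (rule w)
  qed
  show ?thesis
    unfolding Hs_time_conv_def by (rule has_symbol_Hs_integral[OF h w resolvent_integral_symbol])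
qed

text \<open>Now the symbol is the integral of r without the factor \<nu>; its difference quotients
  are values of r beyond t / 2 and are bounded by a (t / 2), since r \<le> a and a is
  nonincreasing.\<close>

lemma time_conv_derivative:
  assumes t: "0 < t"
  shows "has_Hs_derivative s (Hs_time_conv s (m_gam \<gamma> m) (\<lambda>\<tau>. Q_star \<gamma> m \<alpha> \<tau> u)) (G_star \<gamma> m \<alpha> t u) t"
proof (rule has_symbol_derivative[where d="t / 2" and p="\<lambda>\<tau> \<xi>. LBINT x:{0..\<tau>}. resolvent a (\<nu> \<xi>) x" and q="\<lambda>\<xi>. res_cont (\<nu> \<xi>) t"
      and C="a (t / 2)"])
  show "0 < t / 2" using t by simp
  show "has_symbol (\<lambda>\<xi>. LBINT x:{0..\<tau>}. resolvent a (\<nu> \<xi>) x) (Hs_time_conv s (m_gam \<gamma> m) (\<lambda>\<tau>. Q_star \<gamma> m \<alpha> \<tau> u) \<tau>)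
      \<and> bounded_symbol (\<lambda>\<xi>. LBINT x:{0..\<tau>}. resolvent a (\<nu> \<xi>) x)" if "\<bar>\<tau> - t\<bar> < t / 2" for \<tau>
    using that t by (intro conjI time_conv_symbol resolvent_integral_symbol) (simp add: abs_if split: if_splits)
  show "has_symbol (\<lambda>\<xi>. res_cont (\<nu> \<xi>) t) (G_star \<gamma> m \<alpha> t u)" by (rule G_symbol[OF t])
  show "bounded_symbol (\<lambda>\<xi>. res_cont (\<nu> \<xi>) t)" by (rule res_cont_symbol[OF t])
  show "((\<lambda>\<tau>. LBINT x:{0..\<tau>}. resolvent a (\<nu> \<xi>) x) has_real_derivative res_cont (\<nu> \<xi>) t) (at t)" for \<xi>
    by (rule resolvent_integral_derivative[OF \<nu>_nonneg t])
  fix \<xi> h assume h: "h \<noteq> 0" "\<bar>h\<bar> < t / 2"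
  obtain z where z: "t / 2 \<le> z"
    "((LBINT \<tau>:{0..t + h}. resolvent a (\<nu> \<xi>) \<tau>) - (LBINT \<tau>:{0..t}. resolvent a (\<nu> \<xi>) \<tau>)) / h = res_cont (\<nu> \<xi>) z"
    using resolvent_integral_quotient[OF \<nu>_nonneg t h] by blast
  have "res_cont (\<nu> \<xi>) z \<le> a (t / 2)" using res_cont_le_a[of "\<nu> \<xi>" z] a_antimono[of "t / 2" z] z(1) t by simp
  then show "\<bar>((LBINT \<tau>:{0..t + h}. resolvent a (\<nu> \<xi>) \<tau>) - (LBINT \<tau>:{0..t}. resolvent a (\<nu> \<xi>) \<tau>)) / h\<bar> \<le> a (t / 2)"
    unfolding z(2) using res_cont_nonneg[of "\<nu> \<xi>" z] z(1) t by simp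
qed

end

theorem lemma4p1:
  fixes \<gamma> \<alpha> \<beta> s :: real
    and m k :: "real \<Rightarrow> real"
    and u :: "real^'n \<Rightarrow> complex"
  assumes "\<gamma> > 0" and "1 < \<alpha>" and "\<alpha> \<le> 2"
    and "cond_H \<gamma> m \<beta> k"
    and "s \<ge> 0" and "u \<in> Hs s"
  shows "(\<forall>t>0. frac_laplacian \<alpha> (Q_star \<gamma> m \<alpha> t u) \<in> Hs s) \<and>
    (antimono_on {0<..} m \<longrightarrow>
      (\<forall>t>0. frac_laplacian \<alpha> (G_star \<gamma> m \<alpha> t u) \<in> Hs s \<and>
        has_Hs_derivative s (\<lambda>\<tau>. Q_star \<gamma> m \<alpha> \<tau> u)
          (\<lambda>x. - frac_laplacian \<alpha> (G_star \<gamma> m \<alpha> t u) x) t) \<and>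
      (\<beta> > 0 \<or> (\<beta> = 0 \<and> continuous_on {0<..} m) \<longrightarrow>
        (\<forall>t>0. has_Hs_derivative s
          (Hs_time_conv s (m_gam \<gamma> m) (\<lambda>\<tau>. Q_star \<gamma> m \<alpha> \<tau> u))
          (G_star \<gamma> m \<alpha> t u) t)))"
proof -
  have hs: "Hs_element s u" using assms by unfold_locales
  show ?thesis
  proof (intro conjI impI)
    obtain a k' where a: "sonine_kernel a k' \<beta>" "AE t in lborel. 0 \<le> t \<longrightarrow> m_gam \<gamma> m t = a t"
      using cond_H_sonine_kernel[OF assms(4)] .
    interpret relax_hs a k' \<beta> s u \<gamma> \<alpha> m
      using a hs by (intro relax_hs.intro relax_hs_axioms.intro)
    show "\<forall>t>0. frac_laplacian \<alpha> (Q_star \<gamma> m \<alpha> t u) \<in> Hs s" using frac_Q_Hs by blast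
  next
    assume m: "antimono_on {0<..} m"
    \<comment> \<open>A second choice of kernel: this a equals m_\<gamma> at every t > 0, which the
      pointwise equation of r requires.\<close>
    obtain a k' where a: "sonine_kernel_mono a k' \<beta>" "\<And>t. 0 < t \<Longrightarrow> m_gam \<gamma> m t = a t"
      using cond_H_sonine_kernel_mono[OF assms(4,1) m] by blast
    have "AE t in lborel. 0 \<le> t \<longrightarrow> m_gam \<gamma> m t = a t"
      using AE_lborel_singleton[of "0::real"] by eventually_elim (use a(2) in auto)
    then interpret relax_hs_mono a k' \<beta> s u \<gamma> \<alpha> m
      using a hs
      by (intro relax_hs_mono.intro relax_hs.intro relax_hs_axioms.intro relax_hs_mono_axioms.intro sonine_kernel_mono.axioms(1))
    show "\<forall>t>0. frac_laplacian \<alpha> (G_star \<gamma> m \<alpha> t u) \<in> Hs s \<and>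
        has_Hs_derivative s (\<lambda>\<tau>. Q_star \<gamma> m \<alpha> \<tau> u)
          (\<lambda>x. - frac_laplacian \<alpha> (G_star \<gamma> m \<alpha> t u) x) t"
      using Q_derivative has_symbol_Hs(1)[OF frac_G_symbol mult_res_cont_symbol] by blast
    show "\<forall>t>0. has_Hs_derivative s
          (Hs_time_conv s (m_gam \<gamma> m) (\<lambda>\<tau>. Q_star \<gamma> m \<alpha> \<tau> u))
          (G_star \<gamma> m \<alpha> t u) t"
      using time_conv_derivative by blast
  qed
qed

end
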